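(* Suppose $F:\mathbb{R}^d\to\mathbb{R}$ attains minimum value $0$ and satisfies third-order self-bounding regularity with functions $\rho_1,\rho_2$, and that the stochastic gradient oracle $\nabla f(\cdot;\cdot)$ satisfies the noise regularity assumption (with function $\sigma$) and the gradient oracle control assumption (with function $\rho_3$). Let $\epsilon>0$ be a tolerance and $w_0\in\mathbb{R}^d$. For any $\delta\in(0,1)$, there is a choice of the step size $\eta$ and of the other parameters $(K_0,B,\tilde\sigma)$ of Restarted SGD, depending on $\epsilon$, $\delta$, $d$ and $F(w_0)$, such that if Restarted SGD is run from the initialization $w_0$ with these parameters, then with probability at least $1-\delta$, upon making $$T=\tilde O\left(\frac{1}{\epsilon^{3.5}}\right)$$ oracle calls to $\nabla f(\cdot;\cdot)$, Restarted SGD outputs $T$ candidate vectors $w$, one of which satisfies $$\|\nabla F(w)\|\le\epsilon,\qquad\nabla^2F(w)\succeq-\sqrt{\epsilon}\,I.$$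
   Context: $\|\cdot\|$ is the Euclidean norm, $\|\cdot\|_{\mathrm{op}}$ the operator norm (of matrices and third-order tensors), $I$ the $d\times d$ identity, and $\succeq$ the positive semidefinite order. Second-order self-bounding regularity: $F$ is twice differentiable and there is a non-decreasing $\rho_1:\mathbb{R}_{\ge0}\to\mathbb{R}_{\ge0}$ with $\|\nabla^2F(w)\|_{\mathrm{op}}\le\rho_1(F(w))$ for all $w\in\mathbb{R}^d$. Third-order self-bounding regularity: $F$ satisfies second-order self-bounding regularity and, for some non-decreasing $\rho_2:\mathbb{R}_{\ge0}\to\mathbb{R}_{\ge0}$, either (i) $F$ is three times differentiable everywhere and $\|\nabla^3F(w)\|_{\mathrm{op}}\le\rho_2(F(w))$ for all $w$; or (ii) for some constant $\delta_0>0$, $\|\nabla^2F(w)-\nabla^2F(w')\|_{\mathrm{op}}\le\rho_2(F(w))\|w-w'\|$ for all $w,w'\in\mathbb{R}^d$ with $\|w-w'\|\le\delta_0$. Noise regularity assumption: the oracle $\nabla f(\cdot;\zeta)$ ($\zeta$ a random minibatch sample) is unbiased, i.e. $\mathbb{E}_\zeta[\nabla f(w;\zeta)]=\nabla F(w)$, and for a non-decreasing $\sigma:\mathbb{R}^+\to\mathbb{R}^+$ and all $w,\zeta$, $\|\nabla f(w;\zeta)-\nabla F(w)\|^2\le\sigma(F(w))^2$. Gradient oracle control assumption: for every $w,\zeta$, $\|\nabla^2f(w;\zeta)\|_{\mathrm{op}}\le\rho_3(\|\nabla f(w;\zeta)\|,F(w))$, where $\rho_3:\mathbb{R}_{\ge0}\times\mathbb{R}_{\ge0}\to\mathbb{R}_{\ge0}$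 is non-decreasing in both arguments. Restarted SGD with parameters $(\eta,K_0,B,\tilde\sigma)$: starting from an anchor point $u$ (initially $w_0$), set $p_0=u$ and run $p_k=p_{k-1}-\eta(\nabla f(p_{k-1};\zeta_k)+\tilde\sigma\Lambda_k)$, where the $\zeta_k$ are i.i.d. minibatch samples and the $\Lambda_k$ are independent and uniform on the unit Euclidean ball. If some $1\le i\le K_0$ has $\|p_i-p_0\|>B$, take the first such $i$, make $p_i$ the new anchor point and repeat with fresh randomness. If no such $i\le K_0$ exists, return $\frac{1}{K_0}\sum_{k=0}^{K_0-1}p_k$ and stop. The candidate vectors output are the averages $\frac1i\sum_{t=0}^{i-1}p_t$ of the successive blocks (with $i$ the escape index, or $i=K_0$ if no escape). $\tilde O(\cdot)$ hides constant factors, $F(w_0)$-dependent constants (through $\rho_1,\rho_2,\rho_3,\sigma$), and logarithmic factors in $d,1/\epsilon,1/\delta$. *)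

theory Defs
  imports "HOL-Probability.Probability"
begin

section \<open>The spaces $\mathbb{R}^d$ inside one inner product space\<close>

text \<open>
  The constants hidden in $\tilde O(\cdot)$ must not depend on the dimension \<open>d\<close> (only logarithms
  of \<open>d\<close> are hidden), so \<open>d\<close> has to be quantified inside the formula and cannot be the
  cardinality of an index type.  We therefore take the inner product space of all finitely supported
  real sequences and realise $\mathbb{R}^d$ as its subspace \<open>Rd d\<close> of the sequences that vanish
  from index \<open>d\<close> on.  On \<open>Rd d\<close>, \<^const>\<open>inner\<close> and \<^const>\<open>norm\<close> are the Euclidean ones and
  differentiability is \<^const>\<open>has_derivative\<close> at a point within \<open>Rd d\<close>.
\<close>

typedef evec = "{x :: nat \<Rightarrow> real. finite {i. x i \<noteq> 0}}"
  morphisms coord Evec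
  by (rule exI[of _ "\<lambda>_. 0"]) simp

setup_lifting type_definition_evec

lemma finite_coord [simp]: "finite {i. coord x i \<noteq> 0}"
  using coord[of x] by simp

lemma evec_eqI: "(\<And>i. coord x i = coord y i) \<Longrightarrow> x = y"
  by (metis coord_inject ext)

instantiation evec :: real_vector
begin

lift_definition zero_evec :: evec is "\<lambda>_. 0" by simp

lift_definition plus_evec :: "evec \<Rightarrow> evec \<Rightarrow> evec" is "\<lambda>x y i. x i + y i"
  by (rule rev_finite_subset[OF finite_UnI], assumption, assumption) auto

lift_definition uminus_evec :: "evec \<Rightarrow> evec" is "\<lambda>x i. - x i" by simp

lift_definition minus_evec :: "evec \<Rightarrow> evec \<Rightarrow> evec" is "\<lambda>x y i. x i - y i"
  by (rule rev_finite_subset[OF finite_UnI], assumption, assumption) auto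

lift_definition scaleR_evec :: "real \<Rightarrow> evec \<Rightarrow> evec" is "\<lambda>c x i. c * x i"
  by (rule rev_finite_subset) auto

instance
proof
  fix x y z :: evec and a b :: real
  show "x + y + z = x + (y + z)" "x + y = y + x" "0 + x = x" "- x + x = 0" "x - y = x + - y"
    by (transfer; simp add: fun_eq_iff)+
  show "a *\<^sub>R (x + y) = a *\<^sub>R x + a *\<^sub>R y" "(a + b) *\<^sub>R x = a *\<^sub>R x + b *\<^sub>R x"
    "a *\<^sub>R b *\<^sub>R x = (a * b) *\<^sub>R x" "1 *\<^sub>R x = x"
    by (transfer; simp add: fun_eq_iff algebra_simps)+
qed

end

instantiation evec :: real_inner
begin

definition inner_evec :: "evec \<Rightarrow> evec \<Rightarrow> real" where
  "inner_evec x y = (\<Sum>i | coord x i \<noteq> 0. coord x i * coord y i)"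

definition norm_evec :: "evec \<Rightarrow> real" where
  "norm_evec x = sqrt (inner x x)"

definition sgn_evec :: "evec \<Rightarrow> evec" where
  "sgn_evec x = x /\<^sub>R norm x"

definition dist_evec :: "evec \<Rightarrow> evec \<Rightarrow> real" where
  "dist_evec x y = norm (x - y)"

definition uniformity_evec :: "(evec \<times> evec) filter" where
  "uniformity_evec = (INF e\<in>{0<..}. principal {(x, y). dist x y < e})"

definition open_evec :: "evec set \<Rightarrow> bool" where
  "open_evec U \<longleftrightarrow> (\<forall>x\<in>U. \<forall>\<^sub>F (x', y) in uniformity. x' = x \<longrightarrow> y \<in> U)"

instance
proof
  fix x y z :: evec and a b :: real
  have inner_superset: "inner u v = (\<Sum>i\<in>A. coord u i * coord v i)"
    if "finite A" "{i. coord u i \<noteq> 0} \<subseteq> A" for u v A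
    unfolding inner_evec_def using that by (intro sum.mono_neutral_left) auto
  let ?S = "{i. coord x i \<noteq> 0} \<union> {i. coord y i \<noteq> 0}"
  show "sgn x = x /\<^sub>R norm x" by (rule sgn_evec_def)
  show "dist x y = norm (x - y)" by (rule dist_evec_def)
  show "uniformity = (INF e\<in>{0<..}. principal {(x, y :: evec). dist x y < e})"
    by (rule uniformity_evec_def)
  show "open U \<longleftrightarrow> (\<forall>x\<in>U. \<forall>\<^sub>F (x', y) in uniformity. x' = x \<longrightarrow> y \<in> U)" for U :: "evec set"
    by (rule open_evec_def)
  show "inner x y = inner y x"
    by (simp add: inner_superset[of ?S] mult.commute)
  have "inner (x + y) z = (\<Sum>i\<in>?S. coord (x + y) i * coord z i)"
    by (rule inner_superset) (auto simp: plus_evec.rep_eq)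
  then show "inner (x + y) z = inner x z + inner y z"
    by (simp add: inner_superset[of ?S] plus_evec.rep_eq sum.distrib distrib_right)
  have "inner (a *\<^sub>R x) y = (\<Sum>i\<in>?S. coord (a *\<^sub>R x) i * coord y i)"
    by (rule inner_superset) (auto simp: scaleR_evec.rep_eq)
  then show "inner (a *\<^sub>R x) y = a * inner x y"
    by (simp add: inner_superset[of ?S] scaleR_evec.rep_eq sum_distrib_left mult.assoc)
  show "0 \<le> inner x x"
    unfolding inner_evec_def by (intro sum_nonneg) simp
  show "inner x x = 0 \<longleftrightarrow> x = 0"
    unfolding inner_evec_def
    by (subst sum_nonneg_eq_0_iff) (auto intro: evec_eqI simp: zero_evec.rep_eq)
  show "norm x = sqrt (inner x x)" by (rule norm_evec_def)
qed

end

definition Rd :: "nat \<Rightarrow> evec set" where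
  "Rd d = {x. \<forall>i\<ge>d. coord x i = 0}"

lift_definition vec_of :: "nat \<Rightarrow> (nat \<Rightarrow> real) \<Rightarrow> evec" is
  "\<lambda>d x i. if i < d then x i else 0"
  by (rule finite_subset[of _ "{..<_}"]) (auto split: if_splits)

lemma norm_Rd: "x \<in> Rd d \<Longrightarrow> norm x = L2_set (coord x) {..<d}"
  unfolding norm_evec_def inner_evec_def L2_set_def power2_eq_square
  by (intro arg_cong[of _ _ sqrt] sum.mono_neutral_left) (auto simp: Rd_def not_less[symmetric])


section \<open>Derivatives, operator norms and regularity assumptions\<close>

text \<open>
  The description in \<open>grad\<close> and the choice in \<^const>\<open>frechet_derivative\<close> (evaluated in directions
  of \<open>Rd d\<close>) are well defined for \<open>d > 0\<close> whenever the differentiated map is differentiable.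
\<close>

definition grad :: "nat \<Rightarrow> (evec \<Rightarrow> real) \<Rightarrow> evec \<Rightarrow> evec" where
  "grad d F w = (THE g. g \<in> Rd d \<and> (F has_derivative (\<lambda>h. inner g h)) (at w within Rd d))"

definition hess :: "nat \<Rightarrow> (evec \<Rightarrow> real) \<Rightarrow> evec \<Rightarrow> evec \<Rightarrow> evec" where
  "hess d F w = frechet_derivative (grad d F) (at w within Rd d)"

definition third_deriv :: "nat \<Rightarrow> (evec \<Rightarrow> real) \<Rightarrow> evec \<Rightarrow> evec \<Rightarrow> evec \<Rightarrow> evec" where
  "third_deriv d F w h u = frechet_derivative (\<lambda>x. hess d F x u) (at w within Rd d) h"

definition twice_differentiable :: "nat \<Rightarrow> (evec \<Rightarrow> real) \<Rightarrow> bool" where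
  "twice_differentiable d F \<longleftrightarrow>
     F differentiable_on Rd d \<and> grad d F differentiable_on Rd d"

text \<open>Differentiability of the matrix-valued map $\nabla^2 F$ is differentiability of all
  $x \mapsto \nabla^2 F(x)u$.\<close>

definition thrice_differentiable :: "nat \<Rightarrow> (evec \<Rightarrow> real) \<Rightarrow> bool" where
  "thrice_differentiable d F \<longleftrightarrow>
     twice_differentiable d F \<and> (\<forall>u\<in>Rd d. (\<lambda>x. hess d F x u) differentiable_on Rd d)"

definition op_norm :: "nat \<Rightarrow> (evec \<Rightarrow> evec) \<Rightarrow> real" where
  "op_norm d A = (SUP h\<in>Rd d \<inter> cball 0 1. norm (A h))"

definition op_norm3 :: "nat \<Rightarrow> (evec \<Rightarrow> evec \<Rightarrow> evec) \<Rightarrow> real" where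
  "op_norm3 d T = (let U = Rd d \<inter> cball 0 1 in
     SUP (h, u, v)\<in>U \<times> U \<times> U. \<bar>inner (T h u) v\<bar>)"

definition psd :: "nat \<Rightarrow> (evec \<Rightarrow> evec) \<Rightarrow> bool" where
  "psd d A \<longleftrightarrow> (\<forall>h\<in>Rd d. \<forall>u\<in>Rd d. inner (A h) u = inner h (A u)) \<and>
     (\<forall>h\<in>Rd d. 0 \<le> inner h (A h))"

definition loewner_ge :: "nat \<Rightarrow> (evec \<Rightarrow> evec) \<Rightarrow> (evec \<Rightarrow> evec) \<Rightarrow> bool" where
  "loewner_ge d A C \<longleftrightarrow> psd d (\<lambda>h. A h - C h)"

definition nondecr_nonneg :: "(real \<Rightarrow> real) \<Rightarrow> bool" where
  "nondecr_nonneg \<rho> \<longleftrightarrow> mono_on {0..} \<rho> \<and> (\<forall>x\<ge>0. 0 \<le> \<rho> x)"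

definition nondecr_nonneg2 :: "(real \<Rightarrow> real \<Rightarrow> real) \<Rightarrow> bool" where
  "nondecr_nonneg2 \<rho> \<longleftrightarrow>
     (\<forall>y\<ge>0. nondecr_nonneg (\<lambda>x. \<rho> x y)) \<and> (\<forall>x\<ge>0. nondecr_nonneg (\<rho> x))"

definition min_value_zero :: "nat \<Rightarrow> (evec \<Rightarrow> real) \<Rightarrow> bool" where
  "min_value_zero d F \<longleftrightarrow> (\<exists>w\<in>Rd d. F w = 0) \<and> (\<forall>w\<in>Rd d. 0 \<le> F w)"

definition second_order_self_bounding :: "nat \<Rightarrow> (evec \<Rightarrow> real) \<Rightarrow> (real \<Rightarrow> real) \<Rightarrow> bool" where
  "second_order_self_bounding d F \<rho>1 \<longleftrightarrow>
     twice_differentiable d F \<and> nondecr_nonneg \<rho>1 \<and>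
     (\<forall>w\<in>Rd d. op_norm d (hess d F w) \<le> \<rho>1 (F w))"

definition third_order_self_bounding ::
  "nat \<Rightarrow> (evec \<Rightarrow> real) \<Rightarrow> (real \<Rightarrow> real) \<Rightarrow> (real \<Rightarrow> real) \<Rightarrow> bool" where
  "third_order_self_bounding d F \<rho>1 \<rho>2 \<longleftrightarrow>
     second_order_self_bounding d F \<rho>1 \<and> nondecr_nonneg \<rho>2 \<and>
     ((thrice_differentiable d F \<and> (\<forall>w\<in>Rd d. op_norm3 d (third_deriv d F w) \<le> \<rho>2 (F w))) \<or>
      (\<exists>\<delta>0>0. \<forall>w\<in>Rd d. \<forall>w'\<in>Rd d. norm (w - w') \<le> \<delta>0 \<longrightarrow>
         op_norm d (\<lambda>h. hess d F w h - hess d F w' h) \<le> \<rho>2 (F w) * norm (w - w')))"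

text \<open>\<open>P\<close> is the law of the minibatch sample \<open>\<zeta>\<close>; the vector-valued expectation is taken
  coordinatewise.\<close>

definition noise_regularity ::
  "nat \<Rightarrow> 'z measure \<Rightarrow> (evec \<Rightarrow> real) \<Rightarrow> (evec \<Rightarrow> 'z \<Rightarrow> real) \<Rightarrow> (real \<Rightarrow> real) \<Rightarrow> bool" where
  "noise_regularity d P F f \<sigma> \<longleftrightarrow>
     nondecr_nonneg \<sigma> \<and>
     (\<forall>\<zeta>\<in>space P. (\<lambda>w. f w \<zeta>) differentiable_on Rd d) \<and>
     (\<forall>w\<in>Rd d. \<forall>i<d.
        integrable P (\<lambda>\<zeta>. coord (grad d (\<lambda>x. f x \<zeta>) w) i) \<and>
        (\<integral>\<zeta>. coord (grad d (\<lambda>x. f x \<zeta>) w) i \<partial>P) = coord (grad d F w) i) \<and>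
     (\<forall>w\<in>Rd d. \<forall>\<zeta>\<in>space P.
        (norm (grad d (\<lambda>x. f x \<zeta>) w - grad d F w))\<^sup>2 \<le> (\<sigma> (F w))\<^sup>2)"

definition oracle_control ::
  "nat \<Rightarrow> 'z measure \<Rightarrow> (evec \<Rightarrow> real) \<Rightarrow> (evec \<Rightarrow> 'z \<Rightarrow> real) \<Rightarrow> (real \<Rightarrow> real \<Rightarrow> real) \<Rightarrow> bool" where
  "oracle_control d P F f \<rho>3 \<longleftrightarrow>
     nondecr_nonneg2 \<rho>3 \<and>
     (\<forall>\<zeta>\<in>space P. twice_differentiable d (\<lambda>x. f x \<zeta>)) \<and>
     (\<forall>w\<in>Rd d. \<forall>\<zeta>\<in>space P.
        op_norm d (hess d (\<lambda>x. f x \<zeta>) w) \<le> \<rho>3 (norm (grad d (\<lambda>x. f x \<zeta>) w)) (F w))"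


section \<open>Restarted SGD\<close>

definition unif_ball :: "nat \<Rightarrow> evec measure" where
  "unif_ball d =
     distr (uniform_measure (\<Pi>\<^sub>M i\<in>{..<d}. lborel)
              {x \<in> space (\<Pi>\<^sub>M i\<in>{..<d}. lborel). L2_set x {..<d} \<le> 1})
           (restrict_space borel (Rd d)) (vec_of d)"

text \<open>
  The state after some number of oracle calls: the iterates \<open>[p\<^sub>0, \<dots>, p\<^sub>k]\<close> of the
  current block (so the anchor is the head), the candidates output so far, and whether the
  algorithm has stopped.  One step uses one sample \<open>\<zeta>\<close> and one perturbation \<open>\<Lambda>\<close>.  Since
  the samples are i.i.d., continuing along one sequence of samples after a restart is the same as
  restarting with fresh randomness.  In the step below, \<open>length ps\<close> is the index
  \<open>i\<close> of the new iterate \<open>p\<close>, and \<open>c\<close> is the average of \<open>p\<^sub>0, \<dots>, p\<^bsub>i-1\<^esub>\<close>.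
\<close>

type_synonym rsgd_state = "evec list \<times> evec list \<times> bool"

definition rsgd_step ::
  "(evec \<Rightarrow> 'z \<Rightarrow> evec) \<Rightarrow> real \<Rightarrow> nat \<Rightarrow> real \<Rightarrow> real \<Rightarrow> 'z \<times> evec \<Rightarrow> rsgd_state \<Rightarrow> rsgd_state" where
  "rsgd_step g \<eta> K0 B s = (\<lambda>(\<zeta>, \<Lambda>) (ps, cs, stopped).
     if stopped then (ps, cs, True)
     else let p = last ps - \<eta> *\<^sub>R (g (last ps) \<zeta> + s *\<^sub>R \<Lambda>);
              c = (1 / real (length ps)) *\<^sub>R sum_list ps
          in if norm (p - hd ps) > B then ([p], cs @ [c], False)
             else if length ps = K0 then (ps @ [p], cs @ [c], True)
             else (ps @ [p], cs, False))"

primrec rsgd ::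
  "(evec \<Rightarrow> 'z \<Rightarrow> evec) \<Rightarrow> real \<Rightarrow> nat \<Rightarrow> real \<Rightarrow> real \<Rightarrow> evec \<Rightarrow> (nat \<Rightarrow> 'z \<times> evec) \<Rightarrow> nat \<Rightarrow> rsgd_state"
where
  "rsgd g \<eta> K0 B s w0 \<omega> 0 = ([w0], [], False)"
| "rsgd g \<eta> K0 B s w0 \<omega> (Suc n) = rsgd_step g \<eta> K0 B s (\<omega> n) (rsgd g \<eta> K0 B s w0 \<omega> n)"

definition candidates ::
  "(evec \<Rightarrow> 'z \<Rightarrow> evec) \<Rightarrow> real \<Rightarrow> nat \<Rightarrow> real \<Rightarrow> real \<Rightarrow> evec \<Rightarrow> (nat \<Rightarrow> 'z \<times> evec) \<Rightarrow> nat \<Rightarrow> evec list"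
where
  "candidates g \<eta> K0 B s w0 \<omega> n = fst (snd (rsgd g \<eta> K0 B s w0 \<omega> n))"

definition rsgd_prob :: "nat \<Rightarrow> 'z measure \<Rightarrow> (nat \<Rightarrow> 'z \<times> evec) measure" where
  "rsgd_prob d P = (\<Pi>\<^sub>M n\<in>UNIV. P \<Otimes>\<^sub>M unif_ball d)"

definition second_order_stationary :: "nat \<Rightarrow> (evec \<Rightarrow> real) \<Rightarrow> real \<Rightarrow> evec \<Rightarrow> bool" where
  "second_order_stationary d F \<epsilon> w \<longleftrightarrow>
     norm (grad d F w) \<le> \<epsilon> \<and> loewner_ge d (hess d F w) (\<lambda>h. - sqrt \<epsilon> *\<^sub>R h)"

end

theory Submission
  imports Defs "HOL-Real_Asymp.Real_Asymp"
begin

text \<open>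
  Up to powers of logarithms take $B = \epsilon^{1/2}$, $\eta = \epsilon^{3/2}$ and $K_0 = \epsilon^{-2}$, so that a block lasts for the time
  $X = \eta K_0 = \epsilon^{-1/2}$.  On a ball of radius \<open>B\<close> around the anchor, \<open>F\<close> is quadratic up to a negligible error
  and all regularity constants depend only on the value of \<open>F\<close> at the anchor.  With high probability
  three things hold for a block.  If it escapes, then \<open>F\<close> drops by order $B^2 / X = \epsilon^{3/2}$: split the
  quadratic model along the eigenvectors of the Hessian, compare the iteration with noiseless gradient
  descent in the directions of positive curvature, and use that the model is concave in the other
  directions; the noise is controlled by Azuma-type bounds free of the dimension.  If
  it does not escape, then the averaged gradient, which telescopes, is at most \<open>\<epsilon>\<close>.  If
  the Hessian at the anchor has an eigenvalue below $-\epsilon^{1/2}/2$, then it does escape: two copies started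
  \<open>\<eta> / (4 d)\<close> apart along the eigenvector cannot both stay, and the uniform perturbation cannot
  tell their starting points apart.  Since \<open>F \<ge> 0\<close>, only order $\epsilon^{-3/2}$ blocks can escape before one returns a
  second-order stationary point, that is $\epsilon^{-7/2}$ oracle calls.  For \<open>\<epsilon>\<close> above a threshold
  depending on \<open>F w0\<close> the point \<open>w0\<close> itself is stationary.
\<close>

section \<open>The space of finitely supported sequences\<close>

text \<open>The exponents balance three requirements on a block: the cubic error of the model is
  negligible if \<open>A * B * X\<close> is small, the averaged gradient is of order
  \<open>B / X + A * B\<^sup>2\<close>, and noise moves the iterate by about
  \<open>A * sqrt (\<eta> * X)\<close>, which must stay below \<open>B\<close>. Taking
  \<open>X\<close> of order \<open>1 / B\<close> makes the gradient of order
  \<open>B\<^sup>2\<close>, so \<open>B\<close> is about \<open>sqrt \<epsilon>\<close> and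
  \<open>\<eta>\<close> about \<open>B\<^sup>2 / X\<close>. The obstacle is that regularity is
  stated through \<open>F\<close>, without global Lipschitz constants. Within
  \<open>1 / (4 * A)\<close> of the anchor \<open>F\<close> rises by at most 1, so one constant
  \<open>A\<close> computed from \<open>F w0\<close> is valid; a successful escape lowers
  \<open>F\<close>, so the same \<open>A\<close> serves the next anchor. The dimension may enter
  only through logarithms. With positive curvature the noise is weighted so that the squared weights
  sum to a logarithm, whatever the spectrum. Elsewhere the gradient may grow, so noise is measured
  against the random sum of squared gradients, part of which the decrease pays for. At a saddle
  \<open>d\<close> enters through the separation \<open>\<eta> / (4 * d)\<close>, which exponential
  growth makes up for at the cost of a logarithm.\<close>

lemma coord_simps [simp]:
  "coord 0 i = 0" "coord (x + y) i = coord x i + coord y i"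
  "coord (x - y) i = coord x i - coord y i" "coord (- x) i = - coord x i"
  "coord (c *\<^sub>R x) i = c * coord x i"
  by (simp_all add: zero_evec.rep_eq plus_evec.rep_eq minus_evec.rep_eq uminus_evec.rep_eq
      scaleR_evec.rep_eq)

lemma coord_sum [simp]: "coord (sum f A) i = (\<Sum>a\<in>A. coord (f a) i)"
  by (induction A rule: infinite_finite_induct) auto

lemma coord_vec_of [simp]: "coord (vec_of d c) i = (if i < d then c i else 0)"
  by (simp add: vec_of.rep_eq)

definition ebasis :: "nat \<Rightarrow> evec" where
  "ebasis i = vec_of (Suc i) (\<lambda>j. if j = i then 1 else 0)"

lemma coord_ebasis [simp]: "coord (ebasis i) j = (if j = i then 1 else 0)"
  by (simp add: ebasis_def)

lemma inner_ebasis: "inner x (ebasis i) = coord x i"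
proof -
  have "inner (ebasis i) x = (\<Sum>j | coord (ebasis i) j \<noteq> 0. coord (ebasis i) j * coord x j)"
    by (simp add: inner_evec_def)
  also have "{j. coord (ebasis i) j \<noteq> 0} = {i}" by auto
  finally show ?thesis by (simp add: inner_commute)
qed

lemma norm_ebasis [simp]: "norm (ebasis i) = 1"
  by (simp add: norm_eq_sqrt_inner inner_ebasis)

lemma abs_coord_le_norm: "\<bar>coord x i\<bar> \<le> norm x"
  using Cauchy_Schwarz_ineq2[of x "ebasis i"] by (simp add: inner_ebasis)

lemma subspace_Rd [simp]: "subspace (Rd d)"
  by (auto simp: subspace_def Rd_def)

lemma Rd_closed_ops [simp, intro]:
  "0 \<in> Rd d" "x \<in> Rd d \<Longrightarrow> y \<in> Rd d \<Longrightarrow> x + y \<in> Rd d"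
  "x \<in> Rd d \<Longrightarrow> y \<in> Rd d \<Longrightarrow> x - y \<in> Rd d" "x \<in> Rd d \<Longrightarrow> - x \<in> Rd d"
  "x \<in> Rd d \<Longrightarrow> c *\<^sub>R x \<in> Rd d"
  by (auto simp: Rd_def)

lemma Rd_sum [intro]: "(\<And>a. a \<in> A \<Longrightarrow> f a \<in> Rd d) \<Longrightarrow> sum f A \<in> Rd d"
  by (auto simp: Rd_def)

lemma Rd_sum_list [intro]: "set xs \<subseteq> Rd d \<Longrightarrow> sum_list xs \<in> Rd d"
  by (induction xs) auto

lemma vec_of_in_Rd [simp]: "vec_of d c \<in> Rd d"
  by (auto simp: Rd_def)

lemma ebasis_in_Rd [simp]: "i < d \<Longrightarrow> ebasis i \<in> Rd d"
  by (auto simp: Rd_def)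

lemma vec_of_eq_sum: "vec_of d c = (\<Sum>i<d. c i *\<^sub>R ebasis i)"
  by (rule evec_eqI) (auto simp: if_distrib[of "(*) _"] cong: if_cong)

lemma vec_of_coord: "x \<in> Rd d \<Longrightarrow> vec_of d (coord x) = x"
  by (rule evec_eqI) (auto simp: Rd_def)

lemma Rd_eq_sum: "x \<in> Rd d \<Longrightarrow> x = (\<Sum>i<d. coord x i *\<^sub>R ebasis i)"
  using vec_of_coord vec_of_eq_sum by metis

lemma ex_Rd: "\<exists>d. x \<in> Rd d"
proof -
  have "finite {i. coord x i \<noteq> 0}" by simp
  then obtain d where "\<forall>i\<in>{i. coord x i \<noteq> 0}. i < d"
    using finite_nat_set_iff_bounded by blast
  then have "x \<in> Rd d" by (auto simp: Rd_def)
  then show ?thesis ..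
qed

lemma inner_Rd: "x \<in> Rd d \<Longrightarrow> inner x y = (\<Sum>i<d. coord x i * coord y i)"
  by (subst Rd_eq_sum[of x d]) (simp_all add: inner_sum_left inner_commute[of "ebasis _"] inner_ebasis)

lemma norm_le_sum_coord: "x \<in> Rd d \<Longrightarrow> norm x \<le> (\<Sum>i<d. \<bar>coord x i\<bar>)"
  by (subst Rd_eq_sum[of x d], assumption) (rule order.trans[OF norm_sum], simp)

lemma bounded_linear_coord: "bounded_linear (\<lambda>x. coord x i)"
  using bounded_linear_inner_left[of "ebasis i"] by (simp add: inner_ebasis)

lemmas continuous_on_coord [continuous_intros] =
  bounded_linear.continuous_on[OF bounded_linear_coord]

lemma closed_Rd [simp]: "closed (Rd d)"
proof -
  have "Rd d = (\<Inter>i\<in>{d..}. {x. coord x i = 0})" by (auto simp: Rd_def)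
  moreover have "closed {x. coord x i = 0}" for i
    by (intro closed_Collect_eq continuous_intros)
  ultimately show ?thesis by auto
qed

text \<open>Orthogonal projection onto \<open>Rd d\<close>. Precomposing with it extends maps that
  are controlled only on \<open>Rd d\<close> to measurable ones on all of
  \<open>evec\<close>.\<close>

definition proj :: "nat \<Rightarrow> evec \<Rightarrow> evec" where
  "proj d x = vec_of d (coord x)"

lemma proj_in_Rd [simp]: "proj d x \<in> Rd d"
  by (simp add: proj_def)

lemma proj_id [simp]: "x \<in> Rd d \<Longrightarrow> proj d x = x"
  by (simp add: proj_def vec_of_coord)

lemma coord_proj: "coord (proj d x) i = (if i < d then coord x i else 0)"
  by (simp add: proj_def)

lemma inner_proj: "y \<in> Rd d \<Longrightarrow> inner y (proj d x) = inner y x"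
  by (simp add: inner_Rd coord_proj)

lemma norm_proj_le: "norm (proj d x) \<le> norm x"
proof -
  have "(norm (proj d x))\<^sup>2 = inner (proj d x) x"
    by (metis inner_proj power2_norm_eq_inner proj_in_Rd)
  also have "\<dots> \<le> norm (proj d x) * norm x" by (rule norm_cauchy_schwarz)
  finally show ?thesis
    by (cases "norm (proj d x) = 0") (auto simp: power2_eq_square mult_le_cancel_left)
qed

lemma linear_proj: "linear (proj d)"
  by (rule linearI) (auto intro!: evec_eqI simp: coord_proj)

lemma bounded_linear_proj: "bounded_linear (proj d)"
  using linear_proj norm_proj_le
  by (intro bounded_linear_intro[where K=1])
     (auto simp: linear_add linear_scale)

lemmas continuous_on_proj [continuous_intros] =
  bounded_linear.continuous_on[OF bounded_linear_proj]

text \<open>Vectors with finitely many nonzero coordinates, all rational, form a countable dense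
  set. Second countability is what makes sums and differences of \<open>evec\<close>-valued random
  variables Borel measurable.\<close>

instance evec :: second_countable_topology
proof
  define D where "D = range (\<lambda>l::rat list. vec_of (length l) (\<lambda>i. of_rat (l ! i)))"
  define B where "B = (\<lambda>(q, r::rat). ball q (of_rat r)) ` (D \<times> UNIV)"
  have "countable D" unfolding D_def by simp
  then have cB: "countable B" unfolding B_def by simp
  have dense: "\<exists>q\<in>D. dist x q < e" if "e > 0" for x e
  proof -
    obtain d where d: "x \<in> Rd d" using ex_Rd by blast
    define e' where "e' = e / (real d + 1)"
    have "e' > 0" using that by (simp add: e'_def)
    have "\<exists>r::rat. \<bar>coord x i - of_rat r\<bar> < e'" for i
    proof -
      obtain q where "q \<in> \<rat>" "coord x i - e' < q" "q < coord x i"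
        using Rats_dense_in_real[of "coord x i - e'" "coord x i"] \<open>e' > 0\<close> by auto
      then show ?thesis by (metis Rats_cases abs_of_pos diff_gt_0_iff_gt diff_less_eq less_diff_eq add.commute)
    qed
    then obtain r :: "nat \<Rightarrow> rat" where r: "\<And>i. \<bar>coord x i - of_rat (r i)\<bar> < e'" by metis
    define l where "l = map r [0..<d]"
    define q where "q = vec_of (length l) (\<lambda>i. of_rat (l ! i))"
    have "q \<in> D" by (auto simp: q_def D_def)
    have "q = vec_of d (\<lambda>i. of_rat (r i))" by (rule evec_eqI) (auto simp: q_def l_def)
    then have "norm (x - q) \<le> (\<Sum>i<d. \<bar>coord x i - of_rat (r i)\<bar>)"
      using norm_le_sum_coord[of "x - q" d] d by simp
    also have "\<dots> \<le> (\<Sum>i<d. e')" using r by (intro sum_mono) (simp add: less_imp_le)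
    also have "\<dots> < e" using that by (simp add: e'_def field_simps)
    finally show ?thesis using \<open>q \<in> D\<close> by (auto simp: dist_norm)
  qed
  have "topological_basis B"
  proof (rule topological_basisI)
    show "open b" if "b \<in> B" for b using that by (auto simp: B_def)
    fix U and x :: evec assume "open U" "x \<in> U"
    then obtain e where e: "e > 0" "ball x e \<subseteq> U" using open_contains_ball by blast
    obtain r :: rat where r: "0 < real_of_rat r" "real_of_rat r < e / 2"
      using Rats_dense_in_real[of 0 "e/2"] e by (auto elim!: Rats_cases)
    obtain q where q: "q \<in> D" "dist x q < of_rat r" using dense r by blast
    have "ball q (of_rat r) \<subseteq> ball x e"
    proof
      fix y assume "y \<in> ball q (of_rat r)"
      then show "y \<in> ball x e" using q(2) r dist_triangle[of x y q] by simp
    qed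
    with q e show "\<exists>b\<in>B. x \<in> b \<and> b \<subseteq> U"
      by (intro bexI[of _ "ball q (of_rat r)"]) (auto simp: B_def dist_commute)
  qed
  with cB show "\<exists>B::evec set set. countable B \<and> open = generate_topology B"
    using topological_basis_imp_subbasis by blast
qed

lemma borel_measurable_evecI:
  assumes "\<And>x. x \<in> space M \<Longrightarrow> f x \<in> Rd d"
    and "\<And>i. i < d \<Longrightarrow> (\<lambda>x. coord (f x) i) \<in> borel_measurable M"
  shows "f \<in> borel_measurable M"
proof -
  have "(\<lambda>x. \<Sum>i<d. coord (f x) i *\<^sub>R ebasis i) \<in> borel_measurable M"
    using assms(2) by (intro borel_measurable_sum borel_measurable_scaleR) auto
  then show ?thesis
    by (rule measurable_cong[THEN iffD1, rotated]) (simp add: Rd_eq_sum[symmetric] assms(1))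
qed

lemma borel_measurable_proj [measurable]: "proj d \<in> borel_measurable borel"
  by (intro borel_measurable_continuous_onI continuous_intros)

text \<open>Closed bounded sets need not be compact in \<open>evec\<close>. The sphere of
  \<open>Rd d\<close> is a closed part of the image of the cube \<open>C\<close>, compact by
  Tychonoff's theorem, under the continuous map \<open>vec_of d\<close>.\<close>

lemma compact_Rd_sphere: "compact (Rd d \<inter> sphere 0 1)"
proof -
  define C :: "(nat \<Rightarrow> real) set" where "C = PiE UNIV (\<lambda>_. {-1..1})"
  have "compactin (product_topology (\<lambda>_. euclidean) UNIV) C"
    unfolding C_def by (subst compactin_PiE) auto
  then have "compact C" by (simp add: euclidean_product_topology)
  moreover have "continuous_on C (vec_of d)"
    unfolding vec_of_eq_sum
    by (intro continuous_intros continuous_on_product_then_coordinatewise continuous_on_id)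
  ultimately have 1: "compact (vec_of d ` C)" by (rule compact_continuous_image[rotated])
  have "x \<in> vec_of d ` C" if "x \<in> Rd d" "norm x = 1" for x
  proof (rule image_eqI)
    show "x = vec_of d (coord x)" using that by (simp add: vec_of_coord)
    show "coord x \<in> C" using abs_coord_le_norm[of x] that by (auto simp: C_def abs_le_iff minus_le_iff)
  qed
  then have "Rd d \<inter> sphere 0 1 = vec_of d ` C \<inter> (Rd d \<inter> sphere 0 1)" by auto
  also have "compact \<dots>" by (intro compact_Int_closed 1 closed_Int closed_Rd)
      (auto simp: sphere_def intro!: closed_Collect_eq continuous_intros)
  finally show ?thesis .
qed

lemma linear_bounded_on_Rd:
  assumes "linear A" shows "\<exists>C. \<forall>h\<in>Rd d. norm (A h) \<le> C * norm h"
proof (intro exI ballI)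
  fix h assume "h \<in> Rd d"
  then have "A h = (\<Sum>i<d. coord h i *\<^sub>R A (ebasis i))"
    by (subst Rd_eq_sum[of h d]) (simp_all add: linear_sum[OF assms] linear_scale[OF assms])
  then have "norm (A h) \<le> (\<Sum>i<d. \<bar>coord h i\<bar> * norm (A (ebasis i)))"
    using norm_sum[of "\<lambda>i. coord h i *\<^sub>R A (ebasis i)" "{..<d}"] by simp
  also have "\<dots> \<le> (\<Sum>i<d. norm h * norm (A (ebasis i)))"
    by (intro sum_mono mult_right_mono abs_coord_le_norm) auto
  finally show "norm (A h) \<le> (\<Sum>i<d. norm (A (ebasis i))) * norm h"
    by (simp add: sum_distrib_left mult.commute)
qed

section \<open>Eigenbases of symmetric operators\<close>

definition symmetric_on :: "nat \<Rightarrow> (evec \<Rightarrow> evec) \<Rightarrow> bool" where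
  "symmetric_on d H \<longleftrightarrow> linear H \<and> H ` Rd d \<subseteq> Rd d \<and>
     (\<forall>x\<in>Rd d. \<forall>y\<in>Rd d. inner (H x) y = inner x (H y))"

definition eigenbasis :: "nat \<Rightarrow> (evec \<Rightarrow> evec) \<Rightarrow> (nat \<Rightarrow> evec) \<Rightarrow> (nat \<Rightarrow> real) \<Rightarrow> bool" where
  "eigenbasis d H e l \<longleftrightarrow> (\<forall>i<d. e i \<in> Rd d \<and> H (e i) = l i *\<^sub>R e i) \<and>
     (\<forall>i<d. \<forall>j<d. inner (e i) (e j) = (if i = j then 1 else 0))"

text \<open>Dimension count by Steinitz exchange, orthonormal vectors being independent. It yields
  both the existence of a further eigenvector and the completeness of the eigenbasis.\<close>

lemma orthonormal_span_le:
  fixes b c :: "nat \<Rightarrow> evec"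
  assumes "\<And>i j. i < m \<Longrightarrow> j < m \<Longrightarrow> inner (b i) (b j) = (if i = j then 1 else 0)"
    and "b ` {..<m} \<subseteq> span (c ` {..<k})"
  shows "m \<le> k"
proof -
  have inj: "inj_on b {..<m}"
  proof (rule inj_onI)
    fix i j assume "i \<in> {..<m}" "j \<in> {..<m}" "b i = b j"
    then show "i = j" using assms(1)[of i i] assms(1)[of i j] by (auto split: if_splits)
  qed
  have "independent (b ` {..<m})"
  proof (rule pairwise_orthogonal_independent)
    show "pairwise orthogonal (b ` {..<m})"
      using assms(1) by (auto simp: pairwise_def orthogonal_def)
    show "0 \<notin> b ` {..<m}" using assms(1) by fastforce
  qed
  then have "card (b ` {..<m}) \<le> card (c ` {..<k})"
    using independent_span_bound[OF _ _ assms(2)] by blast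
  also have "\<dots> \<le> k" using card_image_le[of "{..<k}" c] by simp
  finally show ?thesis using card_image[OF inj] by simp
qed

lemma inner_orthonormal_residual:
  fixes e :: "nat \<Rightarrow> 'a::real_inner"
  assumes "\<And>i j. i < k \<Longrightarrow> j < k \<Longrightarrow> inner (e i) (e j) = (if i = j then 1 else 0)" "i < k"
  shows "inner (e i) (v - (\<Sum>j<k. inner (e j) v *\<^sub>R e j)) = 0"
proof -
  have "(\<Sum>j<k. inner (e j) v * inner (e i) (e j)) = (\<Sum>j<k. if j = i then inner (e j) v else 0)"
    by (rule sum.cong) (use assms in auto)
  then show ?thesis using assms(2) by (simp add: inner_diff_right inner_sum_right)
qed

text \<open>Inductive step of the spectral theorem: \<open>H\<close> preserves the orthogonal
  complement \<open>W\<close> of the eigenvectors found so far, the Rayleigh quotient attains its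
  maximum on the compact unit sphere of \<open>W\<close>, and a maximiser is an eigenvector.\<close>

lemma ex_eigenvector_orthogonal:
  assumes H: "symmetric_on d H" and "k < d"
    and e: "\<And>i. i < k \<Longrightarrow> e i \<in> Rd d \<and> H (e i) = l i *\<^sub>R e i"
    and on: "\<And>i j. i < k \<Longrightarrow> j < k \<Longrightarrow> inner (e i) (e j) = (if i = j then 1 else 0)"
  shows "\<exists>v c. v \<in> Rd d \<and> norm v = 1 \<and> H v = c *\<^sub>R v \<and> (\<forall>i<k. inner (e i) v = 0)"
proof -
  have lin: "linear H" and HR: "\<And>x. x \<in> Rd d \<Longrightarrow> H x \<in> Rd d"
    and sym: "\<And>x y. x \<in> Rd d \<Longrightarrow> y \<in> Rd d \<Longrightarrow> inner (H x) y = inner x (H y)"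
    using H by (auto simp: symmetric_on_def)
  define W where "W = {v \<in> Rd d. \<forall>i<k. inner (e i) v = 0}"
  have subW: "a *\<^sub>R v + c *\<^sub>R w \<in> W" if "v \<in> W" "w \<in> W" for v w a c
    using that by (auto simp: W_def inner_add_right)
  have HW: "H v \<in> W" if "v \<in> W" for v
    using that e HR by (auto simp: W_def sym[symmetric])
  \<comment> \<open>Otherwise the \<open>k\<close> vectors found so far would span
    \<open>Rd d\<close>, contradicting \<open>k < d\<close>.\<close>
  have "\<exists>v\<in>W. v \<noteq> 0"
  proof (rule ccontr)
    assume "\<not> ?thesis"
    then have W0: "\<And>v. v \<in> W \<Longrightarrow> v = 0" by auto
    have "v \<in> span (e ` {..<k})" if "v \<in> Rd d" for v
    proof -
      have "v - (\<Sum>j<k. inner (e j) v *\<^sub>R e j) \<in> W"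
        unfolding W_def using that e inner_orthonormal_residual[OF on]
        by (auto intro!: Rd_closed_ops Rd_sum)
      then have "v = (\<Sum>j<k. inner (e j) v *\<^sub>R e j)" using W0 by fastforce
      then show ?thesis by (metis (no_types, lifting) imageI span_base span_scale span_sum)
    qed
    then have "ebasis ` {..<d} \<subseteq> span (e ` {..<k})" by auto
    then have "d \<le> k"
      by (intro orthonormal_span_le[of d ebasis e k]) (auto simp: inner_ebasis)
    with \<open>k < d\<close> show False by simp
  qed
  then obtain w where w: "w \<in> W" "w \<noteq> 0" by blast
  define Sp where "Sp = W \<inter> sphere 0 1"
  have "closed {v. \<forall>i<k. inner (e i) v = 0}"
  proof -
    have "{v. \<forall>i<k. inner (e i) v = 0} = (\<Inter>i\<in>{..<k}. {v. inner (e i) v = 0})" by auto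
    also have "closed \<dots>" by (intro closed_INT ballI closed_Collect_eq continuous_intros)
    finally show ?thesis .
  qed
  moreover have "Sp = (Rd d \<inter> sphere 0 1) \<inter> {v. \<forall>i<k. inner (e i) v = 0}"
    by (auto simp: Sp_def W_def)
  ultimately have "compact Sp" by (simp only:) (rule compact_Int_closed[OF compact_Rd_sphere])
  moreover have "(1 / norm w) *\<^sub>R w \<in> Sp"
    using w subW[OF w(1) w(1), of "1/norm w" 0] by (simp add: Sp_def)
  moreover have "continuous_on Sp (\<lambda>v. inner v (H v))"
  proof -
    \<comment> \<open>\<open>H\<close> is bounded only on \<open>Rd d\<close>; composing with
      \<open>proj d\<close> gives a bounded operator on the whole space with the same values on
      \<open>Sp\<close>.\<close>
    have "bounded_linear (\<lambda>v. H (proj d v))"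
    proof -
      obtain C where C: "\<And>h. h \<in> Rd d \<Longrightarrow> norm (H h) \<le> C * norm h"
        using linear_bounded_on_Rd[OF lin] by blast
      have "norm (H (proj d v)) \<le> norm v * \<bar>C\<bar>" for v
      proof -
        have "norm (H (proj d v)) \<le> C * norm (proj d v)" by (rule C) simp
        also have "\<dots> \<le> \<bar>C\<bar> * norm v"
          by (intro mult_mono norm_proj_le) auto
        finally show ?thesis by (simp add: mult.commute)
      qed
      then show ?thesis
        by (intro bounded_linear_intro[where K="\<bar>C\<bar>"])
           (auto simp: linear_add[OF lin] linear_scale[OF lin] linear_add[OF linear_proj]
             linear_scale[OF linear_proj])
    qed
    from bounded_linear.continuous_on[OF this continuous_on_id]
    have "continuous_on Sp (\<lambda>v. H (proj d v))" .
    then have "continuous_on Sp (\<lambda>v. inner v (H (proj d v)))"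
      by (intro continuous_on_inner continuous_on_id)
    moreover have "inner v (H (proj d v)) = inner v (H v)" if "v \<in> Sp" for v
      using that by (simp add: Sp_def W_def)
    ultimately show ?thesis by (simp cong: continuous_on_cong)
  qed
  ultimately obtain v where v: "v \<in> Sp" "\<And>y. y \<in> Sp \<Longrightarrow> inner y (H y) \<le> inner v (H v)"
    using continuous_attains_sup[of Sp "\<lambda>v. inner v (H v)"] by blast
  define c where "c = inner v (H v)"
  have vW: "v \<in> W" and v1: "norm v = 1" using v(1) by (auto simp: Sp_def)
  have vv: "inner v v = 1" using v1 by (simp add: norm_eq_sqrt_inner)
  have ray: "inner y (H y) \<le> c * inner y y" if "y \<in> W" for y
  proof (cases "y = 0")
    case True then show ?thesis by (simp add: linear_0[OF lin])
  next
    case False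
    have "(1 / norm y) *\<^sub>R y \<in> Sp"
      using False subW[OF that that, of "1/norm y" 0] by (simp add: Sp_def)
    from v(2)[OF this] have "inner y (H y) / (norm y)\<^sup>2 \<le> c"
      using False by (simp add: linear_scale[OF lin] c_def power2_eq_square)
    then show ?thesis using False by (simp add: power2_norm_eq_inner divide_le_eq)
  qed
  define r where "r = c *\<^sub>R v - H v"
  have rW: "r \<in> W" using subW[OF vW HW[OF vW], of c "-1"] by (simp add: r_def)
  \<comment> \<open>First variation of the Rayleigh quotient at its maximiser \<open>v\<close> in the direction \<open>r\<close>.\<close>
  have var: "2 * t * inner r r \<le> t\<^sup>2 * (c * inner r r - inner r (H r))" for t
  proof -
    define z where "z = v + (- t) *\<^sub>R r"
    have "z \<in> W" using subW[OF vW rW, of 1 "-t"] by (simp add: z_def)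
    then have "inner z (H z) \<le> c * inner z z" by (rule ray)
    moreover have "inner v (H r) = inner r (H v)"
      using sym[of v r] rW vW by (simp add: W_def inner_commute)
    then have "inner z (H z) = c - 2 * (t * inner r (H v)) + t\<^sup>2 * inner r (H r)"
      unfolding z_def
      by (simp add: linear_add[OF lin] linear_scale[OF lin] inner_add_left linear_diff[OF lin]
          inner_add_right inner_diff_left inner_diff_right c_def[symmetric] power2_eq_square algebra_simps)
    moreover have "c * inner z z = c - 2 * (t * (c * inner r v)) + t\<^sup>2 * (c * inner r r)"
      unfolding z_def
      by (simp add: inner_add_left inner_add_right inner_diff_left inner_diff_right vv
          inner_commute[of v r] power2_eq_square algebra_simps)
    moreover have "t * inner r r = t * (c * inner r v) - t * inner r (H v)"
      by (subst (2) r_def) (simp add: inner_diff_right right_diff_distrib)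
    ultimately show ?thesis by (simp add: right_diff_distrib)
  qed
  have "inner r r = 0"
  proof (rule ccontr)
    assume "inner r r \<noteq> 0"
    then have p: "inner r r > 0" by simp
    \<comment> \<open>With this \<open>q\<close> and \<open>t = inner r r / q\<close>, the
      inequality \<open>var\<close> implies \<open>2 * inner r r \<le> inner r r\<close>.\<close>
    define q where "q = \<bar>c * inner r r - inner r (H r)\<bar> + 1"
    have q: "q > 0" by (simp add: q_def add_nonneg_pos)
    define t where "t = inner r r / q"
    have t: "t > 0" using p q by (simp add: t_def)
    have "2 * t * inner r r \<le> t\<^sup>2 * q"
      using var[of t] by (rule order.trans) (auto intro!: mult_left_mono simp: q_def)
    then have "2 * inner r r \<le> t * q" using t by (simp add: power2_eq_square)
    then show False using q p by (simp add: t_def)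
  qed
  then have "H v = c *\<^sub>R v" by (simp add: r_def)
  with vW v1 show ?thesis by (auto simp: W_def)
qed

lemma ex_eigenbasis:
  assumes H: "symmetric_on d H"
  shows "\<exists>e l. eigenbasis d H e l"
proof -
  have "\<exists>e l. (\<forall>i<k. e i \<in> Rd d \<and> H (e i) = l i *\<^sub>R e i) \<and>
     (\<forall>i<k. \<forall>j<k. inner (e i) (e j) = (if i = j then 1 else 0))" if "k \<le> d" for k
    using that
  proof (induction k)
    case (Suc k)
    then obtain e :: "nat \<Rightarrow> evec" and l where e: "\<forall>i<k. e i \<in> Rd d \<and> H (e i) = l i *\<^sub>R e i"
      "\<forall>i<k. \<forall>j<k. inner (e i) (e j) = (if i = j then 1 else 0)" by auto
    obtain v c where v: "v \<in> Rd d" "norm v = 1" "H v = c *\<^sub>R v" "\<forall>i<k. inner (e i) v = 0"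
      using ex_eigenvector_orthogonal[OF H, of k e l] e Suc.prems by auto
    have "inner v v = 1" using v(2) by (simp add: norm_eq_sqrt_inner)
    with e v show ?case
      by (intro exI[of _ "e(k := v)"] exI[of _ "l(k := c)"]) (auto simp: less_Suc_eq inner_commute)
  qed auto
  from this[of d] show ?thesis by (auto simp: eigenbasis_def)
qed

locale eigen =
  fixes d :: nat and H :: "evec \<Rightarrow> evec" and e :: "nat \<Rightarrow> evec" and l :: "nat \<Rightarrow> real"
  assumes symH: "symmetric_on d H" and eb: "eigenbasis d H e l"
begin

lemma linH: "linear H" and HR: "x \<in> Rd d \<Longrightarrow> H x \<in> Rd d"
    and sym: "x \<in> Rd d \<Longrightarrow> y \<in> Rd d \<Longrightarrow> inner (H x) y = inner x (H y)"
  using symH by (auto simp: symmetric_on_def)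

lemma e_Rd [simp]: "i < d \<Longrightarrow> e i \<in> Rd d" and He: "i < d \<Longrightarrow> H (e i) = l i *\<^sub>R e i"
  and on: "i < d \<Longrightarrow> j < d \<Longrightarrow> inner (e i) (e j) = (if i = j then 1 else 0)"
  using eb by (auto simp: eigenbasis_def)

lemma norm_e: "i < d \<Longrightarrow> norm (e i) = 1"
  using on[of i i] by (simp add: norm_eq_sqrt_inner)

text \<open>A nonzero remainder, normalised, would extend \<open>e\<close> to \<open>d + 1\<close>
  orthonormal vectors inside the span of \<open>d\<close> basis vectors.\<close>

lemma expand:
  assumes "v \<in> Rd d" shows "(\<Sum>i<d. inner (e i) v *\<^sub>R e i) = v"
proof (rule ccontr)
  define w where "w = v - (\<Sum>i<d. inner (e i) v *\<^sub>R e i)"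
  assume "\<not> ?thesis"
  then have w0: "w \<noteq> 0" by (auto simp: w_def)
  have wR: "w \<in> Rd d" using assms by (auto simp: w_def intro!: Rd_closed_ops Rd_sum)
  have we: "inner (e i) w = 0" if "i < d" for i
    unfolding w_def by (rule inner_orthonormal_residual) (use on that in auto)
  define b where "b = e(d := (1 / norm w) *\<^sub>R w)"
  have "Suc d \<le> d"
  proof (rule orthonormal_span_le[of "Suc d" b ebasis])
    show "inner (b i) (b j) = (if i = j then 1 else 0)" if "i < Suc d" "j < Suc d" for i j
      using that on we w0 by (auto simp: b_def less_Suc_eq inner_commute[of w] dot_square_norm power2_eq_square norm_e)
    have "b i \<in> Rd d" if "i < Suc d" for i using that wR by (auto simp: b_def less_Suc_eq)
    moreover have "x \<in> span (ebasis ` {..<d})" if "x \<in> Rd d" for x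
      by (subst Rd_eq_sum[OF that]) (intro span_sum span_scale span_base imageI)
    ultimately show "b ` {..<Suc d} \<subseteq> span (ebasis ` {..<d})" by auto
  qed
  then show False by simp
qed

lemma inner_expand:
  assumes "v \<in> Rd d" shows "inner v w = (\<Sum>i<d. inner (e i) v * inner (e i) w)"
  by (subst expand[OF assms, symmetric]) (simp add: inner_sum_left)

lemma norm2_expand: "v \<in> Rd d \<Longrightarrow> (norm v)\<^sup>2 = (\<Sum>i<d. (inner (e i) v)\<^sup>2)"
  using inner_expand[of v v] by (simp add: power2_norm_eq_inner flip: power2_eq_square)

lemma inner_e_H: "i < d \<Longrightarrow> v \<in> Rd d \<Longrightarrow> inner (e i) (H v) = l i * inner (e i) v"
  by (simp add: sym[symmetric] He)

lemma inner_H_expand: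
  assumes "v \<in> Rd d" shows "inner v (H v) = (\<Sum>i<d. l i * (inner (e i) v)\<^sup>2)"
  by (subst inner_expand[OF assms]) (auto intro!: sum.cong simp: inner_e_H assms power2_eq_square)

text \<open>Functional calculus in the eigenbasis. Unlike \<open>H\<close>, about which nothing is
  known off \<open>Rd d\<close>, it is continuous on the whole space.\<close>

definition diag :: "(nat \<Rightarrow> real) \<Rightarrow> evec \<Rightarrow> evec" where
  "diag c v = (\<Sum>i<d. (c i * inner (e i) v) *\<^sub>R e i)"

lemma diag_Rd [simp]: "diag c v \<in> Rd d"
  by (auto simp: diag_def intro!: Rd_sum)

lemma inner_e_diag: "i < d \<Longrightarrow> inner (e i) (diag c v) = c i * inner (e i) v"
proof -
  assume i: "i < d"
  have "(\<Sum>j<d. c j * inner (e j) v * inner (e i) (e j)) = (\<Sum>j<d. if j = i then c j * inner (e j) v else 0)"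
    by (rule sum.cong) (use on i in auto)
  then show ?thesis using i by (simp add: diag_def inner_sum_right)
qed

lemma inner_diag_left: "inner w (diag c v) = inner (diag c w) v"
  by (simp add: diag_def inner_sum_left inner_sum_right inner_commute algebra_simps)

lemma linear_diag: "linear (diag c)"
  by (rule linearI) (simp_all add: diag_def inner_add_right algebra_simps sum.distrib scaleR_sum_right)

lemma norm2_diag: "(norm (diag c v))\<^sup>2 = (\<Sum>i<d. (c i)\<^sup>2 * (inner (e i) v)\<^sup>2)"
  by (simp add: norm2_expand inner_e_diag power_mult_distrib)

lemma norm_diag_le:
  assumes "\<And>i. i < d \<Longrightarrow> \<bar>c i\<bar> \<le> C" "v \<in> Rd d" "0 \<le> C"
  shows "norm (diag c v) \<le> C * norm v"
proof (rule power2_le_imp_le)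
  have "(norm (diag c v))\<^sup>2 \<le> (\<Sum>i<d. C\<^sup>2 * (inner (e i) v)\<^sup>2)"
    unfolding norm2_diag using assms by (intro sum_mono mult_right_mono) (auto simp: abs_le_square_iff[symmetric])
  also have "\<dots> = (C * norm v)\<^sup>2"
    by (simp add: norm2_expand[OF assms(2)] power_mult_distrib sum_distrib_left)
  finally show "(norm (diag c v))\<^sup>2 \<le> (C * norm v)\<^sup>2" .
qed (use assms in auto)

lemma borel_measurable_diag [measurable]: "diag c \<in> borel_measurable borel"
  unfolding diag_def by (intro borel_measurable_continuous_onI continuous_intros)

end

section \<open>Calculus on $\mathbb{R}^d$\<close>

text \<open>The whole line lies in \<open>Rd d\<close>, so a derivative within this subspace
  restricts to an ordinary two-sided one, and one-variable calculus applies.\<close>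

lemma has_vector_derivative_line:
  assumes "(f has_derivative D) (at (w + t *\<^sub>R h) within Rd d)" "w \<in> Rd d" "h \<in> Rd d"
  shows "((\<lambda>s. f (w + s *\<^sub>R h)) has_vector_derivative D h) (at t)"
proof -
  have "((\<lambda>s. w + s *\<^sub>R h) has_derivative (\<lambda>s. s *\<^sub>R h)) (at t)"
    by (auto intro!: derivative_eq_intros)
  moreover have "(f has_derivative D) (at (w + t *\<^sub>R h) within range (\<lambda>s. w + s *\<^sub>R h))"
    using assms by (elim has_derivative_subset) auto
  ultimately have "((\<lambda>s. f (w + s *\<^sub>R h)) has_derivative (\<lambda>s. D (s *\<^sub>R h))) (at t)"
    by (rule has_derivative_in_compose[where s=UNIV])
  moreover have "linear D" using assms(1) has_derivative_linear by blast
  ultimately show ?thesis by (simp add: has_vector_derivative_def linear_scale)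
qed

lemma has_derivative_Rd_unique:
  assumes "(f has_derivative D) (at w within Rd d)" "(f has_derivative D') (at w within Rd d)"
    and "w \<in> Rd d" "h \<in> Rd d"
  shows "D h = D' h"
  using has_vector_derivative_line[of f D w 0 h d] has_vector_derivative_line[of f D' w 0 h d] assms
  by (auto intro: vector_derivative_unique_at)

lemma has_derivative_Rd_cong:
  assumes "(f has_derivative D) (at w within Rd d)" "w \<in> Rd d" "bounded_linear D'"
    and "\<And>h. h \<in> Rd d \<Longrightarrow> D h = D' h"
  shows "(f has_derivative D') (at w within Rd d)"
proof -
  have "((\<lambda>y. (1 / norm (y - w)) *\<^sub>R (f y - (f w + D (y - w)))) \<longlongrightarrow> 0) (at w within Rd d)"
    using assms(1) by (simp add: has_derivative_within)
  then have "((\<lambda>y. (1 / norm (y - w)) *\<^sub>R (f y - (f w + D' (y - w)))) \<longlongrightarrow> 0) (at w within Rd d)"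
    by (rule Lim_transform_eventually) (auto simp: eventually_at_topological assms intro!: exI[of _ UNIV])
  then show ?thesis using assms(3) by (simp add: has_derivative_within)
qed

lemma mvt_Rd:
  fixes f :: "evec \<Rightarrow> evec"
  assumes S: "convex S" "S \<subseteq> Rd d" and xy: "x \<in> S" "y \<in> S"
    and D: "\<And>z. z \<in> S \<Longrightarrow> (f has_derivative D z) (at z within Rd d)"
    and C: "\<And>z h. z \<in> S \<Longrightarrow> h \<in> Rd d \<Longrightarrow> norm (D z h) \<le> C * norm h"
  shows "norm (f y - f x) \<le> C * norm (y - x)"
proof -
  have xyR: "x \<in> Rd d" "y - x \<in> Rd d" using xy S by auto
  have seg: "x + t *\<^sub>R (y - x) \<in> S" if "t \<in> {0..1}" for t
    using that xy S(1) unfolding convex_alt by (simp add: algebra_simps)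
  define k where "k t = f (x + t *\<^sub>R (y - x))" for t
  have "norm (k 1 - k 0) \<le> (C * norm (y - x)) * norm (1 - 0 :: real)"
  proof (rule differentiable_bound[of "{0..1::real}"])
    fix t :: real assume t: "t \<in> {0..1}"
    have "(k has_vector_derivative D (x + t *\<^sub>R (y - x)) (y - x)) (at t)"
      unfolding k_def by (rule has_vector_derivative_line) (use D seg t xyR in auto)
    then show "(k has_derivative (\<lambda>s. s *\<^sub>R D (x + t *\<^sub>R (y - x)) (y - x))) (at t within {0..1})"
      by (simp add: has_vector_derivative_def has_derivative_at_withinI)
    show "onorm (\<lambda>s::real. s *\<^sub>R D (x + t *\<^sub>R (y - x)) (y - x)) \<le> C * norm (y - x)"
      by (rule onorm_le) (use C[OF seg[OF t] xyR(2)] in \<open>auto simp: mult.commute intro!: mult_left_mono\<close>)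
  qed auto
  then show ?thesis by (simp add: k_def)
qed

text \<open>\<open>op_norm\<close> is a supremum of reals and bounds something only once the set is
  known to be bounded above; finite dimension supplies that.\<close>

lemma op_norm_bound:
  assumes "linear A" "op_norm d A \<le> C" "h \<in> Rd d"
  shows "norm (A h) \<le> C * norm h"
proof (cases "h = 0")
  case True then show ?thesis using linear_0[OF assms(1)] by simp
next
  case False
  obtain K where K: "\<And>h. h \<in> Rd d \<Longrightarrow> norm (A h) \<le> K * norm h"
    using linear_bounded_on_Rd[OF assms(1)] by blast
  have "norm (A x) \<le> \<bar>K\<bar>" if "x \<in> Rd d \<inter> cball 0 1" for x
  proof -
    have "norm (A x) \<le> K * norm x" using K that by blast
    also have "\<dots> \<le> \<bar>K\<bar> * 1" using that by (intro mult_mono) auto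
    finally show ?thesis by simp
  qed
  then have "bdd_above ((\<lambda>h. norm (A h)) ` (Rd d \<inter> cball 0 1))" by (intro bdd_aboveI2)
  moreover have "(1 / norm h) *\<^sub>R h \<in> Rd d \<inter> cball 0 1" using assms(3) by auto
  ultimately have "norm (A ((1 / norm h) *\<^sub>R h)) \<le> op_norm d A"
    unfolding op_norm_def by (rule cSUP_upper[rotated])
  then have "norm (A h) / norm h \<le> C" using assms(2) by (simp add: linear_scale[OF assms(1)])
  then show ?thesis using False by (simp add: divide_le_eq)
qed

lemma grad_works:
  assumes "f differentiable (at w within Rd d)" "w \<in> Rd d"
  shows "grad d f w \<in> Rd d" "(f has_derivative (\<lambda>h. inner (grad d f w) h)) (at w within Rd d)"
proof -
  obtain D where D: "(f has_derivative D) (at w within Rd d)"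
    using assms(1) by (auto simp: differentiable_def)
  have lin: "linear D" using D has_derivative_linear by blast
  define g where "g = (\<Sum>i<d. D (ebasis i) *\<^sub>R ebasis i)"
  have gR: "g \<in> Rd d" by (auto simp: g_def intro!: Rd_sum)
  have "D h = inner g h" if "h \<in> Rd d" for h
  proof -
    have "D h = (\<Sum>i<d. coord h i * D (ebasis i))"
      by (subst Rd_eq_sum[OF that]) (simp add: linear_sum[OF lin] linear_scale[OF lin])
    then show ?thesis
      by (simp add: g_def inner_sum_left inner_commute[of "ebasis _"] inner_ebasis mult.commute)
  qed
  then have gd: "(f has_derivative (\<lambda>h. inner g h)) (at w within Rd d)"
    by (rule has_derivative_Rd_cong[OF D assms(2) bounded_linear_inner_right])
  have "g' = g" if "g' \<in> Rd d" "(f has_derivative (\<lambda>h. inner g' h)) (at w within Rd d)" for g'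
  proof -
    have "inner g' (g' - g) = inner g (g' - g)"
      using has_derivative_Rd_unique[OF that(2) gd assms(2)] that gR by blast
    then have "inner (g' - g) (g' - g) = 0" by (simp add: inner_diff_left)
    then show ?thesis by simp
  qed
  then have "grad d f w = g" unfolding grad_def using gR gd by blast
  then show "grad d f w \<in> Rd d" "(f has_derivative (\<lambda>h. inner (grad d f w) h)) (at w within Rd d)"
    using gR gd by auto
qed

text \<open>The coordinates of \<open>k\<close> from \<open>d\<close> on vanish along
  \<open>Rd d\<close>, hence so do their derivatives.\<close>

lemma has_derivative_in_Rd:
  fixes k :: "evec \<Rightarrow> evec"
  assumes "(k has_derivative D) (at w within Rd d)" "w \<in> Rd d" "\<And>x. x \<in> Rd d \<Longrightarrow> k x \<in> Rd d" "h \<in> Rd d"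
  shows "D h \<in> Rd d"
proof -
  have "coord (D h) i = 0" if "i \<ge> d" for i
  proof (rule has_derivative_Rd_unique[of "\<lambda>x. coord (k x) i" "\<lambda>h. coord (D h) i" w d "\<lambda>h. 0"])
    show "((\<lambda>x. coord (k x) i) has_derivative (\<lambda>h. coord (D h) i)) (at w within Rd d)"
      by (rule bounded_linear.has_derivative[OF bounded_linear_coord assms(1)])
    show "((\<lambda>x. coord (k x) i) has_derivative (\<lambda>h. 0)) (at w within Rd d)"
      by (rule has_derivative_transform[OF assms(2) _ has_derivative_const[of 0]])
         (use assms(3) that in \<open>auto simp: Rd_def\<close>)
  qed (use assms in auto)
  then show ?thesis by (simp add: Rd_def)
qed

lemma twice_differentiable_works:
  assumes "twice_differentiable d f" "w \<in> Rd d"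
  shows "grad d f w \<in> Rd d" "(f has_derivative (\<lambda>h. inner (grad d f w) h)) (at w within Rd d)"
    "(grad d f has_derivative hess d f w) (at w within Rd d)" "linear (hess d f w)"
    "h \<in> Rd d \<Longrightarrow> hess d f w h \<in> Rd d"
proof -
  have g: "grad d f x \<in> Rd d" "(f has_derivative (\<lambda>h. inner (grad d f x) h)) (at x within Rd d)"
    if "x \<in> Rd d" for x
    using grad_works[of f x d] that assms(1)
    by (auto simp: twice_differentiable_def differentiable_on_def)
  show "grad d f w \<in> Rd d" "(f has_derivative (\<lambda>h. inner (grad d f w) h)) (at w within Rd d)"
    using g assms(2) by auto
  show *: "(grad d f has_derivative hess d f w) (at w within Rd d)"
    using assms unfolding hess_def
    by (auto simp: twice_differentiable_def differentiable_on_def frechet_derivative_works)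
  then show "linear (hess d f w)" by (rule has_derivative_linear)
  show "h \<in> Rd d \<Longrightarrow> hess d f w h \<in> Rd d"
    using has_derivative_in_Rd[OF * assms(2)] g by blast
qed

text \<open>\<open>third_deriv\<close> is defined one vector \<open>u\<close> at a time, so
  linearity in \<open>u\<close> has to be recovered (\<open>Tsum\<close>) from uniqueness of
  derivatives. Only then is the supremum in \<open>op_norm3\<close> seen to be bounded, and scaling
  the arguments to unit length gives the estimate.\<close>

lemma op_norm3_bound:
  assumes "thrice_differentiable d f" "w \<in> Rd d" "op_norm3 d (third_deriv d f w) \<le> C"
    and "h \<in> Rd d" "u \<in> Rd d"
  shows "((\<lambda>x. hess d f x u) has_derivative (\<lambda>h. third_deriv d f w h u)) (at w within Rd d)"
    and "norm (third_deriv d f w h u) \<le> C * norm h * norm u"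
proof -
  let ?T = "third_deriv d f w"
  have tw: "twice_differentiable d f" using assms(1) by (simp add: thrice_differentiable_def)
  have D: "((\<lambda>x. hess d f x u) has_derivative (\<lambda>h. ?T h u)) (at w within Rd d)" if "u \<in> Rd d" for u
    using assms(1,2) that unfolding third_deriv_def
    by (auto simp: thrice_differentiable_def differentiable_on_def frechet_derivative_works)
  then show "((\<lambda>x. hess d f x u) has_derivative (\<lambda>h. ?T h u)) (at w within Rd d)"
    using assms by blast
  have linT: "linear (\<lambda>h. ?T h u)" if "u \<in> Rd d" for u
    using D[OF that] by (rule has_derivative_linear)
  have TR: "?T h u \<in> Rd d" if "h \<in> Rd d" "u \<in> Rd d" for h u
    by (rule has_derivative_in_Rd[OF D[OF that(2)] assms(2) _ that(1)])
       (use twice_differentiable_works(5)[OF tw] that in auto)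
  have Tsum: "?T h u = (\<Sum>i<d. coord u i *\<^sub>R ?T h (ebasis i))" if "h \<in> Rd d" "u \<in> Rd d" for h u
  proof (rule has_derivative_Rd_unique[OF D[OF that(2)] _ assms(2) that(1)])
    have "((\<lambda>x. \<Sum>i<d. coord u i *\<^sub>R hess d f x (ebasis i)) has_derivative
            (\<lambda>h. \<Sum>i<d. coord u i *\<^sub>R ?T h (ebasis i))) (at w within Rd d)"
      by (intro has_derivative_sum has_derivative_scaleR_right D) auto
    moreover have "hess d f x u = (\<Sum>i<d. coord u i *\<^sub>R hess d f x (ebasis i))" if "x \<in> Rd d" for x
      using twice_differentiable_works(4)[OF tw that] Rd_eq_sum[OF \<open>u \<in> Rd d\<close>]
      by (metis (no_types, lifting) linear_scale linear_sum sum.cong)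
    ultimately show "((\<lambda>x. hess d f x u) has_derivative
            (\<lambda>h. \<Sum>i<d. coord u i *\<^sub>R ?T h (ebasis i))) (at w within Rd d)"
      using has_derivative_transform[OF assms(2)] by (metis (no_types, lifting))
  qed
  have "\<exists>C. \<forall>h\<in>Rd d. norm (?T h (ebasis i)) \<le> C * norm h" if "i < d" for i
    by (rule linear_bounded_on_Rd[OF linT]) (use that in auto)
  then obtain K where K: "\<And>i h. i < d \<Longrightarrow> h \<in> Rd d \<Longrightarrow> norm (?T h (ebasis i)) \<le> K i * norm h"
    by metis
  let ?U = "Rd d \<inter> cball 0 1"
  have bd: "\<bar>inner (?T h u) v\<bar> \<le> (\<Sum>i<d. \<bar>K i\<bar>)" if "h \<in> ?U" "u \<in> ?U" "v \<in> ?U" for h u v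
  proof -
    have "\<bar>inner (?T h u) v\<bar> \<le> norm (?T h u) * norm v" by (rule Cauchy_Schwarz_ineq2)
    also have "\<dots> \<le> norm (?T h u)" using that by (simp add: mult_left_le)
    also have "\<dots> \<le> (\<Sum>i<d. \<bar>coord u i\<bar> * norm (?T h (ebasis i)))"
      using norm_sum[of "\<lambda>i. coord u i *\<^sub>R ?T h (ebasis i)" "{..<d}"] Tsum that by simp
    also have "\<dots> \<le> (\<Sum>i<d. 1 * \<bar>K i\<bar>)"
    proof (intro sum_mono mult_mono)
      fix i assume i: "i \<in> {..<d}"
      show "\<bar>coord u i\<bar> \<le> 1" using abs_coord_le_norm[of u i] that by simp
      have "norm (?T h (ebasis i)) \<le> K i * norm h" using K i that by auto
      also have "\<dots> \<le> \<bar>K i\<bar> * 1" using that by (intro mult_mono) auto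
      finally show "norm (?T h (ebasis i)) \<le> \<bar>K i\<bar>" by simp
    qed auto
    finally show ?thesis by simp
  qed
  have le1: "\<bar>inner (?T h u) v\<bar> \<le> C" if "h \<in> ?U" "u \<in> ?U" "v \<in> ?U" for h u v
  proof -
    have "bdd_above ((\<lambda>(h, u, v). \<bar>inner (?T h u) v\<bar>) ` (?U \<times> ?U \<times> ?U))"
      unfolding bdd_above_def by (rule exI[of _ "\<Sum>i<d. \<bar>K i\<bar>"]) (use bd in auto)
    then have "(\<lambda>(h, u, v). \<bar>inner (?T h u) v\<bar>) (h, u, v) \<le> op_norm3 d ?T"
      unfolding op_norm3_def Let_def using that by (intro cSUP_upper) auto
    then show ?thesis using assms(3) by simp
  qed
  show "norm (?T h u) \<le> C * norm h * norm u"
  proof (cases "?T h u = 0 \<or> h = 0 \<or> u = 0")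
    case True
    moreover have "C \<ge> 0" using le1[of 0 0 0] linear_0[OF linT[of 0]] by simp
    moreover have "?T 0 u = 0" using linear_0[OF linT[OF assms(5)]] .
    moreover have "?T h 0 = 0" using Tsum[OF assms(4), of 0] by simp
    ultimately show ?thesis by auto
  next
    case False
    let ?v = "?T h u"
    let ?h = "(1 / norm h) *\<^sub>R h" and ?u = "(1 / norm u) *\<^sub>R u" and ?w = "(1 / norm ?v) *\<^sub>R ?v"
    have "?T ?h ?u = (1 / norm u) *\<^sub>R ?T ?h u"
      using Tsum[of ?h ?u] Tsum[of ?h u] assms by (simp add: scaleR_sum_right)
    also have "?T ?h u = (1 / norm h) *\<^sub>R ?v" by (rule linear_scale[OF linT[OF assms(5)]])
    finally have eq: "?T ?h ?u = (1 / norm u) *\<^sub>R (1 / norm h) *\<^sub>R ?v" .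
    have "\<bar>inner (?T ?h ?u) ?w\<bar> \<le> C"
      by (rule le1) (use assms False TR in auto)
    moreover have "inner (?T ?h ?u) ?w = norm ?v / (norm u * norm h)"
      unfolding eq using False by (simp add: dot_square_norm power2_eq_square)
    ultimately have "norm ?v / (norm u * norm h) \<le> C" using abs_le_D1 by metis
    then show ?thesis using False by (simp add: divide_le_eq mult_ac)
  qed
qed

lemma quadratic_upper_bound_real:
  fixes \<phi> \<phi>' \<phi>'' :: "real \<Rightarrow> real"
  assumes "0 \<le> t" and "\<And>s. 0 \<le> s \<Longrightarrow> s \<le> t \<Longrightarrow> (\<phi> has_real_derivative \<phi>' s) (at s)"
    and "\<And>s. 0 \<le> s \<Longrightarrow> s \<le> t \<Longrightarrow> (\<phi>' has_real_derivative \<phi>'' s) (at s)"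
    and "\<And>s. 0 < s \<Longrightarrow> s < t \<Longrightarrow> \<phi>'' s \<le> L"
  shows "\<phi> t \<le> \<phi> 0 + \<phi>' 0 * t + L * t\<^sup>2 / 2"
proof -
  have 1: "\<phi>' s \<le> \<phi>' 0 + L * s" if "0 \<le> s" "s \<le> t" for s
  proof -
    have "L * 0 - \<phi>' 0 \<le> L * s - \<phi>' s"
    proof (rule DERIV_nonneg_imp_increasing_open[OF that(1)])
      fix r assume r: "0 < r" "r < s"
      have "(\<phi>' has_real_derivative \<phi>'' r) (at r)" by (rule assms(3)) (use r that in auto)
      then have "((\<lambda>r. L * r - \<phi>' r) has_real_derivative (L - \<phi>'' r)) (at r)"
        by (auto intro!: derivative_eq_intros)
      then show "\<exists>y. ((\<lambda>r. L * r - \<phi>' r) has_real_derivative y) (at r) \<and> 0 \<le> y"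
        using assms(4)[of r] r that by (intro exI[of _ "L - \<phi>'' r"]) auto
    next
      show "continuous_on {0..s} (\<lambda>r. L * r - \<phi>' r)"
        by (intro continuous_intros continuous_at_imp_continuous_on ballI
            DERIV_isCont[OF assms(3)]) (use that in auto)
    qed
    then show ?thesis by simp
  qed
  have "\<phi>' 0 * 0 + L * 0\<^sup>2 / 2 - \<phi> 0 \<le> \<phi>' 0 * t + L * t\<^sup>2 / 2 - \<phi> t"
  proof (rule DERIV_nonneg_imp_increasing_open[OF assms(1)])
    fix r assume r: "0 < r" "r < t"
    have "(\<phi> has_real_derivative \<phi>' r) (at r)" by (rule assms(2)) (use r in auto)
    then have "((\<lambda>r. \<phi>' 0 * r + L * r\<^sup>2 / 2 - \<phi> r) has_real_derivative (\<phi>' 0 + L * r - \<phi>' r)) (at r)"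
      by (auto intro!: derivative_eq_intros)
    then show "\<exists>y. ((\<lambda>r. \<phi>' 0 * r + L * r\<^sup>2 / 2 - \<phi> r) has_real_derivative y) (at r) \<and> 0 \<le> y"
      using 1[of r] r by (intro exI[of _ "\<phi>' 0 + L * r - \<phi>' r"]) auto
  next
    show "continuous_on {0..t} (\<lambda>r. \<phi>' 0 * r + L * r\<^sup>2 / 2 - \<phi> r)"
      by (intro continuous_intros continuous_at_imp_continuous_on ballI
            DERIV_isCont[OF assms(2)]) auto
  qed
  then show ?thesis by simp
qed

text \<open>The bound on the second derivative is only available below the level \<open>a + 1\<close>; looking at the
  first time that this level is reached shows that it is never reached.\<close>

lemma quadratic_upper_bound_below_level:
  fixes \<phi> \<phi>' \<phi>'' :: "real \<Rightarrow> real"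
  assumes "0 \<le> R" and d1: "\<And>s. 0 \<le> s \<Longrightarrow> s \<le> R \<Longrightarrow> (\<phi> has_real_derivative \<phi>' s) (at s)"
    and d2: "\<And>s. 0 \<le> s \<Longrightarrow> s \<le> R \<Longrightarrow> (\<phi>' has_real_derivative \<phi>'' s) (at s)"
    and L: "\<And>s. 0 \<le> s \<Longrightarrow> s \<le> R \<Longrightarrow> \<phi> s \<le> a + 1 \<Longrightarrow> \<phi>'' s \<le> L"
    and init: "\<phi> 0 \<le> a" "\<phi>' 0 \<le> c"
    and small: "\<And>s. 0 \<le> s \<Longrightarrow> s \<le> R \<Longrightarrow> c * s + L * s\<^sup>2 / 2 < 1"
  shows "\<phi> R \<le> a + c * R + L * R\<^sup>2 / 2"
proof -
  have bound: "\<phi> t \<le> a + c * t + L * t\<^sup>2 / 2"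
    if "0 \<le> t" "t \<le> R" "\<And>s. 0 \<le> s \<Longrightarrow> s < t \<Longrightarrow> \<phi> s < a + 1" for t
  proof -
    have "\<phi> t \<le> \<phi> 0 + \<phi>' 0 * t + L * t\<^sup>2 / 2"
    proof (rule quadratic_upper_bound_real[OF that(1)])
      show "(\<phi> has_real_derivative \<phi>' s) (at s)" if "0 \<le> s" "s \<le> t" for s
        using d1 that \<open>t \<le> R\<close> by simp
      show "(\<phi>' has_real_derivative \<phi>'' s) (at s)" if "0 \<le> s" "s \<le> t" for s
        using d2 that \<open>t \<le> R\<close> by simp
      show "\<phi>'' s \<le> L" if "0 < s" "s < t" for s
        using L[of s] that \<open>t \<le> R\<close> \<open>\<And>s. 0 \<le> s \<Longrightarrow> s < t \<Longrightarrow> \<phi> s < a + 1\<close>[of s] by simp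
    qed
    also have "\<dots> \<le> a + c * t + L * t\<^sup>2 / 2"
      using init that by (intro add_mono mult_right_mono) auto
    finally show ?thesis .
  qed
  have "\<phi> t < a + 1" if t: "0 \<le> t" "t \<le> R" for t
  proof (rule ccontr)
    assume not: "\<not> \<phi> t < a + 1"
    define Z where "Z = {0..R} \<inter> \<phi> -` {a + 1..}"
    have cont: "continuous_on {0..R} \<phi>"
      by (intro continuous_at_imp_continuous_on ballI DERIV_isCont[OF d1]) auto
    have "closed Z" unfolding Z_def
      using continuous_closed_preimage[OF cont] by simp
    moreover have "Z \<noteq> {}" using not t by (auto simp: Z_def)
    moreover have bdd: "bdd_below Z" by (rule bdd_belowI[of _ 0]) (auto simp: Z_def)
    ultimately have inf: "Inf Z \<in> Z" by (intro closed_contains_Inf)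
    have "\<phi> s < a + 1" if "0 \<le> s" "s < Inf Z" for s
    proof (rule ccontr)
      assume "\<not> \<phi> s < a + 1"
      then have "s \<in> Z" using that inf by (auto simp: Z_def)
      then have "Inf Z \<le> s" by (rule cInf_lower) (rule bdd)
      with that show False by simp
    qed
    then have "\<phi> (Inf Z) \<le> a + c * Inf Z + L * (Inf Z)\<^sup>2 / 2"
      using inf by (intro bound) (auto simp: Z_def)
    moreover have "c * Inf Z + L * (Inf Z)\<^sup>2 / 2 < 1" using inf by (intro small) (auto simp: Z_def)
    ultimately show False using inf by (simp add: Z_def)
  qed
  then show ?thesis using bound[of R] assms(1) by simp
qed

section \<open>Self-bounding regularity is locally uniform\<close>

text \<open>Interface between the assumptions and the analysis of a block: beyond it the bounds
  \<open>\<rho>1\<close>, \<open>\<rho>2\<close>, \<open>\<rho>3\<close> and \<open>\<sigma>\<close>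
  are felt only through the constant \<open>A\<close>.\<close>

definition locally_regular ::
  "nat \<Rightarrow> 'z set \<Rightarrow> (evec \<Rightarrow> real) \<Rightarrow> (evec \<Rightarrow> evec) \<Rightarrow> (evec \<Rightarrow> evec \<Rightarrow> evec) \<Rightarrow>
   (evec \<Rightarrow> 'z \<Rightarrow> evec) \<Rightarrow> real \<Rightarrow> evec \<Rightarrow> real \<Rightarrow> bool" where
  "locally_regular d Z F g H gf A u r \<longleftrightarrow>
     u \<in> Rd d \<and> symmetric_on d (H u) \<and> (\<forall>h\<in>Rd d. norm (H u h) \<le> A * norm h) \<and>
     (\<forall>x\<in>Rd d \<inter> cball u r. norm (g x) \<le> A \<and> (\<forall>\<zeta>\<in>Z. norm (gf x \<zeta> - g x) \<le> A) \<and>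
        (\<forall>h\<in>Rd d. norm (H x h - H u h) \<le> A * norm (x - u) * norm h) \<and>
        F x \<le> F u + inner (g u) (x - u) + inner (x - u) (H u (x - u)) / 2 + A * norm (x - u) ^ 3 \<and>
        (\<forall>y\<in>Rd d \<inter> cball u r. \<forall>\<zeta>\<in>Z. norm (gf x \<zeta> - gf y \<zeta>) \<le> A * norm (x - y))) \<and>
     (\<forall>s\<le>r. \<forall>x\<in>Rd d \<inter> cball u s. \<forall>y\<in>Rd d \<inter> cball u s.
        norm (g y - g x - H u (y - x)) \<le> A * s * norm (y - x))"

locale objective =
  fixes d :: nat and F :: "evec \<Rightarrow> real" and \<rho>1 \<rho>2 :: "real \<Rightarrow> real"
  assumes min0: "min_value_zero d F" and tosb: "third_order_self_bounding d F \<rho>1 \<rho>2"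
begin

abbreviation "g \<equiv> grad d F"
abbreviation "H \<equiv> hess d F"

lemma F_nonneg: "w \<in> Rd d \<Longrightarrow> 0 \<le> F w"
  using min0 by (simp add: min_value_zero_def)

lemma tdiff: "twice_differentiable d F" and mono1: "nondecr_nonneg \<rho>1"
  and op1: "w \<in> Rd d \<Longrightarrow> op_norm d (H w) \<le> \<rho>1 (F w)" and mono2: "nondecr_nonneg \<rho>2"
  using tosb by (auto simp: third_order_self_bounding_def second_order_self_bounding_def)

lemmas g_Rd = twice_differentiable_works(1)[OF tdiff]
  and F_deriv = twice_differentiable_works(2)[OF tdiff]
  and g_deriv = twice_differentiable_works(3)[OF tdiff]
  and H_lin = twice_differentiable_works(4)[OF tdiff]
  and H_Rd = twice_differentiable_works(5)[OF tdiff]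

lemma H_bound:
  assumes "w \<in> Rd d" "F w \<le> a" "h \<in> Rd d"
  shows "norm (H w h) \<le> \<rho>1 a * norm h"
proof -
  have "\<rho>1 (F w) \<le> \<rho>1 a"
    using mono1 F_nonneg[OF assms(1)] assms(2) by (auto simp: nondecr_nonneg_def monotone_on_def)
  then show ?thesis
    using op_norm_bound[OF H_lin[OF assms(1)] op1[OF assms(1)] assms(3)]
    by (smt (verit) mult_right_mono norm_ge_zero)
qed

lemma line_derivs:
  assumes "w \<in> Rd d" "v \<in> Rd d"
  shows "((\<lambda>s. F (w + s *\<^sub>R v)) has_real_derivative inner (g (w + s *\<^sub>R v)) v) (at s)"
    and "((\<lambda>s. inner (g (w + s *\<^sub>R v)) v) has_real_derivative inner (H (w + s *\<^sub>R v) v) v) (at s)"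
proof -
  have R: "w + s *\<^sub>R v \<in> Rd d" using assms by auto
  show "((\<lambda>s. F (w + s *\<^sub>R v)) has_real_derivative inner (g (w + s *\<^sub>R v)) v) (at s)"
    using has_vector_derivative_line[OF F_deriv[OF R] assms]
    by (simp add: has_real_derivative_iff_has_vector_derivative)
  show "((\<lambda>s. inner (g (w + s *\<^sub>R v)) v) has_real_derivative inner (H (w + s *\<^sub>R v) v) v) (at s)"
    using bounded_linear.has_vector_derivative[OF bounded_linear_inner_left
        has_vector_derivative_line[OF g_deriv[OF R] assms]]
    by (simp add: has_real_derivative_iff_has_vector_derivative)
qed

lemma line_bound:
  assumes "w \<in> Rd d" "F w \<le> a" "v \<in> Rd d" "norm v = 1" "0 \<le> R" "inner (g w) v \<le> c"
    and "\<And>s. 0 \<le> s \<Longrightarrow> s \<le> R \<Longrightarrow> c * s + (\<rho>1 (a + 1) + 1) * s\<^sup>2 / 2 < 1"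
  shows "F (w + R *\<^sub>R v) \<le> a + c * R + (\<rho>1 (a + 1) + 1) * R\<^sup>2 / 2"
proof (rule quadratic_upper_bound_below_level[OF assms(5)])
  show "((\<lambda>s. F (w + s *\<^sub>R v)) has_real_derivative inner (g (w + s *\<^sub>R v)) v) (at s)"
    "((\<lambda>s. inner (g (w + s *\<^sub>R v)) v) has_real_derivative inner (H (w + s *\<^sub>R v) v) v) (at s)" for s
    using line_derivs assms by auto
  show "inner (H (w + s *\<^sub>R v) v) v \<le> \<rho>1 (a + 1) + 1" if "F (w + s *\<^sub>R v) \<le> a + 1" for s
  proof -
    have "inner (H (w + s *\<^sub>R v) v) v \<le> norm (H (w + s *\<^sub>R v) v) * norm v" by (rule norm_cauchy_schwarz)
    also have "\<dots> \<le> \<rho>1 (a + 1)" using H_bound[OF _ that assms(3)] assms by auto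
    finally show ?thesis by simp
  qed
qed (use assms in auto)

lemma rho1_nonneg: "0 \<le> a \<Longrightarrow> 0 \<le> \<rho>1 a"
  using mono1 by (simp add: nondecr_nonneg_def)

text \<open>A nonnegative function cannot fall far: moving by \<open>G / L\<close> along the
  negative gradient lowers the quadratic upper bound by \<open>G\<^sup>2 / (2 * L)\<close>, so this
  is at most \<open>a\<close>. Then \<open>G \<le> 1 + G\<^sup>2\<close> replaces a square root. The
  summand 1 in \<open>L\<close> makes it safe to divide by.\<close>

lemma grad_bound:
  assumes "w \<in> Rd d" "F w \<le> a"
  shows "norm (g w) \<le> 1 + 2 * (\<rho>1 (a + 1) + 1) * a"
proof (cases "g w = 0")
  case False
  define G where "G = norm (g w)"
  define L where "L = \<rho>1 (a + 1) + 1"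
  define v where "v = (- 1 / G) *\<^sub>R g w"
  have a: "0 \<le> a" using F_nonneg assms by fastforce
  have L: "L \<ge> 1" using rho1_nonneg[of "a+1"] a by (simp add: L_def)
  have G: "G > 0" using False by (simp add: G_def)
  have "F (w + (G / L) *\<^sub>R v) \<le> a + (- G) * (G / L) + (\<rho>1 (a + 1) + 1) * (G / L)\<^sup>2 / 2"
  proof (rule line_bound[OF assms])
    show "v \<in> Rd d" using g_Rd assms by (auto simp: v_def)
    show "norm v = 1" using G by (simp add: v_def G_def)
    show "inner (g w) v \<le> - G" using G by (simp add: v_def G_def dot_square_norm power2_eq_square)
    show "0 \<le> G / L" using G L by simp
    fix s :: real assume s: "0 \<le> s" "s \<le> G / L"
    have "L * s\<^sup>2 / 2 = s * (L * s) / 2" by (simp add: power2_eq_square)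
    also have "\<dots> \<le> s * G / 2" using s L by (intro divide_right_mono mult_left_mono) (auto simp: field_simps)
    also have "\<dots> \<le> G * s" using s G by (simp add: mult.commute)
    finally show "- G * s + (\<rho>1 (a + 1) + 1) * s\<^sup>2 / 2 < 1" by (simp add: L_def)
  qed
  moreover have "0 \<le> F (w + (G / L) *\<^sub>R v)" using g_Rd assms by (intro F_nonneg) (auto simp: v_def)
  moreover have "(\<rho>1 (a + 1) + 1) * (G / L)\<^sup>2 / 2 = G\<^sup>2 / L / 2"
    using L by (simp add: L_def[symmetric] power2_eq_square)
  moreover have "- G * (G / L) = - (G\<^sup>2 / L)" by (simp add: power2_eq_square)
  ultimately have "G\<^sup>2 / L / 2 \<le> a" by linarith
  then have "G\<^sup>2 \<le> 2 * L * a" using L by (simp add: field_simps)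
  moreover have "G \<le> 1 + G\<^sup>2" using zero_le_power2[of "G - 1"] zero_le_power2[of G]
    unfolding power2_diff using G by simp
  ultimately show ?thesis by (simp add: G_def L_def)
next
  case True
  then show ?thesis using F_nonneg[OF assms(1)] assms(2) rho1_nonneg[of "a+1"] by simp
qed

text \<open>A quadratic upper bound with slope and curvature at most \<open>A\<close> rises by less
  than 1 over a distance \<open>1 / (4 * A)\<close>. Hence on this ball every nondecreasing bound
  evaluated at \<open>F\<close> is at most its value at \<open>a + 1\<close>.\<close>

lemma level_bound:
  assumes "w \<in> Rd d" "F w \<le> a" "y \<in> Rd d" "norm (y - w) \<le> r" "norm (g w) \<le> A"
    and "\<rho>1 (a + 1) + 1 \<le> A" "r \<le> 1 / (4 * A)"
  shows "F y \<le> a + 1"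
proof (cases "y = w")
  case False
  define R where "R = norm (y - w)"
  define v where "v = (1 / R) *\<^sub>R (y - w)"
  have a: "0 \<le> a" using F_nonneg assms by fastforce
  have A: "1 \<le> A" using assms(6) rho1_nonneg[of "a+1"] a by simp
  have R: "R > 0" "R \<le> 1 / (4 * A)" using False assms by (auto simp: R_def)
  have small: "A * s + (\<rho>1 (a + 1) + 1) * s\<^sup>2 / 2 < 1" if "0 \<le> s" "s \<le> R" for s
  proof -
    have "A * s \<le> A * (1 / (4 * A))" using that R A by (intro mult_left_mono) auto
    then have As: "A * s \<le> 1 / 4" using A by simp
    moreover have "s \<le> A * s" using A that by (simp add: mult_right_le_one_le mult_le_cancel_right1)
    ultimately have s1: "s \<le> 1 / 4" by simp
    have "(\<rho>1 (a + 1) + 1) * s\<^sup>2 \<le> A * s\<^sup>2" using assms(6) by (intro mult_right_mono) auto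
    also have "\<dots> = (A * s) * s" by (simp add: power2_eq_square)
    also have "\<dots> \<le> (1 / 4) * 1" using As s1 that A by (intro mult_mono) auto
    finally show ?thesis using As by simp
  qed
  have "F (w + R *\<^sub>R v) \<le> a + A * R + (\<rho>1 (a + 1) + 1) * R\<^sup>2 / 2"
  proof (rule line_bound[OF assms(1,2)])
    show "v \<in> Rd d" using assms by (auto simp: v_def)
    show "norm v = 1" using R by (simp add: v_def R_def)
    then show "inner (g w) v \<le> A" using norm_cauchy_schwarz[of "g w" v] assms(5) by simp
  qed (use R small in auto)
  also have "\<dots> \<le> a + 1" using small[of R] R by simp
  finally show ?thesis using R by (simp add: v_def)
next
  case True
  then show ?thesis using assms by simp
qed

text \<open>In case (i) this is the mean value inequality. In case (ii) the bound holds only up to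
  distance \<open>\<delta>0\<close>, so the segment is cut into \<open>n\<close> equal pieces that
  are short enough; convexity keeps the intermediate points where \<open>F \<le> a\<close>, and the
  lengths add up to the whole.\<close>

lemma hess_lipschitz_convex:
  assumes S: "convex S" "S \<subseteq> Rd d" "\<And>x. x \<in> S \<Longrightarrow> F x \<le> a" and xy: "x \<in> S" "y \<in> S" and h: "h \<in> Rd d"
  shows "norm (H y h - H x h) \<le> \<rho>2 a * norm (y - x) * norm h"
proof -
  have le: "\<rho>2 (F z) \<le> \<rho>2 a" if "z \<in> S" for z
  proof -
    have "0 \<le> F z" "F z \<le> a" using F_nonneg[of z] S that by auto
    then show ?thesis using mono2 by (auto simp: nondecr_nonneg_def monotone_on_def)
  qed
  consider (i) "thrice_differentiable d F" "\<And>w. w \<in> Rd d \<Longrightarrow> op_norm3 d (third_deriv d F w) \<le> \<rho>2 (F w)"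
    | (ii) \<delta>0 where "\<delta>0 > 0" "\<And>w w'. w \<in> Rd d \<Longrightarrow> w' \<in> Rd d \<Longrightarrow> norm (w - w') \<le> \<delta>0 \<Longrightarrow>
         op_norm d (\<lambda>h. H w h - H w' h) \<le> \<rho>2 (F w) * norm (w - w')"
    using tosb unfolding third_order_self_bounding_def by blast
  then show ?thesis
  proof cases
    case i
    have "norm (H y h - H x h) \<le> (\<rho>2 a * norm h) * norm (y - x)"
    proof (rule mvt_Rd[OF S(1,2) xy])
      fix z assume z: "z \<in> S"
      then have zR: "z \<in> Rd d" using S by auto
      show "((\<lambda>x. H x h) has_derivative (\<lambda>k. third_deriv d F z k h)) (at z within Rd d)"
        by (rule op_norm3_bound(1)[OF i(1) zR i(2)[OF zR] h h])
      fix k assume k: "k \<in> Rd d"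
      have "norm (third_deriv d F z k h) \<le> \<rho>2 (F z) * norm k * norm h"
        by (rule op_norm3_bound(2)[OF i(1) zR i(2)[OF zR] k h])
      also have "\<dots> \<le> \<rho>2 a * norm k * norm h"
        using le[OF z] by (intro mult_right_mono) auto
      finally show "norm (third_deriv d F z k h) \<le> \<rho>2 a * norm h * norm k" by (simp add: mult_ac)
    qed
    then show ?thesis by (simp add: mult_ac)
  next
    case ii
    obtain n :: nat where n: "norm (y - x) / \<delta>0 < real n" using reals_Archimedean2 by blast
    have n0: "0 < real n" using n ii(1) by (meson divide_nonneg_pos le_less_trans norm_ge_zero)
    define z where "z i = x + (real i / real n) *\<^sub>R (y - x)" for i
    have zS: "z i \<in> S" if "i \<le> n" for i
    proof -
      have "z i = (1 - real i / real n) *\<^sub>R x + (real i / real n) *\<^sub>R y" by (simp add: z_def algebra_simps)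
      then show ?thesis using S(1) xy that n0 unfolding convex_alt by auto
    qed
    have step: "norm (H (z (Suc i)) h - H (z i) h) \<le> \<rho>2 a * (norm (y - x) / real n) * norm h" if "i < n" for i
    proof -
      have "z (Suc i) - z i = (1 / real n) *\<^sub>R (y - x)"
        by (simp add: z_def scaleR_left_diff_distrib[symmetric] diff_divide_distrib[symmetric])
      then have nz: "norm (z (Suc i) - z i) = norm (y - x) / real n" by simp
      have zR: "z (Suc i) \<in> Rd d" "z i \<in> Rd d" using zS[of i] zS[of "Suc i"] that S(2) by auto
      have "norm (H (z (Suc i)) h - H (z i) h) \<le> (\<rho>2 (F (z (Suc i))) * norm (z (Suc i) - z i)) * norm h"
      proof (rule op_norm_bound[OF _ _ h])
        show "linear (\<lambda>h. H (z (Suc i)) h - H (z i) h)"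
          using linear_compose_sub[OF H_lin[OF zR(1)] H_lin[OF zR(2)]] .
        show "op_norm d (\<lambda>h. H (z (Suc i)) h - H (z i) h) \<le> \<rho>2 (F (z (Suc i))) * norm (z (Suc i) - z i)"
          using n n0 ii(1) by (intro ii(2) zR) (simp add: nz field_simps)
      qed
      also have "\<dots> \<le> (\<rho>2 a * norm (z (Suc i) - z i)) * norm h"
        using le[OF zS[of "Suc i"]] that by (intro mult_right_mono) auto
      finally show ?thesis by (simp add: nz)
    qed
    have "H y h - H x h = (\<Sum>i<n. H (z (Suc i)) h - H (z i) h)"
      using n0 sum_lessThan_telescope[of "\<lambda>i. H (z i) h" n] by (simp add: z_def)
    also have "norm \<dots> \<le> (\<Sum>i<n. \<rho>2 a * (norm (y - x) / real n) * norm h)"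
      by (intro sum_norm_le step) auto
    also have "\<dots> = \<rho>2 a * norm (y - x) * norm h" using n0 by simp
    finally show ?thesis .
  qed
qed

lemma convex_Rd_cball: "convex (Rd d \<inter> cball u r)"
  by (intro convex_Int subspace_imp_convex subspace_Rd convex_cball)

text \<open>Evaluating the second-order expansion of \<open>F\<close> along both ways around a small parallelogram gives
  the symmetry of the Hessian.\<close>

lemma hess_sym_of_linearisation:
  assumes u: "u \<in> Rd d" and "r > 0" "A \<ge> 0"
    and lin: "\<And>s x y. s \<le> r \<Longrightarrow> x \<in> Rd d \<inter> cball u s \<Longrightarrow> y \<in> Rd d \<inter> cball u s \<Longrightarrow>
      norm (g y - g x - H u (y - x)) \<le> A * s * norm (y - x)"
    and hk: "h \<in> Rd d" "k \<in> Rd d"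
  shows "inner (H u h) k = inner h (H u k)"
proof -
  note Hlin = H_lin[OF u]
  \<comment> \<open>Mean value theorem for \<open>F\<close> minus its quadratic model along the
    segment; the linearisation of \<open>g\<close> bounds the derivative.\<close>
  have taylor: "\<bar>F y - F x - inner (g x) (y - x) - inner (H u (y - x)) (y - x) / 2\<bar>
      \<le> A * s * (norm (y - x))\<^sup>2"
    if s: "s \<le> r" "x \<in> Rd d \<inter> cball u s" "y \<in> Rd d \<inter> cball u s" for s x y
  proof -
    define v where "v = y - x"
    define \<psi> where "\<psi> t = F (x + t *\<^sub>R v) - t * inner (g x) v - t\<^sup>2 * inner (H u v) v / 2" for t
    have vR: "v \<in> Rd d" and xR: "x \<in> Rd d" using that by (auto simp: v_def)
    have "\<exists>t. 0 < t \<and> t < 1 \<and> \<psi> 1 - \<psi> 0 = (1 - 0) *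
        (inner (g (x + t *\<^sub>R v)) v - inner (g x) v - t * inner (H u v) v)"
    proof (rule MVT2)
      fix t :: real
      show "(\<psi> has_real_derivative inner (g (x + t *\<^sub>R v)) v - inner (g x) v - t * inner (H u v) v) (at t)"
        unfolding \<psi>_def by (auto intro!: derivative_eq_intros line_derivs(1)[OF xR vR])
    qed simp
    then obtain t where t: "0 < t" "t < 1"
      "\<psi> 1 - \<psi> 0 = inner (g (x + t *\<^sub>R v)) v - inner (g x) v - t * inner (H u v) v" by auto
    have in_s: "x + t *\<^sub>R v \<in> Rd d \<inter> cball u s"
    proof -
      have "x + t *\<^sub>R v = (1 - t) *\<^sub>R x + t *\<^sub>R y" by (simp add: v_def algebra_simps)
      then show ?thesis
        using convex_Rd_cball[of u s, unfolded convex_alt] that t by auto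
    qed
    have s0: "0 \<le> s" using that by (smt (verit) IntD2 dist_self mem_cball zero_le_dist)
    have "\<psi> 1 - \<psi> 0 = inner (g (x + t *\<^sub>R v) - g x - H u (x + t *\<^sub>R v - x)) v"
      using t(3) by (simp add: inner_diff_left linear_scale[OF Hlin])
    then have "\<bar>\<psi> 1 - \<psi> 0\<bar> \<le> norm (g (x + t *\<^sub>R v) - g x - H u (x + t *\<^sub>R v - x)) * norm v"
      using Cauchy_Schwarz_ineq2 by metis
    also have "\<dots> \<le> (A * s * norm (x + t *\<^sub>R v - x)) * norm v"
      by (intro mult_right_mono lin s in_s) auto
    also have "\<dots> = t * (A * s * (norm v)\<^sup>2)" using t by (simp add: power2_eq_square)
    also have "\<dots> \<le> A * s * (norm v)\<^sup>2"
      using t s0 assms(3) by (intro mult_left_le_one_le) auto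
    finally show ?thesis by (simp add: \<psi>_def v_def algebra_simps)
  qed
  define K where "K = norm h + norm k + 1"
  have K: "K \<ge> 1" "norm h \<le> K" "norm k \<le> K" by (auto simp: K_def)
  have main: "\<bar>inner (H u h) k - inner (H u k) h\<bar> \<le> t * (6 * A * K ^ 3)" if t: "0 < t" "t \<le> r / K" for t
  proof -
    define s where "s = t * K"
    have sr: "s \<le> r" using t K by (simp add: s_def field_simps)
    \<comment> \<open>The only term that depends on the order of \<open>a\<close> and
      \<open>b\<close> is \<open>inner (H u a) b\<close>; comparing the two orders leaves an error
      of third order in \<open>t\<close>.\<close>
    have path: "\<bar>F (u + t *\<^sub>R (a + b)) - F u - t * inner (g u) (a + b)
        - t\<^sup>2 * (inner (H u a) a + inner (H u b) b) / 2 - t\<^sup>2 * inner (H u a) b\<bar> \<le> 3 * (t * A * K ^ 3) * t\<^sup>2"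
      if ab: "a \<in> Rd d" "b \<in> Rd d" "norm a + norm b \<le> K" for a b
    proof -
      define x where "x = u + t *\<^sub>R a"
      define y where "y = x + t *\<^sub>R b"
      have na: "norm a \<le> K" "norm b \<le> K" using ab(3) norm_ge_zero[of a] norm_ge_zero[of b] by linarith+
      have xs: "x \<in> Rd d \<inter> cball u s" using t u ab na by (auto simp: x_def s_def dist_norm)
      have "y - u = t *\<^sub>R (a + b)" by (simp add: y_def x_def algebra_simps)
      then have "norm (y - u) = t * norm (a + b)" using t by simp
      also have "\<dots> \<le> s" using t norm_triangle_ineq[of a b] ab(3) by (simp add: s_def)
      finally have "dist u y \<le> s" by (simp add: dist_norm norm_minus_commute)
      moreover have "y \<in> Rd d" using u ab by (auto simp: y_def x_def)
      ultimately have ys: "y \<in> Rd d \<inter> cball u s" by simp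
      have us: "u \<in> Rd d \<inter> cball u s" using u t K by (simp add: s_def)
      have 1: "\<bar>F x - F u - inner (g u) (x - u) - inner (H u (x - u)) (x - u) / 2\<bar> \<le> A * s * (norm (x - u))\<^sup>2"
        by (rule taylor[OF sr us xs])
      have 2: "\<bar>F y - F x - inner (g x) (y - x) - inner (H u (y - x)) (y - x) / 2\<bar> \<le> A * s * (norm (y - x))\<^sup>2"
        by (rule taylor[OF sr xs ys])
      have "\<bar>inner (g x - g u - H u (x - u)) (y - x)\<bar> \<le> norm (g x - g u - H u (x - u)) * norm (y - x)"
        by (rule Cauchy_Schwarz_ineq2)
      also have "\<dots> \<le> (A * s * norm (x - u)) * norm (y - x)" by (intro mult_right_mono lin sr us xs) auto
      finally have 3: "\<bar>inner (g x - g u - H u (x - u)) (y - x)\<bar> \<le> A * s * norm (x - u) * norm (y - x)" .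
      have xu: "x - u = t *\<^sub>R a" and yx: "y - x = t *\<^sub>R b" by (simp_all add: x_def y_def)
      have As: "0 \<le> A * s" using assms(3) t K by (simp add: s_def)
      have b1: "A * s * (norm (x - u))\<^sup>2 \<le> A * s * (t\<^sup>2 * K\<^sup>2)"
        unfolding xu using na As t by (intro mult_left_mono) (auto simp: power_mult_distrib intro!: mult_left_mono power_mono)
      have b2: "A * s * (norm (y - x))\<^sup>2 \<le> A * s * (t\<^sup>2 * K\<^sup>2)"
        unfolding yx using na As t by (intro mult_left_mono) (auto simp: power_mult_distrib intro!: mult_left_mono power_mono)
      have "norm (x - u) * norm (y - x) \<le> (t * K) * (t * K)"
        unfolding xu yx using na t K by (intro mult_mono) auto
      from mult_left_mono[OF this As]
      have b3: "A * s * norm (x - u) * norm (y - x) \<le> A * s * (t\<^sup>2 * K\<^sup>2)"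
        by (simp add: power2_eq_square mult_ac)
      have eq: "F y - F u - t * inner (g u) (a + b) - t\<^sup>2 * (inner (H u a) a + inner (H u b) b) / 2 - t\<^sup>2 * inner (H u a) b
        = (F x - F u - inner (g u) (x - u) - inner (H u (x - u)) (x - u) / 2)
          + (F y - F x - inner (g x) (y - x) - inner (H u (y - x)) (y - x) / 2)
          + inner (g x - g u - H u (x - u)) (y - x)"
        unfolding xu yx
        by (simp add: linear_scale[OF Hlin] inner_diff_left inner_add_right power2_eq_square algebra_simps add_divide_distrib)
      have yu: "u + t *\<^sub>R (a + b) = y" by (simp add: y_def x_def algebra_simps)
      have "3 * (t * A * K ^ 3) * t\<^sup>2 = A * s * (t\<^sup>2 * K\<^sup>2) + A * s * (t\<^sup>2 * K\<^sup>2) + A * s * (t\<^sup>2 * K\<^sup>2)"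
        by (simp add: s_def power2_eq_square power3_eq_cube)
      then show ?thesis unfolding yu eq using 1 2 3 b1 b2 b3 by linarith
    qed
    have p1: "\<bar>F (u + t *\<^sub>R (h + k)) - F u - t * inner (g u) (h + k)
        - t\<^sup>2 * (inner (H u h) h + inner (H u k) k) / 2 - t\<^sup>2 * inner (H u h) k\<bar> \<le> 3 * (t * A * K ^ 3) * t\<^sup>2"
      by (rule path) (use hk in \<open>auto simp: K_def\<close>)
    have "\<bar>F (u + t *\<^sub>R (k + h)) - F u - t * inner (g u) (k + h)
        - t\<^sup>2 * (inner (H u k) k + inner (H u h) h) / 2 - t\<^sup>2 * inner (H u k) h\<bar> \<le> 3 * (t * A * K ^ 3) * t\<^sup>2"
      by (rule path) (use hk in \<open>auto simp: K_def\<close>)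
    then have p2: "\<bar>F (u + t *\<^sub>R (h + k)) - F u - t * inner (g u) (h + k)
        - t\<^sup>2 * (inner (H u h) h + inner (H u k) k) / 2 - t\<^sup>2 * inner (H u k) h\<bar> \<le> 3 * (t * A * K ^ 3) * t\<^sup>2"
      by (simp only: add.commute[of k h] add.commute[of "inner (H u k) k"])
    have "\<bar>t\<^sup>2 * inner (H u h) k - t\<^sup>2 * inner (H u k) h\<bar> \<le> 6 * (t * A * K ^ 3) * t\<^sup>2"
      using p1 p2 by linarith
    also have "\<bar>t\<^sup>2 * inner (H u h) k - t\<^sup>2 * inner (H u k) h\<bar> = t\<^sup>2 * \<bar>inner (H u h) k - inner (H u k) h\<bar>"
      by (simp add: right_diff_distrib[symmetric] abs_mult)
    finally show ?thesis using t by (simp add: mult_ac)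
  qed
  have "\<bar>inner (H u h) k - inner (H u k) h\<bar> \<le> 0"
  proof (rule field_le_epsilon)
    fix e :: real assume e: "e > 0"
    define C where "C = 6 * A * K ^ 3 + 1"
    have C: "C \<ge> 1" using assms(3) K by (simp add: C_def)
    define t where "t = min (r / K) (e / C)"
    have t: "0 < t" "t \<le> r / K" "t \<le> e / C" using e C K assms(2) by (auto simp: t_def)
    have "\<bar>inner (H u h) k - inner (H u k) h\<bar> \<le> t * (6 * A * K ^ 3)" by (rule main) fact+
    also have "\<dots> \<le> t * C" using t by (simp add: C_def)
    also have "\<dots> \<le> e" using t C by (simp add: field_simps)
    finally show "\<bar>inner (H u h) k - inner (H u k) h\<bar> \<le> 0 + e" by simp
  qed
  then show ?thesis by (simp add: inner_commute)
qed

end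

lemma grad_Lipschitz_of_oracle_control:
  assumes oc: "oracle_control d P F f \<rho>3" and z: "\<zeta> \<in> space P"
    and S: "convex S" "S \<subseteq> Rd d" and F: "\<And>x. x \<in> S \<Longrightarrow> 0 \<le> F x \<and> F x \<le> a"
    and G: "\<And>x. x \<in> S \<Longrightarrow> norm (grad d (\<lambda>y. f y \<zeta>) x) \<le> G" and xy: "x \<in> S" "y \<in> S"
  shows "norm (grad d (\<lambda>y. f y \<zeta>) y - grad d (\<lambda>y. f y \<zeta>) x) \<le> \<rho>3 G a * norm (y - x)"
proof (rule mvt_Rd[OF S xy])
  have td: "twice_differentiable d (\<lambda>x. f x \<zeta>)" using oc z by (simp add: oracle_control_def)
  fix w assume w: "w \<in> S"
  then have wR: "w \<in> Rd d" using S by auto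
  show "(grad d (\<lambda>y. f y \<zeta>) has_derivative hess d (\<lambda>y. f y \<zeta>) w) (at w within Rd d)"
    by (rule twice_differentiable_works(3)[OF td wR])
  fix h assume h: "h \<in> Rd d"
  show "norm (hess d (\<lambda>y. f y \<zeta>) w h) \<le> \<rho>3 G a * norm h"
  proof (rule op_norm_bound[OF twice_differentiable_works(4)[OF td wR] _ h])
    have m: "nondecr_nonneg2 \<rho>3" using oc by (simp add: oracle_control_def)
    have Fw: "0 \<le> F w" "F w \<le> a" using F[OF w] by auto
    have G0: "0 \<le> G" using G[OF w] norm_ge_zero order_trans by blast
    have "op_norm d (hess d (\<lambda>y. f y \<zeta>) w) \<le> \<rho>3 (norm (grad d (\<lambda>y. f y \<zeta>) w)) (F w)"
      using oc z wR by (simp add: oracle_control_def)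
    also have "\<dots> \<le> \<rho>3 G (F w)"
      using m G[OF w] Fw G0 by (auto simp: nondecr_nonneg2_def nondecr_nonneg_def monotone_on_def)
    also have "\<dots> \<le> \<rho>3 G a"
      using m Fw G0 by (auto simp: nondecr_nonneg2_def nondecr_nonneg_def monotone_on_def)
    finally show "op_norm d (hess d (\<lambda>y. f y \<zeta>) w) \<le> \<rho>3 G a" .
  qed
qed

text \<open>The levels are nested: \<open>F \<le> a + 1\<close> on the ball by
  \<open>level_bound\<close>, and bounding the gradient at that level costs one more, whence
  \<open>\<rho>1 (a + 2)\<close>. The first argument of \<open>\<rho>3\<close> is the resulting
  bound on a stochastic gradient, true gradient plus noise.\<close>

lemma (in objective) locally_regularI:
  assumes nr: "noise_regularity d P F f \<sigma>" and oc: "oracle_control d P F f \<rho>3"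
    and u: "u \<in> Rd d" "F u \<le> a"
    and A: "1 + 2 * (\<rho>1 (a + 2) + 1) * (a + 1) \<le> A" "\<rho>1 (a + 1) + 1 \<le> A" "\<rho>2 (a + 1) \<le> A"
      "\<sigma> (a + 1) \<le> A" "\<rho>3 (1 + 2 * (\<rho>1 (a + 2) + 1) * (a + 1) + \<sigma> (a + 1)) (a + 1) \<le> A"
  shows "locally_regular d (space P) F g H (\<lambda>x \<zeta>. grad d (\<lambda>y. f y \<zeta>) x) A u (1 / (4 * A))"
proof -
  let ?r = "1 / (4 * A)" and ?gf = "\<lambda>x \<zeta>. grad d (\<lambda>y. f y \<zeta>) x"
  let ?G = "1 + 2 * (\<rho>1 (a + 2) + 1) * (a + 1)"
  have a: "0 \<le> a" using F_nonneg u by fastforce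
  have m\<sigma>: "nondecr_nonneg \<sigma>" using nr by (simp add: noise_regularity_def)
  have A1: "1 \<le> A" using A(2) rho1_nonneg[of "a+1"] a by simp
  have g1: "norm (g w) \<le> ?G" if "w \<in> Rd d" "F w \<le> a + 1" for w
    using grad_bound[OF that] by (simp add: add.assoc)
  have lev: "F w \<le> a + 1" if "w \<in> Rd d \<inter> cball u ?r" for w
    by (rule level_bound[where w=u and r="?r" and A=A])
       (use that u A g1[of u] in \<open>auto simp: dist_norm norm_minus_commute\<close>)
  have g2: "norm (g w) \<le> A" if "w \<in> Rd d \<inter> cball u ?r" for w
    using g1[of w] lev[OF that] that A(1) by auto
  have noise: "norm (?gf w \<zeta> - g w) \<le> \<sigma> (a + 1)" if "w \<in> Rd d \<inter> cball u ?r" "\<zeta> \<in> space P" for w \<zeta>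
  proof -
    have "(norm (?gf w \<zeta> - g w))\<^sup>2 \<le> (\<sigma> (F w))\<^sup>2"
      using nr that by (simp add: noise_regularity_def)
    then have "norm (?gf w \<zeta> - g w) \<le> \<bar>\<sigma> (F w)\<bar>" by (metis abs_le_square_iff abs_norm_cancel)
    also have "\<dots> = \<sigma> (F w)" using m\<sigma> F_nonneg[of w] that by (auto simp: nondecr_nonneg_def)
    also have "\<dots> \<le> \<sigma> (a + 1)"
      using m\<sigma> lev[OF that(1)] F_nonneg[of w] that a by (auto simp: nondecr_nonneg_def monotone_on_def)
    finally show ?thesis .
  qed
  have hl: "norm (H y h - H x h) \<le> A * norm (y - x) * norm h"
    if "x \<in> Rd d \<inter> cball u ?r" "y \<in> Rd d \<inter> cball u ?r" "h \<in> Rd d" for x y h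
  proof -
    have "norm (H y h - H x h) \<le> \<rho>2 (a + 1) * norm (y - x) * norm h"
      by (rule hess_lipschitz_convex[OF convex_Rd_cball _ _ that]) (use lev in auto)
    also have "\<dots> \<le> A * norm (y - x) * norm h" using A(3) by (intro mult_right_mono) auto
    finally show ?thesis .
  qed
  have r0: "0 < ?r" using A1 by simp
  have uB: "u \<in> Rd d \<inter> cball u ?r" using u r0 by simp
  have lin: "norm (g y - g x - H u (y - x)) \<le> A * s * norm (y - x)"
    if "s \<le> ?r" "x \<in> Rd d \<inter> cball u s" "y \<in> Rd d \<inter> cball u s" for s x y
  proof -
    have "norm ((\<lambda>z. g z - H u z) y - (\<lambda>z. g z - H u z) x) \<le> (A * s) * norm (y - x)"
    proof (rule mvt_Rd[OF convex_Rd_cball _ that(2,3)])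
      fix z assume z: "z \<in> Rd d \<inter> cball u s"
      obtain C where C: "\<And>h. h \<in> Rd d \<Longrightarrow> norm (H u h) \<le> C * norm h"
        using linear_bounded_on_Rd[OF H_lin[OF u(1)]] by blast
      have "bounded_linear (H u)" using g_deriv[OF u(1)] has_derivative_bounded_linear by blast
      then have "(H u has_derivative H u) (at z within Rd d)"
        by (rule bounded_linear_imp_has_derivative)
      then show "((\<lambda>z. g z - H u z) has_derivative (\<lambda>h. H z h - H u h)) (at z within Rd d)"
        using g_deriv[of z] z by (intro has_derivative_diff) auto
      fix h assume h: "h \<in> Rd d"
      have "z \<in> Rd d \<inter> cball u ?r" using z that(1) by auto
      then have "norm (H z h - H u h) \<le> A * norm (z - u) * norm h" using hl uB h by blast
      also have "\<dots> \<le> A * s * norm h"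
        using z A1 by (intro mult_right_mono mult_left_mono) (auto simp: dist_norm norm_minus_commute)
      finally show "norm (H z h - H u h) \<le> (A * s) * norm h" .
    qed auto
    then show ?thesis by (simp add: linear_diff[OF H_lin[OF u(1)]] algebra_simps)
  qed
  have sym: "symmetric_on d (H u)"
    unfolding symmetric_on_def
    using hess_sym_of_linearisation[OF u(1) r0 _ lin] A1 H_lin[OF u(1)] H_Rd[OF u(1)] by auto
  have taylor: "F x \<le> F u + inner (g u) (x - u) + inner (x - u) (H u (x - u)) / 2 + A * norm (x - u) ^ 3"
    if x: "x \<in> Rd d \<inter> cball u ?r" for x
  proof -
    define v where "v = x - u"
    have vR: "v \<in> Rd d" using x u by (auto simp: v_def)
    define \<psi> where "\<psi> t = F (u + t *\<^sub>R v) - t * inner (g u) v - t\<^sup>2 * inner (H u v) v / 2" for t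
    have "\<exists>t. 0 < t \<and> t < 1 \<and> \<psi> 1 - \<psi> 0 = (1 - 0) *
        (inner (g (u + t *\<^sub>R v)) v - inner (g u) v - t * inner (H u v) v)"
    proof (rule MVT2)
      fix t :: real
      show "(\<psi> has_real_derivative inner (g (u + t *\<^sub>R v)) v - inner (g u) v - t * inner (H u v) v) (at t)"
        unfolding \<psi>_def by (auto intro!: derivative_eq_intros line_derivs(1)[OF u(1) vR])
    qed simp
    then obtain t where t: "0 < t" "t < 1"
      "\<psi> 1 - \<psi> 0 = inner (g (u + t *\<^sub>R v)) v - inner (g u) v - t * inner (H u v) v" by auto
    have nr: "norm v \<le> ?r" using x by (simp add: v_def dist_norm norm_minus_commute)
    have tv: "t * norm v \<le> norm v" using t by (simp add: mult_left_le_one_le)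
    have "u + t *\<^sub>R v \<in> Rd d \<inter> cball u (norm v)" "u \<in> Rd d \<inter> cball u (norm v)"
      using u vR tv t by (auto simp: dist_norm)
    from lin[OF nr this(2,1)]
    have 1: "norm (g (u + t *\<^sub>R v) - g u - H u (t *\<^sub>R v)) \<le> A * norm v * (t * norm v)"
      using t by simp
    have "\<psi> 1 - \<psi> 0 = inner (g (u + t *\<^sub>R v) - g u - H u (t *\<^sub>R v)) v"
      using t(3) by (simp add: inner_diff_left linear_scale[OF H_lin[OF u(1)]])
    also have "\<dots> \<le> norm (g (u + t *\<^sub>R v) - g u - H u (t *\<^sub>R v)) * norm v" by (rule norm_cauchy_schwarz)
    also have "\<dots> \<le> (A * norm v * (t * norm v)) * norm v" using 1 by (rule mult_right_mono) simp
    also have "\<dots> \<le> (A * norm v * norm v) * norm v"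
      using tv A1 by (intro mult_right_mono mult_left_mono) auto
    finally have "\<psi> 1 - \<psi> 0 \<le> A * norm v ^ 3" by (simp add: power3_eq_cube)
    moreover have "u + v = x" by (simp add: v_def)
    ultimately show ?thesis
      unfolding v_def[symmetric] by (simp add: \<psi>_def inner_commute[of v])
  qed
  have gfl: "norm (?gf x \<zeta> - ?gf y \<zeta>) \<le> A * norm (x - y)"
    if xy: "x \<in> Rd d \<inter> cball u ?r" "y \<in> Rd d \<inter> cball u ?r" and z: "\<zeta> \<in> space P" for x y \<zeta>
  proof -
    have "norm (?gf x \<zeta> - ?gf y \<zeta>) \<le> \<rho>3 (?G + \<sigma> (a + 1)) (a + 1) * norm (x - y)"
    proof (rule grad_Lipschitz_of_oracle_control[OF oc z convex_Rd_cball _ _ _ xy(2,1)])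
      fix w assume w: "w \<in> Rd d \<inter> cball u ?r"
      show "0 \<le> F w \<and> F w \<le> a + 1" using lev[OF w] F_nonneg w by auto
      have "norm (?gf w \<zeta>) \<le> norm (g w) + norm (?gf w \<zeta> - g w)"
        by (metis add_diff_cancel_left' diff_add_cancel norm_triangle_ineq add.commute)
      then show "norm (?gf w \<zeta>) \<le> ?G + \<sigma> (a + 1)"
        using g1[of w] lev[OF w] w noise[OF w z] by auto
    qed auto
    also have "\<dots> \<le> A * norm (x - y)" using A(5) by (intro mult_right_mono) auto
    finally show ?thesis .
  qed
  have hb: "norm (H u h) \<le> A * norm h" if "h \<in> Rd d" for h
  proof -
    have "norm (H u h) \<le> \<rho>1 (a + 1) * norm h" by (rule H_bound) (use u that in auto)
    also have "\<dots> \<le> A * norm h" using A(2) by (intro mult_right_mono) auto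
    finally show ?thesis .
  qed
  have noise': "norm (?gf w \<zeta> - g w) \<le> A" if "w \<in> Rd d \<inter> cball u ?r" "\<zeta> \<in> space P" for w \<zeta>
    using noise[OF that] A(4) by simp
  show ?thesis
    unfolding locally_regular_def
    using u(1) sym hb g2 noise' hl[OF uB] taylor gfl lin by auto
qed

section \<open>Supermartingales on a sequence space\<close>

text \<open>Hoeffding's lemma for an interval of length \<open>2 * b\<close>:
  \<open>(2 * b)\<^sup>2 / 8 = b\<^sup>2 / 2\<close>.\<close>

lemma (in prob_space) nn_integral_exp_le:
  fixes y :: "'a \<Rightarrow> real"
  assumes [measurable]: "y \<in> borel_measurable M" and "\<And>x. x \<in> space M \<Longrightarrow> \<bar>y x\<bar> \<le> b"
    and "(\<integral>x. y x \<partial>M) = 0"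
  shows "(\<integral>\<^sup>+x. ennreal (exp (y x)) \<partial>M) \<le> ennreal (exp (b\<^sup>2 / 2))"
proof -
  interpret Y: interval_bounded_random_variable M y "- b" b
    by unfold_locales (use assms in \<open>force intro!: AE_I2 simp: abs_le_iff\<close>)+
  show ?thesis
    using Y.Hoeffdings_lemma_nn_integral_0[of 1] assms(3) by (simp add: power2_eq_square)
qed

context sequence_space
begin

lemma space_S_iff: "w \<in> space S \<longleftrightarrow> (\<forall>n. w n \<in> space M)"
  by (auto simp: space_PiM PiE_iff)

lemma nn_integral_comb_seq:
  assumes [measurable]: "f \<in> borel_measurable S"
  shows "(\<integral>\<^sup>+w. f w \<partial>S) = (\<integral>\<^sup>+w. \<integral>\<^sup>+w'. f (comb_seq k w w') \<partial>S \<partial>S)"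
proof -
  have [measurable]: "(\<lambda>(w, w'). comb_seq k w w') \<in> measurable (S \<Otimes>\<^sub>M S) S"
    by (rule measurable_comb_seq)
  have "(\<integral>\<^sup>+w. f w \<partial>S) = (\<integral>\<^sup>+w. f w \<partial>distr (S \<Otimes>\<^sub>M S) S (\<lambda>(w, w'). comb_seq k w w'))"
    by (simp only: PiM_comb_seq)
  also have "\<dots> = (\<integral>\<^sup>+p. f (case p of (w, w') \<Rightarrow> comb_seq k w w') \<partial>(S \<Otimes>\<^sub>M S))"
    by (rule nn_integral_distr) auto
  also have "\<dots> = (\<integral>\<^sup>+w. \<integral>\<^sup>+w'. f (comb_seq k w w') \<partial>S \<partial>S)"
    by (subst P.nn_integral_fst[symmetric]) auto
  finally show ?thesis .
qed

lemma nn_integral_case_nat: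
  assumes [measurable]: "f \<in> borel_measurable S"
  shows "(\<integral>\<^sup>+w. f w \<partial>S) = (\<integral>\<^sup>+x. \<integral>\<^sup>+w. f (case_nat x w) \<partial>S \<partial>M)"
proof -
  have [measurable]: "(\<lambda>(s, w). case_nat s w) \<in> measurable (M \<Otimes>\<^sub>M S) S"
    by measurable
  have "(\<integral>\<^sup>+w. f w \<partial>S) = (\<integral>\<^sup>+w. f w \<partial>distr (M \<Otimes>\<^sub>M S) S (\<lambda>(s, w). case_nat s w))"
    by (simp only: PiM_iter)
  also have "\<dots> = (\<integral>\<^sup>+p. f (case p of (w, w') \<Rightarrow> case_nat w w') \<partial>(M \<Otimes>\<^sub>M S))"
    by (rule nn_integral_distr) auto
  also have "\<dots> = (\<integral>\<^sup>+x. \<integral>\<^sup>+w. f (case_nat x w) \<partial>S \<partial>M)"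
    by (subst P.nn_integral_fst[symmetric]) auto
  finally show ?thesis .
qed

lemma measurable_fun_upd_S [measurable]:
  "w \<in> space S \<Longrightarrow> (\<lambda>x. w(k := x)) \<in> measurable M S"
  by (rule measurable_PiM_single') (auto simp: space_S_iff PiE_iff)

text \<open>Conditional expectation given the first \<open>k\<close> samples appears as the integral
  over coordinate \<open>k\<close> alone, all others being frozen in \<open>w\<close>. This is
  legitimate because \<open>V (Suc k)\<close> does not look beyond coordinate
  \<open>k\<close>.\<close>

lemma nn_integral_supermartingale:
  fixes V :: "nat \<Rightarrow> (nat \<Rightarrow> 'a) \<Rightarrow> ennreal"
  assumes meas[measurable]: "\<And>k. k \<le> n \<Longrightarrow> V k \<in> borel_measurable S"
    and dep: "\<And>k w w'. (\<And>j. j < k \<Longrightarrow> w j = w' j) \<Longrightarrow> V k w = V k w'"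
    and step: "\<And>k w. k < n \<Longrightarrow> w \<in> space S \<Longrightarrow> (\<integral>\<^sup>+x. V (Suc k) (w(k := x)) \<partial>M) \<le> V k w"
  shows "(\<integral>\<^sup>+w. V n w \<partial>S) \<le> V 0 w0"
proof -
  have "(\<integral>\<^sup>+w. V k w \<partial>S) \<le> V 0 w0" if "k \<le> n" for k
    using that
  proof (induction k)
    case 0
    have "V 0 w = V 0 w0" for w by (rule dep) simp
    then have "(\<integral>\<^sup>+w. V 0 w \<partial>S) = (\<integral>\<^sup>+w. V 0 w0 \<partial>S)" by metis
    then show ?case by (simp add: P.emeasure_space_1)
  next
    case (Suc k)
    have [measurable]: "V (Suc k) \<in> borel_measurable S" by (rule meas) fact
    have "(\<integral>\<^sup>+w. V (Suc k) w \<partial>S) = (\<integral>\<^sup>+w. \<integral>\<^sup>+w'. V (Suc k) (comb_seq k w w') \<partial>S \<partial>S)"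
      by (rule nn_integral_comb_seq) measurable
    also have "\<dots> \<le> (\<integral>\<^sup>+w. V k w \<partial>S)"
    proof (rule nn_integral_mono)
      fix w assume w: "w \<in> space S"
      have "(\<integral>\<^sup>+w'. V (Suc k) (comb_seq k w w') \<partial>S)
          = (\<integral>\<^sup>+x. \<integral>\<^sup>+w''. V (Suc k) (comb_seq k w (case_nat x w'')) \<partial>S \<partial>M)"
        by (rule nn_integral_case_nat) (use w in measurable)
      also have "\<dots> = (\<integral>\<^sup>+x. \<integral>\<^sup>+w''. V (Suc k) (w(k := x)) \<partial>S \<partial>M)"
        by (intro nn_integral_cong dep) (auto simp: comb_seq_def)
      also have "\<dots> \<le> V k w" using step[OF _ w] Suc.prems by (simp add: P.emeasure_space_1)
      finally show "(\<integral>\<^sup>+w'. V (Suc k) (comb_seq k w w') \<partial>S) \<le> V k w" .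
    qed
    also have "\<dots> \<le> V 0 w0" using Suc by simp
    finally show ?case .
  qed
  then show ?thesis by simp
qed

lemma emeasure_exp_Markov:
  fixes Z :: "(nat \<Rightarrow> 'a) \<Rightarrow> real"
  assumes [measurable]: "Z \<in> borel_measurable S" and "(\<integral>\<^sup>+w. ennreal (exp (Z w)) \<partial>S) \<le> 1"
  shows "emeasure S {w \<in> space S. t \<le> Z w} \<le> ennreal (exp (- t))"
proof -
  have "emeasure S {w \<in> space S. t \<le> Z w} = (\<integral>\<^sup>+w. indicator {w \<in> space S. t \<le> Z w} w \<partial>S)"
    by simp
  also have "\<dots> \<le> (\<integral>\<^sup>+w. ennreal (exp (- t)) * ennreal (exp (Z w)) \<partial>S)"
    by (intro nn_integral_mono)
       (auto simp: indicator_def ennreal_mult[symmetric] exp_add[symmetric])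
  also have "\<dots> = ennreal (exp (- t)) * (\<integral>\<^sup>+w. ennreal (exp (Z w)) \<partial>S)"
    by (rule nn_integral_cmult) simp
  also have "\<dots> \<le> ennreal (exp (- t)) * 1" using assms(2) by (intro mult_left_mono) auto
  finally show ?thesis by simp
qed

text \<open>The compensator uses half the squared conditional bound, as in Hoeffding's lemma.\<close>

lemma self_normalised_tail:
  fixes y b :: "nat \<Rightarrow> (nat \<Rightarrow> 'a) \<Rightarrow> real"
  assumes meas[measurable]: "\<And>k. y k \<in> borel_measurable S" "\<And>k. b k \<in> borel_measurable S"
    and dep_y: "\<And>k w w'. (\<And>j. j \<le> k \<Longrightarrow> w j = w' j) \<Longrightarrow> y k w = y k w'"
    and dep_b: "\<And>k w w'. (\<And>j. j < k \<Longrightarrow> w j = w' j) \<Longrightarrow> b k w = b k w'"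
    and bound: "\<And>k w. k < n \<Longrightarrow> w \<in> space S \<Longrightarrow> \<bar>y k w\<bar> \<le> b k w"
    and mean: "\<And>k w. k < n \<Longrightarrow> w \<in> space S \<Longrightarrow> (\<integral>x. y k (w(k := x)) \<partial>M) = 0"
  shows "emeasure S {w \<in> space S. t \<le> (\<Sum>k<n. y k w - (b k w)\<^sup>2 / 2)} \<le> ennreal (exp (- t))"
proof -
  let ?Z = "\<lambda>k w. \<Sum>j<k. y j w - (b j w)\<^sup>2 / 2"
  have Zdep: "?Z k w = ?Z k w'" if "\<And>j. j < k \<Longrightarrow> w j = w' j" for k w w'
    by (intro sum.cong refl arg_cong2[of _ _ _ _ "(-)"] dep_y arg_cong2[of _ _ _ _ "(/)"]
        arg_cong2[of _ _ _ _ "(^)"] dep_b) (auto intro: that)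
  have "(\<integral>\<^sup>+w. ennreal (exp (?Z n w)) \<partial>S) \<le> ennreal (exp (?Z 0 undefined))"
  proof (rule nn_integral_supermartingale[where V="\<lambda>k w. ennreal (exp (?Z k w))"])
    show "ennreal (exp (?Z k w)) = ennreal (exp (?Z k w'))" if "\<And>j. j < k \<Longrightarrow> w j = w' j" for k w w'
      using Zdep[OF that] by simp
    fix k w assume k: "k < n" and w: "w \<in> space S"
    have upd: "w(k := x) \<in> space S" if "x \<in> space M" for x
      using w that by (auto simp: space_S_iff)
    have Zk: "?Z k (w(k := x)) = ?Z k w" and bk: "b k (w(k := x)) = b k w" for x
      by (rule Zdep dep_b; simp)+
    have [measurable]: "(\<lambda>x. y k (w(k := x))) \<in> borel_measurable M"
      using w by measurable
    have "(\<integral>\<^sup>+x. ennreal (exp (?Z (Suc k) (w(k := x)))) \<partial>M)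
        = (\<integral>\<^sup>+x. ennreal (exp (?Z k w - (b k w)\<^sup>2 / 2)) * ennreal (exp (y k (w(k := x)))) \<partial>M)"
      by (simp add: Zk bk ennreal_mult[symmetric] exp_add[symmetric] algebra_simps)
    also have "\<dots> = ennreal (exp (?Z k w - (b k w)\<^sup>2 / 2)) * (\<integral>\<^sup>+x. ennreal (exp (y k (w(k := x)))) \<partial>M)"
      by (rule nn_integral_cmult) simp
    also have "\<dots> \<le> ennreal (exp (?Z k w - (b k w)\<^sup>2 / 2)) * ennreal (exp ((b k w)\<^sup>2 / 2))"
      using bound[OF k upd] mean[OF k w] bk by (intro mult_left_mono M.nn_integral_exp_le) auto
    also have "\<dots> = ennreal (exp (?Z k w))"
      by (simp add: ennreal_mult[symmetric] exp_add[symmetric])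
    finally show "(\<integral>\<^sup>+x. ennreal (exp (?Z (Suc k) (w(k := x)))) \<partial>M) \<le> ennreal (exp (?Z k w))" .
  qed measurable
  then show ?thesis by (intro emeasure_exp_Markov) auto
qed

text \<open>A dimension-free vector Azuma inequality: the exponential moment of the squared norm is
  propagated with coefficients \<open>c k\<close> that satisfy \<open>1 / c (k+1) = 1 / c k + 2 \<rho>\<^sub>k\<^sup>2\<close>.\<close>

lemma vector_azuma:
  fixes Y :: "nat \<Rightarrow> (nat \<Rightarrow> 'a) \<Rightarrow> 'b::{real_inner, second_countable_topology}"
  assumes meas[measurable]: "\<And>k. Y k \<in> borel_measurable S"
    and dep: "\<And>k w w'. (\<And>j. j \<le> k \<Longrightarrow> w j = w' j) \<Longrightarrow> Y k w = Y k w'"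
    and W: "subspace W" "\<And>k w. k < n \<Longrightarrow> w \<in> space S \<Longrightarrow> Y k w \<in> W"
    and bound: "\<And>k w. k < n \<Longrightarrow> w \<in> space S \<Longrightarrow> norm (Y k w) \<le> \<rho> k"
    and mean: "\<And>k w v. k < n \<Longrightarrow> w \<in> space S \<Longrightarrow> v \<in> W \<Longrightarrow> (\<integral>x. inner v (Y k (w(k := x))) \<partial>M) = 0"
    and V: "V > 0" "(\<Sum>k<n. (\<rho> k)\<^sup>2) \<le> V"
  shows "emeasure S {w \<in> space S. 4 * V * (1 / 2 + t) \<le> (norm (\<Sum>k<n. Y k w))\<^sup>2} \<le> ennreal (exp (- t))"
proof -
  let ?R = "\<lambda>k. \<Sum>j<k. (\<rho> j)\<^sup>2"
  let ?S = "\<lambda>k w. \<Sum>j<k. Y j w"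
  \<comment> \<open>\<open>c\<close> starts at \<open>1 / (2 * V)\<close> and, as the
    \<open>(\<rho> k)\<^sup>2\<close> for \<open>k < n\<close> sum to at most \<open>V\<close>, does
    not fall below \<open>1 / (4 * V)\<close> up to time \<open>n\<close>; hence the factor
    \<open>4 * V\<close> in the statement.\<close>
  define c where "c k = 1 / (2 * V + 2 * ?R k)" for k
  have c0: "c k > 0" for k unfolding c_def using V(1) by (intro divide_pos_pos add_pos_nonneg) (auto intro: sum_nonneg)
  have cV: "c k \<le> 1 / (2 * V)" for k
    unfolding c_def using V(1) by (intro divide_left_mono) (auto intro!: sum_nonneg mult_pos_pos add_pos_nonneg)
  have crec: "c (Suc k) * (1 + 2 * c (Suc k) * (\<rho> k)\<^sup>2) \<le> c k" for k
  proof -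
    define D where "D = 2 * V + 2 * ?R k"
    define q where "q = 2 * (\<rho> k)\<^sup>2"
    have D: "D > 0" using c0[of k] by (simp add: c_def D_def zero_less_divide_iff)
    have q: "q \<ge> 0" by (simp add: q_def)
    have eq: "c (Suc k) = 1 / (D + q)" "c k = 1 / D" by (auto simp: c_def D_def q_def algebra_simps)
    have "c (Suc k) * (1 + 2 * c (Suc k) * (\<rho> k)\<^sup>2) = 1 / (D + q) * (1 + 1 / (D + q) * q)"
      by (simp add: eq q_def)
    also have "\<dots> = (D + 2 * q) / (D + q)\<^sup>2"
      using D q by (simp add: field_simps power2_eq_square)
    also have "\<dots> \<le> 1 / D"
    proof -
      have "(D + 2 * q) * D \<le> (D + q)\<^sup>2" by (simp add: power2_eq_square algebra_simps)
      moreover have "(D + q)\<^sup>2 > 0" using D q by (intro zero_less_power) auto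
      ultimately show ?thesis using D by (simp add: pos_divide_le_eq pos_le_divide_eq mult.commute)
    qed
    finally show ?thesis by (simp add: eq)
  qed
  \<comment> \<open>The subtracted term pays for \<open>c (Suc k) * (\<rho> k)\<^sup>2\<close>, the
    part of the new square that is not proportional to the old one. At time \<open>n\<close> it is
    at most \<open>1 / 2\<close>.\<close>
  let ?Z = "\<lambda>k w. c k * (norm (?S k w))\<^sup>2 - ?R k / (2 * V)"
  have Sdep: "?S k w = ?S k w'" if "\<And>j. j < k \<Longrightarrow> w j = w' j" for k w w'
    by (intro sum.cong refl dep) (auto intro: that)
  have "(\<integral>\<^sup>+w. ennreal (exp (?Z n w)) \<partial>S) \<le> ennreal (exp (?Z 0 undefined))"
  proof (rule nn_integral_supermartingale[where V="\<lambda>k w. ennreal (exp (?Z k w))"])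
    show "ennreal (exp (?Z k w)) = ennreal (exp (?Z k w'))" if "\<And>j. j < k \<Longrightarrow> w j = w' j" for k w w'
      using Sdep[OF that] by simp
    fix k w assume k: "k < n" and w: "w \<in> space S"
    have upd: "w(k := x) \<in> space S" if "x \<in> space M" for x
      using w that by (auto simp: space_S_iff)
    have Sk: "?S k (w(k := x)) = ?S k w" for x by (rule Sdep) simp
    define s where "s = ?S k w"
    define y where "y x = Y k (w(k := x))" for x
    define c' where "c' = c (Suc k)"
    have c': "c' > 0" "c' \<le> 1 / (2 * V)" using c0 cV by (auto simp: c'_def)
    have [measurable]: "y \<in> borel_measurable M"
      unfolding y_def using w by measurable
    have sW: "s \<in> W" unfolding s_def using k w by (intro subspace_sum W) auto
    have yb: "norm (y x) \<le> \<rho> k" if "x \<in> space M" for x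
      unfolding y_def by (rule bound[OF k upd[OF that]])
    have "(\<integral>\<^sup>+x. ennreal (exp (?Z (Suc k) (w(k := x)))) \<partial>M)
        \<le> (\<integral>\<^sup>+x. ennreal (exp (c' * (norm s)\<^sup>2 + c' * (\<rho> k)\<^sup>2 - ?R (Suc k) / (2 * V)))
              * ennreal (exp (inner ((2 * c') *\<^sub>R s) (y x))) \<partial>M)"
    proof (rule nn_integral_mono)
      fix x assume x: "x \<in> space M"
      have "(norm (s + y x))\<^sup>2 = (norm s)\<^sup>2 + 2 * inner s (y x) + (norm (y x))\<^sup>2"
        by (simp add: power2_norm_eq_inner inner_add_left inner_add_right inner_commute)
      also have "\<dots> \<le> (norm s)\<^sup>2 + 2 * inner s (y x) + (\<rho> k)\<^sup>2"
        using yb[OF x] by (intro add_left_mono power_mono) auto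
      finally have "c' * (norm (s + y x))\<^sup>2 \<le> c' * ((norm s)\<^sup>2 + 2 * inner s (y x) + (\<rho> k)\<^sup>2)"
        using c' by (intro mult_left_mono) auto
      then have "exp (?Z (Suc k) (w(k := x)))
        \<le> exp (c' * (norm s)\<^sup>2 + c' * (\<rho> k)\<^sup>2 - ?R (Suc k) / (2 * V)) * exp (inner ((2 * c') *\<^sub>R s) (y x))"
        unfolding exp_add[symmetric]
        by (simp add: Sk s_def[symmetric] y_def[symmetric] c'_def[symmetric] distrib_left)
      then show "ennreal (exp (?Z (Suc k) (w(k := x))))
        \<le> ennreal (exp (c' * (norm s)\<^sup>2 + c' * (\<rho> k)\<^sup>2 - ?R (Suc k) / (2 * V)))
              * ennreal (exp (inner ((2 * c') *\<^sub>R s) (y x)))"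
        by (simp add: ennreal_mult[symmetric])
    qed
    also have "\<dots> = ennreal (exp (c' * (norm s)\<^sup>2 + c' * (\<rho> k)\<^sup>2 - ?R (Suc k) / (2 * V)))
        * (\<integral>\<^sup>+x. ennreal (exp (inner ((2 * c') *\<^sub>R s) (y x))) \<partial>M)"
      by (rule nn_integral_cmult) simp
    also have "\<dots> \<le> ennreal (exp (c' * (norm s)\<^sup>2 + c' * (\<rho> k)\<^sup>2 - ?R (Suc k) / (2 * V)))
        * ennreal (exp ((2 * c' * norm s * \<rho> k)\<^sup>2 / 2))"
    proof (intro mult_left_mono M.nn_integral_exp_le)
      show "(\<integral>x. inner ((2 * c') *\<^sub>R s) (y x) \<partial>M) = 0"
        unfolding y_def by (rule mean[OF k w subspace_scale[OF W(1) sW]])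
      fix x assume x: "x \<in> space M"
      have "\<bar>inner ((2 * c') *\<^sub>R s) (y x)\<bar> \<le> norm ((2 * c') *\<^sub>R s) * norm (y x)" by (rule Cauchy_Schwarz_ineq2)
      also have "\<dots> \<le> (2 * c' * norm s) * \<rho> k" using c' yb[OF x] by (intro mult_mono) auto
      finally show "\<bar>inner ((2 * c') *\<^sub>R s) (y x)\<bar> \<le> 2 * c' * norm s * \<rho> k" .
    qed auto
    also have "\<dots> = ennreal (exp (c' * (1 + 2 * c' * (\<rho> k)\<^sup>2) * (norm s)\<^sup>2 + c' * (\<rho> k)\<^sup>2 - ?R (Suc k) / (2 * V)))"
      by (simp add: ennreal_mult[symmetric] exp_add[symmetric] power2_eq_square algebra_simps)
    also have "\<dots> \<le> ennreal (exp (?Z k w))"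
    proof -
      have "c' * (1 + 2 * c' * (\<rho> k)\<^sup>2) * (norm s)\<^sup>2 \<le> c k * (norm s)\<^sup>2"
        using crec[of k] by (intro mult_right_mono) (auto simp: c'_def)
      moreover have "c' * (\<rho> k)\<^sup>2 \<le> 1 / (2 * V) * (\<rho> k)\<^sup>2"
        using c' by (intro mult_right_mono) auto
      ultimately show ?thesis by (simp add: s_def add_divide_distrib)
    qed
    finally show "(\<integral>\<^sup>+x. ennreal (exp (?Z (Suc k) (w(k := x)))) \<partial>M) \<le> ennreal (exp (?Z k w))" .
  qed measurable
  then have int: "(\<integral>\<^sup>+w. ennreal (exp (?Z n w)) \<partial>S) \<le> 1" by simp
  have "t \<le> ?Z n w" if "4 * V * (1 / 2 + t) \<le> (norm (?S n w))\<^sup>2" for w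
  proof -
    have "1 / (4 * V) \<le> c n"
      unfolding c_def using V by (intro divide_left_mono) (auto intro!: mult_pos_pos add_pos_nonneg sum_nonneg)
    then have "1 / (4 * V) * (norm (?S n w))\<^sup>2 \<le> c n * (norm (?S n w))\<^sup>2"
      by (rule mult_right_mono) simp
    moreover have "1 / 2 + t \<le> 1 / (4 * V) * (norm (?S n w))\<^sup>2"
      using that V(1) by (simp add: field_simps)
    moreover have "?R n / (2 * V) \<le> 1 / 2" using V by (simp add: field_simps)
    ultimately show ?thesis by linarith
  qed
  then have "emeasure S {w \<in> space S. 4 * V * (1 / 2 + t) \<le> (norm (?S n w))\<^sup>2}
      \<le> emeasure S {w \<in> space S. t \<le> ?Z n w}"
    by (intro emeasure_mono) auto
  also have "\<dots> \<le> ennreal (exp (- t))" by (rule emeasure_exp_Markov[OF _ int]) measurable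
  finally show ?thesis .
qed

end

section \<open>Perturbed gradient descent on a quadratic model\<close>

text \<open>The weight \<open>1 / 8\<close> matters: the two cross terms treated this way in
  \<open>pos_energy\<close> together use up only half of the available decrease
  \<open>D / 2\<close>.\<close>

lemma mult_le_weighted_squares: "x * y \<le> x\<^sup>2 / 8 + 2 * (y::real)\<^sup>2"
proof -
  have "0 \<le> 2 * (x / 4 - y)\<^sup>2" by simp
  then show ?thesis by (simp add: power2_eq_square algebra_simps)
qed

text \<open>The terms \<open>t * (1 - t) ^ i\<close> decrease and sum to at most 1, so the last of
  the first \<open>m + 1\<close> is at most their average. The bound is uniform in \<open>t\<close>,
  that is, in the curvature.\<close>

lemma geometric_energy_bound:
  fixes t :: real
  assumes "0 \<le> t" "t \<le> 1"
  shows "t * (1 - t) ^ m \<le> 1 / (real m + 1)"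
proof -
  have "(real m + 1) * (t * (1 - t) ^ m) = (\<Sum>i<Suc m. t * (1 - t) ^ m)" by simp
  also have "\<dots> \<le> (\<Sum>i<Suc m. t * (1 - t) ^ i)"
    using assms by (intro sum_mono mult_left_mono power_decreasing) auto
  also have "\<dots> = 1 - (1 - t) ^ Suc m"
    using power_diff_1_eq[of "1 - t" "Suc m"] unfolding sum_distrib_left[symmetric]
    by (simp del: sum.lessThan_Suc power_Suc)
  also have "\<dots> \<le> 1" using assms by simp
  finally show ?thesis by (simp add: field_simps)
qed

lemma sum_power2_Cauchy:
  fixes f h :: "'i \<Rightarrow> real"
  assumes "finite I" "\<And>i. i \<in> I \<Longrightarrow> 0 \<le> f i"
  shows "(\<Sum>i\<in>I. f i * h i)\<^sup>2 \<le> (\<Sum>i\<in>I. f i) * (\<Sum>i\<in>I. f i * (h i)\<^sup>2)"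
proof -
  have "(\<Sum>i\<in>I. f i * h i) = (\<Sum>i\<in>I. sqrt (f i) * (sqrt (f i) * h i))"
    by (rule sum.cong) (use assms in \<open>simp_all flip: mult.assoc\<close>)
  also have "\<dots>\<^sup>2 \<le> (\<Sum>i\<in>I. (sqrt (f i))\<^sup>2) * (\<Sum>i\<in>I. (sqrt (f i) * h i)\<^sup>2)"
    by (rule Cauchy_Schwarz_ineq_sum)
  also have "\<dots> = (\<Sum>i\<in>I. f i) * (\<Sum>i\<in>I. f i * (h i)\<^sup>2)"
    using assms by (simp add: power_mult_distrib)
  finally show ?thesis .
qed

text \<open>One coordinate with curvature \<open>l > 0\<close>: \<open>q\<close> is the noiseless descent, \<open>zr\<close> and \<open>zx\<close> the effect of
  the model error and of the noise.\<close>

lemma positive_coordinate_energy: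
  fixes \<eta> l g :: real and r x :: "nat \<Rightarrow> real" and n :: nat
  assumes \<eta>: "\<eta> > 0" and l: "l > 0" "\<eta> * l \<le> 1"
  defines "a \<equiv> 1 - \<eta> * l"
  defines "q \<equiv> - \<eta> * (\<Sum>j<n. a ^ (n - 1 - j) * g)"
  defines "zr \<equiv> - \<eta> * (\<Sum>j<n. a ^ (n - 1 - j) * r j)"
  defines "zx \<equiv> - \<eta> * (\<Sum>j<n. a ^ (n - 1 - j) * x j)"
  shows "g * (q + zr + zx) + l * (q + zr + zx)\<^sup>2 / 2
    \<le> - (\<eta> / 2) * (\<Sum>k<n. (a ^ k * g)\<^sup>2)
      - \<eta> * (\<Sum>j<n. a ^ (2 * n - 1 - j) * g * r j) - \<eta> * (\<Sum>j<n. a ^ (2 * n - 1 - j) * g * x j)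
      + \<eta> * (\<Sum>j<n. (r j)\<^sup>2) + l * zx\<^sup>2"
proof -
  have a: "0 \<le> a" "a \<le> 1" using \<eta> l by (auto simp: a_def)
  have rev: "(\<Sum>j<n. a ^ (n - 1 - j)) = (\<Sum>j<n. a ^ j)"
    by (rule sum.reindex_bij_witness[of _ "\<lambda>j. n - 1 - j" "\<lambda>j. n - 1 - j"]) auto
  have geo: "\<eta> * l * (\<Sum>j<n. a ^ j) = 1 - a ^ n"
    using power_diff_1_eq[of a n] by (simp add: a_def algebra_simps)
  have q: "q = - \<eta> * (\<Sum>j<n. a ^ j) * g" by (simp only: q_def sum_distrib_right[symmetric] rev mult.assoc)
  have lq: "l * q = - (1 - a ^ n) * g" 
  proof -
    have "l * q = - (\<eta> * l * (\<Sum>j<n. a ^ j)) * g" by (simp add: q)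
    then show ?thesis by (simp only: geo)
  qed
  \<comment> \<open>This is the gradient of the one-dimensional model at the noiseless endpoint
    \<open>q\<close>: it has contracted by \<open>a ^ n\<close>.\<close>
  then have glq: "g + l * q = a ^ n * g" by (simp add: algebra_simps)
  have geo2: "\<eta> * l * (1 + a) * (\<Sum>k<n. (a ^ k)\<^sup>2) = 1 - (a ^ n)\<^sup>2"
  proof -
    have "(1 - a\<^sup>2) * (\<Sum>k<n. (a\<^sup>2) ^ k) = 1 - (a\<^sup>2) ^ n"
      using power_diff_1_eq[of "a\<^sup>2" n] by (simp add: algebra_simps)
    moreover have "1 - a\<^sup>2 = \<eta> * l * (1 + a)" by (simp add: a_def power2_eq_square algebra_simps)
    ultimately show ?thesis by (simp add: power_mult[symmetric] mult.commute)
  qed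
  \<comment> \<open>Energy identity of gradient descent on a parabola, proved after multiplication
    by \<open>l\<close> so that the geometric sums can be inserted.\<close>
  have quad: "g * q + l * q\<^sup>2 / 2 \<le> - (\<eta> / 2) * (\<Sum>k<n. (a ^ k * g)\<^sup>2)"
  proof -
    have "l * (g * q + l * q\<^sup>2 / 2) = g * (l * q) + (l * q)\<^sup>2 / 2"
      by (simp add: power2_eq_square algebra_simps)
    also have "\<dots> = - (1 - (a ^ n)\<^sup>2) * g\<^sup>2 / 2"
      unfolding lq by (simp add: power2_eq_square field_simps)
    also have "\<dots> = - (\<eta> * l * (1 + a) * (\<Sum>k<n. (a ^ k)\<^sup>2)) * g\<^sup>2 / 2" by (simp only: geo2)
    also have "\<dots> = l * (- (\<eta> / 2) * (1 + a) * (\<Sum>k<n. (a ^ k * g)\<^sup>2))"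
      by (simp add: power_mult_distrib sum_distrib_right[symmetric])
    finally have "g * q + l * q\<^sup>2 / 2 = - (\<eta> / 2) * (1 + a) * (\<Sum>k<n. (a ^ k * g)\<^sup>2)"
      using l(1) by (metis mult_left_cancel less_irrefl)
    also have "\<dots> \<le> - (\<eta> / 2) * (\<Sum>k<n. (a ^ k * g)\<^sup>2)"
    proof -
      have "0 \<le> (\<eta> / 2) * a * (\<Sum>k<n. (a ^ k * g)\<^sup>2)"
        using \<eta> a by (intro mult_nonneg_nonneg sum_nonneg) auto
      then show ?thesis by (simp add: algebra_simps)
    qed
    finally show ?thesis .
  qed
  have pow: "a ^ n * a ^ (n - 1 - j) = a ^ (2 * n - 1 - j)" if "j < n" for j
  proof -
    have "n + (n - 1 - j) = 2 * n - 1 - j" using that by simp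
    then show ?thesis by (simp add: power_add[symmetric])
  qed
  have cross: "a ^ n * g * (- \<eta> * (\<Sum>j<n. a ^ (n - 1 - j) * s j)) = - \<eta> * (\<Sum>j<n. a ^ (2 * n - 1 - j) * g * s j)" for s
  proof -
    have "a ^ n * g * (- \<eta> * (\<Sum>j<n. a ^ (n - 1 - j) * s j)) = - \<eta> * (\<Sum>j<n. (a ^ n * a ^ (n - 1 - j)) * g * s j)"
      by (simp add: sum_distrib_left mult_ac)
    also have "(\<Sum>j<n. (a ^ n * a ^ (n - 1 - j)) * g * s j) = (\<Sum>j<n. a ^ (2 * n - 1 - j) * g * s j)"
      by (rule sum.cong) (simp_all only: lessThan_iff pow)
    finally show ?thesis .
  qed
  \<comment> \<open>Cauchy-Schwarz with the geometric weights;
    \<open>\<eta> * l * (\<Sum>j<n. a ^ j) \<le> 1\<close> absorbs the factor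
    \<open>l\<close>.\<close>
  have zr2: "l * zr\<^sup>2 \<le> \<eta> * (\<Sum>j<n. (r j)\<^sup>2)"
  proof -
    have "(\<Sum>j<n. a ^ (n - 1 - j) * r j)\<^sup>2 \<le> (\<Sum>j<n. a ^ (n - 1 - j)) * (\<Sum>j<n. a ^ (n - 1 - j) * (r j)\<^sup>2)"
      by (rule sum_power2_Cauchy) (use a in auto)
    also have "\<dots> \<le> (\<Sum>j<n. a ^ (n - 1 - j)) * (\<Sum>j<n. (r j)\<^sup>2)"
      using a by (intro mult_left_mono sum_mono sum_nonneg) (auto intro: mult_left_le_one_le power_le_one)
    finally have cs: "(\<Sum>j<n. a ^ (n - 1 - j) * r j)\<^sup>2 \<le> (\<Sum>j<n. a ^ j) * (\<Sum>j<n. (r j)\<^sup>2)"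
      by (simp only: rev)
    have "zr\<^sup>2 = \<eta>\<^sup>2 * (\<Sum>j<n. a ^ (n - 1 - j) * r j)\<^sup>2"
      by (simp only: zr_def power_mult_distrib power2_minus)
    also have "\<dots> \<le> \<eta>\<^sup>2 * ((\<Sum>j<n. a ^ j) * (\<Sum>j<n. (r j)\<^sup>2))" by (rule mult_left_mono[OF cs]) simp
    finally have "l * zr\<^sup>2 \<le> l * (\<eta>\<^sup>2 * ((\<Sum>j<n. a ^ j) * (\<Sum>j<n. (r j)\<^sup>2)))"
      using l by (intro mult_left_mono) auto
    also have "\<dots> = \<eta> * ((\<eta> * l * (\<Sum>j<n. a ^ j)) * (\<Sum>j<n. (r j)\<^sup>2))"
      by (simp add: power2_eq_square)
    also have "\<dots> \<le> \<eta> * (1 * (\<Sum>j<n. (r j)\<^sup>2))"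
      unfolding geo using \<eta> a by (intro mult_left_mono mult_right_mono sum_nonneg) auto
    finally show ?thesis by simp
  qed
  have "(zr + zx)\<^sup>2 \<le> 2 * zr\<^sup>2 + 2 * zx\<^sup>2"
    using zero_le_power2[of "zr - zx"] by (simp add: power2_eq_square algebra_simps)
  then have sq: "l * (zr + zx)\<^sup>2 / 2 \<le> l * zr\<^sup>2 + l * zx\<^sup>2"
    using mult_left_mono[of "(zr + zx)\<^sup>2" "2 * zr\<^sup>2 + 2 * zx\<^sup>2" l] l by (simp add: algebra_simps)
  have "g * (q + zr + zx) + l * (q + zr + zx)\<^sup>2 / 2
      = (g * q + l * q\<^sup>2 / 2) + (g + l * q) * zr + (g + l * q) * zx + l * (zr + zx)\<^sup>2 / 2"
    by (simp add: power2_eq_square algebra_simps add_divide_distrib)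
  also have "\<dots> \<le> - (\<eta> / 2) * (\<Sum>k<n. (a ^ k * g)\<^sup>2) + a ^ n * g * zr + a ^ n * g * zx
      + (\<eta> * (\<Sum>j<n. (r j)\<^sup>2) + l * zx\<^sup>2)"
    unfolding glq using quad sq zr2 by linarith
  also have "a ^ n * g * zr = - \<eta> * (\<Sum>j<n. a ^ (2 * n - 1 - j) * g * r j)"
    unfolding zr_def by (rule cross)
  also have "a ^ n * g * zx = - \<eta> * (\<Sum>j<n. a ^ (2 * n - 1 - j) * g * x j)"
    unfolding zx_def by (rule cross)
  finally show ?thesis by simp
qed

locale eigen_step = eigen d H e l for d H e l +
  fixes \<eta> A :: real
  assumes \<eta>: "\<eta> > 0" "\<eta> * A \<le> 1" and l_le: "i < d \<Longrightarrow> \<bar>l i\<bar> \<le> A"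
begin

text \<open>\<open>pw m\<close> propagates by \<open>m\<close> noiseless descent steps in the
  directions of positive curvature; \<open>spw m\<close> does so in the energy norm, hence the
  square root of the curvature. \<open>neg\<close> selects the remaining directions.
  \<open>decay g n\<close> adds up the squared gradients met by the noiseless descent in the
  positive directions.\<close>

definition "pw m = (\<lambda>i. if l i > 0 then (1 - \<eta> * l i) ^ m else 0)"
definition "spw m = (\<lambda>i. if l i > 0 then sqrt (l i) * (1 - \<eta> * l i) ^ m else 0)"
definition "neg = (\<lambda>i. if l i > 0 then 0 else (1::real))"
definition "decay g n = (\<Sum>k<n. (norm (diag (pw k) g))\<^sup>2)"

lemma \<eta>l: "i < d \<Longrightarrow> 0 < l i \<Longrightarrow> \<eta> * l i \<le> 1"
  using l_le[of i] \<eta> mult_left_mono[of "l i" A \<eta>] by linarith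

lemma abs_pw_le: "i < d \<Longrightarrow> \<bar>pw m i\<bar> \<le> 1"
  using \<eta>l[of i] \<eta> by (auto simp: pw_def power_abs power_le_one)

text \<open>\<open>geometric_energy_bound\<close> for \<open>\<eta> * l i\<close> and the even
  exponent \<open>2 * m\<close>. The squares of these bounds form a harmonic sum, which is where a
  logarithm enters.\<close>

lemma abs_spw_le:
  assumes "i < d" shows "\<bar>spw m i\<bar> \<le> sqrt (1 / (\<eta> * real (Suc m)))"
proof (cases "l i > 0")
  case True
  have "(\<eta> * l i) * (1 - \<eta> * l i) ^ (2 * m) \<le> 1 / (real (2 * m) + 1)"
    by (rule geometric_energy_bound) (use \<eta>l[OF assms True] \<eta> True in auto)
  also have "\<dots> \<le> 1 / real (Suc m)" by (simp add: frac_le)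
  finally have "\<eta> * (l i * (1 - \<eta> * l i) ^ (2 * m)) \<le> 1 / real (Suc m)" by (simp add: mult.assoc)
  then have "(\<eta> * (l i * (1 - \<eta> * l i) ^ (2 * m))) * real (Suc m) \<le> 1"
    by (simp only: pos_le_divide_eq of_nat_0_less_iff zero_less_Suc)
  then have "l i * (1 - \<eta> * l i) ^ (2 * m) \<le> 1 / (\<eta> * real (Suc m))"
    using \<eta> by (subst pos_le_divide_eq) (auto simp only: mult_ac intro!: mult_pos_pos)
  moreover have "(spw m i)\<^sup>2 = l i * (1 - \<eta> * l i) ^ (2 * m)"
    using True by (simp add: spw_def power_mult_distrib power_mult[symmetric] mult.commute)
  ultimately show ?thesis by (intro real_le_rsqrt) simp
qed (use \<eta> in \<open>simp add: spw_def\<close>)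

text \<open>The exponent arises when an error of step \<open>j\<close>, propagated to time
  \<open>n\<close>, is paired with the gradient left at time \<open>n\<close>, itself contracted
  \<open>n\<close> times. Larger exponents only shrink the norms.\<close>

lemma decay_shift_le: "(\<Sum>j<n. (norm (diag (pw (2 * n - 1 - j)) g))\<^sup>2) \<le> decay g n"
proof -
  have "(\<Sum>j<n. (norm (diag (pw (2 * n - 1 - j)) g))\<^sup>2) \<le> (\<Sum>j<n. (norm (diag (pw (n - 1 - j)) g))\<^sup>2)"
  proof (rule sum_mono)
    fix j assume "j \<in> {..<n}"
    then have "n - 1 - j \<le> 2 * n - 1 - j" by auto
    then have "(pw (2 * n - 1 - j) i)\<^sup>2 \<le> (pw (n - 1 - j) i)\<^sup>2" if "i < d" for i
      using \<eta>l[OF that] \<eta> by (auto simp: pw_def intro!: power_mono power_decreasing)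
    then show "(norm (diag (pw (2 * n - 1 - j)) g))\<^sup>2 \<le> (norm (diag (pw (n - 1 - j)) g))\<^sup>2"
      unfolding norm2_diag by (intro sum_mono mult_right_mono) auto
  qed
  also have "\<dots> = decay g n" unfolding decay_def
    by (rule sum.reindex_bij_witness[of _ "\<lambda>j. n - 1 - j" "\<lambda>j. n - 1 - j"]) auto
  finally show ?thesis .
qed

end

text \<open>\<open>y\<close> is the displacement from the anchor, \<open>r\<close> the error of the
  linearised gradient and \<open>x\<close> the noise. Everything here is deterministic; probability
  enters only through the bounds \<open>E1\<close> to \<open>E4\<close> assumed in the
  lemmas.\<close>

locale quadratic_sgd = eigen_step d H e l \<eta> A for d H e l \<eta> A +
  fixes R :: real and g0 :: evec and y r x :: "nat \<Rightarrow> evec" and n :: nat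
  assumes y0: "y 0 = 0" and g0: "g0 \<in> Rd d"
    and rx: "k < n \<Longrightarrow> r k \<in> Rd d" "k < n \<Longrightarrow> x k \<in> Rd d" "k < n \<Longrightarrow> norm (r k) \<le> R"
    and step: "k < n \<Longrightarrow> y (Suc k) = y k - \<eta> *\<^sub>R (g0 + H (y k) + r k + x k)"
begin

abbreviation "D \<equiv> decay g0 n"

definition "v k = diag neg (g0 + H (y k))"

lemma y_Rd: "k \<le> n \<Longrightarrow> y k \<in> Rd d"
  by (induction k) (auto simp: y0 step intro!: Rd_closed_ops g0 HR rx)

lemma y_coord: "k < n \<Longrightarrow> i < d \<Longrightarrow> inner (e i) (y (Suc k)) =
   (1 - \<eta> * l i) * inner (e i) (y k) - \<eta> * (inner (e i) g0 + inner (e i) (r k) + inner (e i) (x k))"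
  using y_Rd[of k] by (simp add: step inner_diff_right inner_add_right inner_e_H algebra_simps)

lemma y_coord_closed:
  assumes "i < d" "m \<le> n"
  shows "inner (e i) (y m) = - \<eta> * (\<Sum>j<m. (1 - \<eta> * l i) ^ (m - 1 - j) * inner (e i) g0)
    + (- \<eta> * (\<Sum>j<m. (1 - \<eta> * l i) ^ (m - 1 - j) * inner (e i) (r j)))
    + (- \<eta> * (\<Sum>j<m. (1 - \<eta> * l i) ^ (m - 1 - j) * inner (e i) (x j)))"
  using assms(2)
proof (induction m)
  case (Suc m)
  have sh: "(\<Sum>j<Suc m. (1 - \<eta> * l i) ^ (Suc m - 1 - j) * s j)
     = (1 - \<eta> * l i) * (\<Sum>j<m. (1 - \<eta> * l i) ^ (m - 1 - j) * s j) + s m" for s :: "nat \<Rightarrow> real"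
  proof -
    have "(1 - \<eta> * l i) ^ (m - j) = (1 - \<eta> * l i) * (1 - \<eta> * l i) ^ (m - 1 - j)" if "j < m" for j
      using that by (simp add: power_Suc[symmetric] Suc_diff_Suc del: power_Suc)
    then show ?thesis by (simp add: sum_distrib_left mult.assoc)
  qed
  have "m < n" "m \<le> n" using Suc.prems by auto
  show ?case
    unfolding sh y_coord[OF \<open>m < n\<close> assms(1)] Suc.IH[OF \<open>m \<le> n\<close>] by (simp add: algebra_simps)
qed (simp add: y0)

text \<open>Summing \<open>positive_coordinate_energy\<close> and exchanging sums turns each noise
  term into the norm of one vector or one scalar sum, so that \<open>d\<close> disappears. The bound
  \<open>E2\<close> is relative to \<open>D\<close>, so that its cross term can be absorbed into the
  decrease.\<close>

lemma pos_energy: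
  assumes E1: "(norm (\<Sum>j<n. diag (spw (n - 1 - j)) (x j)))\<^sup>2 \<le> E1"
    and E2: "(\<Sum>j<n. inner (diag (pw (2 * n - 1 - j)) g0) (x j))\<^sup>2 \<le> E2 * D" "E2 \<ge> 0"
  shows "(\<Sum>i<d. if l i > 0 then inner (e i) g0 * inner (e i) (y n) + l i * (inner (e i) (y n))\<^sup>2 / 2 else 0)
    \<le> - (\<eta> / 4) * D + 3 * \<eta> * n * R\<^sup>2 + 2 * \<eta> * E2 + \<eta>\<^sup>2 * E1"
proof -
  let ?c = "\<lambda>i v. inner (e i) v"
  let ?a = "\<lambda>i. 1 - \<eta> * l i"
  define T1 where "T1 i = (\<Sum>k<n. (pw k i)\<^sup>2 * (?c i g0)\<^sup>2)" for i
  define T2 where "T2 i = (\<Sum>j<n. (pw (2 * n - 1 - j) i * ?c i g0) * ?c i (r j))" for i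
  define T3 where "T3 i = (\<Sum>j<n. (pw (2 * n - 1 - j) i * ?c i g0) * ?c i (x j))" for i
  define T4 where "T4 i = (\<Sum>j<n. (?c i (r j))\<^sup>2)" for i
  define T5 where "T5 i = (?c i (\<Sum>j<n. diag (spw (n - 1 - j)) (x j)))\<^sup>2" for i
  have coord: "(if l i > 0 then ?c i g0 * ?c i (y n) + l i * (?c i (y n))\<^sup>2 / 2 else 0)
     \<le> - (\<eta> / 2) * T1 i - \<eta> * T2 i - \<eta> * T3 i + \<eta> * T4 i + \<eta>\<^sup>2 * T5 i" if i: "i < d" for i
  proof (cases "l i > 0")
    case True
    have z2: "l i * (- \<eta> * (\<Sum>j<n. ?a i ^ (n - 1 - j) * ?c i (x j)))\<^sup>2 = \<eta>\<^sup>2 * T5 i"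
      using True i
      by (simp add: T5_def inner_sum_right inner_e_diag spw_def mult.assoc sum_distrib_left[symmetric] power_mult_distrib)
    show ?thesis
      using positive_coordinate_energy[OF \<eta>(1) True \<eta>l[OF i True], of "?c i g0" n "\<lambda>j. ?c i (r j)" "\<lambda>j. ?c i (x j)"]
      unfolding y_coord_closed[OF i order_refl, symmetric] z2
      using True by (simp add: T1_def T2_def T3_def T4_def pw_def power_mult_distrib)
  next
    case False
    have "0 \<le> \<eta> * T4 i + \<eta>\<^sup>2 * T5 i"
      using \<eta> by (auto simp: T4_def T5_def intro!: add_nonneg_nonneg mult_nonneg_nonneg sum_nonneg)
    then show ?thesis using False by (simp add: T1_def T2_def T3_def pw_def)
  qed
  have s1: "(\<Sum>i<d. T1 i) = D"
    unfolding T1_def decay_def norm2_diag by (rule sum.swap)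
  have s2: "(\<Sum>i<d. T2 i) = (\<Sum>j<n. inner (diag (pw (2 * n - 1 - j)) g0) (r j))"
    unfolding T2_def by (subst sum.swap) (simp add: inner_expand[OF diag_Rd] inner_e_diag)
  have s3: "(\<Sum>i<d. T3 i) = (\<Sum>j<n. inner (diag (pw (2 * n - 1 - j)) g0) (x j))"
    unfolding T3_def by (subst sum.swap) (simp add: inner_expand[OF diag_Rd] inner_e_diag)
  have s4: "(\<Sum>i<d. T4 i) \<le> n * R\<^sup>2"
  proof -
    have "(\<Sum>i<d. T4 i) = (\<Sum>j<n. (norm (r j))\<^sup>2)"
      unfolding T4_def by (subst sum.swap) (simp add: norm2_expand rx)
    also have "\<dots> \<le> (\<Sum>j<n. R\<^sup>2)" using rx by (intro sum_mono power_mono) auto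
    finally show ?thesis by simp
  qed
  have s5: "(\<Sum>i<d. T5 i) \<le> E1"
    using E1 unfolding T5_def by (subst norm2_expand[symmetric]) (auto intro!: Rd_sum)
  note wD = decay_shift_le[of n g0]
  have D0: "0 \<le> D" by (simp add: decay_def sum_nonneg)
  have t2: "- (\<Sum>i<d. T2 i) \<le> D / 8 + 2 * n * R\<^sup>2"
  proof -
    have "- (\<Sum>i<d. T2 i) \<le> (\<Sum>j<n. norm (diag (pw (2 * n - 1 - j)) g0) * norm (r j))"
      unfolding s2 sum_negf[symmetric]
      using Cauchy_Schwarz_ineq2 abs_le_D2 by (intro sum_mono) blast
    also have "\<dots> \<le> (\<Sum>j<n. (norm (diag (pw (2 * n - 1 - j)) g0))\<^sup>2 / 8 + 2 * R\<^sup>2)"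
    proof (rule sum_mono)
      fix j assume j: "j \<in> {..<n}"
      have "norm (diag (pw (2 * n - 1 - j)) g0) * norm (r j)
          \<le> (norm (diag (pw (2 * n - 1 - j)) g0))\<^sup>2 / 8 + 2 * (norm (r j))\<^sup>2"
        by (rule mult_le_weighted_squares)
      also have "\<dots> \<le> (norm (diag (pw (2 * n - 1 - j)) g0))\<^sup>2 / 8 + 2 * R\<^sup>2"
        using rx(3)[of j] j by (intro add_left_mono mult_left_mono power_mono) auto
      finally show "norm (diag (pw (2 * n - 1 - j)) g0) * norm (r j)
          \<le> (norm (diag (pw (2 * n - 1 - j)) g0))\<^sup>2 / 8 + 2 * R\<^sup>2" .
    qed
    also have "\<dots> \<le> D / 8 + 2 * n * R\<^sup>2"
      using wD by (simp add: sum.distrib sum_divide_distrib[symmetric])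
    finally show ?thesis .
  qed
  have t3: "- (\<Sum>i<d. T3 i) \<le> D / 8 + 2 * E2"
  proof -
    have "(\<Sum>i<d. T3 i)\<^sup>2 \<le> (sqrt D * sqrt E2)\<^sup>2"
      unfolding s3 using E2 D0 by (simp add: power_mult_distrib mult.commute)
    then have "\<bar>\<Sum>i<d. T3 i\<bar> \<le> \<bar>sqrt D * sqrt E2\<bar>" by (simp only: abs_le_square_iff)
    also have "\<dots> = sqrt D * sqrt E2" using D0 E2 by simp
    also have "\<dots> \<le> (sqrt D)\<^sup>2 / 8 + 2 * (sqrt E2)\<^sup>2" by (rule mult_le_weighted_squares)
    also have "\<dots> = D / 8 + 2 * E2" using D0 E2 by simp
    finally show ?thesis by linarith
  qed
  have "(\<Sum>i<d. if l i > 0 then ?c i g0 * ?c i (y n) + l i * (?c i (y n))\<^sup>2 / 2 else 0)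
     \<le> (\<Sum>i<d. - (\<eta> / 2) * T1 i - \<eta> * T2 i - \<eta> * T3 i + \<eta> * T4 i + \<eta>\<^sup>2 * T5 i)"
    by (intro sum_mono coord) auto
  also have "\<dots> = - (\<eta> / 2) * D + \<eta> * (- (\<Sum>i<d. T2 i)) + \<eta> * (- (\<Sum>i<d. T3 i)) + \<eta> * (\<Sum>i<d. T4 i) + \<eta>\<^sup>2 * (\<Sum>i<d. T5 i)"
    by (simp add: sum.distrib sum_subtractf sum_distrib_left[symmetric] s1 sum_negf sum_divide_distrib[symmetric])
  also have "\<dots> \<le> - (\<eta> / 2) * D + \<eta> * (D / 8 + 2 * n * R\<^sup>2) + \<eta> * (D / 8 + 2 * E2) + \<eta> * (n * R\<^sup>2) + \<eta>\<^sup>2 * E1"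
  proof -
    have "\<eta> * (- (\<Sum>i<d. T2 i)) \<le> \<eta> * (D / 8 + 2 * n * R\<^sup>2)"
      "\<eta> * (- (\<Sum>i<d. T3 i)) \<le> \<eta> * (D / 8 + 2 * E2)" "\<eta> * (\<Sum>i<d. T4 i) \<le> \<eta> * (n * R\<^sup>2)"
      "\<eta>\<^sup>2 * (\<Sum>i<d. T5 i) \<le> \<eta>\<^sup>2 * E1"
      using \<eta> by (intro mult_left_mono t2 t3 s4 s5; simp)+
    then show ?thesis by linarith
  qed
  also have "\<dots> = - (\<eta> / 4) * D + 3 * \<eta> * n * R\<^sup>2 + 2 * \<eta> * E2 + \<eta>\<^sup>2 * E1"
    by (simp add: algebra_simps)
  finally show ?thesis .
qed

text \<open>By Cauchy-Schwarz a long noiseless path forces a large \<open>D\<close>. Together with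
  \<open>pos_energy\<close> this converts displacement into decrease.\<close>

lemma pos_displacement:
  assumes E3: "norm (\<Sum>j<n. diag (pw (n - 1 - j)) (x j)) \<le> E3"
  shows "norm (diag (pw 0) (y n)) \<le> \<eta> * sqrt (n * D) + \<eta> * n * R + \<eta> * E3"
proof -
  have eq: "diag (pw 0) (y n) = - \<eta> *\<^sub>R (\<Sum>j<n. diag (pw (n - 1 - j)) g0)
     + (- \<eta> *\<^sub>R (\<Sum>j<n. diag (pw (n - 1 - j)) (r j))) + (- \<eta> *\<^sub>R (\<Sum>j<n. diag (pw (n - 1 - j)) (x j)))" (is "_ = ?rhs")
  proof -
    have "diag (pw 0) (y n) = (\<Sum>i<d. inner (e i) (diag (pw 0) (y n)) *\<^sub>R e i)" by (simp add: expand)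
    also have "\<dots> = (\<Sum>i<d. inner (e i) ?rhs *\<^sub>R e i)"
    proof (rule sum.cong, rule refl)
      fix i assume i: "i \<in> {..<d}"
      then have "inner (e i) (diag (pw 0) (y n)) = inner (e i) ?rhs"
        using y_coord_closed[of i n]
        by (simp add: inner_e_diag inner_add_right inner_sum_right inner_diff_right pw_def)
      then show "inner (e i) (diag (pw 0) (y n)) *\<^sub>R e i = inner (e i) ?rhs *\<^sub>R e i" by simp
    qed
    also have "\<dots> = ?rhs" by (intro expand Rd_closed_ops Rd_sum diag_Rd)
    finally show ?thesis .
  qed
  have "norm (\<Sum>j<n. diag (pw (n - 1 - j)) g0) \<le> sqrt (n * D)"
  proof (rule real_le_rsqrt)
    have "norm (\<Sum>j<n. diag (pw (n - 1 - j)) g0) \<le> (\<Sum>j<n. norm (diag (pw (n - 1 - j)) g0))" by (rule norm_sum)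
    also have "\<dots> = (\<Sum>j<n. norm (diag (pw j) g0))"
      by (rule sum.reindex_bij_witness[of _ "\<lambda>j. n - 1 - j" "\<lambda>j. n - 1 - j"]) auto
    finally have "(norm (\<Sum>j<n. diag (pw (n - 1 - j)) g0))\<^sup>2 \<le> (\<Sum>j<n. 1 * norm (diag (pw j) g0))\<^sup>2"
      by (intro power_mono) auto
    also have "\<dots> \<le> (\<Sum>j<n. 1) * (\<Sum>j<n. 1 * (norm (diag (pw j) g0))\<^sup>2)" by (rule sum_power2_Cauchy) auto
    finally show "(norm (\<Sum>j<n. diag (pw (n - 1 - j)) g0))\<^sup>2 \<le> n * D" by (simp add: decay_def)
  qed
  moreover have "norm (\<Sum>j<n. diag (pw (n - 1 - j)) (r j)) \<le> n * R"
  proof -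
    have "norm (diag (pw m) (r j)) \<le> R" if "j < n" for j m
    proof -
      have "norm (diag (pw m) (r j)) \<le> 1 * norm (r j)"
        by (rule norm_diag_le) (use \<eta>l \<eta> rx that in \<open>auto simp: pw_def power_abs power_le_one\<close>)
      then show ?thesis using rx(3)[OF that] by simp
    qed
    then have "norm (\<Sum>j<n. diag (pw (n - 1 - j)) (r j)) \<le> (\<Sum>j<n. R)" by (intro sum_norm_le) auto
    then show ?thesis by simp
  qed
  ultimately have "norm (- \<eta> *\<^sub>R (\<Sum>j<n. diag (pw (n - 1 - j)) g0)) \<le> \<eta> * sqrt (n * D)"
    "norm (- \<eta> *\<^sub>R (\<Sum>j<n. diag (pw (n - 1 - j)) (r j))) \<le> \<eta> * (n * R)"
    "norm (- \<eta> *\<^sub>R (\<Sum>j<n. diag (pw (n - 1 - j)) (x j))) \<le> \<eta> * E3"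
    using \<eta> E3 by auto
  then show ?thesis
    unfolding eq by (intro order.trans[OF norm_triangle_ineq] add_mono) (auto simp: mult.assoc)
qed

text \<open>Where \<open>l i \<le> 0\<close> the model is concave, so a step changes it by at most
  its first-order change. The assumption on the noise is relative to the sum of squares of
  \<open>v\<close>, a quarter of which the decrease can afford.\<close>

lemma neg_energy:
  assumes E4: "- (\<Sum>j<n. inner (v j) (x j)) \<le> (\<Sum>j<n. (norm (v j))\<^sup>2) / 4 + E4"
  shows "(\<Sum>i<d. if l i > 0 then 0 else inner (e i) g0 * inner (e i) (y n) + l i * (inner (e i) (y n))\<^sup>2 / 2)
    \<le> - (\<eta> / 2) * (\<Sum>j<n. (norm (v j))\<^sup>2) + \<eta> * n * R\<^sup>2 + \<eta> * E4"
proof -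
  let ?c = "\<lambda>i v. inner (e i) v"
  let ?Q = "\<lambda>k. \<Sum>i<d. if l i > 0 then 0 else ?c i g0 * ?c i (y k) + l i * (?c i (y k))\<^sup>2 / 2"
  have one: "?Q (Suc k) - ?Q k \<le> - \<eta> * inner (v k) (v k + r k + x k)" if k: "k < n" for k
  proof -
    have vc: "?c i (v k) = (if l i > 0 then 0 else ?c i g0 + l i * ?c i (y k))" if "i < d" for i
      using that y_Rd[of k] k by (simp add: v_def inner_e_diag neg_def inner_add_right inner_e_H)
    have "?Q (Suc k) - ?Q k = (\<Sum>i<d. if l i > 0 then 0 else
        (?c i g0 * ?c i (y (Suc k)) + l i * (?c i (y (Suc k)))\<^sup>2 / 2) - (?c i g0 * ?c i (y k) + l i * (?c i (y k))\<^sup>2 / 2))"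
      unfolding sum_subtractf[symmetric] by (rule sum.cong) auto
    also have "\<dots> \<le> (\<Sum>i<d. - \<eta> * (?c i (v k) * ?c i (v k + r k + x k)))"
    proof (rule sum_mono)
      fix i assume "i \<in> {..<d}"
      then have i: "i < d" by simp
      show "(if l i > 0 then 0 else
        (?c i g0 * ?c i (y (Suc k)) + l i * (?c i (y (Suc k)))\<^sup>2 / 2) - (?c i g0 * ?c i (y k) + l i * (?c i (y k))\<^sup>2 / 2))
        \<le> - \<eta> * (?c i (v k) * ?c i (v k + r k + x k))"
      proof (cases "l i > 0")
        case False
        define \<Delta> where "\<Delta> = - \<eta> * ?c i (v k + r k + x k)"
        have dy: "?c i (y (Suc k)) = ?c i (y k) + \<Delta>"
          using y_coord[OF k i] False vc[OF i] by (simp add: \<Delta>_def inner_add_right algebra_simps)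
        have "(?c i g0 * ?c i (y (Suc k)) + l i * (?c i (y (Suc k)))\<^sup>2 / 2) - (?c i g0 * ?c i (y k) + l i * (?c i (y k))\<^sup>2 / 2)
          = (?c i g0 + l i * ?c i (y k)) * \<Delta> + l i * \<Delta>\<^sup>2 / 2"
          unfolding dy by (simp add: power2_eq_square algebra_simps add_divide_distrib)
        also have "\<dots> \<le> (?c i g0 + l i * ?c i (y k)) * \<Delta>"
          using False by (simp add: mult_nonpos_nonneg)
        finally show ?thesis using False vc[OF i] by (simp add: \<Delta>_def mult_ac)
      qed (simp add: vc[OF i])
    qed
    also have "\<dots> = - \<eta> * inner (v k) (v k + r k + x k)"
      unfolding sum_distrib_left[symmetric] by (subst inner_expand[of "v k"]) (auto simp: v_def)
    finally show ?thesis .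
  qed
  have "?Q n - ?Q 0 = (\<Sum>k<n. ?Q (Suc k) - ?Q k)" by (rule sum_lessThan_telescope[symmetric])
  also have "\<dots> \<le> (\<Sum>k<n. - \<eta> * (3 / 4 * (norm (v k))\<^sup>2 - R\<^sup>2 + inner (v k) (x k)))"
  proof (rule sum_mono)
    fix k assume "k \<in> {..<n}"
    then have k: "k < n" by simp
    have "- inner (v k) (r k) \<le> norm (v k) * norm (r k)" using Cauchy_Schwarz_ineq2 abs_le_D2 by blast
    also have "\<dots> \<le> norm (v k) * R" using rx(3)[OF k] by (intro mult_left_mono) auto
    also have "\<dots> \<le> (norm (v k))\<^sup>2 / 4 + R\<^sup>2"
      using zero_le_power2[of "norm (v k) / 2 - R"] by (simp add: power2_eq_square algebra_simps)
    finally have "3 / 4 * (norm (v k))\<^sup>2 - R\<^sup>2 + inner (v k) (x k) \<le> inner (v k) (v k + r k + x k)"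
      by (simp add: inner_add_right dot_square_norm)
    then have "- \<eta> * inner (v k) (v k + r k + x k) \<le> - \<eta> * (3 / 4 * (norm (v k))\<^sup>2 - R\<^sup>2 + inner (v k) (x k))"
      using \<eta> by simp
    with one[OF k] show "?Q (Suc k) - ?Q k \<le> - \<eta> * (3 / 4 * (norm (v k))\<^sup>2 - R\<^sup>2 + inner (v k) (x k))" by linarith
  qed
  also have "\<dots> = - \<eta> * (3 / 4 * (\<Sum>k<n. (norm (v k))\<^sup>2)) + \<eta> * n * R\<^sup>2 + \<eta> * (- (\<Sum>k<n. inner (v k) (x k)))"
    unfolding sum_distrib_left[symmetric] by (simp add: sum.distrib sum_subtractf sum_distrib_left[symmetric] algebra_simps sum_divide_distrib[symmetric])
  also have "\<dots> \<le> - \<eta> * (3 / 4 * (\<Sum>k<n. (norm (v k))\<^sup>2)) + \<eta> * n * R\<^sup>2 + \<eta> * ((\<Sum>j<n. (norm (v j))\<^sup>2) / 4 + E4)"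
    using \<eta> E4 by (intro add_left_mono mult_left_mono) auto
  finally have "?Q n - ?Q 0 \<le> - (\<eta> / 2) * (\<Sum>j<n. (norm (v j))\<^sup>2) + \<eta> * n * R\<^sup>2 + \<eta> * E4"
    by (simp add: algebra_simps)
  moreover have "?Q 0 = 0" by (rule sum.neutral) (simp add: y0)
  ultimately show ?thesis by linarith
qed

lemma neg_displacement:
  assumes E3: "norm (\<Sum>j<n. diag neg (x j)) \<le> E3"
  shows "norm (diag neg (y n)) \<le> \<eta> * sqrt (n * (\<Sum>j<n. (norm (v j))\<^sup>2)) + \<eta> * n * R + \<eta> * E3"
proof -
  have eq: "diag neg (y m) = - \<eta> *\<^sub>R (\<Sum>j<m. v j) + (- \<eta> *\<^sub>R (\<Sum>j<m. diag neg (r j)))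
      + (- \<eta> *\<^sub>R (\<Sum>j<m. diag neg (x j)))" if "m \<le> n" for m
    using that
  proof (induction m)
    case (Suc m)
    then have st: "diag neg (y (Suc m)) = diag neg (y m) - \<eta> *\<^sub>R (v m + diag neg (r m) + diag neg (x m))"
      by (simp add: step v_def linear_diff[OF linear_diag] linear_add[OF linear_diag] linear_scale[OF linear_diag])
    have "m \<le> n" using Suc.prems by simp
    show ?case unfolding st Suc.IH[OF \<open>m \<le> n\<close>] by (simp add: algebra_simps)
  qed (simp add: y0 linear_0[OF linear_diag])
  have "norm (\<Sum>j<n. v j) \<le> sqrt (n * (\<Sum>j<n. (norm (v j))\<^sup>2))"
  proof (rule real_le_rsqrt)
    have "(norm (\<Sum>j<n. v j))\<^sup>2 \<le> (\<Sum>j<n. 1 * norm (v j))\<^sup>2"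
      by (intro power_mono) (auto intro: norm_sum)
    also have "\<dots> \<le> (\<Sum>j<n. 1) * (\<Sum>j<n. 1 * (norm (v j))\<^sup>2)" by (rule sum_power2_Cauchy) auto
    finally show "(norm (\<Sum>j<n. v j))\<^sup>2 \<le> n * (\<Sum>j<n. (norm (v j))\<^sup>2)" by simp
  qed
  moreover have "norm (\<Sum>j<n. diag neg (r j)) \<le> n * R"
  proof -
    have "norm (diag neg (r j)) \<le> R" if "j < n" for j
    proof -
      have "norm (diag neg (r j)) \<le> 1 * norm (r j)"
        by (rule norm_diag_le) (use rx that in \<open>auto simp: neg_def\<close>)
      then show ?thesis using rx(3)[OF that] by simp
    qed
    then have "norm (\<Sum>j<n. diag neg (r j)) \<le> (\<Sum>j<n. R)" by (intro sum_norm_le) auto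
    then show ?thesis by simp
  qed
  ultimately have "norm (- \<eta> *\<^sub>R (\<Sum>j<n. v j)) \<le> \<eta> * sqrt (n * (\<Sum>j<n. (norm (v j))\<^sup>2))"
    "norm (- \<eta> *\<^sub>R (\<Sum>j<n. diag neg (r j))) \<le> \<eta> * (n * R)"
    "norm (- \<eta> *\<^sub>R (\<Sum>j<n. diag neg (x j))) \<le> \<eta> * E3"
    using \<eta> E3 by auto
  then show ?thesis
    unfolding eq[OF order_refl] by (intro order.trans[OF norm_triangle_ineq] add_mono) (auto simp: mult.assoc)
qed

text \<open>One of the two spectral parts of \<open>y n\<close> has length at least
  \<open>B / 2\<close>. Model error and noise account for at most \<open>B / 8\<close> of it, so at
  least \<open>B / 4\<close> is due to the gradients, and Cauchy-Schwarz over a time at most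
  \<open>X\<close> gives the decrease \<open>B\<^sup>2 / (64 * X)\<close>.\<close>

lemma escape_decrease:
  assumes E1: "(norm (\<Sum>j<n. diag (spw (n - 1 - j)) (x j)))\<^sup>2 \<le> E1"
    and E2: "(\<Sum>j<n. inner (diag (pw (2 * n - 1 - j)) g0) (x j))\<^sup>2 \<le> E2 * D" "E2 \<ge> 0"
    and E3: "norm (\<Sum>j<n. diag (pw (n - 1 - j)) (x j)) \<le> E3" "norm (\<Sum>j<n. diag neg (x j)) \<le> E3"
    and E4: "- (\<Sum>j<n. inner (v j) (x j)) \<le> (\<Sum>j<n. (norm (v j))\<^sup>2) / 4 + E4"
    and B: "B > 0" "B \<le> norm (y n)" "\<eta> * n * R \<le> B / 16" "\<eta> * E3 \<le> B / 16" and X: "X > 0" "\<eta> * n \<le> X"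
  shows "inner g0 (y n) + inner (y n) (H (y n)) / 2
    \<le> - (B\<^sup>2 / (64 * X)) + 4 * \<eta> * n * R\<^sup>2 + 2 * \<eta> * E2 + \<eta>\<^sup>2 * E1 + \<eta> * E4"
proof -
  let ?V = "\<Sum>j<n. (norm (v j))\<^sup>2"
  have D0: "0 \<le> D" "0 \<le> ?V" by (auto simp: decay_def sum_nonneg)
  have yR: "y n \<in> Rd d" by (rule y_Rd) simp
  have "inner g0 (y n) + inner (y n) (H (y n)) / 2
     = (\<Sum>i<d. inner (e i) g0 * inner (e i) (y n) + l i * (inner (e i) (y n))\<^sup>2 / 2)"
    using inner_expand[OF g0, of "y n"] inner_H_expand[OF yR]
    by (simp add: sum.distrib sum_divide_distrib)
  also have "\<dots> = (\<Sum>i<d. if l i > 0 then inner (e i) g0 * inner (e i) (y n) + l i * (inner (e i) (y n))\<^sup>2 / 2 else 0)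
     + (\<Sum>i<d. if l i > 0 then 0 else inner (e i) g0 * inner (e i) (y n) + l i * (inner (e i) (y n))\<^sup>2 / 2)"
    unfolding sum.distrib[symmetric] by (rule sum.cong) auto
  also have "\<dots> \<le> (- (\<eta> / 4) * D + 3 * \<eta> * n * R\<^sup>2 + 2 * \<eta> * E2 + \<eta>\<^sup>2 * E1)
     + (- (\<eta> / 2) * ?V + \<eta> * n * R\<^sup>2 + \<eta> * E4)"
    by (intro add_mono pos_energy neg_energy E1 E2 E4)
  finally have main: "inner g0 (y n) + inner (y n) (H (y n)) / 2
     \<le> - (\<eta> / 4) * D - (\<eta> / 2) * ?V + 4 * \<eta> * n * R\<^sup>2 + 2 * \<eta> * E2 + \<eta>\<^sup>2 * E1 + \<eta> * E4"
    by (simp add: algebra_simps)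
  have split: "y n = diag (pw 0) (y n) + diag neg (y n)"
  proof -
    have "(\<Sum>i<d. inner (e i) (y n) *\<^sub>R e i) = diag (pw 0) (y n) + diag neg (y n)"
      unfolding diag_def sum.distrib[symmetric] by (rule sum.cong) (auto simp: pw_def neg_def)
    then show ?thesis using expand[OF yR] by simp
  qed
  have gain: "B\<^sup>2 / (64 * X) \<le> (\<eta> / 4) * W"
    if "B / 2 \<le> \<eta> * sqrt (n * W) + \<eta> * n * R + \<eta> * E3" "W \<ge> 0" for W :: real
  proof -
    have "B / 4 \<le> \<eta> * sqrt (n * W)" using that B by simp
    then have "(B / 4)\<^sup>2 \<le> (\<eta> * sqrt (n * W))\<^sup>2" using B by (intro power_mono) auto
    also have "\<dots> = (\<eta> * n) * (\<eta> * W)" using that(2) by (simp add: power_mult_distrib power2_eq_square)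
    also have "\<dots> \<le> X * (\<eta> * W)" using X that(2) \<eta> by (intro mult_right_mono) auto
    finally have "B\<^sup>2 / 16 \<le> X * (\<eta> * W)" by (simp add: power_divide)
    then show ?thesis using X by (simp add: field_simps)
  qed
  have "norm (y n) \<le> norm (diag (pw 0) (y n)) + norm (diag neg (y n))"
    using norm_triangle_ineq[of "diag (pw 0) (y n)" "diag neg (y n)"] split by simp
  then consider "B / 2 \<le> norm (diag (pw 0) (y n))" | "B / 2 \<le> norm (diag neg (y n))" using B by linarith
  then have "B\<^sup>2 / (64 * X) \<le> (\<eta> / 4) * D + (\<eta> / 2) * ?V"
  proof cases
    case 1
    have "B\<^sup>2 / (64 * X) \<le> (\<eta> / 4) * D"
      by (rule gain) (use 1 pos_displacement[OF E3(1)] D0 in linarith)+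
    then show ?thesis using D0 \<eta> by (simp add: add_increasing2)
  next
    case 2
    have "B\<^sup>2 / (64 * X) \<le> (\<eta> / 4) * ?V"
      by (rule gain) (use 2 neg_displacement[OF E3(2)] D0 in linarith)+
    moreover have "0 \<le> (\<eta> / 4) * D" "(\<eta> / 4) * ?V \<le> (\<eta> / 2) * ?V"
      using D0 \<eta> by (auto intro!: mult_right_mono)
    ultimately show ?thesis by linarith
  qed
  with main show ?thesis by linarith
qed

end

section \<open>The unrestarted iteration and its noise\<close>

primrec sgd :: "(evec \<Rightarrow> 'x \<Rightarrow> evec) \<Rightarrow> real \<Rightarrow> evec \<Rightarrow> (nat \<Rightarrow> 'x) \<Rightarrow> nat \<Rightarrow> evec" where
  "sgd G \<eta> x w 0 = x"
| "sgd G \<eta> x w (Suc n) = sgd G \<eta> x w n - \<eta> *\<^sub>R G (sgd G \<eta> x w n) (w n)"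

lemma sgd_cong: "(\<And>j. j < n \<Longrightarrow> w j = w' j) \<Longrightarrow> sgd G \<eta> x w n = sgd G \<eta> x w' n"
  by (induction n) auto

lemma sgd_comb_seq: "sgd G \<eta> x (comb_seq i w w') (i + n) = sgd G \<eta> (sgd G \<eta> x w i) w' n"
proof (induction n)
  case 0
  show ?case by (auto intro: sgd_cong simp: comb_seq_less)
next
  case (Suc n)
  then show ?case by (simp add: comb_seq_def)
qed

lemma sgd_case_nat: "sgd G \<eta> x (case_nat z w) (Suc n) = sgd G \<eta> (x - \<eta> *\<^sub>R G x z) w n"
  by (induction n) auto

lemma sum_inverse_le: "0 < n \<Longrightarrow> (\<Sum>k<n. 1 / real (n - k)) \<le> 1 + ln (real n)"
proof (induction n)
  case (Suc n)
  have "(\<Sum>k<Suc n. 1 / real (Suc n - k)) = 1 / real (Suc n) + (\<Sum>k<n. 1 / real (n - k))"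
    by (simp only: sum.lessThan_Suc_shift) simp
  also have "\<dots> \<le> 1 + ln (real (Suc n))"
  proof (cases "n = 0")
    case False
    have "ln (real n / real (Suc n)) \<le> real n / real (Suc n) - 1"
      using False by (intro ln_le_minus_one) auto
    also have "\<dots> = - 1 / real (Suc n)" by (simp add: field_simps)
    finally have "1 / real (Suc n) \<le> ln (real (Suc n)) - ln (real n)"
      using False by (simp add: ln_div)
    with Suc False show ?thesis by simp
  qed simp
  finally show ?case .
qed simp

locale sgd_process = sequence_space M for M :: "'x measure" +
  fixes d :: nat and G :: "evec \<Rightarrow> 'x \<Rightarrow> evec" and \<eta> :: real
  assumes G_meas: "(\<lambda>p. G (fst p) (snd p)) \<in> borel_measurable (borel \<Otimes>\<^sub>M M)"
    and G_Rd: "\<And>x z. z \<in> space M \<Longrightarrow> G x z \<in> Rd d"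
begin

lemma borel_measurable_G [measurable (raw)]:
  assumes [measurable]: "f \<in> borel_measurable N" "h \<in> measurable N M"
  shows "(\<lambda>x. G (f x) (h x)) \<in> borel_measurable N"
  using measurable_compose[OF measurable_Pair[OF assms] G_meas] by simp

lemma borel_measurable_sgd [measurable (raw)]:
  assumes [measurable]: "f \<in> borel_measurable N" "h \<in> measurable N S"
  shows "(\<lambda>x. sgd G \<eta> (f x) (h x) n) \<in> borel_measurable N"
proof (induction n)
  case (Suc n)
  note Suc[measurable]
  have [measurable]: "(\<lambda>x. h x n) \<in> measurable N M" by measurable
  show ?case by (simp only: sgd.simps) measurable
qed simp

lemma sgd_Rd:
  assumes "x \<in> Rd d" "w \<in> space S" shows "sgd G \<eta> x w n \<in> Rd d"
  by (induction n) (use assms in \<open>auto simp: space_S_iff intro!: Rd_closed_ops G_Rd\<close>)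

end

text \<open>\<open>taylor\<close> reaches radius \<open>2 * B\<close> because the exit point
  overshoots the ball; the other local bounds are used only inside it. The noise bound
  \<open>2 * A\<close> leaves room for the perturbation, of norm at most
  \<open>1 \<le> A\<close>.\<close>

locale sgd_ball = sgd_process M d G \<eta> for M :: "'x measure" and d G \<eta> +
  fixes F :: "evec \<Rightarrow> real" and g H :: "evec \<Rightarrow> evec" and A B :: real and u :: evec
  assumes \<eta>_pos: "\<eta> > 0" and A_ge: "A \<ge> 1" and \<eta>A: "\<eta> * A \<le> 1" and B_pos: "B > 0" and uR: "u \<in> Rd d"
    and g_meas[measurable]: "g \<in> borel_measurable borel" and gR: "\<And>x. g x \<in> Rd d"
    and Hsym: "symmetric_on d H" and HA: "\<And>h. h \<in> Rd d \<Longrightarrow> norm (H h) \<le> A * norm h"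
    and gA: "\<And>x. x \<in> Rd d \<Longrightarrow> norm (x - u) \<le> B \<Longrightarrow> norm (g x) \<le> A"
    and noiseA: "\<And>x z. x \<in> Rd d \<Longrightarrow> norm (x - u) \<le> B \<Longrightarrow> z \<in> space M \<Longrightarrow> norm (G x z - g x) \<le> 2 * A"
    and mean0: "\<And>x v. x \<in> Rd d \<Longrightarrow> norm (x - u) \<le> B \<Longrightarrow> v \<in> Rd d \<Longrightarrow> (\<integral>z. inner v (G x z - g x) \<partial>M) = 0"
    and lin: "\<And>x. x \<in> Rd d \<Longrightarrow> norm (x - u) \<le> B \<Longrightarrow> norm (g x - g u - H (x - u)) \<le> A * B\<^sup>2"
    and taylor: "\<And>x. x \<in> Rd d \<Longrightarrow> norm (x - u) \<le> 2 * B \<Longrightarrow>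
      F x \<le> F u + inner (g u) (x - u) + inner (x - u) (H (x - u)) / 2 + A * norm (x - u) ^ 3"
begin

abbreviation "pt k w \<equiv> sgd G \<eta> u w k"

definition inb :: "nat \<Rightarrow> (nat \<Rightarrow> 'x) \<Rightarrow> bool" where
  "inb k w \<longleftrightarrow> (\<forall>j\<le>k. norm (pt j w - u) \<le> B)"

text \<open>Set to zero once the ball has been left, where no bound is known. Since
  \<open>inb k\<close> depends only on the samples before \<open>k\<close>, this preserves mean zero
  and makes the bounds hold on the whole sample space.\<close>

definition noise :: "nat \<Rightarrow> (nat \<Rightarrow> 'x) \<Rightarrow> evec" where
  "noise k w = (if inb k w then G (pt k w) (w k) - g (pt k w) else 0)"

lemma pred_inb [measurable]: "Measurable.pred S (inb k)"
  unfolding inb_def by measurable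

lemma borel_measurable_noise [measurable]: "noise k \<in> borel_measurable S"
  unfolding noise_def by measurable

lemma inb_cong: "(\<And>j. j < k \<Longrightarrow> w j = w' j) \<Longrightarrow> inb k w = inb k w'"
  unfolding inb_def by (intro all_cong1 imp_cong refl arg_cong2[of _ _ _ _ "(\<le>)"]
      arg_cong[of _ _ norm] arg_cong2[of _ _ _ _ "(-)"] sgd_cong) auto

lemma noise_cong:
  assumes "\<And>j. j \<le> k \<Longrightarrow> w j = w' j" shows "noise k w = noise k w'"
proof -
  have "inb k w = inb k w'" "pt k w = pt k w'" "w k = w' k"
    using assms by (auto intro!: inb_cong sgd_cong)
  then show ?thesis by (simp add: noise_def)
qed

lemma noise_Rd: "w \<in> space S \<Longrightarrow> noise k w \<in> Rd d"
  by (auto simp: noise_def space_S_iff intro!: Rd_closed_ops gR G_Rd)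

lemma norm_noise: "w \<in> space S \<Longrightarrow> norm (noise k w) \<le> 2 * A"
  using A_ge sgd_Rd[OF uR] by (auto simp: noise_def inb_def space_S_iff intro!: noiseA)

lemma noise_upd:
  assumes "w \<in> space S"
  shows "noise k (w(k := z)) = (if inb k w then G (pt k w) z - g (pt k w) else 0)"
proof -
  have "inb k (w(k := z)) = inb k w" "pt k (w(k := z)) = pt k w"
    by (auto intro!: inb_cong sgd_cong)
  then show ?thesis by (simp add: noise_def)
qed

lemma noise_mean:
  assumes "w \<in> space S" "v \<in> Rd d"
  shows "(\<integral>z. inner v (noise k (w(k := z))) \<partial>M) = 0"
proof (cases "inb k w")
  case True
  then have "norm (pt k w - u) \<le> B" by (simp add: inb_def)
  from mean0[OF sgd_Rd[OF uR assms(1)] this assms(2)] True show ?thesis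
    by (simp add: noise_upd[OF assms(1)])
qed (simp add: noise_upd[OF assms(1)])

lemma noise_tail:
  assumes meas[measurable]: "\<And>k. C k \<in> borel_measurable borel"
    and CR: "\<And>k v. C k v \<in> Rd d" and sym: "\<And>k v w. inner w (C k v) = inner (C k w) v"
    and \<rho>: "\<And>k v. k < n \<Longrightarrow> v \<in> Rd d \<Longrightarrow> norm (C k v) \<le> \<rho> k * norm v"
    and V: "V > 0" "(\<Sum>k<n. (2 * A * \<rho> k)\<^sup>2) \<le> V"
  shows "emeasure S {w \<in> space S. 4 * V * (1 / 2 + t) \<le> (norm (\<Sum>k<n. C k (noise k w)))\<^sup>2} \<le> ennreal (exp (- t))"
proof (rule vector_azuma[where W="Rd d" and \<rho>="\<lambda>k. 2 * A * \<bar>\<rho> k\<bar>"])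
  show "(\<lambda>w. C k (noise k w)) \<in> borel_measurable S" for k by measurable
  show "C k (noise k w) = C k (noise k w')" if "\<And>j. j \<le> k \<Longrightarrow> w j = w' j" for k w w'
    using noise_cong[of k w w'] that by simp
  show "norm (C k (noise k w)) \<le> 2 * A * \<bar>\<rho> k\<bar>" if "k < n" "w \<in> space S" for k w
  proof -
    have "norm (C k (noise k w)) \<le> \<rho> k * norm (noise k w)" by (rule \<rho>[OF that(1) noise_Rd[OF that(2)]])
    also have "\<dots> \<le> \<bar>\<rho> k\<bar> * (2 * A)" using norm_noise[OF that(2)] by (intro mult_mono) auto
    finally show ?thesis by (simp add: mult.commute)
  qed
  show "(\<integral>x. inner v (C k (noise k (w(k := x)))) \<partial>M) = 0" if "w \<in> space S" "v \<in> Rd d" for k w v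
    unfolding sym by (rule noise_mean[OF that(1) CR])
  show "(\<Sum>k<n. (2 * A * \<bar>\<rho> k\<bar>)\<^sup>2) \<le> V" using V(2) by (simp add: power_mult_distrib)
qed (use CR V in auto)

text \<open>The event uses a strict inequality because \<open>V\<close> may be zero, as it is when
  \<open>decay\<close> vanishes at the anchor; the sum is then identically zero.\<close>

lemma noise_inner_tail:
  assumes a: "\<And>k. a k \<in> Rd d" and V: "(\<Sum>k<n. (2 * A * norm (a k))\<^sup>2) \<le> V" and t: "t \<ge> 0"
  shows "emeasure S {w \<in> space S. 4 * V * (1 / 2 + t) < (\<Sum>k<n. inner (a k) (noise k w))\<^sup>2} \<le> ennreal (exp (- t))"
proof (cases "V > 0")
  case True
  have "emeasure S {w \<in> space S. 4 * V * (1 / 2 + t) \<le> (norm (\<Sum>k<n. inner (a k) (noise k w)))\<^sup>2} \<le> ennreal (exp (- t))"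
  proof (rule vector_azuma[where W=UNIV and \<rho>="\<lambda>k. 2 * A * norm (a k)"])
    show "(\<lambda>w. inner (a k) (noise k w)) \<in> borel_measurable S" for k by measurable
    show "inner (a k) (noise k w) = inner (a k) (noise k w')" if "\<And>j. j \<le> k \<Longrightarrow> w j = w' j" for k w w'
      using noise_cong[of k w w'] that by simp
    show "norm (inner (a k) (noise k w)) \<le> 2 * A * norm (a k)" if "w \<in> space S" for k w
    proof -
      have "norm (inner (a k) (noise k w)) \<le> norm (a k) * norm (noise k w)"
        using Cauchy_Schwarz_ineq2 by simp
      also have "\<dots> \<le> norm (a k) * (2 * A)" using norm_noise[OF that] by (intro mult_left_mono) auto
      finally show ?thesis by (simp add: mult.commute)
    qed
    show "(\<integral>x. inner v (inner (a k) (noise k (w(k := x)))) \<partial>M) = 0" if "w \<in> space S" for k w and v :: real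
      using noise_mean[OF that a, of k] by simp
  qed (use True V in auto)
  then show ?thesis
    by (rule order_trans[rotated]) (intro emeasure_mono, auto)
next
  case False
  have "0 \<le> (\<Sum>k<n. (2 * A * norm (a k))\<^sup>2)" by (intro sum_nonneg) auto
  then have V0: "V = 0" "(\<Sum>k<n. (2 * A * norm (a k))\<^sup>2) = 0" using False V by auto
  then have "\<forall>k<n. a k = 0" using A_ge sum_nonneg_eq_0_iff[of "{..<n}" "\<lambda>k. (2 * A * norm (a k))\<^sup>2"] by auto
  then show ?thesis by (simp add: V0)
qed

text \<open>The \<open>v k\<close> are random and no bound on their sum of squares is assumed, so
  the deviation is measured against that sum. With \<open>c = 1 / (8 * A\<^sup>2)\<close> the
  compensator is exactly \<open>c / 4\<close> times it, the share that \<open>neg_energy\<close>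
  allows.\<close>

lemma noise_self_tail:
  assumes meas[measurable]: "\<And>k. v k \<in> borel_measurable S"
    and dep: "\<And>k w w'. (\<And>j. j < k \<Longrightarrow> w j = w' j) \<Longrightarrow> v k w = v k w'"
    and vR: "\<And>k w. v k w \<in> Rd d"
  shows "emeasure S {w \<in> space S. 8 * A\<^sup>2 * t \<le> - (\<Sum>k<n. inner (v k w) (noise k w)) - (\<Sum>k<n. (norm (v k w))\<^sup>2) / 4}
    \<le> ennreal (exp (- t))"
proof -
  define c where "c = 1 / (8 * A\<^sup>2)"
  have c: "c > 0" using A_ge by (simp add: c_def)
  have eq: "(\<Sum>k<n. - c * inner (v k w) (noise k w) - (c * (2 * A) * norm (v k w))\<^sup>2 / 2)
     = c * (- (\<Sum>k<n. inner (v k w) (noise k w)) - (\<Sum>k<n. (norm (v k w))\<^sup>2) / 4)" for w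
  proof -
    have "(c * (2 * A) * norm (v k w))\<^sup>2 / 2 = c * ((norm (v k w))\<^sup>2 / 4)" for k
      using A_ge by (simp add: c_def power2_eq_square field_simps)
    then show ?thesis
      by (simp only: sum_subtractf) (simp add: sum_negf sum_distrib_left sum_divide_distrib right_diff_distrib)
  qed
  have "emeasure S {w \<in> space S. t \<le> (\<Sum>k<n. - c * inner (v k w) (noise k w) - (c * (2 * A) * norm (v k w))\<^sup>2 / 2)}
    \<le> ennreal (exp (- t))"
  proof (rule self_normalised_tail)
    show "(\<lambda>w. - c * inner (v k w) (noise k w)) \<in> borel_measurable S" for k by measurable
    show "(\<lambda>w. c * (2 * A) * norm (v k w)) \<in> borel_measurable S" for k by measurable
    show "- c * inner (v k w) (noise k w) = - c * inner (v k w') (noise k w')" if "\<And>j. j \<le> k \<Longrightarrow> w j = w' j" for k w w'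
      using noise_cong[of k w w'] dep[of k w w'] that by simp
    show "c * (2 * A) * norm (v k w) = c * (2 * A) * norm (v k w')" if "\<And>j. j < k \<Longrightarrow> w j = w' j" for k w w'
      using dep[of k w w'] that by simp
    show "\<bar>- c * inner (v k w) (noise k w)\<bar> \<le> c * (2 * A) * norm (v k w)" if "w \<in> space S" for k w
    proof -
      have "\<bar>inner (v k w) (noise k w)\<bar> \<le> norm (v k w) * norm (noise k w)" by (rule Cauchy_Schwarz_ineq2)
      also have "\<dots> \<le> norm (v k w) * (2 * A)" using norm_noise[OF that] by (intro mult_left_mono) auto
      finally show ?thesis using c by (simp add: abs_mult mult_ac)
    qed
    show "(\<integral>x. - c * inner (v k (w(k := x))) (noise k (w(k := x))) \<partial>M) = 0" if "w \<in> space S" for k w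
    proof -
      have "v k (w(k := x)) = v k w" for x by (rule dep) simp
      then show ?thesis using noise_mean[OF that vR[of k w], of k] by simp
    qed
  qed
  also have "{w \<in> space S. t \<le> (\<Sum>k<n. - c * inner (v k w) (noise k w) - (c * (2 * A) * norm (v k w))\<^sup>2 / 2)}
    = {w \<in> space S. 8 * A\<^sup>2 * t \<le> - (\<Sum>k<n. inner (v k w) (noise k w)) - (\<Sum>k<n. (norm (v k w))\<^sup>2) / 4}"
    unfolding eq using A_ge by (auto simp: c_def field_simps)
  finally show ?thesis .
qed

end

section \<open>One block: decrease on escape, small gradient otherwise\<close>

context sgd_ball
begin

text \<open>Five events suffice, one for each noise bound that \<open>escape_decrease\<close>
  requires, and the bounds on their probabilities do not involve \<open>d\<close>. Outside them the
  errors consume less than half of \<open>B\<^sup>2 / (64 * X)\<close>.\<close>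

lemma escape_tail:
  assumes n: "n > 0" and X: "X > 0" "\<eta> * n \<le> X" and t: "t \<ge> 0" and L: "1 + ln (real n) \<le> 1 / 2 + t"
    and small: "4096 * (A * B * X) \<le> 1" "65536 * (\<eta> * A\<^sup>2 * (1 / 2 + t)\<^sup>2 * X) \<le> B\<^sup>2" "3 * \<eta> * A \<le> B"
  shows "emeasure S {w \<in> space S. inb (n - 1) w \<and> B < norm (pt n w - u) \<and> F u - B\<^sup>2 / (128 * X) < F (pt n w)}
    \<le> ennreal (5 * exp (- t))"
proof -
  define L where "L = 1 / 2 + t"
  have ln0: "0 \<le> ln (real n)" using n by simp
  have L1: "1 \<le> L" using L ln0 unfolding L_def by linarith
  obtain e l where el: "eigenbasis d H e l" using ex_eigenbasis[OF Hsym] by blast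
  interpret E: eigen d H e l by unfold_locales (use Hsym el in auto)
  have l_le: "\<bar>l i\<bar> \<le> A" if "i < d" for i
    using HA[OF E.e_Rd[OF that]] that by (simp add: E.He E.norm_e)
  interpret E: eigen_step d H e l \<eta> A by unfold_locales (use \<eta>_pos \<eta>A l_le in auto)
  \<comment> \<open>Variance budgets: \<open>V1\<close> contains the harmonic sum coming from
    \<open>abs_spw_le\<close>, \<open>V2\<close> is proportional to \<open>decay\<close>, and
    \<open>V3\<close> is the plain sum over \<open>n\<close> steps.\<close>
  define V1 where "V1 = 4 * A\<^sup>2 * (1 + ln (real n)) / \<eta>"
  define V2 where "V2 = 4 * A\<^sup>2 * E.decay (g u) n"
  define V3 where "V3 = 4 * A\<^sup>2 * real n"
  define v where "v k w = E.diag E.neg (g u + H (pt k w - u))" for k w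
  \<comment> \<open>Agrees with \<open>v\<close> on the sample space, but is measurable although nothing is known about \<open>H\<close> off \<open>Rd d\<close>.\<close>
  define vv where "vv k w = E.diag E.neg (g u + (\<Sum>i<d. (l i * inner (e i) (pt k w - u)) *\<^sub>R e i))" for k w
  have Hsum: "H x = (\<Sum>i<d. (l i * inner (e i) x) *\<^sub>R e i)" if "x \<in> Rd d" for x
  proof -
    have "H x = (\<Sum>i<d. inner (e i) (H x) *\<^sub>R e i)" by (rule E.expand[OF E.HR[OF that], symmetric])
    also have "\<dots> = (\<Sum>i<d. (l i * inner (e i) x) *\<^sub>R e i)"
      by (rule sum.cong) (auto simp: E.inner_e_H that)
    finally show ?thesis .
  qed
  have vv: "vv k w = v k w" if "w \<in> space S" for k w
    using Hsum[of "pt k w - u"] sgd_Rd[OF uR that] uR by (simp add: v_def vv_def Rd_closed_ops)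
  define Bad where "Bad = (\<lambda>i::nat.
     if i = 0 then {w \<in> space S. 4 * V1 * (1 / 2 + t) \<le> (norm (\<Sum>k<n. E.diag (E.spw (n - 1 - k)) (noise k w)))\<^sup>2}
     else if i = 1 then {w \<in> space S. 4 * V2 * (1 / 2 + t) < (\<Sum>k<n. inner (E.diag (E.pw (2 * n - 1 - k)) (g u)) (noise k w))\<^sup>2}
     else if i = 2 then {w \<in> space S. 4 * V3 * (1 / 2 + t) \<le> (norm (\<Sum>k<n. E.diag (E.pw (n - 1 - k)) (noise k w)))\<^sup>2}
     else if i = 3 then {w \<in> space S. 4 * V3 * (1 / 2 + t) \<le> (norm (\<Sum>k<n. E.diag E.neg (noise k w)))\<^sup>2}
     else {w \<in> space S. 8 * A\<^sup>2 * t \<le> - (\<Sum>k<n. inner (vv k w) (noise k w)) - (\<Sum>k<n. (norm (vv k w))\<^sup>2) / 4})"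
  have vv_meas[measurable]: "vv k \<in> borel_measurable S" for k
    unfolding vv_def by measurable
  have Bad_meas: "Bad i \<in> sets S" for i unfolding Bad_def by simp
  have V1: "V1 > 0" and V3: "V3 > 0" using A_ge \<eta>_pos n ln0 by (auto simp: V1_def V3_def intro!: divide_pos_pos mult_pos_pos add_pos_nonneg)
  have spw\<rho>: "norm (E.diag (E.spw (n - 1 - k)) x) \<le> sqrt (1 / (\<eta> * real (n - k))) * norm x"
    if "k < n" "x \<in> Rd d" for k x
  proof (rule E.norm_diag_le[OF _ that(2)])
    show "\<bar>E.spw (n - 1 - k) i\<bar> \<le> sqrt (1 / (\<eta> * real (n - k)))" if "i < d" for i
      using E.abs_spw_le[OF that, of "n - 1 - k"] \<open>k < n\<close> by (simp add: Suc_diff_Suc)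
  qed (use \<eta>_pos in simp)
  have pw\<rho>: "norm (E.diag (E.pw m) x) \<le> 1 * norm x" if "x \<in> Rd d" for m x
    by (rule E.norm_diag_le) (use E.abs_pw_le that in auto)
  have neg\<rho>: "norm (E.diag E.neg x) \<le> 1 * norm x" if "x \<in> Rd d" for x
    by (rule E.norm_diag_le) (use that in \<open>auto simp: E.neg_def\<close>)
  have sumV1: "(\<Sum>k<n. (2 * A * sqrt (1 / (\<eta> * real (n - k))))\<^sup>2) \<le> V1"
  proof -
    have "(\<Sum>k<n. (2 * A * sqrt (1 / (\<eta> * real (n - k))))\<^sup>2) = (\<Sum>k<n. 4 * A\<^sup>2 / \<eta> * (1 / real (n - k)))"
      using \<eta>_pos by (intro sum.cong) (auto simp: power_mult_distrib)
    also have "\<dots> = 4 * A\<^sup>2 / \<eta> * (\<Sum>k<n. 1 / real (n - k))" by (simp only: sum_distrib_left)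
    also have "\<dots> \<le> 4 * A\<^sup>2 / \<eta> * (1 + ln (real n))"
      using sum_inverse_le[OF n] \<eta>_pos by (intro mult_left_mono) auto
    finally show ?thesis by (simp add: V1_def)
  qed
  have "emeasure S (Bad i) \<le> ennreal (exp (- t))" if "i < 5" for i
  proof -
    have "emeasure S (Bad 0) \<le> ennreal (exp (- t))"
      unfolding Bad_def
      by (simp, rule noise_tail[where C="\<lambda>k. E.diag (E.spw (n - 1 - k))", OF _ E.diag_Rd _ spw\<rho> V1 sumV1,
            unfolded One_nat_def diff_Suc_eq_diff_pred[symmetric], simplified])
         (auto simp: E.inner_diag_left)
    moreover have "emeasure S (Bad 1) \<le> ennreal (exp (- t))"
    proof -
      have "(\<Sum>k<n. (2 * A * norm (E.diag (E.pw (2 * n - 1 - k)) (g u)))\<^sup>2)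
          = 4 * A\<^sup>2 * (\<Sum>k<n. (norm (E.diag (E.pw (2 * n - 1 - k)) (g u)))\<^sup>2)"
        by (simp add: power_mult_distrib sum_distrib_left)
      also have "\<dots> \<le> V2" unfolding V2_def by (intro mult_left_mono E.decay_shift_le) auto
      finally show ?thesis
        using noise_inner_tail[of "\<lambda>k. E.diag (E.pw (2 * n - 1 - k)) (g u)" n V2 t, OF E.diag_Rd _ t]
        by (simp add: Bad_def)
    qed
    moreover have "emeasure S (Bad 2) \<le> ennreal (exp (- t))"
      using noise_tail[where C="\<lambda>k. E.diag (E.pw (n - 1 - k))" and \<rho>="\<lambda>k. 1" and V=V3 and n=n and t=t,
          OF _ E.diag_Rd _ pw\<rho> V3]
      by (simp add: Bad_def E.inner_diag_left V3_def power_mult_distrib)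
    moreover have "emeasure S (Bad 3) \<le> ennreal (exp (- t))"
      using noise_tail[where C="\<lambda>k. E.diag E.neg" and \<rho>="\<lambda>k. 1" and V=V3 and n=n and t=t,
          OF _ E.diag_Rd _ neg\<rho> V3]
      by (simp add: Bad_def E.inner_diag_left V3_def power_mult_distrib)
    moreover have "emeasure S (Bad 4) \<le> ennreal (exp (- t))"
    proof -
      have dep: "vv k w = vv k w'" if "\<And>j. j < k \<Longrightarrow> w j = w' j" for k w w'
        using sgd_cong[of k w w' G \<eta> u] that by (simp add: vv_def)
      have R: "vv k w \<in> Rd d" for k w by (simp add: vv_def)
      show ?thesis
        using noise_self_tail[of vv, OF vv_meas dep R, of t n] by (simp add: Bad_def)
    qed
    moreover have "i = 0 \<or> i = 1 \<or> i = 2 \<or> i = 3 \<or> i = 4" using that by auto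
    ultimately show ?thesis by blast
  qed
  then have "emeasure S (\<Union>i<5. Bad i) \<le> (\<Sum>i<5::nat. ennreal (exp (- t)))"
    by (intro order_trans[OF emeasure_subadditive_finite] sum_mono) (auto simp: Bad_meas)
  also have "\<dots> = ennreal (5 * exp (- t))" by (simp add: ennreal_mult)
  finally have tot: "emeasure S (\<Union>i<5. Bad i) \<le> ennreal (5 * exp (- t))" .
  have "w \<in> (\<Union>i<5. Bad i)"
    if w: "w \<in> space S" "inb (n - 1) w" "B < norm (pt n w - u)" "F u - B\<^sup>2 / (128 * X) < F (pt n w)" for w
  proof (rule ccontr)
    assume "w \<notin> (\<Union>i<5. Bad i)"
    then have nb: "w \<notin> Bad 0" "w \<notin> Bad 1" "w \<notin> Bad 2" "w \<notin> Bad 3" "w \<notin> Bad 4" by auto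
    have XR: "pt k w \<in> Rd d" for k by (rule sgd_Rd[OF uR w(1)])
    have inbk: "inb k w" "norm (pt k w - u) \<le> B" if "k < n" for k
      using w(2) that by (auto simp: inb_def)
    interpret Q: quadratic_sgd d H e l \<eta> A "A * B\<^sup>2" "g u" "\<lambda>k. pt k w - u"
      "\<lambda>k. g (pt k w) - g u - H (pt k w - u)" "\<lambda>k. noise k w" n
    proof unfold_locales
      show "pt 0 w - u = 0" by simp
      show "g u \<in> Rd d" by (rule gR)
      fix k assume k: "k < n"
      show "g (pt k w) - g u - H (pt k w - u) \<in> Rd d" by (intro Rd_closed_ops gR E.HR XR uR)
      show "noise k w \<in> Rd d" by (rule noise_Rd[OF w(1)])
      show "norm (g (pt k w) - g u - H (pt k w - u)) \<le> A * B\<^sup>2" by (rule lin[OF XR inbk(2)[OF k]])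
      show "pt (Suc k) w - u = pt k w - u - \<eta> *\<^sub>R (g u + H (pt k w - u) + (g (pt k w) - g u - H (pt k w - u)) + noise k w)"
        using inbk(1)[OF k] by (simp add: noise_def algebra_simps)
    qed
    define E3 where "E3 = sqrt (4 * V3 * L)"
    have nb2: "norm x \<le> E3" if "\<not> 4 * V3 * (1 / 2 + t) \<le> (norm x)\<^sup>2" for x :: evec
      unfolding E3_def L_def by (rule real_le_rsqrt) (use that in simp)
    have \<eta>n: "\<eta> * real n * (A * B\<^sup>2) \<le> X * (A * B\<^sup>2)"
      using X A_ge by (intro mult_right_mono) auto
    have XAB: "X * (A * B\<^sup>2) = (A * B * X) * B" by (simp add: power2_eq_square)
    have ABX0: "0 \<le> A * B * X" using A_ge B_pos X by simp
    have "(A * B * X) * B \<le> (1 / 4096) * B" using small(1) B_pos by (intro mult_right_mono) auto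
    with \<eta>n XAB have R16: "\<eta> * real n * (A * B\<^sup>2) \<le> B / 16" using B_pos by linarith
    define q where "q = \<eta> * A\<^sup>2 * X"
    have q0: "0 \<le> q" using \<eta>_pos X by (simp add: q_def)
    have qL2: "65536 * (q * L\<^sup>2) \<le> B\<^sup>2" using small(2) by (simp add: q_def L_def mult_ac)
    have "L \<le> L\<^sup>2" using L1 by (simp add: power2_eq_square)
    have "q * L \<le> q * L\<^sup>2" using \<open>L \<le> L\<^sup>2\<close> q0 by (rule mult_left_mono)
    have E16: "\<eta> * E3 \<le> B / 16"
    proof (rule power2_le_imp_le)
      have "(\<eta> * E3)\<^sup>2 = 16 * (\<eta> * real n) * (\<eta> * A\<^sup>2 * L)"
        using L1 V3 by (simp add: E3_def V3_def power_mult_distrib power2_eq_square)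
      also have "\<dots> \<le> 16 * X * (\<eta> * A\<^sup>2 * L)"
        using X \<eta>_pos L1 by (intro mult_right_mono mult_left_mono) auto
      also have "\<dots> = 16 * (q * L)" by (simp add: q_def)
      also have "\<dots> \<le> B\<^sup>2 / 256"
        using qL2 \<open>q * L \<le> q * L\<^sup>2\<close> zero_le_power2[of B] by linarith
      finally show "(\<eta> * E3)\<^sup>2 \<le> (B / 16)\<^sup>2" by (simp add: power_divide)
    qed (use B_pos in simp)
    have E2D: "(\<Sum>k<n. inner (E.diag (E.pw (2 * n - 1 - k)) (g u)) (noise k w))\<^sup>2 \<le> (16 * A\<^sup>2 * L) * E.decay (g u) n"
      using nb(2) w(1) by (simp add: Bad_def V2_def L_def not_less algebra_simps)
    have E4: "- (\<Sum>j<n. inner (Q.v j) (noise j w)) \<le> (\<Sum>j<n. (norm (Q.v j))\<^sup>2) / 4 + 8 * A\<^sup>2 * t"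
      using nb(5) w(1) vv[OF w(1)] by (simp add: Bad_def v_def Q.v_def)
    have main: "inner (g u) (pt n w - u) + inner (pt n w - u) (H (pt n w - u)) / 2
      \<le> - (B\<^sup>2 / (64 * X)) + 4 * \<eta> * real n * (A * B\<^sup>2)\<^sup>2 + 2 * \<eta> * (16 * A\<^sup>2 * L) + \<eta>\<^sup>2 * (4 * V1 * L) + \<eta> * (8 * A\<^sup>2 * t)"
    proof (rule Q.escape_decrease[OF _ E2D _ _ _ E4 B_pos _ R16 E16 X])
      show "(norm (\<Sum>j<n. E.diag (E.spw (n - 1 - j)) (noise j w)))\<^sup>2 \<le> 4 * V1 * L"
        using nb(1) w(1) by (simp add: Bad_def L_def)
      show "norm (\<Sum>j<n. E.diag (E.pw (n - 1 - j)) (noise j w)) \<le> E3"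
        using nb(3) w(1) by (intro nb2) (simp add: Bad_def)
      show "norm (\<Sum>j<n. E.diag E.neg (noise j w)) \<le> E3"
        using nb(4) w(1) by (intro nb2) (simp add: Bad_def)
    qed (use w(3) L1 in auto)
    \<comment> \<open>Every error is measured in units of \<open>Z\<close>. Together they stay below
      \<open>Z / 128\<close>, half of the main term \<open>Z / 64\<close>.\<close>
    define Z where "Z = B\<^sup>2 / X"
    have Z0: "Z > 0" using B_pos X by (simp add: Z_def)
    have b1: "4 * \<eta> * real n * (A * B\<^sup>2)\<^sup>2 \<le> Z / 4096"
    proof -
      have "4 * \<eta> * real n * (A * B\<^sup>2)\<^sup>2 = 4 * (\<eta> * real n) * (A * B\<^sup>2)\<^sup>2" by simp
      also have "\<dots> \<le> 4 * X * (A * B\<^sup>2)\<^sup>2" using X by (intro mult_right_mono mult_left_mono) auto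
      also have "\<dots> = 4 * ((A * B * X) * (A * B * X)) * Z" using X by (simp add: Z_def power2_eq_square field_simps)
      also have "\<dots> \<le> 4 * ((1 / 4096) * (1 / 4096)) * Z"
        using small(1) ABX0 Z0 by (intro mult_right_mono mult_left_mono mult_mono) auto
      finally show ?thesis using Z0 by simp
    qed
    have b2: "\<eta> * A\<^sup>2 * L\<^sup>2 \<le> Z / 65536"
      using small(2) X by (simp add: Z_def L_def field_simps)
    have b3: "2 * \<eta> * (16 * A\<^sup>2 * L) \<le> 32 * (\<eta> * A\<^sup>2 * L\<^sup>2)"
      using \<open>L \<le> L\<^sup>2\<close> \<eta>_pos by (simp add: mult_left_mono)
    have b4: "\<eta>\<^sup>2 * (4 * V1 * L) \<le> 16 * (\<eta> * A\<^sup>2 * L\<^sup>2)"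
    proof -
      have "\<eta>\<^sup>2 * (4 * V1 * L) = 16 * (\<eta> * A\<^sup>2 * ((1 + ln (real n)) * L))"
        using \<eta>_pos by (simp add: V1_def power2_eq_square)
      also have "\<dots> \<le> 16 * (\<eta> * A\<^sup>2 * (L * L))"
        using L L1 \<eta>_pos by (intro mult_left_mono mult_right_mono) (auto simp: L_def)
      finally show ?thesis by (simp add: power2_eq_square)
    qed
    have b5: "\<eta> * (8 * A\<^sup>2 * t) \<le> 8 * (\<eta> * A\<^sup>2 * L\<^sup>2)"
      using \<open>L \<le> L\<^sup>2\<close> \<eta>_pos by (simp add: mult_left_mono L_def)
    \<comment> \<open>The previous iterate is within \<open>B\<close> of the anchor, and one step
      has length at most \<open>3 * \<eta> * A \<le> B\<close>.\<close>
    have step: "norm (pt n w - u) \<le> 2 * B"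
    proof -
      obtain k where k: "n = Suc k" using n gr0_implies_Suc by blast
      have "norm (pt k w - u) \<le> B" using inbk k by auto
      moreover have "norm (G (pt k w) (w k)) \<le> norm (g (pt k w)) + norm (G (pt k w) (w k) - g (pt k w))"
        by (metis add.commute diff_add_cancel norm_triangle_ineq)
      moreover have "norm (g (pt k w)) \<le> A" "norm (G (pt k w) (w k) - g (pt k w)) \<le> 2 * A"
        using gA[OF XR] noiseA[OF XR] \<open>norm (pt k w - u) \<le> B\<close> w(1) by (auto simp: space_S_iff)
      ultimately have "norm (\<eta> *\<^sub>R G (pt k w) (w k)) \<le> \<eta> * (3 * A)" using \<eta>_pos by simp
      moreover have eq: "pt n w - u = (pt k w - u) - \<eta> *\<^sub>R G (pt k w) (w k)" by (simp add: k)
      moreover have "\<eta> * (3 * A) \<le> B" using small(3) by (simp add: mult_ac)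
      ultimately show ?thesis
        unfolding eq using norm_triangle_ineq4[of "pt k w - u" "\<eta> *\<^sub>R G (pt k w) (w k)"] \<open>norm (pt k w - u) \<le> B\<close>
        by linarith
    qed
    have b6: "A * norm (pt n w - u) ^ 3 \<le> 8 * (Z / 4096)"
    proof -
      have "A * norm (pt n w - u) ^ 3 \<le> A * (2 * B) ^ 3"
        using A_ge step by (intro mult_left_mono power_mono) auto
      also have "\<dots> = 8 * ((A * B * X) * Z)" using X by (simp add: Z_def power2_eq_square power3_eq_cube)
      also have "\<dots> \<le> 8 * ((1 / 4096) * Z)" using small(1) Z0 by (intro mult_left_mono mult_right_mono) auto
      finally show ?thesis by simp
    qed
    have "F (pt n w) \<le> F u + inner (g u) (pt n w - u) + inner (pt n w - u) (H (pt n w - u)) / 2 + A * norm (pt n w - u) ^ 3"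
      by (rule taylor[OF XR step])
    moreover have "B\<^sup>2 / (64 * X) = Z / 64" "B\<^sup>2 / (128 * X) = Z / 128" by (simp_all add: Z_def)
    ultimately show False using w(4) main b1 b2 b3 b4 b5 b6 Z0 by linarith
  qed
  then have "{w \<in> space S. inb (n - 1) w \<and> B < norm (pt n w - u) \<and> F u - B\<^sup>2 / (128 * X) < F (pt n w)} \<subseteq> (\<Union>i<5. Bad i)"
    by blast
  then have "emeasure S {w \<in> space S. inb (n - 1) w \<and> B < norm (pt n w - u) \<and> F u - B\<^sup>2 / (128 * X) < F (pt n w)}
     \<le> emeasure S (\<Union>i<5. Bad i)"
    by (rule emeasure_mono) (auto simp: Bad_meas)
  with tot show ?thesis by (rule order_trans[rotated])
qed

text \<open>The updates telescope, so the summed gradients equal minus the displacement over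
  \<open>\<eta>\<close> up to noise, and the displacement is at most \<open>B\<close>. The linear
  model then identifies the average of the gradients with the gradient at the average, up to
  \<open>2 * A * B\<^sup>2\<close>.\<close>

lemma stay_tail:
  assumes K: "K > 0" and X: "\<eta> * K \<le> X" and t: "t \<ge> 1 / 2"
    and small: "65536 * (\<eta> * A\<^sup>2 * (1 / 2 + t)\<^sup>2 * X) \<le> B\<^sup>2"
  shows "emeasure S {w \<in> space S. inb K w \<and>
      2 * B / (\<eta> * K) + 2 * A * B\<^sup>2 < norm (g ((1 / real K) *\<^sub>R (\<Sum>k<K. pt k w)))} \<le> ennreal (exp (- t))"
proof -
  define L where "L = 1 / 2 + t"
  have L1: "1 \<le> L" using t by (simp add: L_def)
  define V where "V = 4 * A\<^sup>2 * real K"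
  have V0: "V > 0" using A_ge K by (simp add: V_def)
  have projsym: "inner w (proj d v) = inner (proj d w) v" for v w
  proof -
    have "inner (proj d v) w = inner (proj d v) (proj d w)" by (simp add: inner_proj)
    also have "\<dots> = inner (proj d w) (proj d v)" by (rule inner_commute)
    also have "\<dots> = inner (proj d w) v" by (simp add: inner_proj)
    finally show ?thesis by (simp add: inner_commute)
  qed
  \<comment> \<open>\<open>proj d\<close> acts as the identity on the noise; it is inserted because
    \<open>noise_tail\<close> wants an operator with all its values in \<open>Rd d\<close>.\<close>
  define Bad where "Bad = {w \<in> space S. 4 * V * (1 / 2 + t) \<le> (norm (\<Sum>k<K. proj d (noise k w)))\<^sup>2}"
  have [measurable]: "Bad \<in> sets S" unfolding Bad_def by measurable
  have tail: "emeasure S Bad \<le> ennreal (exp (- t))" unfolding Bad_def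
    by (rule noise_tail[where \<rho>="\<lambda>_. 1"])
       (use V0 in \<open>auto simp: linear_proj projsym norm_proj_le V_def power_mult_distrib\<close>)
  have bad: "w \<in> Bad"
    if w: "w \<in> space S" "inb K w" "2 * B / (\<eta> * K) + 2 * A * B\<^sup>2 < norm (g ((1 / real K) *\<^sub>R (\<Sum>k<K. pt k w)))" for w
  proof (rule ccontr)
    define N where "N = (\<Sum>k<K. noise k w)"
    define avg where "avg = (1 / real K) *\<^sub>R (\<Sum>k<K. pt k w)"
    assume "\<not> ?thesis"
    then have N: "(norm N)\<^sup>2 \<le> 4 * V * L"
      using w(1) by (simp add: Bad_def N_def L_def noise_Rd[OF w(1)])
    have \<eta>N: "\<eta> * norm N \<le> B / 16"
    proof (rule power2_le_imp_le)
      have "(\<eta> * norm N)\<^sup>2 \<le> \<eta>\<^sup>2 * (4 * V * L)"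
        unfolding power_mult_distrib using N by (intro mult_left_mono) auto
      also have "\<dots> = 16 * (\<eta> * real K) * (\<eta> * A\<^sup>2 * L)" by (simp add: V_def power2_eq_square)
      also have "\<dots> \<le> 16 * X * (\<eta> * A\<^sup>2 * L\<^sup>2)"
        using X \<eta>_pos L1 K by (intro mult_mono mult_left_mono) (auto simp: power2_eq_square intro: order_trans[of _ "\<eta> * real K"])
      also have "\<dots> \<le> (B / 16)\<^sup>2"
      proof -
        define Y where "Y = \<eta> * A\<^sup>2 * L\<^sup>2 * X"
        have "0 \<le> X" using X \<eta>_pos by (meson order_trans mult_nonneg_nonneg less_imp_le of_nat_0_le_iff)
        then have "0 \<le> Y" using \<eta>_pos by (simp add: Y_def)
        moreover have "65536 * Y \<le> B\<^sup>2" using small by (simp add: Y_def L_def)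
        ultimately have "16 * Y \<le> B\<^sup>2 / 256" by linarith
        then show ?thesis by (simp add: Y_def power_divide mult_ac)
      qed
      finally show "(\<eta> * norm N)\<^sup>2 \<le> (B / 16)\<^sup>2" .
    qed (use B_pos in simp)
    have XR: "pt k w \<in> Rd d" for k by (rule sgd_Rd[OF uR w(1)])
    have inbk: "norm (pt k w - u) \<le> B" "inb k w" if "k \<le> K" for k
      using w(2) that by (auto simp: inb_def)
    define r where "r x = g x - g u - H (x - u)" for x
    have linH: "linear H" using Hsym by (simp add: symmetric_on_def)
    have avg_eq: "avg - u = (1 / real K) *\<^sub>R (\<Sum>k<K. pt k w - u)"
      using K by (simp add: avg_def sum_subtractf scaleR_diff_right scaleR_sum_right sum_constant_scaleR)
    have avgR: "avg \<in> Rd d" by (auto simp: avg_def intro!: Rd_closed_ops Rd_sum XR)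
    have "norm (\<Sum>k<K. pt k w - u) \<le> (\<Sum>k<K. B)" by (intro sum_norm_le) (use inbk in auto)
    then have avgB: "norm (avg - u) \<le> B" unfolding avg_eq using K by (simp add: field_simps)
    have tele: "pt m w - u = - \<eta> *\<^sub>R (\<Sum>k<m. g (pt k w) + noise k w)" if "m \<le> K" for m
      using that
    proof (induction m)
      case (Suc m)
      have "inb m w" "m \<le> K" using inbk[of m] Suc.prems by auto
      have "pt (Suc m) w - u = (pt m w - u) - \<eta> *\<^sub>R (g (pt m w) + noise m w)"
        using \<open>inb m w\<close> by (simp add: noise_def algebra_simps)
      then show ?case unfolding Suc.IH[OF \<open>m \<le> K\<close>] by (simp add: algebra_simps)
    qed simp
    have "\<eta> *\<^sub>R (\<Sum>k<K. g (pt k w)) = - (pt K w - u) - \<eta> *\<^sub>R N"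
      unfolding tele[OF order_refl] by (simp add: N_def sum.distrib algebra_simps)
    then have "\<eta> * norm (\<Sum>k<K. g (pt k w)) = norm (- (pt K w - u) - \<eta> *\<^sub>R N)"
      using \<eta>_pos by (metis abs_of_pos norm_scaleR)
    also have "\<dots> \<le> B + B / 16"
      using norm_triangle_ineq4[of "- (pt K w - u)" "\<eta> *\<^sub>R N"] inbk(1)[of K] \<eta>N \<eta>_pos
      by (simp add: norm_minus_commute)
    finally have "\<eta> * norm (\<Sum>k<K. g (pt k w)) \<le> 2 * B" using B_pos by simp
    then have gs: "norm ((1 / real K) *\<^sub>R (\<Sum>k<K. g (pt k w))) \<le> 2 * B / (\<eta> * K)"
      using \<eta>_pos K by (simp add: field_simps)
    have "(\<Sum>k<K. g (pt k w)) = (\<Sum>k<K. g u + H (pt k w - u) + r (pt k w))" by (simp add: r_def)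
    also have "\<dots> = real K *\<^sub>R g u + H (\<Sum>k<K. pt k w - u) + (\<Sum>k<K. r (pt k w))"
      by (simp add: sum.distrib linear_sum[OF linH] sum_constant_scaleR)
    finally have "(1 / real K) *\<^sub>R (\<Sum>k<K. g (pt k w)) = g u + H (avg - u) + (1 / real K) *\<^sub>R (\<Sum>k<K. r (pt k w))"
      unfolding avg_eq linear_scale[OF linH] using K by (simp add: scaleR_add_right)
    then have gavg: "g avg = (1 / real K) *\<^sub>R (\<Sum>k<K. g (pt k w)) + (r avg - (1 / real K) *\<^sub>R (\<Sum>k<K. r (pt k w)))"
      by (simp add: r_def)
    have "norm (r avg) \<le> A * B\<^sup>2" unfolding r_def by (rule lin[OF avgR avgB])
    moreover have "norm ((1 / real K) *\<^sub>R (\<Sum>k<K. r (pt k w))) \<le> A * B\<^sup>2"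
    proof -
      have "norm (\<Sum>k<K. r (pt k w)) \<le> (\<Sum>k<K. A * B\<^sup>2)"
        unfolding r_def by (intro sum_norm_le lin XR) (use inbk in auto)
      then show ?thesis using K by (simp add: field_simps)
    qed
    ultimately have "norm (g avg) \<le> 2 * B / (\<eta> * K) + (A * B\<^sup>2 + A * B\<^sup>2)"
      unfolding gavg using gs norm_triangle_ineq[of "(1 / real K) *\<^sub>R (\<Sum>k<K. g (pt k w))" "r avg - (1 / real K) *\<^sub>R (\<Sum>k<K. r (pt k w))"]
        norm_triangle_ineq4[of "r avg" "(1 / real K) *\<^sub>R (\<Sum>k<K. r (pt k w))"] by linarith
    then show False using w(3) by (simp add: avg_def)
  qed
  have "emeasure S {w \<in> space S. inb K w \<and>
      2 * B / (\<eta> * K) + 2 * A * B\<^sup>2 < norm (g ((1 / real K) *\<^sub>R (\<Sum>k<K. pt k w)))} \<le> emeasure S Bad"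
    using bad by (intro emeasure_mono) auto
  with tail show ?thesis by (rule order_trans[rotated])
qed

end

section \<open>Escape from a strict saddle by coupling\<close>

text \<open>The terms linear in \<open>N\<close> have mean zero, and each of the two squares gains
  at most \<open>q\<^sup>2\<close>. Both are treated at once because the potential in
  \<open>coupling\<close> is such a weighted sum.\<close>

lemma (in prob_space) nn_integral_quadratic_le:
  fixes N :: "'a \<Rightarrow> 'b::{real_inner, second_countable_topology}"
  assumes [measurable]: "N \<in> borel_measurable M" and q: "\<And>z. z \<in> space M \<Longrightarrow> norm (N z) \<le> q"
    and mean: "\<And>v. v \<in> W \<Longrightarrow> (\<integral>z. inner v (N z) \<partial>M) = 0"
    and W: "subspace W" "p \<in> W" "e \<in> W" "norm e = 1" and c: "c1 \<ge> 0" "c2 \<ge> 0"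
  shows "(\<integral>\<^sup>+z. ennreal (c1 * (s + inner e (N z))\<^sup>2 + c2 * (norm (p + N z))\<^sup>2) \<partial>M)
    \<le> ennreal (c1 * (s\<^sup>2 + q\<^sup>2) + c2 * ((norm p)\<^sup>2 + q\<^sup>2))"
proof -
  define C where "C = c1 * (s\<^sup>2 + q\<^sup>2) + c2 * ((norm p)\<^sup>2 + q\<^sup>2)"
  define v where "v = (2 * c1 * s) *\<^sub>R e + (2 * c2) *\<^sub>R p"
  have vW: "v \<in> W" unfolding v_def using W by (intro subspace_add subspace_scale) auto
  have le: "c1 * (s + inner e (N z))\<^sup>2 + c2 * (norm (p + N z))\<^sup>2 \<le> C + inner v (N z)" if "z \<in> space M" for z
  proof -
    have "\<bar>inner e (N z)\<bar> \<le> norm e * norm (N z)" by (rule Cauchy_Schwarz_ineq2)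
    then have "\<bar>inner e (N z)\<bar> \<le> \<bar>q\<bar>" using q[OF that] W by simp
    then have 1: "(inner e (N z))\<^sup>2 \<le> q\<^sup>2" by (simp add: abs_le_square_iff)
    have 2: "(norm (N z))\<^sup>2 \<le> q\<^sup>2" using q[OF that] by (intro power_mono) auto
    have "c1 * (s + inner e (N z))\<^sup>2 \<le> c1 * (s\<^sup>2 + 2 * s * inner e (N z) + q\<^sup>2)"
      using 1 c by (intro mult_left_mono) (auto simp: power2_sum)
    moreover have "(norm (p + N z))\<^sup>2 = (norm p)\<^sup>2 + 2 * inner p (N z) + (norm (N z))\<^sup>2"
      by (simp add: power2_norm_eq_inner inner_add_left inner_add_right inner_commute)
    then have "c2 * (norm (p + N z))\<^sup>2 \<le> c2 * ((norm p)\<^sup>2 + 2 * inner p (N z) + q\<^sup>2)"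
      using 2 c by (intro mult_left_mono) auto
    ultimately show ?thesis by (simp add: C_def v_def inner_add_left algebra_simps)
  qed
  have int: "integrable M (\<lambda>z. inner v (N z))"
  proof (rule integrable_const_bound[where B="norm v * q"])
    have "norm (inner v (N z)) \<le> norm v * q" if "z \<in> space M" for z
      using Cauchy_Schwarz_ineq2[of v "N z"] q[OF that] by (smt (verit) mult_left_mono norm_ge_zero real_norm_def)
    then show "AE z in M. norm (inner v (N z)) \<le> norm v * q" by (intro AE_I2) auto
  qed simp
  have "(\<integral>\<^sup>+z. ennreal (c1 * (s + inner e (N z))\<^sup>2 + c2 * (norm (p + N z))\<^sup>2) \<partial>M)
      \<le> (\<integral>\<^sup>+z. ennreal (C + inner v (N z)) \<partial>M)"
    by (intro nn_integral_mono ennreal_leI le)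
  also have "\<dots> = ennreal (\<integral>z. C + inner v (N z) \<partial>M)"
  proof (rule nn_integral_eq_integral)
    show "AE z in M. 0 \<le> C + inner v (N z)"
    proof (rule AE_I2)
      fix z assume "z \<in> space M"
      have "0 \<le> c1 * (s + inner e (N z))\<^sup>2 + c2 * (norm (p + N z))\<^sup>2" using c by simp
      with le[OF \<open>z \<in> space M\<close>] show "0 \<le> C + inner v (N z)" by linarith
    qed
  qed (use int in simp)
  also have "(\<integral>z. C + inner v (N z) \<partial>M) = C"
    using int mean[OF vW] by (simp add: prob_space)
  finally show ?thesis by (simp add: C_def)
qed

context sgd_process
begin

text \<open>The centre \<open>u\<close> is separate from the starting point \<open>x\<close>, so
  that the Markov property can restart the iteration anywhere while keeping the same ball.\<close>

definition stay :: "evec \<Rightarrow> real \<Rightarrow> nat \<Rightarrow> evec \<Rightarrow> (nat \<Rightarrow> 'x) \<Rightarrow> bool" where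
  "stay u B n x w \<longleftrightarrow> (\<forall>j\<le>n. norm (sgd G \<eta> x w j - u) \<le> B)"

lemma pred_stay [measurable (raw)]:
  assumes [measurable]: "f \<in> borel_measurable N" "h \<in> measurable N S"
  shows "Measurable.pred N (\<lambda>y. stay u B n (f y) (h y))"
  unfolding stay_def by measurable

lemma stay_cong: "(\<And>j. j < k \<Longrightarrow> w j = w' j) \<Longrightarrow> stay u B k x w = stay u B k x w'"
  unfolding stay_def by (intro all_cong1 imp_cong refl arg_cong2[of _ _ _ _ "(\<le>)"]
      arg_cong[of _ _ norm] arg_cong2[of _ _ _ _ "(-)"] sgd_cong) auto

definition pstay :: "evec \<Rightarrow> real \<Rightarrow> nat \<Rightarrow> evec \<Rightarrow> ennreal" where
  "pstay u B n x = emeasure S {w \<in> space S. stay u B n x w}"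

lemma borel_measurable_pstay [measurable]: "pstay u B n \<in> borel_measurable borel"
proof -
  have "(\<lambda>x. \<integral>\<^sup>+w. indicator {p \<in> space (borel \<Otimes>\<^sub>M S). stay u B n (fst p) (snd p)} (x, w) \<partial>S) \<in> borel_measurable borel"
    by (rule P.borel_measurable_nn_integral) measurable
  moreover have "(\<integral>\<^sup>+w. indicator {p \<in> space (borel \<Otimes>\<^sub>M S). stay u B n (fst p) (snd p)} (x, w) \<partial>S) = pstay u B n x" for x
  proof -
    have "(\<integral>\<^sup>+w. indicator {p \<in> space (borel \<Otimes>\<^sub>M S). stay u B n (fst p) (snd p)} (x, w) \<partial>S)
      = (\<integral>\<^sup>+w. indicator {w \<in> space S. stay u B n x w} w \<partial>S)"
      by (rule nn_integral_cong) (auto simp: indicator_def space_pair_measure)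
    then show ?thesis by (simp add: pstay_def)
  qed
  ultimately show ?thesis by (simp add: fun_eq_iff[symmetric])
qed

lemma pstay_le_1: "pstay u B n x \<le> 1"
  unfolding pstay_def by (rule P.emeasure_le_1)

lemma pstay_Suc_le: "pstay u B (Suc n) x \<le> (\<integral>\<^sup>+z. pstay u B n (x - \<eta> *\<^sub>R G x z) \<partial>M)"
proof -
  have "pstay u B (Suc n) x = (\<integral>\<^sup>+w. indicator {w \<in> space S. stay u B (Suc n) x w} w \<partial>S)"
    by (simp add: pstay_def)
  also have "\<dots> = (\<integral>\<^sup>+z. \<integral>\<^sup>+w. indicator {w \<in> space S. stay u B (Suc n) x w} (case_nat z w) \<partial>S \<partial>M)"
    by (rule nn_integral_case_nat) measurable
  also have "\<dots> \<le> (\<integral>\<^sup>+z. pstay u B n (x - \<eta> *\<^sub>R G x z) \<partial>M)"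
  proof (rule nn_integral_mono)
    fix z assume z: "z \<in> space M"
    have "stay u B n (x - \<eta> *\<^sub>R G x z) w" if "stay u B (Suc n) x (case_nat z w)" for w
      unfolding stay_def
    proof (intro allI impI)
      fix j assume "j \<le> n"
      then show "norm (sgd G \<eta> (x - \<eta> *\<^sub>R G x z) w j - u) \<le> B"
        using that[unfolded stay_def, rule_format, of "Suc j"] by (simp only: sgd_case_nat)
    qed
    then have "(\<integral>\<^sup>+w. indicator {w \<in> space S. stay u B (Suc n) x w} (case_nat z w) \<partial>S)
      \<le> (\<integral>\<^sup>+w. indicator {w \<in> space S. stay u B n (x - \<eta> *\<^sub>R G x z) w} w \<partial>S)"
      by (intro nn_integral_mono) (auto simp: indicator_def)
    then show "(\<integral>\<^sup>+w. indicator {w \<in> space S. stay u B (Suc n) x w} (case_nat z w) \<partial>S)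
      \<le> pstay u B n (x - \<eta> *\<^sub>R G x z)" by (simp add: pstay_def)
  qed
  finally show ?thesis .
qed

lemma pstay_add_le:
  assumes x: "x \<in> Rd d" and c: "\<And>y. y \<in> Rd d \<Longrightarrow> pstay u B n y \<le> c"
  shows "pstay u B (i + n) x \<le> pstay u B i x * c"
proof -
  have "pstay u B (i + n) x = (\<integral>\<^sup>+w. indicator {w \<in> space S. stay u B (i + n) x w} w \<partial>S)"
    by (simp add: pstay_def)
  also have "\<dots> = (\<integral>\<^sup>+w. \<integral>\<^sup>+w'. indicator {w \<in> space S. stay u B (i + n) x w} (comb_seq i w w') \<partial>S \<partial>S)"
    by (rule nn_integral_comb_seq) measurable
  also have "\<dots> \<le> (\<integral>\<^sup>+w. indicator {w \<in> space S. stay u B i x w} w * c \<partial>S)"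
  proof (rule nn_integral_mono)
    fix w assume w: "w \<in> space S"
    have imp: "stay u B i x w \<and> stay u B n (sgd G \<eta> x w i) w'" if "stay u B (i + n) x (comb_seq i w w')" for w'
    proof
      have "stay u B i x (comb_seq i w w')" using that by (auto simp: stay_def)
      then show "stay u B i x w" using stay_cong[of i "comb_seq i w w'" w] by (simp add: comb_seq_less)
      show "stay u B n (sgd G \<eta> x w i) w'"
        unfolding stay_def
      proof (intro allI impI)
        fix j assume "j \<le> n"
        then show "norm (sgd G \<eta> (sgd G \<eta> x w i) w' j - u) \<le> B"
          using that[unfolded stay_def, rule_format, of "i + j"] by (simp add: sgd_comb_seq)
      qed
    qed
    have "(\<integral>\<^sup>+w'. indicator {w \<in> space S. stay u B (i + n) x w} (comb_seq i w w') \<partial>S)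
      \<le> (\<integral>\<^sup>+w'. indicator {w \<in> space S. stay u B i x w} w * indicator {w' \<in> space S. stay u B n (sgd G \<eta> x w i) w'} w' \<partial>S)"
      using imp w by (intro nn_integral_mono) (auto simp: indicator_def)
    also have "\<dots> = indicator {w \<in> space S. stay u B i x w} w * pstay u B n (sgd G \<eta> x w i)"
      by (subst nn_integral_cmult) (auto simp: pstay_def)
    also have "\<dots> \<le> indicator {w \<in> space S. stay u B i x w} w * c"
      by (intro mult_left_mono c sgd_Rd x w) auto
    finally show "(\<integral>\<^sup>+w'. indicator {w \<in> space S. stay u B (i + n) x w} (comb_seq i w w') \<partial>S)
      \<le> indicator {w \<in> space S. stay u B i x w} w * c" .
  qed
  also have "\<dots> = pstay u B i x * c"
    by (subst nn_integral_multc) (auto simp: pstay_def)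
  finally show ?thesis .
qed

end

text \<open>\<open>shift\<close> bounds by \<open>1 / 4\<close> the total variation distance between
  the law of one step and its translate by length \<open>a0\<close> in any direction of
  \<open>Rd d\<close>. This is how the uniform perturbation enters.\<close>

locale sgd_saddle = sgd_ball M d G \<eta> F g H A B u for M :: "'x measure" and d G \<eta> F g H A B u +
  fixes a0 :: real
  assumes B1: "B \<le> 1" and a0: "a0 > 0"
    and gLip: "\<And>x y. x \<in> Rd d \<Longrightarrow> y \<in> Rd d \<Longrightarrow> norm (x - u) \<le> B \<Longrightarrow> norm (y - u) \<le> B \<Longrightarrow>
        norm (g x - g y - H (x - y)) \<le> A * B * norm (x - y)"
    and GLip: "\<And>x y z. x \<in> Rd d \<Longrightarrow> y \<in> Rd d \<Longrightarrow> norm (x - u) \<le> B \<Longrightarrow> norm (y - u) \<le> B \<Longrightarrow> z \<in> space M \<Longrightarrow>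
        norm (G x z - G y z) \<le> A * norm (x - y)"
    and shift: "\<And>x e \<phi>. x \<in> Rd d \<Longrightarrow> e \<in> Rd d \<Longrightarrow> norm e = 1 \<Longrightarrow>
        \<phi> \<in> borel_measurable borel \<Longrightarrow> (\<And>y. \<phi> y \<le> (1::ennreal)) \<Longrightarrow>
        (\<integral>\<^sup>+z. \<phi> (x - \<eta> *\<^sub>R G x z) \<partial>M) \<le> (\<integral>\<^sup>+z. \<phi> (x - \<eta> *\<^sub>R G x z - a0 *\<^sub>R e) \<partial>M) + ennreal (1 / 4)"
begin

definition both :: "evec \<Rightarrow> evec \<Rightarrow> nat \<Rightarrow> (nat \<Rightarrow> 'x) \<Rightarrow> bool" where
  "both y y' k w \<longleftrightarrow> stay u B k y w \<and> stay u B k y' w"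

text \<open>A stopped process: once a copy is outside the ball the value is frozen, so that the
  potential in \<open>coupling\<close> remains a supermartingale where the local bounds are
  lost.\<close>

primrec gap :: "evec \<Rightarrow> evec \<Rightarrow> real \<Rightarrow> nat \<Rightarrow> (nat \<Rightarrow> 'x) \<Rightarrow> evec" where
  "gap y y' \<Gamma> 0 w = y - y'"
| "gap y y' \<Gamma> (Suc k) w = (if both y y' k w
     then (1 / \<Gamma> ^ Suc k) *\<^sub>R (sgd G \<eta> y w (Suc k) - sgd G \<eta> y' w (Suc k)) else gap y y' \<Gamma> k w)"

lemma both_cong: "(\<And>j. j < k \<Longrightarrow> w j = w' j) \<Longrightarrow> both y y' k w = both y y' k w'"
  unfolding both_def using stay_cong[of k w w'] by auto

lemma gap_cong: "(\<And>j. j < k \<Longrightarrow> w j = w' j) \<Longrightarrow> gap y y' \<Gamma> k w = gap y y' \<Gamma> k w'"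
proof (induction k)
  case (Suc k)
  have "gap y y' \<Gamma> k w = gap y y' \<Gamma> k w'" using Suc by simp
  moreover have "both y y' k w = both y y' k w'" using Suc by (intro both_cong) simp
  moreover have "sgd G \<eta> x w (Suc k) = sgd G \<eta> x w' (Suc k)" for x
    using Suc.prems by (rule sgd_cong)
  ultimately show ?case by (simp only: gap.simps)
qed simp

lemma borel_measurable_gap [measurable]: "gap y y' \<Gamma> k \<in> borel_measurable S"
proof (induction k)
  case (Suc k)
  note Suc[measurable]
  show ?case unfolding gap.simps both_def by measurable
qed simp

lemma gap_both: "both y y' k w \<Longrightarrow> gap y y' \<Gamma> k w = (1 / \<Gamma> ^ k) *\<^sub>R (sgd G \<eta> y w k - sgd G \<eta> y' w k)"
  by (cases k) (auto simp: both_def stay_def)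

text \<open>Two copies driven by the same samples separate along the direction of negative curvature.
  Normalising by the deterministic growth \<open>(1 + \<eta> \<gamma>) ^ k\<close>, second moments suffice.\<close>

lemma coupling:
  assumes y: "y \<in> Rd d" and e: "e \<in> Rd d" "norm e = 1" "H e = - \<gamma> *\<^sub>R e" and \<gamma>: "\<gamma> \<ge> 0"
    and contr: "\<And>x. x \<in> Rd d \<Longrightarrow> norm (x - \<eta> *\<^sub>R H x) \<le> (1 + \<eta> * \<gamma>) * norm x"
    and n: "real n * (3 * (\<eta> * A * B) + 9 * (\<eta> * A)\<^sup>2) \<le> 1 / 128" and grow: "4 * B < (1 + \<eta> * \<gamma>) ^ n * a0"
  shows "emeasure S {w \<in> space S. both y (y - a0 *\<^sub>R e) n w} \<le> ennreal (1 / 16)"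
proof -
  define y' where "y' = y - a0 *\<^sub>R e"
  define \<Gamma> where "\<Gamma> = 1 + \<eta> * \<gamma>"
  define \<theta> where "\<theta> = \<eta> * A * B"
  \<comment> \<open>\<open>3 * \<theta>\<close> covers the linearisation error of \<open>g\<close>,
    and \<open>9 * (\<eta> * A)\<^sup>2\<close> the difference of the two noises, which is
    proportional to the gap because the copies share their samples.\<close>
  define \<beta> where "\<beta> = 3 * \<theta> + 9 * (\<eta> * A)\<^sup>2"
  \<comment> \<open>The first square is the drift of the component along \<open>e\<close> from its
    initial value \<open>a0\<close>. The second term reserves, for each of the \<open>n - k\<close>
    remaining steps, the variance that one step can add; the prefactor discounts relative
    growth.\<close>
  define V where "V k w = (1 / (1 + \<beta>) ^ k) * ((inner e (gap y y' \<Gamma> k w) - a0)\<^sup>2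
      + \<beta> * real (n - k) * (norm (gap y y' \<Gamma> k w))\<^sup>2)" for k w
  have y'R: "y' \<in> Rd d" using y e by (auto simp: y'_def)
  have \<Gamma>1: "\<Gamma> \<ge> 1" using \<gamma> \<eta>_pos by (simp add: \<Gamma>_def)
  have \<theta>: "0 \<le> \<theta>" "\<theta> \<le> 1"
  proof -
    show "0 \<le> \<theta>" using \<eta>_pos A_ge B_pos by (simp add: \<theta>_def)
    have "\<eta> * A * B \<le> 1 * 1" using \<eta>A B1 B_pos \<eta>_pos A_ge by (intro mult_mono) auto
    then show "\<theta> \<le> 1" by (simp add: \<theta>_def)
  qed
  have \<beta>0: "\<beta> \<ge> 0" using \<theta> by (simp add: \<beta>_def)
  have ee: "inner e e = 1" using e(2) by (simp add: dot_square_norm)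
  have symH: "inner e (H x) = - \<gamma> * inner e x" if "x \<in> Rd d" for x
    using Hsym that e by (simp add: symmetric_on_def) (metis inner_minus_left inner_scaleR_left e(3) mult_minus_left scaleR_minus_left)
  have "(\<integral>\<^sup>+w. ennreal (V n w) \<partial>S) \<le> ennreal (V 0 undefined)"
  proof (rule nn_integral_supermartingale[where V="\<lambda>k w. ennreal (V k w)"])
    show "(\<lambda>w. ennreal (V k w)) \<in> borel_measurable S" for k unfolding V_def by measurable
    show "ennreal (V k w) = ennreal (V k w')" if "\<And>j. j < k \<Longrightarrow> w j = w' j" for k w w'
      using gap_cong[of k w w' y y' \<Gamma>] that by (simp add: V_def)
    fix k w assume k: "k < n" and w: "w \<in> space S"
    show "(\<integral>\<^sup>+z. ennreal (V (Suc k) (w(k := z))) \<partial>M) \<le> ennreal (V k w)"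
    proof (cases "both y y' k w")
      case False
      have eq: "gap y y' \<Gamma> (Suc k) (w(k := z)) = gap y y' \<Gamma> k w" for z
      proof -
        have "both y y' k (w(k := z)) = both y y' k w" "gap y y' \<Gamma> k (w(k := z)) = gap y y' \<Gamma> k w"
          by (auto intro!: both_cong gap_cong)
        then show ?thesis using False by simp
      qed
      have "V (Suc k) (w(k := z)) \<le> V k w" for z
        unfolding V_def eq
      proof (rule mult_mono)
        show "1 / (1 + \<beta>) ^ Suc k \<le> 1 / (1 + \<beta>) ^ k"
          using \<beta>0 by (intro divide_left_mono power_increasing) auto
        show "(inner e (gap y y' \<Gamma> k w) - a0)\<^sup>2 + \<beta> * real (n - Suc k) * (norm (gap y y' \<Gamma> k w))\<^sup>2
          \<le> (inner e (gap y y' \<Gamma> k w) - a0)\<^sup>2 + \<beta> * real (n - k) * (norm (gap y y' \<Gamma> k w))\<^sup>2"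
          using \<beta>0 by (intro add_left_mono mult_right_mono mult_left_mono) auto
      qed (use \<beta>0 in auto)
      then have "(\<integral>\<^sup>+z. ennreal (V (Suc k) (w(k := z))) \<partial>M) \<le> (\<integral>\<^sup>+z. ennreal (V k w) \<partial>M)"
        by (intro nn_integral_mono ennreal_leI) auto
      then show ?thesis by (simp add: M.emeasure_space_1)
    next
      case True
      define x where "x = sgd G \<eta> y w k"
      define x' where "x' = sgd G \<eta> y' w k"
      define \<delta> where "\<delta> = x - x'"
      define W where "W = gap y y' \<Gamma> k w"
      define P where "P = 1 / \<Gamma> ^ Suc k"
      \<comment> \<open>\<open>m\<close> is the conditional mean of the next normalised gap and
        \<open>N\<close> its fluctuation.\<close>
      define m where "m = P *\<^sub>R (\<delta> - \<eta> *\<^sub>R (g x - g x'))"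
      define N where "N z = (- P * \<eta>) *\<^sub>R ((G x z - g x) - (G x' z - g x'))" for z
      have P: "P > 0" "P * \<Gamma> ^ k \<le> 1" "P * \<Gamma> = 1 / \<Gamma> ^ k" using \<Gamma>1 by (auto simp: P_def)
      have xR: "x \<in> Rd d" "x' \<in> Rd d" using y y'R w by (auto simp: x_def x'_def intro!: sgd_Rd)
      have xB: "norm (x - u) \<le> B" "norm (x' - u) \<le> B" using True by (auto simp: both_def stay_def x_def x'_def)
      have \<delta>R: "\<delta> \<in> Rd d" using xR by (auto simp: \<delta>_def)
      have Weq: "W = (1 / \<Gamma> ^ k) *\<^sub>R \<delta>" using gap_both[OF True] by (simp add: W_def \<delta>_def x_def x'_def)
      have nW: "norm W = norm \<delta> / \<Gamma> ^ k" using \<Gamma>1 by (simp add: Weq)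
      have P\<delta>: "P * norm \<delta> \<le> norm W"
      proof -
        have "P * norm \<delta> = norm W / \<Gamma>" using \<Gamma>1 by (simp add: P_def nW)
        also have "\<dots> \<le> norm W" using \<Gamma>1 by (simp add: divide_le_eq mult_left_le mult_le_cancel_left1)
        finally show ?thesis .
      qed
      define \<rho> where "\<rho> = g x - g x' - H \<delta>"
      have \<rho>: "norm \<rho> \<le> A * B * norm \<delta>" unfolding \<rho>_def \<delta>_def by (rule gLip[OF xR xB])
      have m_eq: "m = P *\<^sub>R (\<delta> - \<eta> *\<^sub>R H \<delta>) - (P * \<eta>) *\<^sub>R \<rho>" by (simp add: m_def \<rho>_def algebra_simps)
      have \<rho>W: "norm ((P * \<eta>) *\<^sub>R \<rho>) \<le> \<theta> * norm W"
      proof -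
        have "norm ((P * \<eta>) *\<^sub>R \<rho>) = P * \<eta> * norm \<rho>" using P \<eta>_pos by simp
        also have "\<dots> \<le> P * \<eta> * (A * B * norm \<delta>)" using P \<eta>_pos \<rho> by (intro mult_left_mono) auto
        also have "\<dots> = \<theta> * (P * norm \<delta>)" by (simp add: \<theta>_def)
        also have "\<dots> \<le> \<theta> * norm W" using P\<delta> \<theta> by (intro mult_left_mono) auto
        finally show ?thesis .
      qed
      have nm: "norm m \<le> (1 + \<theta>) * norm W"
      proof -
        have "norm (P *\<^sub>R (\<delta> - \<eta> *\<^sub>R H \<delta>)) \<le> P * (\<Gamma> * norm \<delta>)"
          using P contr[OF \<delta>R] by (simp add: \<Gamma>_def)
        also have "\<dots> = norm W" using P by (simp add: nW mult.assoc[symmetric])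
        finally have "norm (P *\<^sub>R (\<delta> - \<eta> *\<^sub>R H \<delta>)) \<le> norm W" .
        then show ?thesis
          unfolding m_eq using norm_triangle_ineq4[of "P *\<^sub>R (\<delta> - \<eta> *\<^sub>R H \<delta>)" "(P * \<eta>) *\<^sub>R \<rho>"] \<rho>W
          by (simp add: distrib_right)
      qed
      have em: "\<bar>inner e m - inner e W\<bar> \<le> \<theta> * norm W"
      proof -
        have "inner e (P *\<^sub>R (\<delta> - \<eta> *\<^sub>R H \<delta>)) = (P * \<Gamma>) * inner e \<delta>"
          by (simp add: inner_diff_right symH[OF \<delta>R] \<Gamma>_def algebra_simps)
        also have "\<dots> = inner e W" by (simp add: Weq P)
        finally have "inner e m - inner e W = - inner e ((P * \<eta>) *\<^sub>R \<rho>)" by (simp add: m_eq inner_diff_right)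
        then show ?thesis
          using Cauchy_Schwarz_ineq2[of e "(P * \<eta>) *\<^sub>R \<rho>"] \<rho>W e(2) by simp
      qed
      have mR: "m \<in> Rd d" unfolding m_def by (intro Rd_closed_ops \<delta>R gR)
      define q where "q = 3 * (\<eta> * A) * norm W"
      have Nq: "norm (N z) \<le> q" if z: "z \<in> space M" for z
      proof -
        have 1: "norm (G x z - G x' z) \<le> A * norm \<delta>" unfolding \<delta>_def by (rule GLip[OF xR xB z])
        have 2: "norm (g x - g x') \<le> 2 * A * norm \<delta>"
        proof -
          have "norm (g x - g x') \<le> norm (H \<delta>) + norm \<rho>"
            using norm_triangle_ineq[of "H \<delta>" \<rho>] by (simp add: \<rho>_def)
          also have "\<dots> \<le> A * norm \<delta> + A * B * norm \<delta>" by (intro add_mono HA \<delta>R \<rho>)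
          also have "A * B * norm \<delta> \<le> A * 1 * norm \<delta>" using B1 A_ge by (intro mult_right_mono mult_left_mono) auto
          finally show ?thesis by simp
        qed
        have eq: "(G x z - g x) - (G x' z - g x') = (G x z - G x' z) - (g x - g x')" by simp
        then have "norm ((G x z - g x) - (G x' z - g x')) \<le> 3 * A * norm \<delta>"
          unfolding eq using norm_triangle_ineq4[of "G x z - G x' z" "g x - g x'"] 1 2 by linarith
        then have "norm (N z) \<le> (P * \<eta>) * (3 * A * norm \<delta>)"
          using P \<eta>_pos by (simp add: N_def mult_left_mono)
        also have "\<dots> = 3 * (\<eta> * A) * (P * norm \<delta>)" by simp
        also have "\<dots> \<le> q" unfolding q_def using P\<delta> \<eta>_pos A_ge by (intro mult_left_mono) auto
        finally show ?thesis .
      qed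
      have Nmean: "(\<integral>z. inner v (N z) \<partial>M) = 0" if v: "v \<in> Rd d" for v
      proof -
        have int: "integrable M (\<lambda>z. inner v (G s z - g s))" if "s \<in> Rd d" "norm (s - u) \<le> B" for s
        proof (rule M.integrable_const_bound[where B="norm v * (2 * A)"])
          have "norm (inner v (G s z - g s)) \<le> norm v * (2 * A)" if "z \<in> space M" for z
            using Cauchy_Schwarz_ineq2[of v "G s z - g s"] noiseA[OF \<open>s \<in> Rd d\<close> \<open>norm (s - u) \<le> B\<close> that]
            by (smt (verit) mult_left_mono norm_ge_zero real_norm_def)
          then show "AE z in M. norm (inner v (G s z - g s)) \<le> norm v * (2 * A)" by (intro AE_I2) auto
        qed measurable
        have "(\<integral>z. inner v (N z) \<partial>M) = (\<integral>z. (- P * \<eta>) * (inner v (G x z - g x) - inner v (G x' z - g x')) \<partial>M)"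
          by (simp only: N_def inner_scaleR_right inner_diff_right)
        also have "\<dots> = (- P * \<eta>) * ((\<integral>z. inner v (G x z - g x) \<partial>M) - (\<integral>z. inner v (G x' z - g x') \<partial>M))"
          using int xR xB by (simp only: integral_mult_right_zero Bochner_Integration.integral_diff)
        finally show ?thesis by (simp add: mean0 xR xB v)
      qed
      have gap': "gap y y' \<Gamma> (Suc k) (w(k := z)) = m + N z" for z
      proof -
        have "both y y' k (w(k := z)) = both y y' k w" by (rule both_cong) simp
        moreover have "sgd G \<eta> s (w(k := z)) k = sgd G \<eta> s w k" for s by (rule sgd_cong) simp
        ultimately have "gap y y' \<Gamma> (Suc k) (w(k := z)) = P *\<^sub>R ((x - \<eta> *\<^sub>R G x z) - (x' - \<eta> *\<^sub>R G x' z))"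
          using True by (simp add: x_def x'_def P_def)
        then show ?thesis by (simp add: m_def N_def \<delta>_def algebra_simps)
      qed
      define c1 where "c1 = 1 / (1 + \<beta>) ^ Suc k"
      define c2 where "c2 = c1 * (\<beta> * real (n - Suc k))"
      have c: "c1 > 0" "c2 \<ge> 0" using \<beta>0 by (auto simp: c1_def c2_def)
      have "(\<integral>\<^sup>+z. ennreal (V (Suc k) (w(k := z))) \<partial>M)
        = (\<integral>\<^sup>+z. ennreal (c1 * ((inner e m - a0) + inner e (N z))\<^sup>2 + c2 * (norm (m + N z))\<^sup>2) \<partial>M)"
        unfolding V_def gap' c1_def[symmetric] c2_def by (simp add: inner_add_right algebra_simps)
      also have "\<dots> \<le> ennreal (c1 * ((inner e m - a0)\<^sup>2 + q\<^sup>2) + c2 * ((norm m)\<^sup>2 + q\<^sup>2))"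
      proof (rule M.nn_integral_quadratic_le[where W="Rd d"])
        show "N \<in> borel_measurable M" unfolding N_def by measurable
      qed (use Nq Nmean mR e c in auto)
      also have "\<dots> \<le> ennreal (V k w)"
      proof (rule ennreal_leI)
        have q2: "q\<^sup>2 = 9 * (\<eta> * A)\<^sup>2 * (norm W)\<^sup>2" by (simp add: q_def power_mult_distrib)
        define D where "D = \<bar>inner e W - a0\<bar>"
        have "\<bar>inner e m - a0\<bar> \<le> D + \<theta> * norm W" using em by (simp add: D_def)
        then have "(inner e m - a0)\<^sup>2 \<le> (D + \<theta> * norm W)\<^sup>2"
          by (metis abs_ge_zero power2_abs power_mono)
        \<comment> \<open>The cross term is split by
          \<open>2 * D * norm W \<le> D\<^sup>2 + (norm W)\<^sup>2\<close>, which carries the factor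
          \<open>\<theta>\<close>.\<close>
        also have "\<dots> \<le> (1 + \<theta>) * D\<^sup>2 + (\<theta> + \<theta>\<^sup>2) * (norm W)\<^sup>2"
        proof -
          have "0 \<le> \<theta> * (D - norm W)\<^sup>2" using \<theta> by simp
          then show ?thesis by (simp add: power2_eq_square algebra_simps)
        qed
        also have "\<dots> \<le> (1 + \<beta>) * D\<^sup>2 + (2 * \<theta>) * (norm W)\<^sup>2"
        proof -
          have "\<theta>\<^sup>2 \<le> \<theta>" using \<theta> by (simp add: power2_eq_square mult_left_le)
          moreover have "\<theta> \<le> \<beta>" using \<theta> by (simp add: \<beta>_def)
          ultimately show ?thesis by (intro add_mono mult_right_mono) auto
        qed
        finally have "(inner e m - a0)\<^sup>2 \<le> (1 + \<beta>) * D\<^sup>2 + (2 * \<theta>) * (norm W)\<^sup>2" .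
        then have i1: "(inner e m - a0)\<^sup>2 + q\<^sup>2 \<le> (1 + \<beta>) * D\<^sup>2 + \<beta> * (norm W)\<^sup>2"
        proof -
          have "0 \<le> \<theta> * (norm W)\<^sup>2" using \<theta> by simp
          moreover have "\<beta> * (norm W)\<^sup>2 = 2 * \<theta> * (norm W)\<^sup>2 + \<theta> * (norm W)\<^sup>2 + q\<^sup>2"
            unfolding q2 \<beta>_def by (simp add: algebra_simps)
          ultimately show ?thesis
            using \<open>(inner e m - a0)\<^sup>2 \<le> (1 + \<beta>) * D\<^sup>2 + (2 * \<theta>) * (norm W)\<^sup>2\<close> by linarith
        qed
        have "(norm m)\<^sup>2 \<le> ((1 + \<theta>) * norm W)\<^sup>2" using nm by (intro power_mono) auto
        also have "\<dots> = (1 + 2 * \<theta> + \<theta>\<^sup>2) * (norm W)\<^sup>2" by (simp add: power2_eq_square algebra_simps)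
        also have "\<dots> \<le> (1 + 3 * \<theta>) * (norm W)\<^sup>2"
          using \<theta> by (intro mult_right_mono) (auto simp: power2_eq_square mult_left_le)
        finally have i2: "(norm m)\<^sup>2 + q\<^sup>2 \<le> (1 + \<beta>) * (norm W)\<^sup>2"
          unfolding q2 \<beta>_def by (simp add: algebra_simps)
        have "c1 * ((inner e m - a0)\<^sup>2 + q\<^sup>2) + c2 * ((norm m)\<^sup>2 + q\<^sup>2)
          \<le> c1 * ((1 + \<beta>) * D\<^sup>2 + \<beta> * (norm W)\<^sup>2) + c2 * ((1 + \<beta>) * (norm W)\<^sup>2)"
          using c by (intro add_mono mult_left_mono i1 i2) auto
        also have "\<dots> \<le> c1 * ((1 + \<beta>) * D\<^sup>2 + (1 + \<beta>) * \<beta> * (norm W)\<^sup>2) + c2 * ((1 + \<beta>) * (norm W)\<^sup>2)"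
        proof -
          have "\<beta> * (norm W)\<^sup>2 \<le> (1 + \<beta>) * \<beta> * (norm W)\<^sup>2"
            using \<beta>0 by (intro mult_right_mono) (auto simp: algebra_simps)
          then show ?thesis using c by (intro add_right_mono mult_left_mono add_left_mono) auto
        qed
        also have "\<dots> = (c1 * (1 + \<beta>)) * (D\<^sup>2 + \<beta> * real (n - k) * (norm W)\<^sup>2)"
        proof -
          have "real (n - k) = real (n - Suc k) + 1" using k by (simp add: of_nat_diff)
          then show ?thesis by (simp add: c2_def algebra_simps)
        qed
        also have "c1 * (1 + \<beta>) = 1 / (1 + \<beta>) ^ k" using \<beta>0 by (simp add: c1_def)
        finally show "c1 * ((inner e m - a0)\<^sup>2 + q\<^sup>2) + c2 * ((norm m)\<^sup>2 + q\<^sup>2) \<le> V k w"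
          by (simp add: V_def D_def W_def)
      qed
      finally show ?thesis .
    qed
  qed
  \<comment> \<open>Initially the gap is \<open>a0 *\<^sub>R e\<close>, so the drift vanishes and
    only the variance reserve remains.\<close>
  also have "V 0 undefined = \<beta> * real n * a0\<^sup>2"
    by (simp add: V_def y'_def ee power_mult_distrib e(2))
  finally have EV: "(\<integral>\<^sup>+w. ennreal (V n w) \<partial>S) \<le> ennreal (\<beta> * real n * a0\<^sup>2)" .
  have n\<beta>: "real n * \<beta> \<le> 1 / 128" using n by (simp add: \<beta>_def \<theta>_def)
  have pow2: "(1 + \<beta>) ^ n \<le> 2"
  proof -
    have "(1 + \<beta>) ^ n \<le> exp \<beta> ^ n" using \<beta>0 by (intro power_mono) (auto simp: exp_ge_add_one_self)
    also have "\<dots> = exp (real n * \<beta>)" by (simp add: exp_of_nat_mult)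
    also have "\<dots> \<le> exp (ln 2)" unfolding exp_le_cancel_iff using n\<beta> ln2_ge_two_thirds by linarith
    finally show ?thesis by simp
  qed
  \<comment> \<open>If both copies stay, their distance is at most \<open>2 * B\<close>, and by
    \<open>grow\<close> the normalised gap is at most \<open>a0 / 2\<close>; its component along
    \<open>e\<close> has then drifted by at least \<open>a0 / 2\<close>.\<close>
  have low: "a0\<^sup>2 / 8 \<le> V n w" if "both y y' n w" for w
  proof -
    have "norm (sgd G \<eta> y w n - sgd G \<eta> y' w n) \<le> norm (sgd G \<eta> y w n - u) + norm (sgd G \<eta> y' w n - u)"
      using norm_triangle_ineq4[of "sgd G \<eta> y w n - u" "sgd G \<eta> y' w n - u"] by simp
    also have "\<dots> \<le> 2 * B" using that unfolding both_def stay_def by fastforce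
    finally have "norm (gap y y' \<Gamma> n w) \<le> (1 / \<Gamma> ^ n) * (2 * B)"
      unfolding gap_both[OF that] using \<Gamma>1 by (simp add: divide_right_mono)
    also have "\<dots> \<le> a0 / 2"
      using grow \<Gamma>1 by (simp add: \<Gamma>_def[symmetric] pos_divide_le_eq) (simp add: algebra_simps)
    finally have "\<bar>inner e (gap y y' \<Gamma> n w)\<bar> \<le> a0 / 2"
      using Cauchy_Schwarz_ineq2[of e "gap y y' \<Gamma> n w"] e(2) by simp
    then have "a0 / 2 \<le> \<bar>inner e (gap y y' \<Gamma> n w) - a0\<bar>" using a0 by linarith
    then have "(a0 / 2)\<^sup>2 \<le> (inner e (gap y y' \<Gamma> n w) - a0)\<^sup>2"
      using a0 by (metis abs_le_square_iff abs_of_nonneg divide_nonneg_pos less_imp_le zero_less_numeral)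
    moreover have "1 / 2 \<le> 1 / (1 + \<beta>) ^ n" using pow2 \<beta>0 by (intro divide_left_mono) auto
    ultimately have "1 / 2 * (a0 / 2)\<^sup>2 \<le> 1 / (1 + \<beta>) ^ n * (inner e (gap y y' \<Gamma> n w) - a0)\<^sup>2"
      using \<beta>0 by (intro mult_mono) auto
    then show ?thesis by (simp add: V_def power_divide)
  qed
  \<comment> \<open>Markov's inequality; \<open>real n * \<beta> \<le> 1 / 128\<close> is what turns
    the level \<open>a0\<^sup>2 / 8\<close> into the probability \<open>1 / 16\<close>.\<close>
  have "ennreal (a0\<^sup>2 / 8) * emeasure S {w \<in> space S. both y y' n w}
    = (\<integral>\<^sup>+w. ennreal (a0\<^sup>2 / 8) * indicator {w \<in> space S. both y y' n w} w \<partial>S)"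
    unfolding both_def by (subst nn_integral_cmult_indicator) auto
  also have "\<dots> \<le> (\<integral>\<^sup>+w. ennreal (V n w) \<partial>S)"
    using low by (intro nn_integral_mono) (auto simp: indicator_def intro!: ennreal_leI)
  also note EV
  also have "\<beta> * real n * a0\<^sup>2 \<le> (a0\<^sup>2 / 8) * (1 / 16)"
    using mult_right_mono[OF n\<beta>, of "a0\<^sup>2"] by (simp add: mult_ac)
  finally have fin: "ennreal (a0\<^sup>2 / 8) * emeasure S {w \<in> space S. both y y' n w} \<le> ennreal (a0\<^sup>2 / 8) * ennreal (1 / 16)"
    by (simp add: ennreal_mult[symmetric] ennreal_leI)
  have "ennreal (a0\<^sup>2 / 8) \<noteq> 0" using a0 by simp
  then show ?thesis
    unfolding y'_def[symmetric] using fin by (subst (asm) ennreal_mult_le_mult_iff) auto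
qed

text \<open>By \<open>coupling\<close> the probabilities of staying from \<open>y\<close> and from
  \<open>y - a0 *\<^sub>R e\<close> sum to at most \<open>17 / 16\<close>. Averaging over a random
  first step, the first exceeds the second by at most \<open>1 / 4\<close> according to
  \<open>shift\<close>, so it is at most \<open>21 / 32\<close>.\<close>

lemma pstay_trial:
  assumes e: "e \<in> Rd d" "norm e = 1" "H e = - \<gamma> *\<^sub>R e" and \<gamma>: "\<gamma> \<ge> 0"
    and contr: "\<And>x. x \<in> Rd d \<Longrightarrow> norm (x - \<eta> *\<^sub>R H x) \<le> (1 + \<eta> * \<gamma>) * norm x"
    and n: "real n * (3 * (\<eta> * A * B) + 9 * (\<eta> * A)\<^sup>2) \<le> 1 / 128" and grow: "4 * B < (1 + \<eta> * \<gamma>) ^ n * a0"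
    and x: "x \<in> Rd d"
  shows "pstay u B (Suc n) x \<le> ennreal (3 / 4)"
proof -
  let ?p = "pstay u B n"
  have two: "?p y + ?p (y - a0 *\<^sub>R e) \<le> ennreal (17 / 16)" if y: "y \<in> Rd d" for y
  proof -
    let ?E = "{w \<in> space S. stay u B n y w}" and ?E' = "{w \<in> space S. stay u B n (y - a0 *\<^sub>R e) w}"
    have meas: "?E \<in> sets S" "?E' \<in> sets S" by measurable
    have "?p y + ?p (y - a0 *\<^sub>R e) = emeasure S (?E \<union> ?E') + emeasure S (?E \<inter> ?E')"
      unfolding pstay_def using emeasure_Un_Int[OF meas] by simp
    also have "\<dots> \<le> 1 + ennreal (1 / 16)"
    proof (rule add_mono[OF P.emeasure_le_1])
      have "?E \<inter> ?E' = {w \<in> space S. both y (y - a0 *\<^sub>R e) n w}" by (auto simp: both_def)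
      then show "emeasure S (?E \<inter> ?E') \<le> ennreal (1 / 16)" using coupling[OF y e \<gamma> contr n grow] by simp
    qed
    also have "\<dots> = ennreal (17 / 16)" by (subst ennreal_1[symmetric], subst ennreal_plus[symmetric]) auto
    finally show ?thesis .
  qed
  define I where "I = (\<integral>\<^sup>+z. ?p (x - \<eta> *\<^sub>R G x z) \<partial>M)"
  define I' where "I' = (\<integral>\<^sup>+z. ?p (x - \<eta> *\<^sub>R G x z - a0 *\<^sub>R e) \<partial>M)"
  have "I + I' = (\<integral>\<^sup>+z. ?p (x - \<eta> *\<^sub>R G x z) + ?p (x - \<eta> *\<^sub>R G x z - a0 *\<^sub>R e) \<partial>M)"
    unfolding I_def I'_def by (rule nn_integral_add[symmetric]) measurable
  also have "\<dots> \<le> (\<integral>\<^sup>+z. ennreal (17 / 16) \<partial>M)"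
    by (intro nn_integral_mono two Rd_closed_ops x G_Rd)
  also have "\<dots> = ennreal (17 / 16)" by (simp add: M.emeasure_space_1)
  finally have sum: "I + I' \<le> ennreal (17 / 16)" .
  have sh: "I \<le> I' + ennreal (1 / 4)"
    unfolding I_def I'_def by (rule shift[OF x e(1,2)]) (auto simp: pstay_le_1)
  have "I < \<top>" "I' < \<top>" using sum by (auto simp: less_top[symmetric] top_unique)
  then obtain r r' where r: "I = ennreal r" "I' = ennreal r'" "0 \<le> r" "0 \<le> r'"
    by (metis less_top_ennreal)
  have "r + r' \<le> 17 / 16" "r \<le> r' + 1 / 4"
    using sum sh r by (simp_all add: ennreal_plus[symmetric] del: ennreal_plus)
  then have "r \<le> 3 / 4" by simp
  then have "I \<le> ennreal (3 / 4)" by (simp add: r ennreal_leI)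
  then show ?thesis using pstay_Suc_le[of u B n x] by (simp add: I_def)
qed

text \<open>\<open>coupling\<close> needs that no direction grows faster than \<open>e\<close>, so
  the eigenvector of the least eigenvalue is taken, which is at most \<open>- \<gamma>0\<close>. The
  bound for one trial holds from every starting point in \<open>Rd d\<close>, so successive trials
  multiply.\<close>

lemma pstay_saddle:
  assumes h: "h \<in> Rd d" "inner h (H h) < - \<gamma>0 * (norm h)\<^sup>2" and \<gamma>0: "\<gamma>0 \<ge> 0"
    and n: "real n * (3 * (\<eta> * A * B) + 9 * (\<eta> * A)\<^sup>2) \<le> 1 / 128" and grow: "4 * B < (1 + \<eta> * \<gamma>0) ^ n * a0"
    and x: "x \<in> Rd d"
  shows "pstay u B (m * Suc n) x \<le> ennreal ((3 / 4) ^ m)"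
proof -
  obtain e l where el: "eigenbasis d H e l" using ex_eigenbasis[OF Hsym] by blast
  interpret E: eigen d H e l by unfold_locales (use Hsym el in auto)
  have l_le: "\<bar>l i\<bar> \<le> A" if "i < d" for i
    using HA[OF E.e_Rd[OF that]] that by (simp add: E.He E.norm_e)
  have "\<exists>i<d. l i \<le> - \<gamma>0"
  proof (rule ccontr)
    assume "\<not> ?thesis"
    then have "inner h (H h) \<ge> (\<Sum>i<d. - \<gamma>0 * (inner (e i) h)\<^sup>2)"
      unfolding E.inner_H_expand[OF h(1)] by (intro sum_mono mult_right_mono) (auto simp: not_le intro: less_imp_le)
    then show False using h(2) by (simp only: sum_distrib_left[symmetric] E.norm2_expand[OF h(1), symmetric])
  qed
  then have ne: "{..<d} \<noteq> {}" and ex: "\<exists>i\<in>{..<d}. l i \<le> - \<gamma>0" by auto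
  obtain i where i: "i < d" "\<And>j. j < d \<Longrightarrow> l i \<le> l j"
    using arg_min_if_finite[of "{..<d}" l] ne by (metis finite_lessThan lessThan_iff not_le_imp_less)
  define \<gamma> where "\<gamma> = - l i"
  have \<gamma>: "\<gamma>0 \<le> \<gamma>" using ex i(2) by (force simp: \<gamma>_def)
  have contr: "norm (x - \<eta> *\<^sub>R H x) \<le> (1 + \<eta> * \<gamma>) * norm x" if x: "x \<in> Rd d" for x
  proof -
    have "x - \<eta> *\<^sub>R H x = (\<Sum>i<d. inner (e i) (x - \<eta> *\<^sub>R H x) *\<^sub>R e i)"
      by (rule E.expand[symmetric]) (intro Rd_closed_ops x E.HR)
    also have "\<dots> = E.diag (\<lambda>j. 1 - \<eta> * l j) x"
      unfolding E.diag_def by (rule sum.cong) (auto simp: inner_diff_right E.inner_e_H x algebra_simps)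
    also have "norm \<dots> \<le> (1 + \<eta> * \<gamma>) * norm x"
    proof (rule E.norm_diag_le[OF _ x])
      fix j assume j: "j < d"
      have "\<eta> * l j \<le> \<eta> * A" using l_le[OF j] \<eta>_pos by (intro mult_left_mono) auto
      moreover have "\<eta> * l i \<le> \<eta> * l j" using i(2)[OF j] \<eta>_pos by (intro mult_left_mono) auto
      ultimately show "\<bar>1 - \<eta> * l j\<bar> \<le> 1 + \<eta> * \<gamma>" using \<eta>A by (simp add: \<gamma>_def)
    qed (use \<gamma> \<gamma>0 \<eta>_pos in simp)
    finally show ?thesis .
  qed
  have grow': "4 * B < (1 + \<eta> * \<gamma>) ^ n * a0"
  proof -
    have "(1 + \<eta> * \<gamma>0) ^ n * a0 \<le> (1 + \<eta> * \<gamma>) ^ n * a0"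
      using \<gamma> \<gamma>0 \<eta>_pos a0 by (intro mult_right_mono power_mono) (auto intro: mult_left_mono)
    with grow show ?thesis by linarith
  qed
  have trial: "pstay u B (Suc n) x \<le> ennreal (3 / 4)" if "x \<in> Rd d" for x
    by (rule pstay_trial[of "e i" \<gamma>])
       (use i E.He[of i] E.norm_e contr n grow' that \<gamma> \<gamma>0 in \<open>auto simp: \<gamma>_def\<close>)
  show ?thesis using x
  proof (induction m arbitrary: x)
    case 0
    show ?case using pstay_le_1 by simp
  next
    case (Suc m)
    have "pstay u B (Suc n + m * Suc n) x \<le> pstay u B (Suc n) x * ennreal ((3 / 4) ^ m)"
      by (rule pstay_add_le[OF Suc.prems Suc.IH])
    also have "\<dots> \<le> ennreal (3 / 4) * ennreal ((3 / 4) ^ m)"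
      by (intro mult_right_mono trial Suc.prems) auto
    also have "\<dots> = ennreal ((3 / 4) ^ Suc m)" by (simp add: ennreal_mult[symmetric])
    finally show ?case by (simp only: mult_Suc)
  qed
qed

end

section \<open>The uniform distribution on the unit ball\<close>

lemma distr_PiM_lborel:
  fixes T :: "nat \<Rightarrow> real \<Rightarrow> real"
  assumes T: "\<And>i. i < d \<Longrightarrow> T i \<in> borel_measurable borel" "\<And>i. i < d \<Longrightarrow> distr lborel borel (T i) = lborel"
  shows "distr (\<Pi>\<^sub>M i\<in>{..<d}. lborel) (\<Pi>\<^sub>M i\<in>{..<d}. lborel) (\<lambda>x. \<lambda>i\<in>{..<d}. T i (x i)) = (\<Pi>\<^sub>M i\<in>{..<d}. lborel)"
    (is "distr ?P ?P ?f = ?P")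
proof -
  interpret product_sigma_finite "\<lambda>_::nat. lborel :: real measure"
    by (simp add: product_sigma_finite_def sigma_finite_lborel)
  have f: "?f \<in> measurable ?P ?P"
  proof (rule measurable_restrict)
    fix i assume "i \<in> {..<d}"
    then have "T i \<in> measurable lborel lborel" using T(1)[of i] by (simp add: measurable_lborel1 measurable_lborel2)
    then show "(\<lambda>x. T i (x i)) \<in> measurable ?P lborel"
      using \<open>i \<in> {..<d}\<close> by (rule measurable_compose[OF measurable_component_singleton, rotated])
  qed
  show ?thesis
  proof (rule PiM_eqI)
    fix A assume A: "\<And>i. i \<in> {..<d} \<Longrightarrow> A i \<in> sets (lborel :: real measure)"
    have pre: "T i -` A i \<in> sets borel" if "i \<in> {..<d}" for i
      using measurable_sets[OF T(1)[of i], of "A i"] A[OF that] that by simp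
    have "emeasure (distr ?P ?P ?f) (Pi\<^sub>E {..<d} A) = emeasure ?P (?f -` Pi\<^sub>E {..<d} A \<inter> space ?P)"
      by (rule emeasure_distr[OF f]) (use A in \<open>auto intro!: sets_PiM_I_finite\<close>)
    also have "?f -` Pi\<^sub>E {..<d} A \<inter> space ?P = Pi\<^sub>E {..<d} (\<lambda>i. T i -` A i)"
      by (auto simp: space_PiM PiE_iff extensional_def)
    also have "emeasure ?P \<dots> = (\<Prod>i<d. emeasure lborel (T i -` A i))"
      using pre by (intro emeasure_PiM) auto
    also have "\<dots> = (\<Prod>i<d. emeasure lborel (A i))"
    proof (rule prod.cong[OF refl])
      fix i assume i: "i \<in> {..<d}"
      have "T i \<in> measurable lborel borel" using T(1)[of i] i by (simp add: measurable_lborel1)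
      then have "emeasure (distr lborel borel (T i)) (A i) = emeasure lborel (T i -` A i)"
        using A[OF i] by (subst emeasure_distr) auto
      then show "emeasure lborel (T i -` A i) = emeasure lborel (A i)" using T(2)[of i] i by simp
    qed
    finally show "emeasure (distr ?P ?P ?f) (Pi\<^sub>E {..<d} A) = (\<Prod>i\<in>{..<d}. emeasure lborel (A i))" .
  qed auto
qed

lemma nn_integral_PiM_lborel_transform:
  fixes T :: "nat \<Rightarrow> real \<Rightarrow> real"
  assumes T: "\<And>i. i < d \<Longrightarrow> T i \<in> borel_measurable borel" "\<And>i. i < d \<Longrightarrow> distr lborel borel (T i) = lborel"
    and h: "h \<in> borel_measurable (\<Pi>\<^sub>M i\<in>{..<d}. lborel)"
  shows "(\<integral>\<^sup>+x. h x \<partial>(\<Pi>\<^sub>M i\<in>{..<d}. lborel)) = (\<integral>\<^sup>+x. h (\<lambda>i\<in>{..<d}. T i (x i)) \<partial>(\<Pi>\<^sub>M i\<in>{..<d}. lborel))"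
    (is "(\<integral>\<^sup>+x. h x \<partial>?P) = _")
proof -
  have f: "(\<lambda>x. \<lambda>i\<in>{..<d}. T i (x i)) \<in> measurable ?P ?P"
  proof (rule measurable_restrict)
    fix i assume "i \<in> {..<d}"
    then have "T i \<in> measurable lborel lborel" using T(1)[of i] by (simp add: measurable_lborel1 measurable_lborel2)
    then show "(\<lambda>x. T i (x i)) \<in> measurable ?P lborel"
      using \<open>i \<in> {..<d}\<close> by (rule measurable_compose[OF measurable_component_singleton, rotated])
  qed
  have "(\<integral>\<^sup>+x. h x \<partial>?P) = (\<integral>\<^sup>+x. h x \<partial>distr ?P ?P (\<lambda>x. \<lambda>i\<in>{..<d}. T i (x i)))"
    by (simp only: distr_PiM_lborel[OF T])
  also have "\<dots> = (\<integral>\<^sup>+x. h (\<lambda>i\<in>{..<d}. T i (x i)) \<partial>?P)"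
    by (rule nn_integral_distr[OF f]) (use h in simp)
  finally show ?thesis .
qed

lemma vec_of_restrict [simp]: "vec_of d (restrict x {..<d}) = vec_of d x"
  by (rule evec_eqI) simp

lemma norm_vec_of: "norm (vec_of d x) = L2_set x {..<d}"
  by (subst norm_Rd[OF vec_of_in_Rd]) (auto intro!: L2_set_cong)

lemma measurable_vec_of [measurable]: "vec_of d \<in> borel_measurable (\<Pi>\<^sub>M i\<in>{..<d}. lborel)"
  by (rule borel_measurable_evecI[where d=d]) auto

context
  fixes d :: nat
begin

private abbreviation "P \<equiv> (\<Pi>\<^sub>M i\<in>{..<d}. lborel :: real measure)"
private abbreviation "Q \<equiv> {x \<in> space P. L2_set x {..<d} \<le> 1}"

lemma emeasure_L2_ball:
  assumes "r > 0"
  shows "emeasure P {x \<in> space P. L2_set x {..<d} \<le> r} = ennreal (unit_ball_vol (real d) * r ^ d)"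
proof -
  have "{x \<in> space P. L2_set x {..<d} \<le> r} = {f. sqrt (\<Sum>i\<in>{..<d}. (f i)\<^sup>2) \<le> r} \<inter> space P"
    by (auto simp: L2_set_def)
  then show ?thesis using emeasure_cball_aux[of "{..<d}" r] assms by simp
qed

lemma sets_L2_ball [measurable]: "{x \<in> space P. L2_set x {..<d} \<le> r} \<in> sets P"
  unfolding L2_set_def by measurable

lemma emeasure_Q: "emeasure P Q = ennreal (unit_ball_vol (real d))"
  using emeasure_L2_ball[of 1] by simp

lemma prob_space_unif_ball: "prob_space (unif_ball d)"
  unfolding unif_ball_def
proof (rule prob_space.prob_space_distr)
  show "prob_space (uniform_measure P Q)"
  proof (rule prob_space_uniform_measure)
    have "unit_ball_vol (real d) > 0" by (rule unit_ball_vol_pos) simp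
    then show "emeasure P Q \<noteq> 0" by (simp only: emeasure_Q ennreal_eq_0_iff not_le)
  qed (simp add: emeasure_Q)
  show "vec_of d \<in> measurable (uniform_measure P Q) (restrict_space borel (Rd d))"
    by (intro measurable_restrict_space2) (auto simp: measurable_vec_of)
qed

lemma space_unif_ball: "space (unif_ball d) = Rd d"
  by (simp add: unif_ball_def space_restrict_space)

lemma sets_unif_ball: "sets (unif_ball d) = sets (restrict_space borel (Rd d))"
  by (simp add: unif_ball_def)

lemma measurable_id_unif_ball [measurable]: "(\<lambda>x. x) \<in> borel_measurable (unif_ball d)"
  using measurable_restrict_space1[OF measurable_ident, of borel "Rd d"]
  by (simp add: measurable_cong_sets[OF sets_unif_ball refl] id_def)

lemma nn_integral_unif_ball:
  assumes [measurable]: "\<phi> \<in> borel_measurable borel"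
  shows "(\<integral>\<^sup>+x. \<phi> x \<partial>unif_ball d) = (\<integral>\<^sup>+x. \<phi> (vec_of d x) * indicator Q x \<partial>P) / ennreal (unit_ball_vol (real d))"
proof -
  have v: "vec_of d \<in> measurable (uniform_measure P Q) (restrict_space borel (Rd d))"
    by (intro measurable_restrict_space2) (auto simp: measurable_vec_of)
  have "(\<integral>\<^sup>+x. \<phi> x \<partial>unif_ball d) = (\<integral>\<^sup>+x. \<phi> (vec_of d x) \<partial>uniform_measure P Q)"
    unfolding unif_ball_def by (rule nn_integral_distr[OF v]) (auto intro: measurable_restrict_space1)
  also have "\<dots> = (\<integral>\<^sup>+x. \<phi> (vec_of d x) * indicator Q x \<partial>P) / emeasure P Q"
    by (rule nn_integral_uniform_measure) measurable
  finally show ?thesis by (simp add: emeasure_Q)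
qed

lemma AE_unif_ball: "AE x in unif_ball d. norm x \<le> 1"
proof -
  have "(\<integral>\<^sup>+x. indicator {x. 1 < norm x} x \<partial>unif_ball d)
      = (\<integral>\<^sup>+x. indicator {x. 1 < norm x} (vec_of d x) * indicator Q x \<partial>P) / ennreal (unit_ball_vol (real d))"
    by (rule nn_integral_unif_ball) measurable
  also have "(\<integral>\<^sup>+x. indicator {x. 1 < norm x} (vec_of d x) * indicator Q x \<partial>P) = (\<integral>\<^sup>+x. 0 \<partial>P)"
    by (rule nn_integral_cong) (auto simp: indicator_def norm_vec_of)
  finally have "(\<integral>\<^sup>+x. indicator {x. 1 < norm x} x \<partial>unif_ball d) = 0" by simp
  then have "AE x in unif_ball d. indicator {x. 1 < norm x} x = (0::ennreal)"
    by (subst (asm) nn_integral_0_iff_AE) auto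
  then show ?thesis by eventually_elim (auto simp: indicator_def split: if_splits)
qed

lemma nn_integral_unif_ball_uminus:
  assumes [measurable]: "\<phi> \<in> borel_measurable borel"
  shows "(\<integral>\<^sup>+x. \<phi> (- x) \<partial>unif_ball d) = (\<integral>\<^sup>+x. \<phi> x \<partial>unif_ball d)"
proof -
  have "(\<integral>\<^sup>+x. \<phi> (vec_of d x) * indicator Q x \<partial>P)
      = (\<integral>\<^sup>+x. \<phi> (vec_of d (\<lambda>i\<in>{..<d}. - x i)) * indicator Q (\<lambda>i\<in>{..<d}. - x i) \<partial>P)"
    by (rule nn_integral_PiM_lborel_transform) (auto simp: lborel_distr_uminus)
  also have "\<dots> = (\<integral>\<^sup>+x. \<phi> (- vec_of d x) * indicator Q x \<partial>P)"
  proof (rule nn_integral_cong)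
    fix x assume x: "x \<in> space P"
    have "vec_of d (\<lambda>i\<in>{..<d}. - x i) = - vec_of d x" by (rule evec_eqI) simp
    moreover have "L2_set (\<lambda>i\<in>{..<d}. - x i) {..<d} = L2_set x {..<d}"
      unfolding L2_set_def by (auto intro!: arg_cong[of _ _ sqrt] sum.cong)
    ultimately show "\<phi> (vec_of d (\<lambda>i\<in>{..<d}. - x i)) * indicator Q (\<lambda>i\<in>{..<d}. - x i) = \<phi> (- vec_of d x) * indicator Q x"
      using x by (auto simp: indicator_def space_PiM)
  qed
  finally show ?thesis by (simp add: nn_integral_unif_ball)
qed

text \<open>Translated by length \<open>c\<close>, the unit ball still contains the original ball
  shrunk to radius \<open>1 - c\<close>; by Bernoulli's inequality the rest is a fraction at most
  \<open>c * real d\<close> of the volume. So \<open>c\<close> of order \<open>1 / d\<close>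
  suffices, and \<open>d\<close> later enters only through a logarithm.\<close>

lemma nn_integral_unif_ball_shift:
  assumes [measurable]: "\<phi> \<in> borel_measurable borel" and \<phi>1: "\<And>x. \<phi> x \<le> 1"
    and e: "e \<in> Rd d" "norm e = 1" and c: "0 \<le> c" "c < 1"
  shows "(\<integral>\<^sup>+x. \<phi> x \<partial>unif_ball d) \<le> (\<integral>\<^sup>+x. \<phi> (x + c *\<^sub>R e) \<partial>unif_ball d) + ennreal (c * real d)"
proof -
  define V where "V = unit_ball_vol (real d)"
  have V: "V > 0" by (simp add: V_def)
  let ?R = "{x \<in> space P. L2_set x {..<d} \<le> 1 - c}"
  define sh where "sh x = (\<lambda>i\<in>{..<d}. - (c * coord e i) + x i)" for x
  have tri: "L2_set (sh x) {..<d} \<le> 1" if "L2_set x {..<d} \<le> 1 - c" for x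
  proof -
    have "vec_of d (sh x) = vec_of d x - c *\<^sub>R e"
      by (rule evec_eqI) (use e in \<open>auto simp: sh_def Rd_def\<close>)
    then have "norm (vec_of d (sh x)) \<le> norm (vec_of d x) + norm (c *\<^sub>R e)" by (simp only: norm_triangle_ineq4)
    then show ?thesis using that e c by (simp add: norm_vec_of)
  qed
  have sh_m[measurable]: "sh \<in> measurable P P"
    unfolding sh_def by (rule measurable_restrict) (auto intro!: measurable_compose[OF measurable_component_singleton])
  have "(\<integral>\<^sup>+x. \<phi> (vec_of d x + c *\<^sub>R e) * indicator Q x \<partial>P)
      = (\<integral>\<^sup>+x. \<phi> (vec_of d (sh x) + c *\<^sub>R e) * indicator Q (sh x) \<partial>P)"
    unfolding sh_def
  proof (rule nn_integral_PiM_lborel_transform)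
    show "distr lborel borel (\<lambda>a. - (c * coord e i) + a) = lborel" for i
      by (rule lborel_distr_plus)
  qed auto
  also have "\<dots> = (\<integral>\<^sup>+x. \<phi> (vec_of d x) * indicator Q (sh x) \<partial>P)"
  proof (rule nn_integral_cong)
    fix x
    have "vec_of d (sh x) + c *\<^sub>R e = vec_of d x"
      by (rule evec_eqI) (use e in \<open>auto simp: sh_def Rd_def\<close>)
    then show "\<phi> (vec_of d (sh x) + c *\<^sub>R e) * indicator Q (sh x) = \<phi> (vec_of d x) * indicator Q (sh x)" by simp
  qed
  finally have tr: "(\<integral>\<^sup>+x. \<phi> (vec_of d x + c *\<^sub>R e) * indicator Q x \<partial>P) = (\<integral>\<^sup>+x. \<phi> (vec_of d x) * indicator Q (sh x) \<partial>P)" .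
  have "(\<integral>\<^sup>+x. \<phi> (vec_of d x) * indicator Q x \<partial>P)
      \<le> (\<integral>\<^sup>+x. \<phi> (vec_of d x) * indicator Q (sh x) + indicator (Q - ?R) x \<partial>P)"
  proof (rule nn_integral_mono)
    fix x assume x: "x \<in> space P"
    show "\<phi> (vec_of d x) * indicator Q x \<le> \<phi> (vec_of d x) * indicator Q (sh x) + indicator (Q - ?R) x"
    proof (cases "x \<in> ?R")
      case True
      have "sh x \<in> space P" using measurable_space[OF sh_m x] .
      then show ?thesis using tri[of x] True by (auto simp: indicator_def)
    next
      case False
      then show ?thesis using \<phi>1[of "vec_of d x"] x by (auto simp: indicator_def intro: add_increasing)
    qed
  qed
  also have "\<dots> = (\<integral>\<^sup>+x. \<phi> (vec_of d x) * indicator Q (sh x) \<partial>P) + emeasure P (Q - ?R)"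
    by (subst nn_integral_add) (auto intro!: measurable_compose[OF sh_m])
  also have "emeasure P (Q - ?R) \<le> ennreal (V * (c * real d))"
  proof -
    have "emeasure P (Q - ?R) = emeasure P Q - emeasure P ?R"
      using c by (intro emeasure_Diff) (auto simp: emeasure_L2_ball)
    also have "\<dots> = ennreal (V - V * (1 - c) ^ d)"
      using emeasure_L2_ball[of "1 - c"] c V by (simp add: emeasure_Q V_def[symmetric] ennreal_minus)
    also have "\<dots> \<le> ennreal (V * (c * real d))"
    proof (rule ennreal_leI)
      have "1 + real d * (- c) \<le> (1 + (- c)) ^ d" by (rule Bernoulli_inequality) (use c in simp)
      then have "V * (1 - real d * c) \<le> V * (1 - c) ^ d" using V by (intro mult_left_mono) auto
      then show "V - V * (1 - c) ^ d \<le> V * (c * real d)" by (simp add: algebra_simps)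
    qed
    finally show ?thesis .
  qed
  finally have "(\<integral>\<^sup>+x. \<phi> (vec_of d x) * indicator Q x \<partial>P)
    \<le> (\<integral>\<^sup>+x. \<phi> (vec_of d x + c *\<^sub>R e) * indicator Q x \<partial>P) + ennreal (V * (c * real d))"
    by (simp add: tr add_left_mono)
  then have "(\<integral>\<^sup>+x. \<phi> (vec_of d x) * indicator Q x \<partial>P) / ennreal V
    \<le> ((\<integral>\<^sup>+x. \<phi> (vec_of d x + c *\<^sub>R e) * indicator Q x \<partial>P) + ennreal (V * (c * real d))) / ennreal V"
    by (rule divide_right_mono_ennreal)
  also have "\<dots> = (\<integral>\<^sup>+x. \<phi> (vec_of d x + c *\<^sub>R e) * indicator Q x \<partial>P) / ennreal V + ennreal (c * real d)"
    using V c by (simp add: add_divide_distrib_ennreal divide_ennreal)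
  finally show ?thesis
    using nn_integral_unif_ball[of \<phi>] nn_integral_unif_ball[of "\<lambda>x. \<phi> (x + c *\<^sub>R e)"]
    by (simp add: V_def)
qed

end

text \<open>Agrees with the identity almost surely under \<open>unif_ball\<close>, and is odd, so
  that the symmetry of the ball gives mean zero.\<close>

definition clip :: "evec \<Rightarrow> evec" where
  "clip x = (if norm x \<le> 1 then x else 0)"

lemma norm_clip_le: "norm (clip x) \<le> 1" and clip_Rd: "x \<in> Rd d \<Longrightarrow> clip x \<in> Rd d"
  by (auto simp: clip_def)

lemma borel_measurable_clip [measurable]: "clip \<in> borel_measurable borel"
  unfolding clip_def by measurable

lemma integral_clip_unif_ball: "(\<integral>x. inner v (clip x) \<partial>unif_ball d) = 0"
proof -
  interpret prob_space "unif_ball d" by (rule prob_space_unif_ball)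
  have [measurable]: "(\<lambda>x. inner v (clip x)) \<in> borel_measurable (unif_ball d)"
    by (rule measurable_compose[OF measurable_id_unif_ball]) measurable
  have int: "integrable (unif_ball d) (\<lambda>x. inner v (clip x))"
  proof (rule integrable_const_bound[where B="norm v"])
    have "norm (inner v (clip x)) \<le> norm v" for x
      using Cauchy_Schwarz_ineq2[of v "clip x"] mult_left_mono[OF norm_clip_le[of x], of "norm v"] by simp
    then show "AE x in unif_ball d. norm (inner v (clip x)) \<le> norm v" by simp
  qed simp
  have clipm: "clip (- x) = - clip x" for x by (simp add: clip_def)
  have "(\<integral>\<^sup>+x. ennreal (inner v (clip x)) \<partial>unif_ball d) = (\<integral>\<^sup>+x. ennreal (inner v (clip (- x))) \<partial>unif_ball d)"
    by (rule nn_integral_unif_ball_uminus[symmetric]) measurable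
  then have "(\<integral>\<^sup>+x. ennreal (inner v (clip x)) \<partial>unif_ball d) = (\<integral>\<^sup>+x. ennreal (- inner v (clip x)) \<partial>unif_ball d)"
    by (simp add: clipm)
  then show ?thesis using real_lebesgue_integral_def[OF int] by simp
qed

section \<open>Joint measurability of the stochastic gradient\<close>

text \<open>The point is replaced by the first member of a dense sequence within
  \<open>1 / (n + 1)\<close> of it. The index \<open>j n\<close> takes countably many values, so the
  approximations are jointly measurable, and continuity gives the limit.\<close>

lemma borel_measurable_caratheodory:
  fixes f :: "'a::{second_countable_topology, metric_space} \<Rightarrow> 'z \<Rightarrow> real"
  assumes [measurable]: "\<And>x. f x \<in> borel_measurable P"
    and cont: "\<And>z. z \<in> space P \<Longrightarrow> continuous_on UNIV (\<lambda>x. f x z)"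
  shows "(\<lambda>p. f (fst p) (snd p)) \<in> borel_measurable (borel \<Otimes>\<^sub>M P)"
proof -
  obtain D :: "'a set" where D: "countable D" "\<And>X. open X \<Longrightarrow> X \<noteq> {} \<Longrightarrow> \<exists>d\<in>D. d \<in> X"
    by (rule countable_dense_setE) blast
  define t where "t = from_nat_into D"
  have dense: "\<exists>k. dist x (t k) < r" if "r > 0" for x r
  proof -
    obtain q where "q \<in> D" "q \<in> ball x r" using D(2)[of "ball x r"] \<open>r > 0\<close> by fastforce
    then show ?thesis using from_nat_into_surj[OF D(1)] by (auto simp: t_def)
  qed
  define j where "j n x = (LEAST k. dist x (t k) < 1 / real (Suc n))" for n x
  have jm[measurable]: "j n \<in> measurable borel (count_space UNIV)" for n
    unfolding j_def by measurable
  have jd: "dist x (t (j n x)) < 1 / real (Suc n)" for n x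
    unfolding j_def by (rule LeastI_ex) (intro dense, simp)
  show ?thesis
  proof (rule borel_measurable_LIMSEQ_real)
    fix n show "(\<lambda>p. f (t (j n (fst p))) (snd p)) \<in> borel_measurable (borel \<Otimes>\<^sub>M P)"
      by (rule measurable_compose_countable[where f="\<lambda>k p. f (t k) (snd p)" and g="\<lambda>p. j n (fst p)"]) measurable
  next
    fix p :: "'a \<times> 'z" assume "p \<in> space (borel \<Otimes>\<^sub>M P)"
    then have z: "snd p \<in> space P" by (auto simp: space_pair_measure)
    have "(\<lambda>n. t (j n (fst p))) \<longlonglongrightarrow> fst p"
    proof (rule metric_LIMSEQ_I)
      fix r :: real assume "r > 0"
      then obtain N where N: "1 / real (Suc N) < r" using nat_approx_posE by (metis of_nat_Suc)
      show "\<exists>no. \<forall>n\<ge>no. dist (t (j n (fst p))) (fst p) < r"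
      proof (intro exI[of _ N] allI impI)
        fix n assume "N \<le> n"
        then have "1 / real (Suc n) \<le> 1 / real (Suc N)" by (intro divide_left_mono) auto
        then show "dist (t (j n (fst p))) (fst p) < r" using jd[of "fst p" n] N by (simp add: dist_commute)
      qed
    qed
    then show "(\<lambda>n. f (t (j n (fst p))) (snd p)) \<longlonglongrightarrow> f (fst p) (snd p)"
      using cont[OF z] by (auto simp: continuous_on_eq_continuous_at intro: continuous_within_tendsto_compose' isCont_tendsto_compose)
  qed
qed

section \<open>Restarted SGD as a sequence of blocks\<close>

lemma rsgd_step_append:
  "rsgd_step g \<eta> K0 B s z (ps, cs @ cs', b) =
    (let (ps', ds, b') = rsgd_step g \<eta> K0 B s z (ps, cs', b) in (ps', cs @ ds, b'))"
  by (cases z) (simp add: rsgd_step_def Let_def)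

text \<open>A step uses the candidate list only to append to it, so a run that continues from a
  singleton block is a fresh run on the shifted samples.\<close>

lemma rsgd_restart:
  assumes "rsgd g \<eta> K0 B s u w i = ([v], cs, False)"
  shows "rsgd g \<eta> K0 B s u w (i + m) =
    (let (ps, ds, b) = rsgd g \<eta> K0 B s v (\<lambda>k. w (i + k)) m in (ps, cs @ ds, b))"
proof (induction m)
  case 0
  show ?case using assms by simp
next
  case (Suc m)
  obtain ps ds b where "rsgd g \<eta> K0 B s v (\<lambda>k. w (i + k)) m = (ps, ds, b)" by (metis prod_cases3)
  then show ?case using Suc by (simp add: rsgd_step_append)
qed

lemma candidates_Suc: "set (candidates g \<eta> K0 B s u w n) \<subseteq> set (candidates g \<eta> K0 B s u w (Suc n))"
proof -
  obtain ps cs b where 1: "rsgd g \<eta> K0 B s u w n = (ps, cs, b)" by (metis prod_cases3)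
  obtain \<zeta> \<Lambda> where 2: "w n = (\<zeta>, \<Lambda>)" by fastforce
  show ?thesis by (auto simp: candidates_def 1 2 rsgd_step_def Let_def)
qed

lemma candidates_mono:
  assumes "n \<le> m" shows "set (candidates g \<eta> K0 B s u w n) \<subseteq> set (candidates g \<eta> K0 B s u w m)"
  using assms by (induction rule: dec_induct) (use candidates_Suc in blast)+

lemma rsgd_block:
  assumes K0: "k < K0" and stay: "\<And>j. j \<le> k \<Longrightarrow> norm (x j - x 0) \<le> B"
    and step: "\<And>j. j < k \<Longrightarrow> x (Suc j) = x j - \<eta> *\<^sub>R (g (x j) (fst (w j)) + s *\<^sub>R snd (w j))"
  shows "rsgd g \<eta> K0 B s (x 0) w k = (map x [0..<Suc k], [], False)"
  using assms
proof (induction k)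
  case (Suc k)
  have IH: "rsgd g \<eta> K0 B s (x 0) w k = (map x [0..<Suc k], [], False)"
    by (rule Suc.IH) (use Suc.prems in auto)
  obtain \<zeta> \<Lambda> where 2: "w k = (\<zeta>, \<Lambda>)" by fastforce
  have hd: "hd (map x [0..<Suc k]) = x 0" by (simp add: hd_map upt_conv_Cons del: upt_Suc)
  have last: "last (map x [0..<Suc k]) = x k" by simp
  have p: "x k - \<eta> *\<^sub>R (g (x k) \<zeta> + s *\<^sub>R \<Lambda>) = x (Suc k)" using Suc.prems(3)[of k] 2 by simp
  have "norm (x (Suc k) - x 0) \<le> B" using Suc.prems(2) by simp
  then show ?case
    using Suc.prems(1)
    by (simp only: rsgd.simps IH rsgd_step_def 2 prod.case hd last p Let_def length_map length_upt) simp
qed simp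

lemma rsgd_block_exit:
  assumes K0: "k < K0" and stay: "\<And>j. j \<le> k \<Longrightarrow> norm (x j - x 0) \<le> B"
    and step: "\<And>j. j \<le> k \<Longrightarrow> x (Suc j) = x j - \<eta> *\<^sub>R (g (x j) (fst (w j)) + s *\<^sub>R snd (w j))"
    and exit: "B < norm (x (Suc k) - x 0)"
  shows "\<exists>c. rsgd g \<eta> K0 B s (x 0) w (Suc k) = ([x (Suc k)], [c], False)"
proof -
  have IH: "rsgd g \<eta> K0 B s (x 0) w k = (map x [0..<Suc k], [], False)"
    by (rule rsgd_block) (use assms in auto)
  obtain \<zeta> \<Lambda> where 2: "w k = (\<zeta>, \<Lambda>)" by fastforce
  have hd: "hd (map x [0..<Suc k]) = x 0" by (simp add: hd_map upt_conv_Cons del: upt_Suc)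
  have last: "last (map x [0..<Suc k]) = x k" by simp
  have p: "x k - \<eta> *\<^sub>R (g (x k) \<zeta> + s *\<^sub>R \<Lambda>) = x (Suc k)" using step[of k] 2 by simp
  show ?thesis
    using exit by (simp only: rsgd.simps IH rsgd_step_def 2 prod.case hd last p Let_def) simp
qed

text \<open>After \<open>K0 - 1\<close> calls the block already holds \<open>K0\<close> points,
  \<open>x 0\<close> included, so the length test fires in call \<open>K0\<close> and the average
  leaves out the last iterate.\<close>

lemma rsgd_block_stop:
  assumes K0: "K0 = Suc k" and stay: "\<And>j. j \<le> K0 \<Longrightarrow> norm (x j - x 0) \<le> B"
    and step: "\<And>j. j \<le> k \<Longrightarrow> x (Suc j) = x j - \<eta> *\<^sub>R (g (x j) (fst (w j)) + s *\<^sub>R snd (w j))"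
  shows "candidates g \<eta> K0 B s (x 0) w K0 = [(1 / real K0) *\<^sub>R (\<Sum>j<K0. x j)]"
proof -
  have IH: "rsgd g \<eta> K0 B s (x 0) w k = (map x [0..<Suc k], [], False)"
    by (rule rsgd_block) (use assms in auto)
  obtain \<zeta> \<Lambda> where 2: "w k = (\<zeta>, \<Lambda>)" by fastforce
  have hd: "hd (map x [0..<Suc k]) = x 0" by (simp add: hd_map upt_conv_Cons del: upt_Suc)
  have last: "last (map x [0..<Suc k]) = x k" by simp
  have p: "x k - \<eta> *\<^sub>R (g (x k) \<zeta> + s *\<^sub>R \<Lambda>) = x (Suc k)" using step[of k] 2 by simp
  have "norm (x (Suc k) - x 0) \<le> B" using stay K0 by simp
  moreover have "length (map x [0..<Suc k]) = K0" by (simp add: K0)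
  moreover have "sum_list (map x [0..<Suc k]) = (\<Sum>j<K0. x j)"
    by (simp only: K0 sum_list_distinct_conv_sum_set[OF distinct_upt] atLeast_upt)
  ultimately show ?thesis
    by (simp only: candidates_def K0 rsgd.simps(2)) (simp only: K0[symmetric] IH rsgd_step_def 2 prod.case hd last p Let_def, simp)
qed

lemma locally_regularD:
  assumes "locally_regular d Z F g H gf A u r"
  shows "u \<in> Rd d" "symmetric_on d (H u)" "h \<in> Rd d \<Longrightarrow> norm (H u h) \<le> A * norm h"
    and "x \<in> Rd d \<Longrightarrow> norm (x - u) \<le> r \<Longrightarrow> norm (g x) \<le> A"
    and "x \<in> Rd d \<Longrightarrow> norm (x - u) \<le> r \<Longrightarrow> \<zeta> \<in> Z \<Longrightarrow> norm (gf x \<zeta> - g x) \<le> A"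
    and "x \<in> Rd d \<Longrightarrow> norm (x - u) \<le> r \<Longrightarrow> h \<in> Rd d \<Longrightarrow> norm (H x h - H u h) \<le> A * norm (x - u) * norm h"
    and "x \<in> Rd d \<Longrightarrow> norm (x - u) \<le> r \<Longrightarrow>
      F x \<le> F u + inner (g u) (x - u) + inner (x - u) (H u (x - u)) / 2 + A * norm (x - u) ^ 3"
    and "x \<in> Rd d \<Longrightarrow> norm (x - u) \<le> r \<Longrightarrow> y \<in> Rd d \<Longrightarrow> norm (y - u) \<le> r \<Longrightarrow> \<zeta> \<in> Z \<Longrightarrow>
      norm (gf x \<zeta> - gf y \<zeta>) \<le> A * norm (x - y)"
    and "s \<le> r \<Longrightarrow> x \<in> Rd d \<Longrightarrow> norm (x - u) \<le> s \<Longrightarrow> y \<in> Rd d \<Longrightarrow> norm (y - u) \<le> s \<Longrightarrow>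
      norm (g y - g x - H u (y - x)) \<le> A * s * norm (y - x)"
proof -
  have cb: "x \<in> Rd d \<inter> cball u r \<longleftrightarrow> x \<in> Rd d \<and> norm (x - u) \<le> r" for x r
    by (auto simp: dist_norm norm_minus_commute)
  from assms have 1: "u \<in> Rd d" "symmetric_on d (H u)" "\<forall>h\<in>Rd d. norm (H u h) \<le> A * norm h"
    and 2: "\<forall>x\<in>Rd d \<inter> cball u r. norm (g x) \<le> A \<and> (\<forall>\<zeta>\<in>Z. norm (gf x \<zeta> - g x) \<le> A) \<and>
        (\<forall>h\<in>Rd d. norm (H x h - H u h) \<le> A * norm (x - u) * norm h) \<and>
        F x \<le> F u + inner (g u) (x - u) + inner (x - u) (H u (x - u)) / 2 + A * norm (x - u) ^ 3 \<and>
        (\<forall>y\<in>Rd d \<inter> cball u r. \<forall>\<zeta>\<in>Z. norm (gf x \<zeta> - gf y \<zeta>) \<le> A * norm (x - y))"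
    and 3: "\<forall>s\<le>r. \<forall>x\<in>Rd d \<inter> cball u s. \<forall>y\<in>Rd d \<inter> cball u s.
        norm (g y - g x - H u (y - x)) \<le> A * s * norm (y - x)"
    unfolding locally_regular_def by simp_all
  show "u \<in> Rd d" "symmetric_on d (H u)" "h \<in> Rd d \<Longrightarrow> norm (H u h) \<le> A * norm h"
    using 1 by auto
  have D2: "norm (g x) \<le> A \<and> (\<forall>\<zeta>\<in>Z. norm (gf x \<zeta> - g x) \<le> A) \<and>
        (\<forall>h\<in>Rd d. norm (H x h - H u h) \<le> A * norm (x - u) * norm h) \<and>
        F x \<le> F u + inner (g u) (x - u) + inner (x - u) (H u (x - u)) / 2 + A * norm (x - u) ^ 3 \<and>
        (\<forall>y\<in>Rd d \<inter> cball u r. \<forall>\<zeta>\<in>Z. norm (gf x \<zeta> - gf y \<zeta>) \<le> A * norm (x - y))"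
    if "x \<in> Rd d" "norm (x - u) \<le> r"
    by (rule bspec[OF 2]) (use that in \<open>simp add: cb del: Int_iff mem_cball\<close>)
  show "x \<in> Rd d \<Longrightarrow> norm (x - u) \<le> r \<Longrightarrow> norm (g x) \<le> A"
    "x \<in> Rd d \<Longrightarrow> norm (x - u) \<le> r \<Longrightarrow> \<zeta> \<in> Z \<Longrightarrow> norm (gf x \<zeta> - g x) \<le> A"
    "x \<in> Rd d \<Longrightarrow> norm (x - u) \<le> r \<Longrightarrow> h \<in> Rd d \<Longrightarrow> norm (H x h - H u h) \<le> A * norm (x - u) * norm h"
    "x \<in> Rd d \<Longrightarrow> norm (x - u) \<le> r \<Longrightarrow>
      F x \<le> F u + inner (g u) (x - u) + inner (x - u) (H u (x - u)) / 2 + A * norm (x - u) ^ 3"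
    using D2 by simp_all
  show "norm (gf x \<zeta> - gf y \<zeta>) \<le> A * norm (x - y)"
    if "x \<in> Rd d" "norm (x - u) \<le> r" "y \<in> Rd d" "norm (y - u) \<le> r" "\<zeta> \<in> Z"
  proof -
    have "\<forall>y\<in>Rd d \<inter> cball u r. \<forall>\<zeta>\<in>Z. norm (gf x \<zeta> - gf y \<zeta>) \<le> A * norm (x - y)"
      using D2[OF that(1,2)] by simp
    moreover have "y \<in> Rd d \<inter> cball u r" using that by (simp add: cb del: Int_iff mem_cball)
    ultimately show ?thesis using that(5) by blast
  qed
  show "norm (g y - g x - H u (y - x)) \<le> A * s * norm (y - x)"
    if "s \<le> r" "x \<in> Rd d" "norm (x - u) \<le> s" "y \<in> Rd d" "norm (y - u) \<le> s"
  proof -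
    have "x \<in> Rd d \<inter> cball u s" "y \<in> Rd d \<inter> cball u s" using that by (simp_all add: cb del: Int_iff mem_cball)
    then show ?thesis using 3 that(1) by blast
  qed
qed

locale rsgd_setting = objective d F \<rho>1 \<rho>2 for d F \<rho>1 \<rho>2 +
  fixes P :: "'z measure" and f :: "evec \<Rightarrow> 'z \<Rightarrow> real" and \<sigma> :: "real \<Rightarrow> real" and \<rho>3 :: "real \<Rightarrow> real \<Rightarrow> real"
  assumes prob_P: "prob_space P" and nr: "noise_regularity d P F f \<sigma>" and oc: "oracle_control d P F f \<rho>3"
begin

definition M :: "('z \<times> evec) measure" where "M = P \<Otimes>\<^sub>M unif_ball d"
definition gf :: "evec \<Rightarrow> 'z \<Rightarrow> evec" where "gf x \<zeta> = grad d (\<lambda>y. f y \<zeta>) x"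

text \<open>Projecting and clipping makes measurability and the bounds hold everywhere; since the perturbation lies
  in the unit ball of \<open>Rd d\<close> almost surely, the process changes only on a null set.\<close>

definition G :: "evec \<Rightarrow> 'z \<times> evec \<Rightarrow> evec" where "G x z = gf (proj d x) (fst z) + clip (snd z)"
definition gp :: "evec \<Rightarrow> evec" where "gp x = g (proj d x)"

lemma space_M: "z \<in> space M \<longleftrightarrow> fst z \<in> space P \<and> snd z \<in> Rd d"
  by (cases z) (auto simp: M_def space_pair_measure space_unif_ball)

sublocale Ms: prob_space M
proof -
  interpret PP: prob_space P by (rule prob_P)
  interpret U: prob_space "unif_ball d" by (rule prob_space_unif_ball)
  interpret PU: pair_prob_space P "unif_ball d" ..
  show "prob_space M" unfolding M_def by (rule PU.prob_space_axioms)
qed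

sublocale seq: sequence_space M ..

lemma rsgd_prob_eq: "rsgd_prob d P = seq.S"
  by (simp add: rsgd_prob_def M_def)

lemma fst_M [measurable]: "fst \<in> measurable M P"
  by (simp add: M_def)

lemma snd_M [measurable]: "snd \<in> borel_measurable M"
  unfolding M_def by (rule measurable_compose[OF measurable_snd measurable_id_unif_ball])

lemma f_twice: "\<zeta> \<in> space P \<Longrightarrow> twice_differentiable d (\<lambda>x. f x \<zeta>)"
  using oc by (simp add: oracle_control_def)

lemma gf_Rd: "\<zeta> \<in> space P \<Longrightarrow> x \<in> Rd d \<Longrightarrow> gf x \<zeta> \<in> Rd d"
  unfolding gf_def by (rule twice_differentiable_works(1)[OF f_twice])

lemma grad_continuous:
  assumes "twice_differentiable d \<phi>" shows "continuous_on UNIV (\<lambda>x. grad d \<phi> (proj d x))"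
proof -
  have "continuous_on (Rd d) (grad d \<phi>)"
    using assms differentiable_imp_continuous_on by (auto simp: twice_differentiable_def)
  then show ?thesis
    by (rule continuous_on_compose2[OF _ continuous_on_proj[OF continuous_on_id]]) auto
qed

lemma gp_measurable [measurable]: "gp \<in> borel_measurable borel"
  unfolding gp_def using grad_continuous[OF tdiff] by (rule borel_measurable_continuous_onI)

lemma gf_measurable: "(\<lambda>p. gf (proj d (fst p)) (snd p)) \<in> borel_measurable (borel \<Otimes>\<^sub>M P)"
proof (rule borel_measurable_evecI[where d=d])
  show "gf (proj d (fst p)) (snd p) \<in> Rd d" if "p \<in> space (borel \<Otimes>\<^sub>M P)" for p :: "evec \<times> 'z"
    using that by (auto simp: space_pair_measure intro!: gf_Rd)
  fix i assume i: "i < d"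
  show "(\<lambda>p. coord (gf (proj d (fst p)) (snd p)) i) \<in> borel_measurable (borel \<Otimes>\<^sub>M P)"
  proof (rule borel_measurable_caratheodory[where f="\<lambda>x \<zeta>. coord (gf (proj d x) \<zeta>) i"])
    show "(\<lambda>\<zeta>. coord (gf (proj d x) \<zeta>) i) \<in> borel_measurable P" for x
      using nr i by (auto simp: noise_regularity_def gf_def intro: borel_measurable_integrable)
    show "continuous_on UNIV (\<lambda>x. coord (gf (proj d x) \<zeta>) i)" if "\<zeta> \<in> space P" for \<zeta>
      unfolding gf_def by (intro continuous_on_coord grad_continuous f_twice that)
  qed
qed

lemma G_measurable: "(\<lambda>p. G (fst p) (snd p)) \<in> borel_measurable (borel \<Otimes>\<^sub>M M)"
proof -
  have "(\<lambda>p. (fst p, fst (snd p))) \<in> measurable (borel \<Otimes>\<^sub>M M) (borel \<Otimes>\<^sub>M P)"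
    by measurable
  from measurable_compose[OF this gf_measurable]
  have [measurable]: "(\<lambda>p. gf (proj d (fst p)) (fst (snd p))) \<in> borel_measurable (borel \<Otimes>\<^sub>M M)" by simp
  show ?thesis unfolding G_def by measurable
qed

lemma sgd_process: "sgd_process M d G"
proof
  show "(\<lambda>p. G (fst p) (snd p)) \<in> borel_measurable (borel \<Otimes>\<^sub>M M)" by (rule G_measurable)
  show "G x z \<in> Rd d" if "z \<in> space M" for x z
    using that unfolding G_def space_M by (intro Rd_closed_ops gf_Rd clip_Rd) auto
qed

lemma G_mean:
  assumes x: "x \<in> Rd d" and v: "v \<in> Rd d"
  shows "(\<integral>z. inner v (G x z - gp x) \<partial>M) = 0"
proof -
  interpret PP: prob_space P by (rule prob_P)
  interpret U: prob_space "unif_ball d" by (rule prob_space_unif_ball)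
  interpret PU: pair_prob_space P "unif_ball d" ..
  have int: "integrable P (\<lambda>\<zeta>. coord (gf x \<zeta>) i)" "(\<integral>\<zeta>. coord (gf x \<zeta>) i \<partial>P) = coord (g x) i" if "i < d" for i
    using nr x that by (auto simp: noise_regularity_def gf_def)
  have eq: "inner v (gf x \<zeta> - g x) = (\<Sum>i<d. coord v i * (coord (gf x \<zeta>) i - coord (g x) i))" for \<zeta>
    by (simp add: inner_Rd[OF v])
  have intv: "integrable P (\<lambda>\<zeta>. inner v (gf x \<zeta> - g x))"
    unfolding eq using int by (intro Bochner_Integration.integrable_sum integrable_mult_right Bochner_Integration.integrable_diff) auto
  have zero: "(\<integral>\<zeta>. inner v (gf x \<zeta> - g x) \<partial>P) = 0"
    unfolding eq using int by (subst Bochner_Integration.integral_sum) (auto simp: PP.prob_space)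
  have intc: "integrable (unif_ball d) (\<lambda>y. inner v (clip y))"
  proof (rule U.integrable_const_bound[where B="norm v"])
    have "norm (inner v (clip y)) \<le> norm v" for y
      using Cauchy_Schwarz_ineq2[of v "clip y"] mult_left_mono[OF norm_clip_le[of y], of "norm v"] by simp
    then show "AE y in unif_ball d. norm (inner v (clip y)) \<le> norm v" by simp
    show "(\<lambda>y. inner v (clip y)) \<in> borel_measurable (unif_ball d)"
      by (rule measurable_compose[OF measurable_id_unif_ball]) measurable
  qed
  have d1: "distr M P fst = P" unfolding M_def by (rule U.distr_pair_fst)
  have d2: "distr M (unif_ball d) snd = unif_ball d"
  proof (rule measure_eqI)
    fix E assume E: "E \<in> sets (distr M (unif_ball d) snd)"
    then have "emeasure (distr M (unif_ball d) snd) E = emeasure M (space P \<times> E)"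
      using sets.sets_into_space[of E "unif_ball d"]
      by (subst emeasure_distr) (auto simp: M_def space_pair_measure intro!: arg_cong2[of _ _ _ _ emeasure])
    also have "\<dots> = emeasure (unif_ball d) E"
      using E unfolding M_def by (subst U.emeasure_pair_measure_Times) (auto simp: PP.emeasure_space_1)
    finally show "emeasure (distr M (unif_ball d) snd) E = emeasure (unif_ball d) E" .
  qed simp
  have snd': "snd \<in> measurable M (unif_ball d)" by (simp add: M_def)
  have i1: "integrable M (\<lambda>z. inner v (gf x (fst z) - g x))"
    using intv by (subst (asm) d1[symmetric]) (rule integrable_distr[OF fst_M])
  have i2: "integrable M (\<lambda>z. inner v (clip (snd z)))"
    using intc by (subst (asm) d2[symmetric]) (rule integrable_distr[OF snd'])
  have "(\<integral>z. inner v (gf x (fst z) - g x) \<partial>M) = (\<integral>\<zeta>. inner v (gf x \<zeta> - g x) \<partial>distr M P fst)"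
    by (rule integral_distr[symmetric, OF fst_M]) (simp only: d1 borel_measurable_integrable[OF intv])
  moreover have "(\<integral>z. inner v (clip (snd z)) \<partial>M) = (\<integral>y. inner v (clip y) \<partial>distr M (unif_ball d) snd)"
    by (rule integral_distr[symmetric, OF snd']) (rule borel_measurable_integrable[OF intc])
  moreover have "(\<integral>z. inner v (G x z - gp x) \<partial>M) = (\<integral>z. inner v (gf x (fst z) - g x) + inner v (clip (snd z)) \<partial>M)"
    using x by (simp add: G_def gp_def inner_add_right inner_diff_right algebra_simps)
  ultimately show ?thesis
    using i1 i2 by (simp add: d1 d2 zero integral_clip_unif_ball)
qed

text \<open>Given the minibatch, one step is affine in the perturbation with factor
  \<open>- \<eta>\<close>, so translating it by \<open>\<eta> / (4 * d)\<close> amounts to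
  translating the ball by \<open>1 / (4 * d)\<close>, at a cost of \<open>1 / 4\<close>. Clipping is
  removed and restored on a null set.\<close>

lemma G_shift:
  assumes d: "d > 0" and \<eta>: "\<eta> > 0" and e: "e \<in> Rd d" "norm e = 1"
    and \<phi>[measurable]: "\<phi> \<in> borel_measurable borel" and \<phi>1: "\<And>y. \<phi> y \<le> (1::ennreal)"
  shows "(\<integral>\<^sup>+z. \<phi> (x - \<eta> *\<^sub>R G x z) \<partial>M)
    \<le> (\<integral>\<^sup>+z. \<phi> (x - \<eta> *\<^sub>R G x z - (\<eta> / (4 * real d)) *\<^sub>R e) \<partial>M) + ennreal (1 / 4)"
proof -
  interpret PP: prob_space P by (rule prob_P)
  interpret U: prob_space "unif_ball d" by (rule prob_space_unif_ball)
  define c where "c = 1 / (4 * real d)"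
  have c: "0 \<le> c" "c < 1" "c * real d = 1 / 4" using d by (auto simp: c_def divide_less_eq)
  have [measurable]: "(\<lambda>z. G x z) \<in> borel_measurable M"
    using measurable_compose[OF _ G_measurable, of "\<lambda>z. (x, z)" M] by simp
  have fub: "(\<integral>\<^sup>+z. h z \<partial>M) = (\<integral>\<^sup>+\<zeta>. \<integral>\<^sup>+y. h (\<zeta>, y) \<partial>unif_ball d \<partial>P)"
    if "h \<in> borel_measurable M" for h :: "'z \<times> evec \<Rightarrow> ennreal"
    using that unfolding M_def by (rule U.nn_integral_fst[symmetric])
  have ae: "(\<integral>\<^sup>+y. h (clip y) \<partial>unif_ball d) = (\<integral>\<^sup>+y. h y \<partial>unif_ball d)" for h :: "evec \<Rightarrow> ennreal"
    by (rule nn_integral_cong_AE) (use AE_unif_ball[of d] in eventually_elim, simp add: clip_def)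
  have "(\<integral>\<^sup>+z. \<phi> (x - \<eta> *\<^sub>R G x z) \<partial>M) = (\<integral>\<^sup>+\<zeta>. \<integral>\<^sup>+y. \<phi> (x - \<eta> *\<^sub>R G x (\<zeta>, y)) \<partial>unif_ball d \<partial>P)"
    by (rule fub) measurable
  also have "\<dots> \<le> (\<integral>\<^sup>+\<zeta>. (\<integral>\<^sup>+y. \<phi> (x - \<eta> *\<^sub>R G x (\<zeta>, y) - (\<eta> * c) *\<^sub>R e) \<partial>unif_ball d) + ennreal (1 / 4) \<partial>P)"
  proof (rule nn_integral_mono)
    fix \<zeta>
    let ?h = "\<lambda>y. \<phi> (x - \<eta> *\<^sub>R (gf (proj d x) \<zeta> + y))"
    have "(\<integral>\<^sup>+y. \<phi> (x - \<eta> *\<^sub>R G x (\<zeta>, y)) \<partial>unif_ball d) = (\<integral>\<^sup>+y. ?h y \<partial>unif_ball d)"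
      unfolding G_def using ae[of ?h] by simp
    also have "\<dots> \<le> (\<integral>\<^sup>+y. ?h (y + c *\<^sub>R e) \<partial>unif_ball d) + ennreal (c * real d)"
      by (rule nn_integral_unif_ball_shift) (use \<phi>1 e c in auto)
    also have "(\<integral>\<^sup>+y. ?h (y + c *\<^sub>R e) \<partial>unif_ball d) = (\<integral>\<^sup>+y. ?h (clip y + c *\<^sub>R e) \<partial>unif_ball d)"
      using ae[of "\<lambda>y. ?h (y + c *\<^sub>R e)"] by simp
    also have "(\<lambda>y. ?h (clip y + c *\<^sub>R e)) = (\<lambda>y. \<phi> (x - \<eta> *\<^sub>R G x (\<zeta>, y) - (\<eta> * c) *\<^sub>R e))"
      by (simp add: G_def algebra_simps)
    finally show "(\<integral>\<^sup>+y. \<phi> (x - \<eta> *\<^sub>R G x (\<zeta>, y)) \<partial>unif_ball d)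
      \<le> (\<integral>\<^sup>+y. \<phi> (x - \<eta> *\<^sub>R G x (\<zeta>, y) - (\<eta> * c) *\<^sub>R e) \<partial>unif_ball d) + ennreal (1 / 4)"
      by (simp add: c(3))
  qed
  also have "\<dots> = (\<integral>\<^sup>+\<zeta>. \<integral>\<^sup>+y. \<phi> (x - \<eta> *\<^sub>R G x (\<zeta>, y) - (\<eta> * c) *\<^sub>R e) \<partial>unif_ball d \<partial>P) + ennreal (1 / 4)"
  proof -
    have "(\<lambda>z. \<phi> (x - \<eta> *\<^sub>R G x z - (\<eta> * c) *\<^sub>R e)) \<in> borel_measurable (P \<Otimes>\<^sub>M unif_ball d)"
      unfolding M_def[symmetric] by measurable
    from U.borel_measurable_nn_integral_fst[OF this]
    show ?thesis by (subst nn_integral_add) (auto simp: PP.emeasure_space_1)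
  qed
  also have "(\<integral>\<^sup>+\<zeta>. \<integral>\<^sup>+y. \<phi> (x - \<eta> *\<^sub>R G x (\<zeta>, y) - (\<eta> * c) *\<^sub>R e) \<partial>unif_ball d \<partial>P)
    = (\<integral>\<^sup>+z. \<phi> (x - \<eta> *\<^sub>R G x z - (\<eta> * c) *\<^sub>R e) \<partial>M)"
    by (rule fub[symmetric]) measurable
  finally show ?thesis by (simp add: c_def)
qed

text \<open>The bound \<open>1 / (8 * A)\<close> on \<open>B\<close> leaves room for the radius
  \<open>2 * B\<close> that the Taylor bound of \<open>sgd_ball\<close> requires.\<close>

lemma sgd_saddleI:
  assumes d: "d > 0" and lr: "locally_regular d (space P) F g H gf A u (1 / (4 * A))"
    and A: "A \<ge> 1" and B: "B > 0" "B \<le> 1 / (8 * A)" and \<eta>: "\<eta> > 0" "\<eta> * A \<le> 1"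
  shows "sgd_saddle M d G \<eta> F gp (H u) A B u (\<eta> / (4 * real d))"
proof -
  interpret sgd_process M d G \<eta> by (rule sgd_process)
  have B4: "2 * B \<le> 1 / (4 * A)" using B by simp
  have B': "B \<le> 1 / (4 * A)" using B4 B by linarith
  note lr' = locally_regularD[OF lr]
  have uR: "u \<in> Rd d" by (rule lr'(1))
  have noise: "norm (gf x \<zeta> - g x) \<le> A" if "x \<in> Rd d" "norm (x - u) \<le> B" "\<zeta> \<in> space P" for x \<zeta>
    by (rule lr'(5)[OF that(1) _ that(3)]) (use that B' in linarith)
  note gdiff = lr'(9)
  show ?thesis
  proof unfold_locales
    show "gp x \<in> Rd d" for x unfolding gp_def by (rule g_Rd) simp
    show "symmetric_on d (H u)" by (rule lr'(2))
    show "norm (H u h) \<le> A * norm h" if "h \<in> Rd d" for h by (rule lr'(3)[OF that])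
    show "norm (gp x) \<le> A" if "x \<in> Rd d" "norm (x - u) \<le> B" for x
      using lr'(4)[of x] that B' by (simp add: gp_def)
    show "norm (G x z - gp x) \<le> 2 * A" if "x \<in> Rd d" "norm (x - u) \<le> B" "z \<in> space M" for x z
    proof -
      have "norm (G x z - gp x) = norm ((gf x (fst z) - g x) + clip (snd z))"
        using that by (simp add: G_def gp_def algebra_simps)
      also have "\<dots> \<le> A + 1"
        using norm_triangle_ineq[of "gf x (fst z) - g x" "clip (snd z)"] noise[OF that(1,2), of "fst z"]
          norm_clip_le[of "snd z"] that(3) by (simp add: space_M)
      finally show ?thesis using A by simp
    qed
    show "(\<integral>z. inner v (G x z - gp x) \<partial>M) = 0" if "x \<in> Rd d" "norm (x - u) \<le> B" "v \<in> Rd d" for x v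
      by (rule G_mean[OF that(1,3)])
    show "norm (gp x - gp u - H u (x - u)) \<le> A * B\<^sup>2" if "x \<in> Rd d" "norm (x - u) \<le> B" for x
    proof -
      have "norm (g x - g u - H u (x - u)) \<le> A * B * norm (x - u)"
        by (rule gdiff[OF B']) (use that uR B in auto)
      also have "\<dots> \<le> A * B * B" using that A B by (intro mult_left_mono) auto
      finally show ?thesis using that uR by (simp add: gp_def power2_eq_square mult.assoc)
    qed
    show "F x \<le> F u + inner (gp u) (x - u) + inner (x - u) (H u (x - u)) / 2 + A * norm (x - u) ^ 3"
      if "x \<in> Rd d" "norm (x - u) \<le> 2 * B" for x
      using lr'(7)[of x] that B4 uR by (simp add: gp_def)
    have "1 / (8 * A) \<le> 1 / 8" using A by (intro divide_left_mono) auto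
    then show "B \<le> 1" using B by linarith
    show "0 < \<eta> / (4 * real d)" using \<eta> d by simp
    show "norm (gp x - gp y - H u (x - y)) \<le> A * B * norm (x - y)"
      if "x \<in> Rd d" "y \<in> Rd d" "norm (x - u) \<le> B" "norm (y - u) \<le> B" for x y
      using gdiff[OF B' that(2,4,1,3)] that by (simp add: gp_def)
    show "norm (G x z - G y z) \<le> A * norm (x - y)"
      if "x \<in> Rd d" "y \<in> Rd d" "norm (x - u) \<le> B" "norm (y - u) \<le> B" "z \<in> space M" for x y z
    proof -
      have "norm (gf x (fst z) - gf y (fst z)) \<le> A * norm (x - y)"
        by (rule lr'(8)) (use that B' in \<open>simp_all add: space_M\<close>)
      then show ?thesis using that by (simp add: G_def)
    qed
    show "(\<integral>\<^sup>+z. \<phi> (x - \<eta> *\<^sub>R G x z) \<partial>M) \<le> (\<integral>\<^sup>+z. \<phi> (x - \<eta> *\<^sub>R G x z - (\<eta> / (4 * real d)) *\<^sub>R e) \<partial>M) + ennreal (1 / 4)"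
      if "e \<in> Rd d" "norm e = 1" "\<phi> \<in> borel_measurable borel" "\<And>y. \<phi> y \<le> (1::ennreal)" for x e \<phi>
      by (rule G_shift[OF d \<eta>(1) that])
  qed (use A B \<eta> uR in auto)
qed

end

context rsgd_setting
begin

text \<open>A constant depending on the point suffices for the qualitative facts, symmetry and
  continuity of the Hessian.\<close>

lemma ex_locally_regular:
  assumes "u \<in> Rd d"
  shows "\<exists>A\<ge>1. locally_regular d (space P) F g H gf A u (1 / (4 * A))"
proof -
  define S where "S = {1, 1 + 2 * (\<rho>1 (F u + 2) + 1) * (F u + 1), \<rho>1 (F u + 1) + 1, \<rho>2 (F u + 1), \<sigma> (F u + 1),
      \<rho>3 (1 + 2 * (\<rho>1 (F u + 2) + 1) * (F u + 1) + \<sigma> (F u + 1)) (F u + 1)}"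
  have fin: "finite S" by (simp add: S_def)
  have "gf = (\<lambda>x \<zeta>. grad d (\<lambda>y. f y \<zeta>) x)" by (simp add: gf_def fun_eq_iff)
  moreover have "locally_regular d (space P) F g H (\<lambda>x \<zeta>. grad d (\<lambda>y. f y \<zeta>) x) (Max S) u (1 / (4 * Max S))"
    by (rule locally_regularI[OF nr oc assms order_refl]; rule Max_ge[OF fin]; simp only: S_def insert_iff simp_thms)
  moreover have "1 \<le> Max S" by (rule Max_ge[OF fin]) (simp only: S_def insert_iff simp_thms)
  ultimately show ?thesis by metis
qed

lemma hess_continuous:
  assumes h: "h \<in> Rd d" shows "continuous_on UNIV (\<lambda>x. H (proj d x) h)"
  unfolding continuous_on_eq_continuous_at[OF open_UNIV]
proof
  fix x :: evec
  obtain A where A: "A \<ge> 1" "locally_regular d (space P) F g H gf A (proj d x) (1 / (4 * A))"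
    using ex_locally_regular[of "proj d x"] by auto
  have "((\<lambda>y. H (proj d y) h - H (proj d x) h) \<longlongrightarrow> 0) (at x)"
  proof (rule Lim_null_comparison)
    have "\<forall>\<^sub>F y in at x. dist y x < 1 / (4 * A)" using A(1) unfolding eventually_at
      by (intro exI[of _ "1 / (4 * A)"]) auto
    then show "\<forall>\<^sub>F y in at x. norm (H (proj d y) h - H (proj d x) h) \<le> A * norm (y - x) * norm h"
    proof eventually_elim
      case (elim y)
      have le: "norm (proj d y - proj d x) \<le> norm (y - x)"
        using norm_proj_le[of d "y - x"] by (simp add: linear_diff[OF linear_proj])
      have "norm (H (proj d y) h - H (proj d x) h) \<le> A * norm (proj d y - proj d x) * norm h"
        by (rule locally_regularD(6)[OF A(2) _ _ h]) (use elim le in \<open>auto simp: dist_norm\<close>)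
      also have "\<dots> \<le> A * norm (y - x) * norm h"
        using le A(1) by (intro mult_right_mono mult_left_mono) auto
      finally show ?case .
    qed
    have "((\<lambda>y. A * norm (y - x) * norm h) \<longlongrightarrow> A * norm (x - x) * norm h) (at x)"
      by (intro tendsto_intros)
    then show "((\<lambda>y. A * norm (y - x) * norm h) \<longlongrightarrow> 0) (at x)" by simp
  qed
  then show "isCont (\<lambda>x. H (proj d x) h) x" by (simp add: isCont_def LIM_zero_iff)
qed

lemma sosp_iff:
  assumes "x \<in> Rd d"
  shows "second_order_stationary d F \<epsilon> x \<longleftrightarrow>
    norm (g x) \<le> \<epsilon> \<and> (\<forall>h\<in>Rd d. - sqrt \<epsilon> * (norm h)\<^sup>2 \<le> inner h (H x h))"
proof -
  obtain A where "locally_regular d (space P) F g H gf A x (1 / (4 * A))"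
    using ex_locally_regular[OF assms] by auto
  from locally_regularD(2)[OF this]
  have "inner (H x h) u = inner h (H x u)" if "h \<in> Rd d" "u \<in> Rd d" for h u
    using that by (auto simp: symmetric_on_def)
  then show ?thesis
    unfolding second_order_stationary_def loewner_ge_def psd_def
    by (simp add: inner_add_left inner_add_right power2_norm_eq_inner) (metis minus_le_iff add_increasing2 le_add_same_cancel1 add.commute neg_le_iff_le diff_ge_0_iff_ge diff_minus_eq_add)
qed

text \<open>The quantifier over directions is uncountable, so measurability comes from topology:
  each direction defines a closed set, by \<open>hess_continuous\<close>, and the intersection is
  closed.\<close>

lemma pred_sosp: "Measurable.pred borel (\<lambda>x. second_order_stationary d F \<epsilon> (proj d x))"
proof -
  have "{x. \<forall>h\<in>Rd d. - sqrt \<epsilon> * (norm h)\<^sup>2 \<le> inner h (H (proj d x) h)}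
      = (\<Inter>h\<in>Rd d. {x. - sqrt \<epsilon> * (norm h)\<^sup>2 \<le> inner h (H (proj d x) h)})" by auto
  also have "closed \<dots>"
    by (intro closed_INT ballI closed_Collect_le continuous_on_inner continuous_on_const hess_continuous)
  finally have [measurable]: "{x. \<forall>h\<in>Rd d. - sqrt \<epsilon> * (norm h)\<^sup>2 \<le> inner h (H (proj d x) h)} \<in> sets borel"
    by (rule borel_closed)
  have "Measurable.pred borel (\<lambda>x. norm (gp x) \<le> \<epsilon> \<and> x \<in> {x. \<forall>h\<in>Rd d. - sqrt \<epsilon> * (norm h)\<^sup>2 \<le> inner h (H (proj d x) h)})"
    by measurable
  then show ?thesis by (simp add: sosp_iff gp_def)
qed

lemma F_measurable: "(\<lambda>x. F (proj d x)) \<in> borel_measurable borel"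
proof (rule borel_measurable_continuous_onI)
  have "continuous_on (Rd d) F"
    using tdiff differentiable_imp_continuous_on by (auto simp: twice_differentiable_def)
  then show "continuous_on UNIV (\<lambda>x. F (proj d x))"
    by (rule continuous_on_compose2[OF _ continuous_on_proj[OF continuous_on_id]]) auto
qed

end

locale rsgd_run = rsgd_setting d F \<rho>1 \<rho>2 P f \<sigma> \<rho>3
  for d F \<rho>1 \<rho>2 and P :: "'z measure" and f \<sigma> \<rho>3 +
  fixes \<epsilon> \<eta> B :: real and K0 :: nat
begin

sublocale proc: sgd_process M d G \<eta> by (rule sgd_process)

abbreviation "R \<equiv> rsgd gf \<eta> K0 B 1"

definition found :: "nat \<Rightarrow> evec \<Rightarrow> (nat \<Rightarrow> 'z \<times> evec) \<Rightarrow> bool" where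
  "found n u w \<longleftrightarrow> (\<exists>c\<in>set (candidates gf \<eta> K0 B 1 u w n). second_order_stationary d F \<epsilon> c)"

text \<open>On these samples clipping does nothing, so \<open>sgd\<close> with \<open>G\<close>
  follows the algorithm exactly; \<open>AE_good\<close> makes the restriction harmless.\<close>

definition good :: "(nat \<Rightarrow> 'z \<times> evec) \<Rightarrow> bool" where
  "good w \<longleftrightarrow> (\<forall>n. norm (snd (w n)) \<le> 1)"

lemma AE_good: "AE w in seq.S. good w"
proof -
  have "AE w in seq.S. norm (snd (w n)) \<le> 1" for n
  proof -
    interpret PP: prob_space P by (rule prob_P)
    interpret U: prob_space "unif_ball d" by (rule prob_space_unif_ball)
    interpret PU: pair_prob_space P "unif_ball d" ..
    have 1: "AE z in M. norm (snd z) \<le> 1"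
    proof -
      have "AE \<zeta> in P. AE y in unif_ball d. norm (snd (\<zeta>, y)) \<le> 1" using AE_unif_ball[of d] by simp
      moreover have "{z \<in> space (P \<Otimes>\<^sub>M unif_ball d). norm (snd z) \<le> 1} \<in> sets (P \<Otimes>\<^sub>M unif_ball d)"
        unfolding M_def[symmetric] by measurable
      ultimately show ?thesis unfolding M_def by (intro PU.AE_pair_measure) auto
    qed
    have eq: "distr seq.S M (\<lambda>w. w n) = M"
      by (rule distr_PiM_component) (auto simp: Ms.prob_space_axioms)
    have "AE z in distr seq.S M (\<lambda>w. w n). norm (snd z) \<le> 1" by (subst eq) (rule 1)
    then show ?thesis by (subst (asm) AE_distr_iff) auto
  qed
  then show ?thesis unfolding good_def by (simp add: AE_all_countable)
qed

lemma pred_good [measurable]: "Measurable.pred seq.S good"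
  unfolding good_def by measurable

text \<open>Instead of putting a sigma-algebra on lists, the induction carries finitely many
  features of the state, which one step updates in terms of each other and the new sample. The
  candidates are represented among them only through \<open>found\<close>.\<close>

lemma rsgd_components_measurable:
  assumes u: "u \<in> Rd d"
  shows "(\<lambda>w. length (fst (R u w n))) \<in> measurable seq.S (count_space UNIV)
    \<and> (\<lambda>w. hd (fst (R u w n))) \<in> borel_measurable seq.S
    \<and> (\<lambda>w. last (fst (R u w n))) \<in> borel_measurable seq.S
    \<and> (\<lambda>w. sum_list (fst (R u w n))) \<in> borel_measurable seq.S
    \<and> Measurable.pred seq.S (\<lambda>w. snd (snd (R u w n)))
    \<and> Measurable.pred seq.S (found n u)
    \<and> (\<forall>w\<in>space seq.S. fst (R u w n) \<noteq> [] \<and> set (fst (R u w n)) \<subseteq> Rd d)"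
proof (induction n)
  case 0
  show ?case using u by (simp add: found_def candidates_def)
next
  case (Suc n)
  define le where "le w = length (fst (R u w n))" for w
  define h where "h w = hd (fst (R u w n))" for w
  define la where "la w = last (fst (R u w n))" for w
  define su where "su w = sum_list (fst (R u w n))" for w
  define st where "st w = snd (snd (R u w n))" for w
  define fo where "fo w = found n u w" for w
  have [measurable]: "le \<in> measurable seq.S (count_space UNIV)" "h \<in> borel_measurable seq.S"
    "la \<in> borel_measurable seq.S" "su \<in> borel_measurable seq.S" "Measurable.pred seq.S st" "Measurable.pred seq.S fo"
    and ne: "\<And>w. w \<in> space seq.S \<Longrightarrow> fst (R u w n) \<noteq> []"
    and sub: "\<And>w. w \<in> space seq.S \<Longrightarrow> set (fst (R u w n)) \<subseteq> Rd d"
    using Suc unfolding le_def h_def la_def su_def st_def fo_def by auto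
  have laR: "la w \<in> Rd d" if "w \<in> space seq.S" for w
    using last_in_set[OF ne[OF that]] sub[OF that] by (auto simp: la_def)
  define p where "p w = la w - \<eta> *\<^sub>R (gf (proj d (la w)) (fst (w n)) + snd (w n))" for w
  have [measurable]: "p \<in> borel_measurable seq.S"
  proof -
    have 1: "(\<lambda>w. (la w, fst (w n))) \<in> measurable seq.S (borel \<Otimes>\<^sub>M P)" by measurable
    have [measurable]: "(\<lambda>w. gf (proj d (la w)) (fst (w n))) \<in> borel_measurable seq.S"
      using measurable_compose[OF 1 gf_measurable] by simp
    show ?thesis unfolding p_def by measurable
  qed
  define c where "c w = (1 / real (le w)) *\<^sub>R su w" for w
  have [measurable]: "c \<in> borel_measurable seq.S" unfolding c_def by measurable
  have suR: "su w \<in> Rd d" if "w \<in> space seq.S" for w unfolding su_def by (rule Rd_sum_list[OF sub[OF that]])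
  have pR: "p w \<in> Rd d" if "w \<in> space seq.S" for w
    unfolding p_def using that laR[OF that]
    by (intro Rd_closed_ops gf_Rd) (auto simp: seq.space_S_iff space_M)
  have cR: "proj d (c w) = c w" if "w \<in> space seq.S" for w
    using suR[OF that] by (simp add: c_def Rd_closed_ops)
  define ex where "ex w \<longleftrightarrow> B < norm (p w - h w)" for w
  define fi where "fi w \<longleftrightarrow> le w = K0" for w
  have [measurable]: "Measurable.pred seq.S ex" "Measurable.pred seq.S fi"
    unfolding ex_def fi_def by measurable
  have nx: "length (fst (R u w (Suc n))) = (if st w then le w else if ex w then 1 else Suc (le w))"
    "hd (fst (R u w (Suc n))) = (if st w then h w else if ex w then p w else h w)"
    "last (fst (R u w (Suc n))) = (if st w then la w else p w)"
    "sum_list (fst (R u w (Suc n))) = (if st w then su w else if ex w then p w else su w + p w)"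
    "snd (snd (R u w (Suc n))) = (st w \<or> (\<not> ex w \<and> fi w))"
    "found (Suc n) u w = (fo w \<or> (\<not> st w \<and> (ex w \<or> fi w) \<and> second_order_stationary d F \<epsilon> (proj d (c w))))"
    "fst (R u w (Suc n)) \<noteq> [] \<and> set (fst (R u w (Suc n))) \<subseteq> Rd d"
    if w: "w \<in> space seq.S" for w
  proof -
    obtain ps cs b where 1: "R u w n = (ps, cs, b)" by (metis prod_cases3)
    obtain \<zeta> \<Lambda> where 2: "w n = (\<zeta>, \<Lambda>)" by fastforce
    have ps: "ps \<noteq> []" "set ps \<subseteq> Rd d" using ne[OF w] sub[OF w] 1 by auto
    have eqs: "le w = length ps" "h w = hd ps" "la w = last ps" "su w = sum_list ps" "st w = b"
      by (simp_all add: le_def h_def la_def su_def st_def 1)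
    have foeq: "fo w = (\<exists>c\<in>set cs. second_order_stationary d F \<epsilon> c)"
      by (simp add: fo_def found_def candidates_def 1)
    have peq: "last ps - \<eta> *\<^sub>R (gf (last ps) \<zeta> + 1 *\<^sub>R \<Lambda>) = p w"
      using laR[OF w] by (simp add: p_def eqs 2)
    have ceq: "(1 / real (length ps)) *\<^sub>R sum_list ps = proj d (c w)"
      unfolding cR[OF w] by (simp add: c_def eqs)
    have R': "R u w (Suc n) = (if b then (ps, cs, True)
        else if ex w then ([p w], cs @ [proj d (c w)], False)
        else if fi w then (ps @ [p w], cs @ [proj d (c w)], True) else (ps @ [p w], cs, False))"
      by (simp only: rsgd.simps 1 2 rsgd_step_def prod.case Let_def peq ceq ex_def fi_def eqs)
    show "length (fst (R u w (Suc n))) = (if st w then le w else if ex w then 1 else Suc (le w))"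
      "hd (fst (R u w (Suc n))) = (if st w then h w else if ex w then p w else h w)"
      "last (fst (R u w (Suc n))) = (if st w then la w else p w)"
      "sum_list (fst (R u w (Suc n))) = (if st w then su w else if ex w then p w else su w + p w)"
      "snd (snd (R u w (Suc n))) = (st w \<or> (\<not> ex w \<and> fi w))"
      "fst (R u w (Suc n)) \<noteq> [] \<and> set (fst (R u w (Suc n))) \<subseteq> Rd d"
      unfolding R' eqs using ps pR[OF w] by auto
    show "found (Suc n) u w = (fo w \<or> (\<not> st w \<and> (ex w \<or> fi w) \<and> second_order_stationary d F \<epsilon> (proj d (c w))))"
      unfolding found_def candidates_def R' foeq eqs by auto
  qed
  have [measurable]: "Measurable.pred seq.S (\<lambda>w. second_order_stationary d F \<epsilon> (proj d (c w)))"
    by (rule measurable_compose[OF _ pred_sosp]) measurable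
  have "(\<lambda>w. length (fst (R u w (Suc n)))) \<in> measurable seq.S (count_space UNIV)"
    by (rule measurable_cong[THEN iffD2, OF nx(1)]) measurable
  moreover have "(\<lambda>w. hd (fst (R u w (Suc n)))) \<in> borel_measurable seq.S"
    by (rule measurable_cong[THEN iffD2, OF nx(2)]) measurable
  moreover have "(\<lambda>w. last (fst (R u w (Suc n)))) \<in> borel_measurable seq.S"
    by (rule measurable_cong[THEN iffD2, OF nx(3)]) measurable
  moreover have "(\<lambda>w. sum_list (fst (R u w (Suc n)))) \<in> borel_measurable seq.S"
    by (rule measurable_cong[THEN iffD2, OF nx(4)]) measurable
  moreover have "Measurable.pred seq.S (\<lambda>w. snd (snd (R u w (Suc n))))"
    by (rule measurable_cong[THEN iffD2, OF nx(5)]) measurable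
  moreover have "Measurable.pred seq.S (found (Suc n) u)"
    by (rule measurable_cong[THEN iffD2, OF nx(6)]) measurable
  ultimately show ?case using nx(7) by blast
qed

lemma pred_found [measurable]: "u \<in> Rd d \<Longrightarrow> Measurable.pred seq.S (found n u)"
  using rsgd_components_measurable by blast

definition pmiss :: "nat \<Rightarrow> evec \<Rightarrow> ennreal" where
  "pmiss n u = emeasure seq.S {w \<in> space seq.S. \<not> found n u w}"

lemma sgd_step:
  assumes "u \<in> Rd d" "w \<in> space seq.S" "good w"
  shows "sgd G \<eta> u w (Suc j) = sgd G \<eta> u w j - \<eta> *\<^sub>R (gf (sgd G \<eta> u w j) (fst (w j)) + 1 *\<^sub>R snd (w j))"
  using proc.sgd_Rd[OF assms(1,2), of j] assms(3) by (simp add: G_def good_def clip_def)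

lemma found_mono: "found n u w \<Longrightarrow> n \<le> m \<Longrightarrow> found m u w"
  using candidates_mono[of n m gf \<eta> K0 B 1 u w] by (auto simp: found_def)

lemma found_stop:
  assumes u: "u \<in> Rd d" and w: "w \<in> space seq.S" "good w" and K0: "K0 > 0" "K0 \<le> n"
    and stay: "proc.stay u B K0 u w"
    and sosp: "second_order_stationary d F \<epsilon> ((1 / real K0) *\<^sub>R (\<Sum>k<K0. sgd G \<eta> u w k))"
  shows "found n u w"
proof -
  obtain k where k: "K0 = Suc k" using K0 gr0_implies_Suc by blast
  have "candidates gf \<eta> K0 B 1 (sgd G \<eta> u w 0) w K0 = [(1 / real K0) *\<^sub>R (\<Sum>j<K0. sgd G \<eta> u w j)]"
    by (rule rsgd_block_stop[OF k]) (use stay sgd_step[OF u w] in \<open>auto simp: proc.stay_def\<close>)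
  then have "found K0 u w" using sosp by (simp add: found_def)
  then show ?thesis using found_mono K0 by blast
qed

lemma found_exit:
  assumes u: "u \<in> Rd d" and w: "w \<in> space seq.S" "good w" and i: "Suc k \<le> K0"
    and stay: "proc.stay u B k u w" and exit: "B < norm (sgd G \<eta> u w (Suc k) - u)"
    and f: "found m (sgd G \<eta> u w (Suc k)) (\<lambda>j. w (Suc k + j))"
  shows "found (Suc k + m) u w"
proof -
  have "\<exists>c. rsgd gf \<eta> K0 B 1 (sgd G \<eta> u w 0) w (Suc k) = ([sgd G \<eta> u w (Suc k)], [c], False)"
    by (rule rsgd_block_exit) (use i stay exit sgd_step[OF u w] in \<open>auto simp: proc.stay_def simp del: sgd.simps(2)\<close>)
  then obtain c where "R u w (Suc k) = ([sgd G \<eta> u w (Suc k)], [c], False)" by auto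
  from rsgd_restart[OF this, of m] f show ?thesis
    by (auto simp: found_def candidates_def split: prod.splits)
qed

end

text \<open>A block consists of \<open>m\<close> saddle trials of \<open>Suc n1\<close> steps each,
  the extra step being the one that randomises the start. \<open>X\<close> bounds the duration
  \<open>\<eta> * K0\<close> of a block, and \<open>t\<close> is the exponent in the concentration
  bounds.\<close>

locale rsgd_params = rsgd_run d F \<rho>1 \<rho>2 P f \<sigma> \<rho>3 \<epsilon> \<eta> B K0
  for d F \<rho>1 \<rho>2 and P :: "'z measure" and f \<sigma> \<rho>3 \<epsilon> \<eta> B K0 +
  fixes A X t :: real and n1 m :: nat
  assumes d: "d > 0" and \<epsilon>: "\<epsilon> > 0" and A1: "A \<ge> 1" and B: "B > 0" "B \<le> 1 / (8 * A)"
    and \<eta>: "\<eta> > 0" "\<eta> * A \<le> 1" and K0: "K0 = m * Suc n1" "K0 > 0"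
    and X: "X > 0" "\<eta> * K0 \<le> X" and t: "t \<ge> 1 / 2" "1 + ln (real K0) \<le> 1 / 2 + t"
    and small: "4096 * (A * B * X) \<le> 1" "65536 * (\<eta> * A\<^sup>2 * (1 / 2 + t)\<^sup>2 * X) \<le> B\<^sup>2" "3 * \<eta> * A \<le> B"
    and grad_small: "2 * B / (\<eta> * K0) + 2 * A * B\<^sup>2 \<le> \<epsilon>" and hess_small: "A * B \<le> sqrt \<epsilon> / 2"
    and trial: "real n1 * (3 * (\<eta> * A * B) + 9 * (\<eta> * A)\<^sup>2) \<le> 1 / 128"
      "4 * B < (1 + \<eta> * (sqrt \<epsilon> / 2)) ^ n1 * (\<eta> / (4 * real d))"
begin

definition gain :: real where "gain = B\<^sup>2 / (128 * X)"
text \<open>Bound on the failure probability of one block: a large averaged gradient, a saddle that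
  is not left, and, for each of the \<open>K0\<close> possible exit times, an exit without the
  decrease.\<close>

definition bad :: real where "bad = exp (- t) + (3 / 4) ^ m + real K0 * (5 * exp (- t))"

lemma gain_pos: "gain > 0"
  using B X by (simp add: gain_def)

lemma bad_nonneg: "bad \<ge> 0"
  by (simp add: bad_def)

text \<open>If no stationary candidate is found, either one of the three failures occurs or the
  block exits with decrease \<open>gain\<close> and the rest of the run misses too. The exit times
  are disjoint events, so the last alternative costs \<open>c\<close> once rather than
  \<open>K0\<close> times.\<close>

lemma block_step:
  assumes u: "u \<in> Rd d" and lr: "locally_regular d (space P) F g H gf A u (1 / (4 * A))" and n: "K0 \<le> n"
    and next_block: "\<And>u' n'. u' \<in> Rd d \<Longrightarrow> F u' \<le> F u - gain \<Longrightarrow> n - K0 \<le> n' \<Longrightarrow> pmiss n' u' \<le> c"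
  shows "pmiss n u \<le> ennreal bad + c"
proof -
  interpret S: sgd_saddle M d G \<eta> F gp "H u" A B u "\<eta> / (4 * real d)"
    by (rule sgd_saddleI[OF d lr A1 B \<eta>])
  let ?x = "\<lambda>w k. sgd G \<eta> u w k"
  let ?avg = "\<lambda>w. (1 / real K0) *\<^sub>R (\<Sum>k<K0. ?x w k)"
  have inb: "S.inb k w = proc.stay u B k u w" for k w
    by (simp add: S.inb_def proc.stay_def)
  define stop where "stop = {w \<in> space seq.S. proc.stay u B K0 u w \<and> \<epsilon> < norm (gp (?avg w))}"
  define stuck where "stuck = {w \<in> space seq.S. proc.stay u B K0 u w \<and>
      (\<exists>h\<in>Rd d. inner h (H u h) < - (sqrt \<epsilon> / 2) * (norm h)\<^sup>2)}"
  \<comment> \<open>\<open>proj d\<close> changes nothing at an iterate, but makes the event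
    measurable, nothing being known about \<open>F\<close> off \<open>Rd d\<close>.\<close>
  define fails where "fails i = {w \<in> space seq.S. S.inb (i - 1) w \<and> B < norm (?x w i - u) \<and> F u - B\<^sup>2 / (128 * X) < F (proj d (?x w i))}" for i
  define ex where "ex i = {w \<in> space seq.S. S.inb (i - 1) w \<and> B < norm (?x w i - u)}" for i
  define rest where "rest i = {w \<in> space seq.S. w \<in> ex i \<and> F (proj d (?x w i)) \<le> F u - gain \<and> good w \<and> \<not> found n u w}" for i
  note [measurable] = pred_found[OF u] F_measurable
  have meas: "stop \<in> sets seq.S" "stuck \<in> sets seq.S" "\<And>i. fails i \<in> sets seq.S" "\<And>i. ex i \<in> sets seq.S"
    unfolding stop_def stuck_def fails_def ex_def by measurable
  note [measurable] = meas
  have rest_meas: "rest i \<in> sets seq.S" for i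
    unfolding rest_def by measurable
  have p_stop: "emeasure seq.S stop \<le> ennreal (exp (- t))"
  proof -
    have "emeasure seq.S stop \<le> emeasure seq.S {w \<in> space seq.S. S.inb K0 w \<and>
        2 * B / (\<eta> * K0) + 2 * A * B\<^sup>2 < norm (gp (?avg w))}"
      unfolding stop_def inb using grad_small by (intro emeasure_mono) (auto simp flip: inb)
    also have "\<dots> \<le> ennreal (exp (- t))" by (rule S.stay_tail[OF K0(2) X(2) t(1) small(2)])
    finally show ?thesis .
  qed
  have p_stuck: "emeasure seq.S stuck \<le> ennreal ((3 / 4) ^ m)"
  proof (cases "\<exists>h\<in>Rd d. inner h (H u h) < - (sqrt \<epsilon> / 2) * (norm h)\<^sup>2")
    case True
    then obtain h where h: "h \<in> Rd d" "inner h (H u h) < - (sqrt \<epsilon> / 2) * (norm h)\<^sup>2" by blast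
    have "emeasure seq.S stuck \<le> proc.pstay u B K0 u"
      unfolding stuck_def proc.pstay_def by (intro emeasure_mono) auto
    also have "\<dots> \<le> ennreal ((3 / 4) ^ m)"
      unfolding K0(1) by (rule S.pstay_saddle[OF h _ trial u]) (use \<epsilon> in simp)
    finally show ?thesis .
  next
    case False
    then have "stuck = {}" by (auto simp: stuck_def)
    then show ?thesis by simp
  qed
  have p_fails: "emeasure seq.S (fails i) \<le> ennreal (5 * exp (- t))" if i: "i \<in> {1..K0}" for i
  proof -
    have eq: "fails i = {w \<in> space seq.S. S.inb (i - 1) w \<and> B < norm (?x w i - u) \<and> F u - B\<^sup>2 / (128 * X) < F (?x w i)}"
      unfolding fails_def using proc.sgd_Rd[OF u] by auto
    have ik: "0 < i" "i \<le> K0" using i by auto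
    have "\<eta> * real i \<le> \<eta> * K0" using ik \<eta> by (intro mult_left_mono) auto
    then have "\<eta> * real i \<le> X" using X by linarith
    moreover have "ln (real i) \<le> ln (real K0)" using ik by simp
    then have "1 + ln (real i) \<le> 1 / 2 + t" using t by linarith
    moreover have "0 \<le> t" using t by simp
    ultimately show ?thesis unfolding eq using ik by (intro S.escape_tail X(1) small) auto
  qed
  \<comment> \<open>Markov property at the exit: \<open>ex i\<close> is decided by the first
    \<open>i\<close> samples, and \<open>found_exit\<close> identifies what follows with a run from
    the new anchor on the later samples. At least \<open>n - K0\<close> calls are left for
    it.\<close>
  have p_rest: "emeasure seq.S (rest i) \<le> emeasure seq.S (ex i) * c" if i: "i \<in> {1..K0}" for i
  proof -
    obtain k where k: "i = Suc k" "Suc k \<le> K0" using i by (cases i) auto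
    have "emeasure seq.S (rest i) = (\<integral>\<^sup>+w. indicator (rest i) w \<partial>seq.S)" using rest_meas by simp
    also have "\<dots> = (\<integral>\<^sup>+w. \<integral>\<^sup>+w'. indicator (rest i) (comb_seq i w w') \<partial>seq.S \<partial>seq.S)"
      by (rule seq.nn_integral_comb_seq) (use rest_meas in measurable)
    also have "\<dots> \<le> (\<integral>\<^sup>+w. indicator (ex i) w * c \<partial>seq.S)"
    proof (rule nn_integral_mono)
      fix w assume w: "w \<in> space seq.S"
      have xR: "?x w i \<in> Rd d" by (rule proc.sgd_Rd[OF u w])
      show "(\<integral>\<^sup>+w'. indicator (rest i) (comb_seq i w w') \<partial>seq.S) \<le> indicator (ex i) w * c"
      proof (cases "w \<in> ex i \<and> F (?x w i) \<le> F u - gain")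
        case True
        have "(\<integral>\<^sup>+w'. indicator (rest i) (comb_seq i w w') \<partial>seq.S)
          \<le> (\<integral>\<^sup>+w'. indicator {w' \<in> space seq.S. \<not> found (n - i) (?x w i) w'} w' \<partial>seq.S)"
        proof (rule nn_integral_mono)
          fix w' assume w': "w' \<in> space seq.S"
          have "\<not> found (n - i) (?x w i) w'" if r: "comb_seq i w w' \<in> rest i"
          proof
            let ?cw = "comb_seq i w w'"
            assume fo: "found (n - i) (?x w i) w'"
            have cw: "?cw \<in> space seq.S" "good ?cw" "\<not> found n u ?cw" "?cw \<in> ex i" using r by (auto simp: rest_def)
            have xi: "?x ?cw i = ?x w i" by (rule sgd_cong) (simp add: comb_seq_less)
            have sh: "(\<lambda>j. ?cw (Suc k + j)) = w'" unfolding k(1)[symmetric] by (rule ext) (simp add: comb_seq_def)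
            have "found (Suc k + (n - i)) u ?cw"
            proof (rule found_exit[OF u cw(1,2) k(2)])
              show "proc.stay u B k u ?cw" using cw(4) by (simp add: ex_def inb k)
              show "B < norm (?x ?cw (Suc k) - u)" using cw(4) by (simp add: ex_def k del: sgd.simps)
              show "found (n - i) (?x ?cw (Suc k)) (\<lambda>j. ?cw (Suc k + j))"
                unfolding sh using fo xi by (simp add: k(1) del: sgd.simps)
            qed
            moreover have "Suc k + (n - i) = n" using k n by simp
            ultimately show False using cw(3) by simp
          qed
          then show "indicator (rest i) (comb_seq i w w') \<le> (indicator {w' \<in> space seq.S. \<not> found (n - i) (?x w i) w'} w' :: ennreal)"
            using w' by (auto simp: indicator_def)
        qed
        also have "\<dots> = pmiss (n - i) (?x w i)"
          unfolding pmiss_def using pred_found[OF xR] by (subst nn_integral_indicator) auto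
        also have "\<dots> \<le> c" by (rule next_block[OF xR]) (use True i in auto)
        finally show ?thesis using True by simp
      next
        case False
        have "comb_seq i w w' \<notin> rest i" for w'
        proof
          assume r: "comb_seq i w w' \<in> rest i"
          have eq: "?x (comb_seq i w w') j = ?x w j" if "j \<le> i" for j
            by (rule sgd_cong) (use that in \<open>simp add: comb_seq_less\<close>)
          have "S.inb (i - 1) (comb_seq i w w') = S.inb (i - 1) w"
            by (rule S.inb_cong) (simp add: comb_seq_less)
          then have "w \<in> ex i" using r w eq[of i] by (simp add: rest_def ex_def)
          moreover have "F (?x w i) \<le> F u - gain" using r eq[of i] xR by (simp add: rest_def)
          ultimately show False using False by blast
        qed
        then show ?thesis by (simp add: indicator_def)
      qed
    qed
    also have "\<dots> = emeasure seq.S (ex i) * c" by (subst nn_integral_multc) auto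
    finally show ?thesis .
  qed
  have disj: "disjoint_family_on ex {1..K0}"
  proof -
    have "ex i \<inter> ex j = {}" if "i < j" for i j
    proof -
      have "i \<le> j - 1" using that by simp
      then show ?thesis by (auto simp: ex_def S.inb_def)
    qed
    then show ?thesis unfolding disjoint_family_on_def by (metis Int_commute linorder_neqE_nat)
  qed
  have sum_rest: "(\<Sum>i\<in>{1..K0}. emeasure seq.S (rest i)) \<le> c"
  proof -
    have "(\<Sum>i\<in>{1..K0}. emeasure seq.S (rest i)) \<le> (\<Sum>i\<in>{1..K0}. emeasure seq.S (ex i) * c)"
      by (intro sum_mono p_rest)
    also have "\<dots> = emeasure seq.S (\<Union>i\<in>{1..K0}. ex i) * c"
      using disj by (subst sum_distrib_right[symmetric], subst sum_emeasure) auto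
    also have "\<dots> \<le> 1 * c" by (intro mult_right_mono seq.P.emeasure_le_1) auto
    finally show ?thesis by simp
  qed
  have cover: "w \<in> stop \<union> stuck \<union> (\<Union>i\<in>{1..K0}. fails i) \<union> (\<Union>i\<in>{1..K0}. rest i)"
    if w: "w \<in> space seq.S" "good w" "\<not> found n u w" for w
  proof (cases "proc.stay u B K0 u w")
    case True
    have xR: "?x w k \<in> Rd d" for k by (rule proc.sgd_Rd[OF u w(1)])
    have avgR: "?avg w \<in> Rd d" by (intro Rd_closed_ops Rd_sum xR)
    have "\<not> second_order_stationary d F \<epsilon> (?avg w)"
      using found_stop[OF u w(1,2) K0(2) n True] w(3) by blast
    then consider "\<epsilon> < norm (g (?avg w))" | h where "h \<in> Rd d" "inner h (H (?avg w) h) < - sqrt \<epsilon> * (norm h)\<^sup>2"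
      using sosp_iff[OF avgR] by (meson not_le)
    then show ?thesis
    proof cases
      case 1
      then show ?thesis using True w(1) avgR by (simp add: stop_def gp_def)
    next
      case (2 h)
      \<comment> \<open>The negative direction at the average is carried over to the anchor, where
        the saddle estimate applies. The Hessian changes by at most \<open>A * B\<close> in between,
        which costs half of \<open>sqrt \<epsilon>\<close>.\<close>
      have "norm (\<Sum>k<K0. ?x w k - u) \<le> (\<Sum>k<K0. B)"
        using True by (intro sum_norm_le) (auto simp: proc.stay_def)
      moreover have "?avg w - u = (1 / real K0) *\<^sub>R (\<Sum>k<K0. ?x w k - u)"
        using K0(2) by (simp add: sum_subtractf scaleR_diff_right sum_constant_scaleR)
      ultimately have avgB: "norm (?avg w - u) \<le> B" using K0(2) by (simp add: field_simps)
      have "1 / (8 * A) \<le> 1 / (4 * A)" using A1 by (intro divide_left_mono) auto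
      then have r: "norm (?avg w - u) \<le> 1 / (4 * A)" using avgB B by linarith
      have "norm (H (?avg w) h - H u h) \<le> A * norm (?avg w - u) * norm h"
        by (rule locally_regularD(6)[OF lr avgR r 2(1)])
      also have "\<dots> \<le> A * B * norm h" using avgB A1 by (intro mult_right_mono mult_left_mono) auto
      also have "\<dots> \<le> (sqrt \<epsilon> / 2) * norm h" using hess_small by (intro mult_right_mono) auto
      finally have hd: "norm (H (?avg w) h - H u h) \<le> (sqrt \<epsilon> / 2) * norm h" .
      have "- inner h (H (?avg w) h - H u h) \<le> norm h * norm (H (?avg w) h - H u h)"
        using Cauchy_Schwarz_ineq2 abs_le_D2 by blast
      also have "\<dots> \<le> norm h * ((sqrt \<epsilon> / 2) * norm h)" using hd by (rule mult_left_mono) simp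
      finally have "inner h (H u h) \<le> inner h (H (?avg w) h) + (sqrt \<epsilon> / 2) * (norm h)\<^sup>2"
        by (simp add: inner_diff_right power2_eq_square mult_ac)
      then have "inner h (H u h) < - (sqrt \<epsilon> / 2) * (norm h)\<^sup>2" using 2(2) by simp
      then show ?thesis using True w(1) 2(1) by (auto simp: stuck_def)
    qed
  next
    case False
    define i where "i = (LEAST j. B < norm (?x w j - u))"
    have ex0: "\<exists>j\<le>K0. B < norm (?x w j - u)" using False by (auto simp: proc.stay_def not_le)
    then have i: "B < norm (?x w i - u)" unfolding i_def by (metis (mono_tags, lifting) LeastI)
    have "i \<le> K0" using ex0 unfolding i_def by (meson Least_le order_trans)
    have below: "norm (?x w j - u) \<le> B" if "j < i" for j
      using not_less_Least[of j "\<lambda>j. B < norm (?x w j - u)"] that by (simp add: i_def)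
    have i0: "i \<noteq> 0" using i B by (intro notI) simp
    have exi: "w \<in> ex i" using w(1) i below i0 by (auto simp: ex_def S.inb_def)
    have ii: "i \<in> {1..K0}" using i0 \<open>i \<le> K0\<close> by simp
    show ?thesis
    proof (cases "F (proj d (?x w i)) \<le> F u - gain")
      case True
      then have "w \<in> rest i" using exi w by (simp add: rest_def)
      then show ?thesis using ii by blast
    next
      case False
      then have "w \<in> fails i" using exi w by (simp add: fails_def ex_def gain_def)
      then show ?thesis using ii by blast
    qed
  qed
  have "pmiss n u = emeasure seq.S {w \<in> space seq.S. good w \<and> \<not> found n u w}"
    unfolding pmiss_def
  proof (rule emeasure_eq_AE)
    show "AE w in seq.S. (w \<in> {w \<in> space seq.S. \<not> found n u w}) = (w \<in> {w \<in> space seq.S. good w \<and> \<not> found n u w})"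
      using AE_good by eventually_elim auto
  qed measurable
  also have "\<dots> \<le> emeasure seq.S (stop \<union> stuck \<union> (\<Union>i\<in>{1..K0}. fails i) \<union> (\<Union>i\<in>{1..K0}. rest i))"
    using cover rest_meas by (intro emeasure_mono) auto
  also have "\<dots> \<le> emeasure seq.S stop + emeasure seq.S stuck + (\<Sum>i\<in>{1..K0}. emeasure seq.S (fails i)) + (\<Sum>i\<in>{1..K0}. emeasure seq.S (rest i))"
    using rest_meas
    by (intro order_trans[OF emeasure_subadditive] add_mono emeasure_subadditive_finite order_refl sets.Un sets.finite_UN) auto
  also have "\<dots> \<le> ennreal (exp (- t)) + ennreal ((3 / 4) ^ m) + (\<Sum>i\<in>{1..K0}. ennreal (5 * exp (- t))) + c"
    by (intro add_mono p_stop p_stuck sum_mono p_fails sum_rest)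
  also have "(\<Sum>i\<in>{1..K0}. ennreal (5 * exp (- t))) = ennreal (real K0 * (5 * exp (- t)))"
    by (simp add: ennreal_mult ennreal_of_nat_eq_real_of_nat)
  also have "ennreal (exp (- t)) + ennreal ((3 / 4) ^ m) + ennreal (real K0 * (5 * exp (- t))) = ennreal bad"
    by (simp add: bad_def ennreal_plus)
  finally show ?thesis .
qed

text \<open>Induction on the number \<open>N\<close> of decreases still possible; at
  \<open>N = 0\<close> the hypothesis \<open>F u < 0\<close> is absurd. Anchors reached with a
  decrease stay in the sublevel set of \<open>\<Delta>\<close>, so one \<open>A\<close> serves
  throughout.\<close>

lemma pmiss_le:
  assumes lr: "\<And>u. u \<in> Rd d \<Longrightarrow> F u \<le> \<Delta> \<Longrightarrow> locally_regular d (space P) F g H gf A u (1 / (4 * A))"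
    and u: "u \<in> Rd d" "F u \<le> \<Delta>" "F u < real N * gain" and n: "N * K0 \<le> n"
  shows "pmiss n u \<le> ennreal (real N * bad)"
  using u n
proof (induction N arbitrary: u n)
  case 0
  then show ?case using F_nonneg[of u] by simp
next
  case (Suc N)
  have "pmiss n u \<le> ennreal bad + ennreal (real N * bad)"
  proof (rule block_step[OF Suc.prems(1) lr])
    fix u' n' assume u': "u' \<in> Rd d" "F u' \<le> F u - gain" "n - K0 \<le> n'"
    show "pmiss n' u' \<le> ennreal (real N * bad)"
    proof (rule Suc.IH[OF u'(1)])
      show "F u' \<le> \<Delta>" using u'(2) Suc.prems(2) gain_pos by linarith
      show "F u' < real N * gain" using u'(2) Suc.prems(3) by (simp add: algebra_simps)
      show "N * K0 \<le> n'" using u'(3) Suc.prems(4) by simp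
    qed
  qed (use Suc.prems in auto)
  also have "\<dots> = ennreal (real (Suc N) * bad)"
    using bad_nonneg by (subst ennreal_plus[symmetric]) (auto simp: algebra_simps)
  finally show ?case .
qed

lemma prob_found:
  assumes lr: "\<And>u. u \<in> Rd d \<Longrightarrow> F u \<le> \<Delta> \<Longrightarrow> locally_regular d (space P) F g H gf A u (1 / (4 * A))"
    and u: "u \<in> Rd d" "F u \<le> \<Delta>" "F u < real N * gain" and \<delta>: "real N * bad \<le> \<delta>"
  shows "measure (rsgd_prob d P) {w \<in> space (rsgd_prob d P).
      \<exists>c\<in>set (candidates (\<lambda>x \<zeta>. grad d (\<lambda>y. f y \<zeta>) x) \<eta> K0 B 1 u w (N * K0)). second_order_stationary d F \<epsilon> c} \<ge> 1 - \<delta>"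
proof -
  have gfeq: "(\<lambda>x \<zeta>. grad d (\<lambda>y. f y \<zeta>) x) = gf" by (simp add: gf_def fun_eq_iff)
  note [measurable] = pred_found[OF u(1)]
  have "ennreal (seq.P.prob {w \<in> space seq.S. \<not> found (N * K0) u w}) = pmiss (N * K0) u"
    unfolding pmiss_def by (rule seq.P.emeasure_eq_measure[symmetric])
  also have "\<dots> \<le> ennreal (real N * bad)" by (rule pmiss_le[OF lr u order_refl])
  finally have "seq.P.prob {w \<in> space seq.S. \<not> found (N * K0) u w} \<le> real N * bad"
    using bad_nonneg by (simp add: ennreal_le_iff)
  moreover have "seq.P.prob {w \<in> space seq.S. \<not> found (N * K0) u w} = 1 - seq.P.prob {w \<in> space seq.S. found (N * K0) u w}"
    by (rule seq.P.prob_neg) measurable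
  ultimately have "1 - \<delta> \<le> seq.P.prob {w \<in> space seq.S. found (N * K0) u w}" using \<delta> by linarith
  then show ?thesis by (simp add: rsgd_prob_eq gfeq found_def)
qed

end

section \<open>Choice of the parameters\<close>

text \<open>\<open>L \<ge> 84\<close> means \<open>L / 4 \<ge> 21\<close>: in
  \<open>ex_admissible\<close> block length and number of blocks cost \<open>exp (20 * lg)\<close>,
  and one more \<open>exp lg\<close> brings the failure probability below \<open>\<delta>\<close>.
  The exponent 16 collects the powers of \<open>L\<close> in the constants.\<close>

lemma ex_exp_dominates_power:
  fixes c :: real shows "\<exists>L\<ge>84. c * L ^ 16 \<le> exp (L / 4 - 21)"
proof -
  have "((\<lambda>L::real. L ^ 16 * exp (- (L / 4))) \<longlongrightarrow> 0) at_top"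
    by real_asymp
  then have "\<forall>\<^sub>F L in at_top. L ^ 16 * exp (- (L / 4)) < exp (- 21) / (\<bar>c\<bar> + 1)"
    by (rule order_tendstoD) (simp add: divide_pos_pos add_nonneg_pos)
  then have "\<forall>\<^sub>F L in at_top. L \<ge> 84 \<and> L ^ 16 * exp (- (L / 4)) < exp (- 21) / (\<bar>c\<bar> + 1)"
    using eventually_ge_at_top[of "84::real"] by eventually_elim auto
  then obtain L :: real where L: "L \<ge> 84" "L ^ 16 * exp (- (L / 4)) < exp (- 21) / (\<bar>c\<bar> + 1)"
    using eventually_happens'[OF trivial_limit_at_top_linorder] by blast
  have "c * L ^ 16 \<le> (\<bar>c\<bar> + 1) * L ^ 16" using L by (intro mult_right_mono) auto
  also have "\<dots> = ((\<bar>c\<bar> + 1) * (L ^ 16 * exp (- (L / 4)))) * exp (L / 4)"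
    by (simp add: exp_minus)
  also have "\<dots> \<le> exp (- 21) * exp (L / 4)"
    using L(2) by (intro mult_right_mono) (simp_all add: field_simps)
  also have "\<dots> = exp (L / 4 - 21)" by (simp add: exp_add[symmetric])
  finally show ?thesis using L by blast
qed

text \<open>The numerical conditions of \<open>rsgd_params\<close> and \<open>prob_found\<close>,
  with \<open>gain\<close> and \<open>bad\<close> unfolded, so that the parameters can be chosen by
  pure real arithmetic.\<close>

definition "admissible d \<epsilon> \<delta> A \<Delta> \<eta> K0 B X t n1 m N \<longleftrightarrow>
    B > 0 \<and> B \<le> 1 / (8 * A) \<and> \<eta> > 0 \<and> \<eta> * A \<le> 1 \<and> K0 = m * Suc n1 \<and> K0 > 0 \<and>
    X > 0 \<and> \<eta> * real K0 \<le> X \<and> t \<ge> 1 / 2 \<and> 1 + ln (real K0) \<le> 1 / 2 + t \<and>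
    4096 * (A * B * X) \<le> 1 \<and> 65536 * (\<eta> * A\<^sup>2 * (1 / 2 + t)\<^sup>2 * X) \<le> B\<^sup>2 \<and> 3 * \<eta> * A \<le> B \<and>
    2 * B / (\<eta> * real K0) + 2 * A * B\<^sup>2 \<le> \<epsilon> \<and> A * B \<le> sqrt \<epsilon> / 2 \<and>
    real n1 * (3 * (\<eta> * A * B) + 9 * (\<eta> * A)\<^sup>2) \<le> 1 / 128 \<and>
    4 * B < (1 + \<eta> * (sqrt \<epsilon> / 2)) ^ n1 * (\<eta> / (4 * real d)) \<and>
    \<Delta> < real N * (B\<^sup>2 / (128 * X)) \<and>
    real N * (exp (- t) + (3 / 4) ^ m + real K0 * (5 * exp (- t))) \<le> (\<delta>::real)"

text \<open>With \<open>e = sqrt \<epsilon>\<close> the choices amount to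
  \<open>B = e / (b1 * lg\<^sup>2)\<close>, \<open>X = x1 * lg\<^sup>2 / e\<close> and
  \<open>\<eta> = e ^ 3 / (h1 * lg ^ 8)\<close>. Hence \<open>K0\<close> is of order at most
  \<open>lg ^ 10 / e ^ 4\<close> and \<open>N\<close> of order at most
  \<open>lg ^ 6 / e ^ 3\<close>, which explains the exponents 16 and 3.5. The constant
  \<open>b1\<close> makes \<open>4096 * (A * B * X)\<close> equal to \<open>1 / A\<close>.\<close>

lemma ex_admissible:
  fixes A \<Delta> L \<epsilon> \<delta> :: real and d :: nat
  defines "x1 \<equiv> 6 * L\<^sup>2"
  defines "b1 \<equiv> 4096 * A\<^sup>2 * x1"
  defines "h1 \<equiv> 262144 * A\<^sup>2 * L\<^sup>2 * x1 * b1\<^sup>2"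
  defines "lg \<equiv> 1 + ln (real d) + ln (1 + 1 / \<epsilon>) + ln (1 / \<delta>)"
  assumes A: "A \<ge> 1" and L: "L \<ge> 84" and big: "112 * (1 + 128 * \<bar>\<Delta>\<bar> * x1 * b1\<^sup>2) * x1 * h1 \<le> exp (L / 4 - 21)"
    and d: "d > 0" and \<epsilon>: "\<epsilon> > 0" "\<epsilon> < A\<^sup>2" and \<delta>: "0 < \<delta>" "\<delta> < 1"
  shows "\<exists>\<eta> K0 B X t n1 m N. admissible d \<epsilon> \<delta> A \<Delta> \<eta> K0 B X t n1 m N \<and>
    real (N * K0) \<le> (A ^ 3 + 128 * \<bar>\<Delta>\<bar> * x1 * b1\<^sup>2) * (x1 * h1) * (1 / \<epsilon> powr 3.5) * lg ^ 16"
proof -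

  \<comment> \<open>The logarithmic factor and its exponential bounds\<close>
  define e where "e = sqrt \<epsilon>"
  have e: "e > 0" "e\<^sup>2 = \<epsilon>" using \<epsilon> by (auto simp: e_def)
  have eA: "e < A"
    using \<epsilon>(2) A unfolding e_def by (intro real_less_lsqrt) auto
  have lns: "0 \<le> ln (real d)" "0 \<le> ln (1 + 1 / \<epsilon>)" "0 \<le> ln (1 / \<delta>)"
    using d \<epsilon> \<delta> by (auto simp: ln_ge_zero)
  have l1: "lg \<ge> 1" using lns by (simp add: lg_def)
  have expd: "real d \<le> exp lg"
  proof -
    have "real d = exp (ln (real d))" using d by simp
    also have "\<dots> \<le> exp lg" using lns by (simp add: lg_def)
    finally show ?thesis .
  qed
  have exp\<epsilon>: "1 / \<epsilon> \<le> exp lg"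
  proof -
    have "1 / \<epsilon> \<le> exp (ln (1 + 1 / \<epsilon>))" using \<epsilon> by (simp add: add_pos_pos)
    also have "\<dots> \<le> exp lg" using lns by (simp add: lg_def)
    finally show ?thesis .
  qed
  have exp\<delta>: "exp (- lg) \<le> \<delta>"
  proof -
    have "exp (- lg) \<le> exp (- ln (1 / \<delta>))" using lns by (simp add: lg_def)
    also have "\<dots> = \<delta>" using \<delta> by (simp add: ln_div)
    finally show ?thesis .
  qed
  have lexp: "lg \<le> exp lg" using exp_ge_add_one_self[of lg] by linarith
  have pow_exp: "lg ^ k \<le> exp (real k * lg)" for k
    using power_mono[OF lexp, of k] l1 by (simp add: exp_of_nat_mult)
  have e4: "1 / e ^ 4 \<le> exp (2 * lg)"
  proof -
    have "1 / e ^ 4 = (1 / \<epsilon>)\<^sup>2" using e by (simp add: power_divide e(2)[symmetric] power_mult[symmetric])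
    also have "\<dots> \<le> (exp lg)\<^sup>2" using exp\<epsilon> \<epsilon> by (intro power_mono) auto
    finally show ?thesis by (simp add: exp_double)
  qed
  have L2: "L\<^sup>2 \<ge> 1" using L by (simp add: one_le_power)
  have x1: "x1 \<ge> 6" using L2 by (simp add: x1_def)
  have A2: "A \<le> A\<^sup>2" "1 \<le> A\<^sup>2"
    unfolding power2_eq_square using A mult_left_mono[of 1 A A] by linarith+
  have b1: "b1 \<ge> 4096 * A\<^sup>2" "b1 \<ge> 4096"
  proof -
    have "4096 * A\<^sup>2 * 1 \<le> 4096 * A\<^sup>2 * x1" using x1 by (intro mult_left_mono) auto
    then show "b1 \<ge> 4096 * A\<^sup>2" by (simp add: b1_def)
    then show "b1 \<ge> 4096" using A2 by linarith
  qed
  have h1: "h1 > 0" using A L x1 b1 by (auto simp: h1_def)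
  have l2: "lg\<^sup>2 \<ge> 1" using l1 by (simp add: one_le_power)

  \<comment> \<open>The parameters\<close>
  define B where "B = e / (b1 * lg\<^sup>2)"
  define X where "X = x1 * lg\<^sup>2 / e"
  \<comment> \<open>\<open>\<eta> * Dn = B\<^sup>2\<close> is the noise condition with
    \<open>1 / 2 + t\<close> replaced by \<open>2 * t\<close>, whence
    \<open>262144 = 4 * 65536\<close>.\<close>
  define Dn where "Dn = 262144 * A\<^sup>2 * L\<^sup>2 * lg\<^sup>2 * X"
  define \<eta> where "\<eta> = B\<^sup>2 / Dn"
  define t where "t = L * lg"
  \<comment> \<open>Number of steps after which growth by \<open>1 + x\<close> with
    \<open>x = \<eta> * e / 2\<close>, bounded below by \<open>exp (x / 2)\<close>, reaches
    \<open>exp (L * lg / 4)\<close>.\<close>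
  define nn where "nn = L * lg / (\<eta> * e)"
  define n1 where "n1 = nat \<lceil>nn\<rceil>"
  define m where "m = nat \<lceil>L * lg\<rceil>"
  define K0 where "K0 = m * Suc n1"
  define gain where "gain = B\<^sup>2 / (128 * X)"
  define N where "N = nat \<lfloor>\<Delta> / gain\<rfloor> + 1"

  \<comment> \<open>Sizes of the radius and of the step\<close>
  have Bp: "B > 0" using e b1 l1 by (simp add: B_def)
  have Xp: "X > 0" using e x1 l1 by (simp add: X_def)
  have Be: "B \<le> e / (4096 * A\<^sup>2)"
  proof -
    have "4096 * A\<^sup>2 * 1 \<le> b1 * lg\<^sup>2" using b1 l2 A2 by (intro mult_mono) auto
    then show ?thesis unfolding B_def using e A b1 l1 by (intro divide_left_mono) auto
  qed
  have ABe: "A * B \<le> e / 4096"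
  proof -
    have "A * B \<le> A\<^sup>2 * (e / (4096 * A\<^sup>2))" using Be A2 Bp by (intro mult_mono) auto
    then show ?thesis using A by simp
  qed
  have BAB: "B \<le> A * B" using A Bp mult_right_mono[of 1 A B] by linarith
  have Be': "B \<le> e / 4096" using ABe BAB by linarith
  have B8: "B \<le> 1 / (8 * A)"
  proof -
    have "e / (4096 * A\<^sup>2) \<le> A / (4096 * A\<^sup>2)" using eA by (intro divide_right_mono) auto
    also have "\<dots> = 1 / (4096 * A)" using A by (simp add: power2_eq_square)
    also have "\<dots> \<le> 1 / (8 * A)" using A by (intro divide_left_mono) auto
    finally show ?thesis using Be by linarith
  qed
  have AB8: "A * B \<le> 1 / 8" using mult_left_mono[OF B8, of A] A by simp
  have B1: "B \<le> 1" using AB8 BAB by linarith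
  have AX: "6 \<le> A * X"
  proof -
    have "6 * 1 \<le> x1 * lg\<^sup>2" using x1 l2 by (intro mult_mono) auto
    moreover have "1 \<le> A / e" using eA e by simp
    ultimately have "6 * 1 \<le> (x1 * lg\<^sup>2) * (A / e)" by (intro mult_mono) auto
    then show ?thesis by (simp add: X_def mult_ac)
  qed
  have Dn1: "Dn \<ge> 1"
  proof -
    have "1 * 1 \<le> L\<^sup>2 * lg\<^sup>2" using L2 l2 by (intro mult_mono) auto
    moreover have "1 * 6 \<le> A * (A * X)" using A AX by (intro mult_mono) auto
    ultimately have "(1 * 1) * (1 * 6) \<le> (L\<^sup>2 * lg\<^sup>2) * (A * (A * X))"
      by (rule mult_mono) simp_all
    then show ?thesis by (simp add: Dn_def power2_eq_square mult_ac)
  qed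
  have \<eta>p: "\<eta> > 0" using Bp Dn1 by (simp add: \<eta>_def)
  have \<eta>B: "\<eta> \<le> B\<^sup>2" unfolding \<eta>_def using Dn1 by (simp add: divide_le_eq mult_le_cancel_left1)
  have \<eta>AB: "\<eta> * A \<le> B * (1 / 8)"
  proof -
    have "\<eta> * A \<le> B\<^sup>2 * A" using \<eta>B A by (intro mult_right_mono) auto
    also have "\<dots> = B * (A * B)" by (simp add: power2_eq_square)
    also have "\<dots> \<le> B * (1 / 8)" using AB8 Bp by (intro mult_left_mono) auto
    finally show ?thesis .
  qed
  have \<eta>A1: "\<eta> * A \<le> 1" using \<eta>AB B1 by linarith
  have \<eta>A3: "3 * \<eta> * A \<le> B" using \<eta>AB Bp by simp
  have \<eta>e: "\<eta> * e \<le> 1" using mult_left_mono[of e A \<eta>] eA \<eta>p \<eta>A1 by linarith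
  have \<eta>eq: "\<eta> = e ^ 3 / (h1 * lg ^ 8)"
  proof -
    have "\<eta> = (e\<^sup>2 / (b1\<^sup>2 * lg ^ 4)) / (262144 * A\<^sup>2 * L\<^sup>2 * lg\<^sup>2 * (x1 * lg\<^sup>2 / e))"
      by (simp add: \<eta>_def B_def Dn_def X_def power_divide power_mult_distrib)
    also have "\<dots> = e ^ 3 / (262144 * A\<^sup>2 * L\<^sup>2 * x1 * b1\<^sup>2 * (lg ^ 4 * lg\<^sup>2 * lg\<^sup>2))"
      using e by (simp add: power2_eq_square power3_eq_cube)
    also have "lg ^ 4 * lg\<^sup>2 * lg\<^sup>2 = lg ^ 8" by (simp flip: power_add)
    finally show ?thesis by (simp add: h1_def)
  qed

  \<comment> \<open>Duration of a block\<close>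
  have Ll: "L * lg \<ge> 84" using mult_mono[of 84 L 1 lg] L l1 by simp
  have nn1: "nn \<ge> 1"
    unfolding nn_def using \<eta>e Ll \<eta>p e by (subst pos_le_divide_eq) auto
  have n1b: "nn \<le> real n1" "real n1 \<le> nn + 1" using nn1 unfolding n1_def by linarith+
  have mb: "L * lg \<le> real m" "real m \<le> L * lg + 1" using Ll unfolding m_def by linarith+
  have \<eta>nn: "\<eta> * nn = L * lg / e" using \<eta>p by (simp add: nn_def)
  have K0r: "real K0 = real m * (real n1 + 1)" by (simp add: K0_def algebra_simps)
  have K0up: "\<eta> * real K0 \<le> X"
  proof -
    have "real K0 \<le> (2 * (L * lg)) * (3 * nn)"
      unfolding K0r using mb n1b nn1 Ll by (intro mult_mono) auto
    then have "\<eta> * real K0 \<le> \<eta> * ((2 * (L * lg)) * (3 * nn))" using \<eta>p by (intro mult_left_mono) auto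
    also have "\<dots> = 6 * (L * lg) * (\<eta> * nn)" by simp
    also have "\<dots> = X" unfolding \<eta>nn by (simp add: X_def x1_def power2_eq_square)
    finally show ?thesis .
  qed
  have K0low: "1 / e \<le> \<eta> * real K0"
  proof -
    have "1 * nn \<le> real K0" unfolding K0r using mb n1b nn1 Ll by (intro mult_mono) auto
    then have "\<eta> * nn \<le> \<eta> * real K0" using \<eta>p by simp
    moreover have "1 / e \<le> L * lg / e" using Ll e by (intro divide_right_mono) auto
    ultimately show ?thesis using \<eta>nn by linarith
  qed
  have K0p: "K0 > 0" using K0low e \<eta>p by (metis divide_pos_pos less_le_trans mult_zero_right of_nat_0 less_irrefl zero_less_one gr0I)

  \<comment> \<open>Model error, noise, gradient and Hessian conditions for one block\<close>
  have BX: "B * X = x1 / b1" using e l1 by (simp add: B_def X_def)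
  have small1: "4096 * (A * B * X) \<le> 1"
  proof -
    have "4096 * (A * B * X) = 4096 * A * (x1 / b1)" by (simp add: BX[symmetric])
    also have "\<dots> = 1 / A" using A x1 by (simp add: b1_def power2_eq_square)
    also have "\<dots> \<le> 1" using A by simp
    finally show ?thesis .
  qed
  have t1: "t \<ge> 84" using Ll by (simp add: t_def)
  have small2: "65536 * (\<eta> * A\<^sup>2 * (1 / 2 + t)\<^sup>2 * X) \<le> B\<^sup>2"
  proof -
    have "(1 / 2 + t)\<^sup>2 \<le> (2 * t)\<^sup>2" using t1 by (intro power_mono) auto
    then have "65536 * (\<eta> * A\<^sup>2 * (1 / 2 + t)\<^sup>2 * X) \<le> 65536 * (\<eta> * A\<^sup>2 * (2 * t)\<^sup>2 * X)"
      using \<eta>p Xp by (intro mult_left_mono mult_right_mono) auto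
    also have "\<dots> = \<eta> * Dn" by (simp add: t_def Dn_def power_mult_distrib)
    also have "\<dots> = B\<^sup>2" using Dn1 by (simp add: \<eta>_def)
    finally show ?thesis .
  qed
  have \<eta>AX: "65536 * (\<eta> * A\<^sup>2 * X) \<le> 1"
  proof -
    have "1 \<le> (1 / 2 + t)\<^sup>2" using t1 by (simp add: one_le_power)
    then have "65536 * (\<eta> * A\<^sup>2 * 1 * X) \<le> 65536 * (\<eta> * A\<^sup>2 * (1 / 2 + t)\<^sup>2 * X)"
      using \<eta>p Xp by (intro mult_left_mono mult_right_mono) auto
    moreover have "B\<^sup>2 \<le> 1" using B1 Bp by (simp add: power_le_one)
    ultimately show ?thesis using small2 by simp
  qed
  have grad: "2 * B / (\<eta> * real K0) + 2 * A * B\<^sup>2 \<le> \<epsilon>"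
  proof -
    have "2 * B / (\<eta> * real K0) \<le> 2 * B / (1 / e)"
      using K0low Bp e \<eta>p K0p by (intro divide_left_mono) auto
    also have "\<dots> \<le> 2 * (e / 4096) * e" using Be' e by simp
    finally have 1: "2 * B / (\<eta> * real K0) \<le> \<epsilon> / 2048" using e(2) by (simp add: power2_eq_square)
    have "2 * A * B\<^sup>2 = 2 * ((A * B) * B)" by (simp add: power2_eq_square)
    also have "\<dots> \<le> 2 * ((e / 4096) * (e / 4096))" using ABe Be' Bp A e by (intro mult_left_mono mult_mono) auto
    finally have 2: "2 * A * B\<^sup>2 \<le> \<epsilon> / 2048"
      using e(2) \<epsilon> by (simp add: power2_eq_square)
    show ?thesis using 1 2 \<epsilon> by linarith
  qed
  have hess: "A * B \<le> sqrt \<epsilon> / 2" unfolding e_def[symmetric] using ABe e(1) by linarith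
  have n1K: "\<eta> * real n1 \<le> X"
  proof -
    have "1 * real n1 \<le> real K0" unfolding K0r using mb Ll by (intro mult_mono) auto
    then have "\<eta> * real n1 \<le> \<eta> * real K0" using \<eta>p by simp
    then show ?thesis using K0up by linarith
  qed
  have trial1: "real n1 * (3 * (\<eta> * A * B) + 9 * (\<eta> * A)\<^sup>2) \<le> 1 / 128"
  proof -
    have "real n1 * (3 * (\<eta> * A * B) + 9 * (\<eta> * A)\<^sup>2) = (\<eta> * real n1) * (3 * (A * B) + 9 * (\<eta> * A\<^sup>2))"
      by (simp add: power2_eq_square algebra_simps)
    also have "\<dots> \<le> X * (3 * (A * B) + 9 * (\<eta> * A\<^sup>2))"
      using n1K A Bp \<eta>p by (intro mult_right_mono) auto
    also have "\<dots> = 3 * (A * B * X) + 9 * (\<eta> * A\<^sup>2 * X)" by (simp add: algebra_simps)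
    also have "\<dots> \<le> 1 / 128" using small1 \<eta>AX by linarith
    finally show ?thesis .
  qed

  \<comment> \<open>Growth at a saddle\<close>
  have x1h1: "x1 * h1 > 0" "h1 \<le> x1 * h1" using x1 h1 by auto
  have big1: "112 * (x1 * h1) \<le> exp (L / 4 - 21)"
  proof -
    have "1 * (112 * (x1 * h1)) \<le> (1 + 128 * \<bar>\<Delta>\<bar> * x1 * b1\<^sup>2) * (112 * (x1 * h1))"
      using x1h1 x1 by (intro mult_right_mono) auto
    then show ?thesis using big by (simp add: mult_ac)
  qed
  have trial2: "4 * B < (1 + \<eta> * (sqrt \<epsilon> / 2)) ^ n1 * (\<eta> / (4 * real d))"
  proof -
    define x where "x = \<eta> * (sqrt \<epsilon> / 2)"
    have x: "0 < x" "x \<le> 1 / 2" using \<eta>p e \<eta>e by (auto simp: x_def e_def[symmetric])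
    have "exp (x / 2) \<le> 1 + x"
    proof -
      have "exp (x / 2) \<le> 1 + x / 2 + (x / 2)\<^sup>2" using x by (intro exp_bound) auto
      moreover have "(x / 2)\<^sup>2 \<le> x / 2" using x by (simp add: power2_eq_square mult_left_le)
      ultimately show ?thesis by simp
    qed
    then have "exp (x / 2) ^ n1 \<le> (1 + x) ^ n1" by (intro power_mono) auto
    moreover have "exp (x / 2) ^ n1 = exp (real n1 * (x / 2))" by (rule exp_of_nat_mult[symmetric])
    moreover have "L * lg / 4 \<le> real n1 * (x / 2)"
    proof -
      have "L * lg / 4 = nn * (x / 2)" using \<eta>p e by (simp add: nn_def x_def e_def[symmetric])
      also have "\<dots> \<le> real n1 * (x / 2)" using n1b x by (intro mult_right_mono) auto
      finally show ?thesis .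
    qed
    ultimately have growth: "exp (L * lg / 4) \<le> (1 + x) ^ n1" by (metis exp_le_cancel_iff order_trans)
    \<comment> \<open>The required growth is polynomial in \<open>d\<close>,
      \<open>1 / \<epsilon>\<close> and \<open>lg\<close>, hence a constant times
      \<open>exp (8 * lg)\<close>, which \<open>exp (L * lg / 4)\<close> beats.\<close>
    have "16 * real d * B / \<eta> = 16 * real d * (h1 * (lg ^ 6 / (b1 * e\<^sup>2)))"
    proof -
      have l8: "lg ^ 8 = lg\<^sup>2 * lg ^ 6" by (simp flip: power_add)
      show ?thesis using e l1 h1 b1
        by (simp add: B_def \<eta>eq l8 power2_eq_square power3_eq_cube)
    qed
    also have "\<dots> \<le> 16 * exp lg * (h1 * (exp (6 * lg) * exp lg))"
    proof -
      have "lg ^ 6 / (b1 * e\<^sup>2) = (lg ^ 6 / b1) * (1 / \<epsilon>)" by (simp add: e)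
      also have "\<dots> \<le> exp (6 * lg) * exp lg"
      proof (intro mult_mono exp\<epsilon>)
        have "lg ^ 6 / b1 \<le> lg ^ 6 / 1" using b1 l1 by (intro divide_left_mono) auto
        then show "lg ^ 6 / b1 \<le> exp (6 * lg)" using pow_exp[of 6] by simp
      qed (use \<epsilon> in auto)
      finally show ?thesis using expd h1 l1 b1 e by (intro mult_mono mult_left_mono) auto
    qed
    also have "\<dots> = 16 * h1 * exp (8 * lg)" by (simp flip: exp_add)
    also have "\<dots> < 112 * (x1 * h1) * exp (8 * lg)" using x1h1 h1 by simp
    also have "\<dots> \<le> exp (L / 4 - 21) * exp (8 * lg)" using big1 by (intro mult_right_mono) auto
    also have "\<dots> = exp (L / 4 - 21 + 8 * lg)" by (simp add: exp_add)
    also have "\<dots> \<le> exp (L * lg / 4)"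
    proof -
      have "21 * (lg - 1) \<le> (L / 4) * (lg - 1)" using L l1 by (intro mult_right_mono) auto
      then show ?thesis using l1 by (simp add: algebra_simps)
    qed
    also note growth
    finally have "16 * real d * B / \<eta> < (1 + x) ^ n1" .
    then have "16 * real d * B < (1 + x) ^ n1 * \<eta>" using \<eta>p by (simp add: pos_divide_less_eq)
    then have "4 * B < (1 + x) ^ n1 * (\<eta> / (4 * real d))" using d by (simp add: field_simps)
    then show ?thesis by (simp add: x_def)
  qed

  \<comment> \<open>Bounds on the block length and on the number of blocks\<close>
  have K0b: "real K0 \<le> x1 * h1 * (lg ^ 10 / e ^ 4)"
  proof -
    have "real K0 \<le> X / \<eta>" using K0up \<eta>p by (simp add: pos_le_divide_eq mult.commute)
    also have "X / \<eta> = x1 * h1 * ((lg\<^sup>2 * lg ^ 8) / (e * e ^ 3))"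
      by (simp add: X_def \<eta>eq)
    also have "lg\<^sup>2 * lg ^ 8 = lg ^ 10" by (simp flip: power_add)
    also have "e * e ^ 3 = e ^ 4" by (simp flip: power_Suc)
    finally show ?thesis .
  qed
  have K0exp: "real K0 \<le> x1 * h1 * exp (12 * lg)"
  proof -
    have "lg ^ 10 / e ^ 4 = lg ^ 10 * (1 / e ^ 4)" by simp
    also have "\<dots> \<le> exp (10 * lg) * exp (2 * lg)"
      using pow_exp[of 10] e4 e by (intro mult_mono) auto
    also have "\<dots> = exp (12 * lg)" by (simp flip: exp_add)
    finally have "x1 * h1 * (lg ^ 10 / e ^ 4) \<le> x1 * h1 * exp (12 * lg)" using x1h1 by (intro mult_left_mono) auto
    with K0b show ?thesis by linarith
  qed
  have lnK: "1 + ln (real K0) \<le> 1 / 2 + t"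
  proof -
    have "real K0 \<le> exp (L / 4 - 21) * exp (12 * lg)"
    proof -
      have "x1 * h1 \<le> exp (L / 4 - 21)" using big1 x1h1 by linarith
      then have "x1 * h1 * exp (12 * lg) \<le> exp (L / 4 - 21) * exp (12 * lg)" by (intro mult_right_mono) auto
      with K0exp show ?thesis by linarith
    qed
    then have "real K0 \<le> exp (L / 4 - 21 + 12 * lg)" by (simp add: exp_add)
    then have "ln (real K0) \<le> ln (exp (L / 4 - 21 + 12 * lg))" using K0p by (subst ln_le_cancel_iff) auto
    then have "ln (real K0) \<le> L / 4 - 21 + 12 * lg" by simp
    moreover have "L * 1 \<le> L * lg" using L l1 by (intro mult_left_mono) auto
    moreover have "84 * lg \<le> L * lg" using L l1 by (intro mult_right_mono) auto
    ultimately show ?thesis using L l1 unfolding t_def by linarith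
  qed
  have gainp: "gain > 0" using Bp Xp by (simp add: gain_def)
  have gain_inv: "1 / gain = 128 * x1 * b1\<^sup>2 * (lg ^ 6 / e ^ 3)"
  proof -
    have "lg ^ 6 = lg\<^sup>2 * (lg\<^sup>2 * lg\<^sup>2)" by (simp flip: power_add)
    then show ?thesis using e l1 b1 x1
      by (simp add: gain_def B_def X_def power_divide power_mult_distrib power2_eq_square power3_eq_cube)
  qed
  have Nlow: "\<Delta> < real N * gain"
  proof -
    have "\<Delta> / gain < real N" unfolding N_def by linarith
    then show ?thesis using gainp by (simp add: pos_divide_less_eq)
  qed
  \<comment> \<open>\<open>\<Delta>\<close> is an arbitrary real here, hence the absolute
    value.\<close>
  have Nup: "real N \<le> \<bar>\<Delta>\<bar> * (1 / gain) + 1"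
  proof -
    have "real N \<le> \<bar>\<Delta> / gain\<bar> + 1" unfolding N_def by linarith
    then show ?thesis using gainp by (simp add: abs_divide)
  qed
  have e1: "1 / e \<le> exp lg"
  proof (rule power2_le_imp_le)
    have "(1 / e)\<^sup>2 = 1 / \<epsilon>" using e by (simp add: power_divide)
    also have "\<dots> \<le> exp lg" by (rule exp\<epsilon>)
    also have "\<dots> \<le> (exp lg)\<^sup>2" using l1 by (simp add: power2_eq_square)
    finally show "(1 / e)\<^sup>2 \<le> (exp lg)\<^sup>2" .
  qed simp
  have Nexp: "real N \<le> (1 + 128 * \<bar>\<Delta>\<bar> * x1 * b1\<^sup>2) * exp (8 * lg)"
  proof -
    have "lg ^ 6 / e ^ 3 = lg ^ 6 * ((1 / e) * (1 / \<epsilon>))" using e(2) by (simp add: power2_eq_square power3_eq_cube)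
    also have "\<dots> \<le> exp (6 * lg) * (exp lg * exp lg)"
      using pow_exp[of 6] e1 exp\<epsilon> e \<epsilon> by (intro mult_mono) auto
    also have "\<dots> = exp (8 * lg)" by (simp flip: exp_add)
    finally have "\<bar>\<Delta>\<bar> * (1 / gain) \<le> \<bar>\<Delta>\<bar> * (128 * x1 * b1\<^sup>2 * exp (8 * lg))"
      unfolding gain_inv using x1 by (intro mult_left_mono) auto
    moreover have "1 \<le> exp (8 * lg)" using l1 by simp
    ultimately have "real N \<le> \<bar>\<Delta>\<bar> * (128 * x1 * b1\<^sup>2 * exp (8 * lg)) + exp (8 * lg)" using Nup by linarith
    then show ?thesis by (simp add: algebra_simps)
  qed

  \<comment> \<open>Total failure probability\<close>
  have bad: "real N * (exp (- t) + (3 / 4) ^ m + real K0 * (5 * exp (- t))) \<le> \<delta>"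
  proof -
    have tq: "exp (- t) \<le> exp (- (L * lg / 4))" using Ll by (simp add: t_def)
    have "(3 / 4 :: real) \<le> exp (- (1 / 4))" using exp_ge_add_one_self[of "- (1 / 4)"] by simp
    then have "(3 / 4 :: real) ^ m \<le> exp (- (1 / 4)) ^ m" by (intro power_mono) auto
    also have "\<dots> = exp (- (real m / 4))" by (simp add: exp_of_nat_mult[symmetric])
    also have "\<dots> \<le> exp (- (L * lg / 4))" using mb by simp
    finally have mq: "(3 / 4 :: real) ^ m \<le> exp (- (L * lg / 4))" .
    have K1: "1 \<le> real K0" using K0p by simp
    have "exp (- t) + (3 / 4) ^ m + real K0 * (5 * exp (- t))
      \<le> real K0 * exp (- (L * lg / 4)) + real K0 * exp (- (L * lg / 4)) + real K0 * (5 * exp (- (L * lg / 4)))"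
    proof (intro add_mono)
      have "exp (- (L * lg / 4)) \<le> real K0 * exp (- (L * lg / 4))" using K1 by simp
      then show "exp (- t) \<le> real K0 * exp (- (L * lg / 4))" "(3 / 4) ^ m \<le> real K0 * exp (- (L * lg / 4))"
        using tq mq by linarith+
      show "real K0 * (5 * exp (- t)) \<le> real K0 * (5 * exp (- (L * lg / 4)))"
        using tq by (intro mult_left_mono) auto
    qed
    also have "\<dots> = 7 * real K0 * exp (- (L * lg / 4))" by simp
    also have "\<dots> \<le> 7 * (x1 * h1 * exp (12 * lg)) * exp (- (L * lg / 4))"
      using K0exp by (intro mult_right_mono mult_left_mono) auto
    finally have "real N * (exp (- t) + (3 / 4) ^ m + real K0 * (5 * exp (- t)))
      \<le> ((1 + 128 * \<bar>\<Delta>\<bar> * x1 * b1\<^sup>2) * exp (8 * lg)) * (7 * (x1 * h1 * exp (12 * lg)) * exp (- (L * lg / 4)))"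
      using Nexp x1 by (intro mult_mono) auto
    also have "\<dots> = (7 * (1 + 128 * \<bar>\<Delta>\<bar> * x1 * b1\<^sup>2) * x1 * h1) * exp (20 * lg - L * lg / 4)"
    proof -
      have "exp (20 * lg - L * lg / 4) = exp (8 * lg) * exp (12 * lg) * exp (- (L * lg / 4))"
        by (simp flip: exp_add)
      then show ?thesis by (simp only: mult_ac)
    qed
    also have "\<dots> \<le> exp (L / 4 - 21) * exp (20 * lg - L * lg / 4)"
    proof (rule mult_right_mono)
      have "0 \<le> (1 + 128 * \<bar>\<Delta>\<bar> * x1 * b1\<^sup>2) * x1 * h1" using x1 h1 by simp
      then show "7 * (1 + 128 * \<bar>\<Delta>\<bar> * x1 * b1\<^sup>2) * x1 * h1 \<le> exp (L / 4 - 21)" using big by linarith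
    qed simp
    also have "\<dots> = exp (L / 4 - 21 + (20 * lg - L * lg / 4))" by (simp only: exp_add)
    also have "\<dots> \<le> exp (- lg)"
    proof -
      have "21 * (lg - 1) \<le> (L / 4) * (lg - 1)" using L l1 by (intro mult_right_mono) auto
      then show ?thesis by (simp add: algebra_simps)
    qed
    also note exp\<delta>
    finally show ?thesis .
  qed

  \<comment> \<open>Number of oracle calls\<close>
  have total: "real (N * K0) \<le> (A ^ 3 + 128 * \<bar>\<Delta>\<bar> * x1 * b1\<^sup>2) * (x1 * h1) * (1 / \<epsilon> powr 3.5) * lg ^ 16"
  proof -
    have "1 \<le> A ^ 3 * (lg ^ 6 / e ^ 3)"
    proof -
      have "1 * 1 \<le> (A ^ 3 / e ^ 3) * lg ^ 6"
        using eA e l1 by (intro mult_mono) (auto simp: one_le_power intro!: power_mono)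
      then show ?thesis by simp
    qed
    then have "real N \<le> (A ^ 3 + 128 * \<bar>\<Delta>\<bar> * x1 * b1\<^sup>2) * (lg ^ 6 / e ^ 3)"
      using Nup unfolding gain_inv by (simp add: algebra_simps)
    then have "real N * real K0 \<le> ((A ^ 3 + 128 * \<bar>\<Delta>\<bar> * x1 * b1\<^sup>2) * (lg ^ 6 / e ^ 3)) * (x1 * h1 * (lg ^ 10 / e ^ 4))"
      using K0b A x1 l1 e by (intro mult_mono) auto
    also have "\<dots> = (A ^ 3 + 128 * \<bar>\<Delta>\<bar> * x1 * b1\<^sup>2) * (x1 * h1) * (1 / (e ^ 3 * e ^ 4)) * (lg ^ 6 * lg ^ 10)" by simp
    also have "lg ^ 6 * lg ^ 10 = lg ^ 16" by (simp flip: power_add)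
    also have "e ^ 3 * e ^ 4 = \<epsilon> powr 3.5"
    proof -
      have "e ^ 3 * e ^ 4 = e ^ 7" by (simp flip: power_add)
      also have "\<dots> = (\<epsilon> powr (1 / 2)) ^ 7" using \<epsilon> by (simp add: e_def powr_half_sqrt)
      also have "\<dots> = \<epsilon> powr 3.5" using \<epsilon> by (simp add: powr_power)
      finally show ?thesis .
    qed
    finally show ?thesis by simp
  qed
  have t12: "t \<ge> 1 / 2" using t1 by simp
  have "admissible d \<epsilon> \<delta> A \<Delta> \<eta> K0 B X t n1 m N"
    unfolding admissible_def
    using Bp B8 \<eta>p \<eta>A1 K0_def K0p Xp K0up t12 lnK small1 small2 \<eta>A3 grad hess trial1 trial2
      Nlow[unfolded gain_def] bad by blast
  with total show ?thesis by blast
qed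

text \<open>\<open>x1 * b1\<^sup>2\<close> and \<open>h1\<close> are \<open>L ^ 6\<close> and
  \<open>L ^ 8\<close> times constants in \<open>A\<close>, so the requirement on \<open>L\<close>
  is that an exponential beats a multiple of \<open>L ^ 16\<close>. Thus \<open>L\<close>, and with
  it \<open>C\<close>, depends only on \<open>A\<close> and \<open>\<Delta>\<close>, whence the
  uniformity in \<open>d\<close>, \<open>\<epsilon>\<close> and \<open>\<delta>\<close>.\<close>

lemma ex_admissible_uniform:
  fixes A \<Delta> :: real
  assumes A: "A \<ge> 1"
  shows "\<exists>C>0. \<forall>(d::nat) \<epsilon> \<delta>. d > 0 \<longrightarrow> \<epsilon> > 0 \<longrightarrow> \<epsilon> < A\<^sup>2 \<longrightarrow> 0 < \<delta> \<longrightarrow> \<delta> < 1 \<longrightarrow>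
    (\<exists>\<eta> K0 B X t n1 m N. admissible d \<epsilon> \<delta> A \<Delta> \<eta> K0 B X t n1 m N \<and>
      real (N * K0) \<le> C * (1 / \<epsilon> powr 3.5) * (1 + ln (real d) + ln (1 + 1 / \<epsilon>) + ln (1 / \<delta>)) ^ 16)"
proof -
  define k where "k = 6 * (4096 * A\<^sup>2 * 6)\<^sup>2"
  define h where "h = 262144 * A\<^sup>2 * 6 * (4096 * A\<^sup>2 * 6)\<^sup>2"
  define c where "c = 112 * (1 + 128 * \<bar>\<Delta>\<bar> * k) * 6 * h"
  obtain L where L: "L \<ge> 84" "c * L ^ 16 \<le> exp (L / 4 - 21)" using ex_exp_dominates_power[of c] by blast
  define x1 where "x1 = 6 * L\<^sup>2"
  define b1 where "b1 = 4096 * A\<^sup>2 * x1"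
  define h1 where "h1 = 262144 * A\<^sup>2 * L\<^sup>2 * x1 * b1\<^sup>2"
  have xb: "x1 * b1\<^sup>2 = k * L ^ 6"
    by (simp add: x1_def b1_def k_def power_mult_distrib flip: power_add power_mult)
  have h1: "h1 = h * L ^ 8"
    unfolding x1_def b1_def h1_def h_def by algebra
  have big: "112 * (1 + 128 * \<bar>\<Delta>\<bar> * x1 * b1\<^sup>2) * x1 * h1 \<le> exp (L / 4 - 21)"
  proof -
    have L6: "1 \<le> L ^ 6" using L by (simp add: one_le_power)
    have k0: "0 \<le> k" "0 \<le> h" using A by (auto simp: k_def h_def)
    have "1 + 128 * \<bar>\<Delta>\<bar> * x1 * b1\<^sup>2 = 1 + 128 * \<bar>\<Delta>\<bar> * k * L ^ 6"
      by (simp add: xb mult.assoc)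
    also have "\<dots> \<le> (1 + 128 * \<bar>\<Delta>\<bar> * k) * L ^ 6" using L6 by (simp add: algebra_simps)
    finally have "112 * (1 + 128 * \<bar>\<Delta>\<bar> * x1 * b1\<^sup>2) * x1 * h1 \<le> 112 * ((1 + 128 * \<bar>\<Delta>\<bar> * k) * L ^ 6) * x1 * h1"
      unfolding h1 x1_def using k0 L by (intro mult_right_mono mult_left_mono) auto
    also have "\<dots> = c * (L ^ 6 * L\<^sup>2 * L ^ 8)" by (simp add: h1 x1_def c_def)
    also have "L ^ 6 * L\<^sup>2 * L ^ 8 = L ^ 16" by (simp flip: power_add)
    finally show ?thesis using L(2) by linarith
  qed
  define C where "C = (A ^ 3 + 128 * \<bar>\<Delta>\<bar> * x1 * b1\<^sup>2) * (x1 * h1)"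
  have "x1 > 0" "b1 > 0" "h1 > 0" using A L by (auto simp: x1_def b1_def h1_def)
  then have "C > 0" using A unfolding C_def by (intro mult_pos_pos add_pos_nonneg) auto
  moreover have "\<exists>\<eta> K0 B X t n1 m N. admissible d \<epsilon> \<delta> A \<Delta> \<eta> K0 B X t n1 m N \<and>
      real (N * K0) \<le> C * (1 / \<epsilon> powr 3.5) * (1 + ln (real d) + ln (1 + 1 / \<epsilon>) + ln (1 / \<delta>)) ^ 16"
    if "d > 0" "\<epsilon> > 0" "\<epsilon> < A\<^sup>2" "0 < \<delta>" "\<delta> < 1" for d :: nat and \<epsilon> \<delta>
    unfolding C_def x1_def b1_def h1_def
    by (rule ex_admissible[OF A L(1) big[unfolded x1_def b1_def h1_def] that])
  ultimately show ?thesis by blast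
qed

theorem theorem3p5:
  shows "\<exists>q :: nat. \<forall>(\<rho>1 :: real \<Rightarrow> real) (\<rho>2 :: real \<Rightarrow> real) (\<rho>3 :: real \<Rightarrow> real \<Rightarrow> real)
            (\<sigma> :: real \<Rightarrow> real) (\<Delta> :: real).
    \<exists>C :: real. \<forall>(d :: nat) (\<epsilon> :: real) (\<delta> :: real). d > 0 \<longrightarrow> \<epsilon> > 0 \<longrightarrow> 0 < \<delta> \<longrightarrow> \<delta> < 1 \<longrightarrow>
    (\<exists>(\<eta> :: real) (K0 :: nat) (B :: real) (s :: real) (T :: nat).
       \<eta> > 0 \<and> K0 > 0 \<and> B > 0 \<and> s > 0 \<and>
       T \<le> nat \<lceil>C * (1 / \<epsilon> powr 3.5) * (1 + ln (real d) + ln (1 + 1 / \<epsilon>) + ln (1 / \<delta>)) ^ q\<rceil> \<and>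
       (\<forall>(F :: evec \<Rightarrow> real) (P :: 'z measure) (f :: evec \<Rightarrow> 'z \<Rightarrow> real) (w0 :: evec).
          min_value_zero d F \<longrightarrow>
          third_order_self_bounding d F \<rho>1 \<rho>2 \<longrightarrow>
          prob_space P \<longrightarrow>
          noise_regularity d P F f \<sigma> \<longrightarrow>
          oracle_control d P F f \<rho>3 \<longrightarrow>
          w0 \<in> Rd d \<longrightarrow> F w0 = \<Delta> \<longrightarrow>
          measure (rsgd_prob d P)
            {\<omega> \<in> space (rsgd_prob d P).
               \<exists>w \<in> set (candidates (\<lambda>x \<zeta>. grad d (\<lambda>y. f y \<zeta>) x) \<eta> K0 B s w0 \<omega> T).
                 second_order_stationary d F \<epsilon> w} \<ge> 1 - \<delta>))"
proof (rule exI[of _ 16], intro allI)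
  fix \<rho>1 \<rho>2 \<sigma> :: "real \<Rightarrow> real" and \<rho>3 :: "real \<Rightarrow> real \<Rightarrow> real" and \<Delta> :: real
  \<comment> \<open>The five bounds of \<open>locally_regularI\<close> at the level
    \<open>\<Delta>\<close>, together with 1. It is fixed before \<open>d\<close> and
    \<open>F\<close> are.\<close>
  define A where "A = Max {1, 1 + 2 * (\<rho>1 (\<Delta> + 2) + 1) * (\<Delta> + 1), \<rho>1 (\<Delta> + 1) + 1, \<rho>2 (\<Delta> + 1), \<sigma> (\<Delta> + 1),
      \<rho>3 (1 + 2 * (\<rho>1 (\<Delta> + 2) + 1) * (\<Delta> + 1) + \<sigma> (\<Delta> + 1)) (\<Delta> + 1)}"
  have A: "1 \<le> A" "1 + 2 * (\<rho>1 (\<Delta> + 2) + 1) * (\<Delta> + 1) \<le> A" "\<rho>1 (\<Delta> + 1) + 1 \<le> A" "\<rho>2 (\<Delta> + 1) \<le> A"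
    "\<sigma> (\<Delta> + 1) \<le> A" "\<rho>3 (1 + 2 * (\<rho>1 (\<Delta> + 2) + 1) * (\<Delta> + 1) + \<sigma> (\<Delta> + 1)) (\<Delta> + 1) \<le> A"
    unfolding A_def by (rule Max_ge; simp only: insert_iff simp_thms finite_insert finite.emptyI)+
  obtain C where C: "C > 0" and adm: "\<And>(d::nat) \<epsilon> \<delta>. d > 0 \<Longrightarrow> \<epsilon> > 0 \<Longrightarrow> \<epsilon> < A\<^sup>2 \<Longrightarrow> 0 < \<delta> \<Longrightarrow> \<delta> < 1 \<Longrightarrow>
    \<exists>\<eta> K0 B X t n1 m N. admissible d \<epsilon> \<delta> A \<Delta> \<eta> K0 B X t n1 m N \<and>
      real (N * K0) \<le> C * (1 / \<epsilon> powr 3.5) * (1 + ln (real d) + ln (1 + 1 / \<epsilon>) + ln (1 / \<delta>)) ^ 16"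
    using ex_admissible_uniform[OF A(1), of \<Delta>] by blast
  let ?bound = "\<lambda>(d::nat) \<epsilon> \<delta>. C * (1 / \<epsilon> powr 3.5) * (1 + ln (real d) + ln (1 + 1 / \<epsilon>) + ln (1 / \<delta>)) ^ 16"
  show "\<exists>C. \<forall>d \<epsilon> \<delta>. d > 0 \<longrightarrow> \<epsilon> > 0 \<longrightarrow> 0 < \<delta> \<longrightarrow> \<delta> < 1 \<longrightarrow>
    (\<exists>\<eta> K0 B s T. \<eta> > 0 \<and> K0 > 0 \<and> B > 0 \<and> s > 0 \<and>
       T \<le> nat \<lceil>C * (1 / \<epsilon> powr 3.5) * (1 + ln (real d) + ln (1 + 1 / \<epsilon>) + ln (1 / \<delta>)) ^ 16\<rceil> \<and>
       (\<forall>F (P :: 'z measure) f w0.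
          min_value_zero d F \<longrightarrow> third_order_self_bounding d F \<rho>1 \<rho>2 \<longrightarrow> prob_space P \<longrightarrow>
          noise_regularity d P F f \<sigma> \<longrightarrow> oracle_control d P F f \<rho>3 \<longrightarrow> w0 \<in> Rd d \<longrightarrow> F w0 = \<Delta> \<longrightarrow>
          1 - \<delta> \<le> measure (rsgd_prob d P)
            {\<omega> \<in> space (rsgd_prob d P).
               \<exists>w \<in> set (candidates (\<lambda>x \<zeta>. grad d (\<lambda>y. f y \<zeta>) x) \<eta> K0 B s w0 \<omega> T).
                 second_order_stationary d F \<epsilon> w}))"
  proof (rule exI[of _ C], intro allI impI)
    fix d :: nat and \<epsilon> \<delta> :: real
    assume d: "d > 0" and \<epsilon>: "\<epsilon> > 0" and \<delta>: "0 < \<delta>" "\<delta> < 1"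
    have setting: "rsgd_setting d F \<rho>1 \<rho>2 P f \<sigma> \<rho>3"
      if "min_value_zero d F" "third_order_self_bounding d F \<rho>1 \<rho>2" "prob_space P"
        "noise_regularity d P F f \<sigma>" "oracle_control d P F f \<rho>3" for F and P :: "'z measure" and f
      using that by (intro rsgd_setting.intro objective.intro rsgd_setting_axioms.intro)
    have regular: "locally_regular d (space P) F (grad d F) (hess d F) (rsgd_setting.gf d f) A u (1 / (4 * A))"
      if "rsgd_setting d F \<rho>1 \<rho>2 P f \<sigma> \<rho>3" "u \<in> Rd d" "F u \<le> \<Delta>" for F and P :: "'z measure" and f u
    proof -
      interpret rsgd_setting d F \<rho>1 \<rho>2 P f \<sigma> \<rho>3 by fact
      have "gf = (\<lambda>x \<zeta>. grad d (\<lambda>y. f y \<zeta>) x)" by (simp add: gf_def fun_eq_iff)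
      then show ?thesis using locally_regularI[OF nr oc that(2,3) A(2-6)] by metis
    qed
    show "\<exists>\<eta> K0 B s T. \<eta> > 0 \<and> K0 > 0 \<and> B > 0 \<and> s > 0 \<and> T \<le> nat \<lceil>?bound d \<epsilon> \<delta>\<rceil> \<and>
       (\<forall>F (P :: 'z measure) f w0.
          min_value_zero d F \<longrightarrow> third_order_self_bounding d F \<rho>1 \<rho>2 \<longrightarrow> prob_space P \<longrightarrow>
          noise_regularity d P F f \<sigma> \<longrightarrow> oracle_control d P F f \<rho>3 \<longrightarrow> w0 \<in> Rd d \<longrightarrow> F w0 = \<Delta> \<longrightarrow>
          1 - \<delta> \<le> measure (rsgd_prob d P)
            {\<omega> \<in> space (rsgd_prob d P).
               \<exists>w \<in> set (candidates (\<lambda>x \<zeta>. grad d (\<lambda>y. f y \<zeta>) x) \<eta> K0 B s w0 \<omega> T).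
                 second_order_stationary d F \<epsilon> w})"
    proof (cases "\<epsilon> < A\<^sup>2")
      case True
      obtain \<eta> K0 B X t n1 m N where ad: "admissible d \<epsilon> \<delta> A \<Delta> \<eta> K0 B X t n1 m N"
        and T: "real (N * K0) \<le> ?bound d \<epsilon> \<delta>"
        using adm[OF d \<epsilon> True \<delta>] by blast
      note ad' = ad[unfolded admissible_def]
      have T': "N * K0 \<le> nat \<lceil>?bound d \<epsilon> \<delta>\<rceil>" using T by linarith
      have pos: "\<eta> > 0" "K0 > 0" "B > 0" using ad' by blast+
      have prob: "1 - \<delta> \<le> measure (rsgd_prob d P)
            {\<omega> \<in> space (rsgd_prob d P).
               \<exists>w \<in> set (candidates (\<lambda>x \<zeta>. grad d (\<lambda>y. f y \<zeta>) x) \<eta> K0 B 1 w0 \<omega> (N * K0)).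
                 second_order_stationary d F \<epsilon> w}"
        if h: "min_value_zero d F" "third_order_self_bounding d F \<rho>1 \<rho>2" "prob_space P"
          "noise_regularity d P F f \<sigma>" "oracle_control d P F f \<rho>3" and w0: "w0 \<in> Rd d" "F w0 = \<Delta>"
        for F and P :: "'z measure" and f w0
      proof -
        note st = setting[OF h]
        interpret rsgd_params d F \<rho>1 \<rho>2 P f \<sigma> \<rho>3 \<epsilon> \<eta> B K0 A X t n1 m
          by (intro rsgd_params.intro rsgd_run.intro st rsgd_params_axioms.intro) (use ad' d \<epsilon> A(1) in auto)
        show ?thesis
        proof (rule prob_found[OF regular[OF st] w0(1)])
          show "F w0 \<le> \<Delta>" using w0 by simp
          show "F w0 < real N * gain" unfolding w0(2) gain_def using ad' by blast
          show "real N * bad \<le> \<delta>" unfolding bad_def using ad' by blast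
        qed
      qed
      show ?thesis
        by (intro exI[of _ \<eta>] exI[of _ K0] exI[of _ B] exI[of _ "1::real"] exI[of _ "N * K0"]
            conjI allI impI pos T' prob zero_less_one)
    next
      case False
      have l1: "1 \<le> 1 + ln (real d) + ln (1 + 1 / \<epsilon>) + ln (1 / \<delta>)"
        using d \<epsilon> \<delta> by (simp add: ln_ge_zero)
      have "0 < ?bound d \<epsilon> \<delta>" using C \<epsilon> l1 by (intro mult_pos_pos zero_less_power) auto
      then have T: "1 \<le> nat \<lceil>?bound d \<epsilon> \<delta>\<rceil>" by linarith
      have "1 - \<delta> \<le> measure (rsgd_prob d P)
            {\<omega> \<in> space (rsgd_prob d P).
               \<exists>w \<in> set (candidates (\<lambda>x \<zeta>. grad d (\<lambda>y. f y \<zeta>) x) 1 1 1 1 w0 \<omega> 1).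
                 second_order_stationary d F \<epsilon> w}"
        if h: "min_value_zero d F" "third_order_self_bounding d F \<rho>1 \<rho>2" "prob_space P"
          "noise_regularity d P F f \<sigma>" "oracle_control d P F f \<rho>3" and w0: "w0 \<in> Rd d" "F w0 = \<Delta>"
        for F and P :: "'z measure" and f w0
      proof -
        interpret rsgd_setting d F \<rho>1 \<rho>2 P f \<sigma> \<rho>3 by (rule setting[OF h])
        have lr: "locally_regular d (space P) F g H gf A w0 (1 / (4 * A))"
          by (rule regular[OF rsgd_setting_axioms w0(1)]) (simp add: w0)
        have "A \<le> A\<^sup>2" using mult_left_mono[of 1 A A] A(1) unfolding power2_eq_square by linarith
        then have A\<epsilon>: "A \<le> \<epsilon>" "A \<le> sqrt \<epsilon>" using False by (auto intro!: real_le_rsqrt)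
        have "norm (g w0) \<le> A" by (rule locally_regularD(4)[OF lr w0(1)]) (use A(1) in simp)
        moreover have "- sqrt \<epsilon> * (norm h)\<^sup>2 \<le> inner h (H w0 h)" if "h \<in> Rd d" for h
        proof -
          have "- inner h (H w0 h) \<le> norm h * norm (H w0 h)" using Cauchy_Schwarz_ineq2 abs_le_D2 by blast
          also have "\<dots> \<le> norm h * (A * norm h)" using locally_regularD(3)[OF lr that] by (intro mult_left_mono) auto
          also have "\<dots> \<le> norm h * (sqrt \<epsilon> * norm h)" using A\<epsilon> by (intro mult_left_mono mult_right_mono) auto
          finally show ?thesis by (simp add: power2_eq_square mult_ac)
        qed
        ultimately have sosp: "second_order_stationary d F \<epsilon> w0"
          using A\<epsilon> by (simp add: sosp_iff[OF w0(1)])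
        \<comment> \<open>With \<open>K0 = 1\<close> the first call ends the block, by exit or by
          stopping, and either way the candidate is the average of the single point
          \<open>w0\<close>.\<close>
        have "w0 \<in> set (candidates gf' 1 1 1 1 w0 \<omega> 1)" for gf' :: "evec \<Rightarrow> 'z \<Rightarrow> evec" and \<omega>
        proof -
          obtain \<zeta> \<Lambda> where 2: "\<omega> 0 = (\<zeta>, \<Lambda>)" by fastforce
          show ?thesis by (simp add: candidates_def rsgd_step_def Let_def 2)
        qed
        then have "{\<omega> \<in> space (rsgd_prob d P).
               \<exists>w \<in> set (candidates (\<lambda>x \<zeta>. grad d (\<lambda>y. f y \<zeta>) x) 1 1 1 1 w0 \<omega> 1).
                 second_order_stationary d F \<epsilon> w} = space (rsgd_prob d P)"
          using sosp by blast
        then show ?thesis using \<delta> by (simp add: rsgd_prob_eq seq.P.prob_space)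
      qed
      then show ?thesis using T by (intro exI[of _ 1]) auto
    qed
  qed
qed

end
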